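(* Let $(M,\omega)$ be a compact symplectic Fano manifold of real dimension $2n>2$, $G$ a compact connected Lie subgroup of $Ham(M,\omega)$, $\xi$ an element of the center of $Lie(G)$, $J\in AK^G_\omega$, and let $a$ be a $G$-invariant $1$-form such that $\rho^\nabla-\omega=da$. Then the almost-Kähler metric $g$ induced by $(\omega,J)$ is a GeAKRS (with respect to $\xi$) if and only if the $d^c$-exact part of the Hodge decomposition of the $1$-form $a$ with respect to the twisted Laplacian $\tilde\Delta^c=J\Delta^{\tilde g}J^{-1}$ of the conformal metric $\tilde g=e^{-\frac{2f_\xi}{n-1}}g$ is $-d^cf_\xi$.
   Context: Let $(M,\omega)$ be a symplectic manifold of real dimension $2n$. An almost-complex structure $J$ is compatible with $\omega$ if $\omega(J\cdot,J\cdot)=\omega(\cdot,\cdot)$ and $g:=\omega(\cdot,J\cdot)$ is a Riemannian metric, called the almost-Kähler metric induced by $J$. $D^g$ is the Levi-Civita connection. The canonical Hermitian connection is $\nabla_XY=D^g_XY-\frac12 J(D^g_XJ)Y$, with curvature $R^\nabla_{X,Y}=\nabla_{[X,Y]}-[\nabla_X,\nabla_Y]$; the first-Chern--Ricci form is $\rho^\nabla(X,Y)=\frac12\sum_{i=1}^{2n}g(R^\nabla_{X,Y}e_i,Je_i)$ for a $J$-adapted $g$-orthonormal local frame $\{e_i\}$; it represents $2\pi c_1(M)$. The Chern scalar curvature $s^c$ is defined by $s^c\omega^n=n\,\rho^\nabla\wedge\omega^{n-1}$. For any metric $g$, $\delta^g$ is the codifferential and $\Delta^g=\delta^gd+d\delta^g$.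 $(M,\omega)$ is symplectic Fano if $2\pi c_1(M)=[\omega]$. $Ham(M,\omega)$ is the group of Hamiltonian symplectomorphisms and $AK^G_\omega$ is the space of $G$-invariant almost-complex structures compatible with $\omega$. An element $\xi$ of the center of $Lie(G)$ is identified with the vector field it defines on $M$; $f_\xi$ is the potential defined by $\omega(\xi,\cdot)=-df_\xi$ and $\int_M f_\xi e^{-2f_\xi}\omega^n=0$. The metric $g$ is a generalized almost-Kähler--Ricci soliton (GeAKRS) with respect to $\xi$ if $s^c-n-2\Delta^gf_\xi+2f_\xi-2|df_\xi|_g^2\equiv0$. $J$ acts on $p$-forms by $(J\psi)(X_1,\dots,X_p)=\psi(J^{-1}X_1,\dots,J^{-1}X_p)$ (so $J\alpha=-\alpha\circ J$ on 1-forms), $d^c=JdJ^{-1}$, and $\tilde\delta^c=J\delta^{\tilde g}J^{-1}$. The Hodge decomposition of a $1$-form $a$ with respect to $\tilde\Delta^c=\tilde\delta^cd^c+d^c\tilde\delta^c=J\Delta^{\tilde g}J^{-1}$ is $a=a_{\tilde H^c}+d^ch+\tilde\delta^c\psi$, with $a_{\tilde H^c}$ $\tilde\Delta^c$-harmonic, $h$ a function, $\psi$ a 2-form; $d^ch$ is called the $d^c$-exact part. *)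

theory Defs
  imports
    "HOL-Analysis.Analysis"
    "HOL-Combinatorics.Permutations"
    "HOL-Library.Function_Algebras"
begin

text \<open>
  Sums, differences and zeros of functions, vector fields and forms are the pointwise ones of
  HOL-Library.Function_Algebras.
\<close>

section \<open>Smooth manifolds given by an atlas\<close>

text \<open>The set \<open>S\<close> is always open below.\<close>

primrec Ck_on ::
  "nat \<Rightarrow> 'a::real_normed_vector set \<Rightarrow> ('a \<Rightarrow> 'b::real_normed_vector) \<Rightarrow> bool" where
  "Ck_on 0 S f \<longleftrightarrow> continuous_on S f"
| "Ck_on (Suc k) S f \<longleftrightarrow>
     (\<forall>x\<in>S. f differentiable (at x)) \<and> (\<forall>v. Ck_on k S (\<lambda>x. frechet_derivative f (at x) v))"

definition smooth_on ::
  "'a::real_normed_vector set \<Rightarrow> ('a \<Rightarrow> 'b::real_normed_vector) \<Rightarrow> bool" where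
  "smooth_on S f \<longleftrightarrow> (\<forall>k. Ck_on k S f)"

type_synonym ('m, 'e) chart = "'m set \<times> ('m \<Rightarrow> 'e)"
type_synonym ('m, 'e) atlas = "('m, 'e) chart set"

definition carrier :: "('m, 'e) atlas \<Rightarrow> 'm set" where
  "carrier A = \<Union> (fst ` A)"

definition smooth_atlas :: "('m, 'e::euclidean_space) atlas \<Rightarrow> bool" where
  "smooth_atlas A \<longleftrightarrow>
     (\<forall>(U, \<phi>)\<in>A. inj_on \<phi> U \<and> open (\<phi> ` U)) \<and>
     (\<forall>(U, \<phi>)\<in>A. \<forall>(V, \<psi>)\<in>A.
        open (\<phi> ` (U \<inter> V)) \<and> smooth_on (\<phi> ` (U \<inter> V)) (\<psi> \<circ> inv_into U \<phi>))"

text \<open>The topology for which all charts are homeomorphisms onto open sets.\<close>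

definition manifold_topology :: "('m, 'e::euclidean_space) atlas \<Rightarrow> 'm topology" where
  "manifold_topology A =
     topology (\<lambda>W. W \<subseteq> carrier A \<and> (\<forall>(U, \<phi>)\<in>A. open (\<phi> ` (W \<inter> U))))"

text \<open>Compact manifolds without boundary; second countability is automatic.\<close>

definition compact_manifold :: "('m, 'e::euclidean_space) atlas \<Rightarrow> bool" where
  "compact_manifold A \<longleftrightarrow>
     smooth_atlas A \<and> Hausdorff_space (manifold_topology A) \<and> compact_space (manifold_topology A)"

definition smooth_functions :: "('m, 'e::euclidean_space) atlas \<Rightarrow> ('m \<Rightarrow> real) set" where
  "smooth_functions A = {f. \<forall>(U, \<phi>)\<in>A. smooth_on (\<phi> ` U) (f \<circ> inv_into U \<phi>)}"

definition smooth_map ::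
  "('m, 'e::euclidean_space) atlas \<Rightarrow> ('k, 'f::euclidean_space) atlas \<Rightarrow> ('m \<Rightarrow> 'k) \<Rightarrow> bool" where
  "smooth_map A B F \<longleftrightarrow>
     F ` carrier A \<subseteq> carrier B \<and>
     (\<forall>(U, \<phi>)\<in>A. \<forall>(V, \<psi>)\<in>B.
        open (\<phi> ` (U \<inter> F -` V)) \<and> smooth_on (\<phi> ` (U \<inter> F -` V)) (\<psi> \<circ> F \<circ> inv_into U \<phi>))"

definition prod_atlas :: "('m, 'e) atlas \<Rightarrow> ('k, 'f) atlas \<Rightarrow> ('m \<times> 'k, 'e \<times> 'f) atlas" where
  "prod_atlas A B = {(U \<times> V, map_prod \<phi> \<psi>) | U \<phi> V \<psi>. (U, \<phi>) \<in> A \<and> (V, \<psi>) \<in> B}"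

definition real_atlas :: "(real, real) atlas" where
  "real_atlas = {(UNIV, id)}"


section \<open>Tangent vectors and vector fields\<close>

text \<open>
  Tangent vectors at \<open>p\<close> are the derivations at \<open>p\<close> of the algebra of smooth functions, extended
  by 0 to the remaining functions in order to make them unique as HOL functions.
\<close>

type_synonym 'm tvec = "('m \<Rightarrow> real) \<Rightarrow> real"
type_synonym 'm vfield = "'m \<Rightarrow> 'm tvec"

definition tangent :: "('m, 'e::euclidean_space) atlas \<Rightarrow> 'm \<Rightarrow> 'm tvec set" where
  "tangent A p = {v.
     (\<forall>f. f \<notin> smooth_functions A \<longrightarrow> v f = 0) \<and>
     (\<forall>f\<in>smooth_functions A. \<forall>h\<in>smooth_functions A.
        (\<forall>c. v (\<lambda>x. c * f x + h x) = c * v f + v h) \<and>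
        v (\<lambda>x. f x * h x) = f p * v h + h p * v f)}"

definition push :: "('m, 'e::euclidean_space) atlas \<Rightarrow> ('m \<Rightarrow> 'm) \<Rightarrow> 'm tvec \<Rightarrow> 'm tvec" where
  "push A F v = (\<lambda>f. if f \<in> smooth_functions A then v (f \<circ> F) else 0)"

definition vector_field :: "('m, 'e::euclidean_space) atlas \<Rightarrow> 'm vfield \<Rightarrow> bool" where
  "vector_field A X \<longleftrightarrow>
     (\<forall>p. X p \<in> tangent A p) \<and>
     (\<forall>f\<in>smooth_functions A. (\<lambda>p. X p f) \<in> smooth_functions A)"

definition lie_bracket :: "'m vfield \<Rightarrow> 'm vfield \<Rightarrow> 'm vfield" where
  "lie_bracket X Y = (\<lambda>p f. X p (\<lambda>q. Y q f) - Y p (\<lambda>q. X q f))"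

definition fscale :: "('m \<Rightarrow> real) \<Rightarrow> ('m \<Rightarrow> 'z \<Rightarrow> real) \<Rightarrow> ('m \<Rightarrow> 'z \<Rightarrow> real)" where
  "fscale h X = (\<lambda>p z. h p * X p z)"

definition extends ::
  "('m, 'e::euclidean_space) atlas \<Rightarrow> 'm \<Rightarrow> 'm vfield list \<Rightarrow> 'm tvec list \<Rightarrow> bool" where
  "extends A p Xs vs \<longleftrightarrow> (\<forall>X\<in>set Xs. vector_field A X) \<and> map (\<lambda>X. X p) Xs = vs"


section \<open>Differential forms\<close>

text \<open>
  A \<open>k\<close>-form takes a list of \<open>k\<close> tangent vectors at \<open>p\<close>; it is extended by 0 to all other lists.
\<close>

type_synonym 'm form = "'m \<Rightarrow> 'm tvec list \<Rightarrow> real"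

definition forms :: "('m, 'e::euclidean_space) atlas \<Rightarrow> nat \<Rightarrow> 'm form set" where
  "forms A k = {\<alpha>.
     (\<forall>p vs. \<not> (length vs = k \<and> set vs \<subseteq> tangent A p) \<longrightarrow> \<alpha> p vs = 0) \<and>
     (\<forall>p vs. length vs = k \<and> set vs \<subseteq> tangent A p \<longrightarrow>
        (\<forall>i<k. \<forall>u\<in>tangent A p. \<forall>w\<in>tangent A p. \<forall>c.
           \<alpha> p (vs[i := (\<lambda>f. c * u f + w f)]) = c * \<alpha> p (vs[i := u]) + \<alpha> p (vs[i := w])) \<and>
        (\<forall>i<k. \<forall>j<k. i \<noteq> j \<and> vs ! i = vs ! j \<longrightarrow> \<alpha> p vs = 0)) \<and>
     (\<forall>Xs. length Xs = k \<and> (\<forall>X\<in>set Xs. vector_field A X) \<longrightarrow>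
        (\<lambda>p. \<alpha> p (map (\<lambda>X. X p) Xs)) \<in> smooth_functions A)}"

definition fun_form :: "('m \<Rightarrow> real) \<Rightarrow> 'm form" where
  "fun_form f = (\<lambda>p vs. if vs = [] then f p else 0)"

definition del_nth :: "nat \<Rightarrow> 'a list \<Rightarrow> 'a list" where
  "del_nth i xs = take i xs @ drop (Suc i) xs"

text \<open>
  The exterior derivative in its invariant form, the vector fields \<open>Xs\<close> being arbitrary extensions
  of the tangent vectors \<open>vs\<close>. For a \<open>k\<close>-form only lists \<open>vs\<close> of length \<open>k + 1\<close> contribute.
\<close>

definition ext_d :: "('m, 'e::euclidean_space) atlas \<Rightarrow> 'm form \<Rightarrow> 'm form" where
  "ext_d A \<alpha> = (\<lambda>p vs. if set vs \<subseteq> tangent A p then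
     (THE r. \<forall>Xs. extends A p Xs vs \<longrightarrow>
        r = (\<Sum>i<length vs. (-1) ^ i * (Xs ! i) p (\<lambda>q. \<alpha> q (map (\<lambda>X. X q) (del_nth i Xs))))
          + (\<Sum>j<length vs. \<Sum>i<j. (-1) ^ (i + j) *
               \<alpha> p (lie_bracket (Xs ! i) (Xs ! j) p # del_nth i (del_nth j vs))))
     else 0)"

text \<open>
  On a \<open>k\<close>-form and an \<open>l\<close>-form only the summand with the splitting \<open>(k, l)\<close> is nonzero.
\<close>

definition wedge :: "'m form \<Rightarrow> 'm form \<Rightarrow> 'm form" where
  "wedge \<alpha> \<beta> = (\<lambda>p vs. \<Sum>k\<le>length vs. 1 / (fact k * fact (length vs - k)) *
     (\<Sum>\<sigma> | \<sigma> permutes {..<length vs}. of_int (sign \<sigma>) *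
        \<alpha> p (take k (permute_list \<sigma> vs)) * \<beta> p (drop k (permute_list \<sigma> vs))))"

primrec form_power :: "'m form \<Rightarrow> nat \<Rightarrow> 'm form" where
  "form_power \<alpha> 0 = fun_form (\<lambda>_. 1)"
| "form_power \<alpha> (Suc k) = wedge \<alpha> (form_power \<alpha> k)"

definition pullback :: "('m, 'e::euclidean_space) atlas \<Rightarrow> ('m \<Rightarrow> 'm) \<Rightarrow> 'm form \<Rightarrow> 'm form" where
  "pullback A F \<alpha> =
     (\<lambda>p vs. if set vs \<subseteq> tangent A p then \<alpha> (F p) (map (push A F) vs) else 0)"

definition G_invariant_form ::
  "('m, 'e::euclidean_space) atlas \<Rightarrow> ('m \<Rightarrow> 'm) set \<Rightarrow> 'm form \<Rightarrow> bool" where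
  "G_invariant_form A G \<alpha> \<longleftrightarrow> (\<forall>F\<in>G. pullback A F \<alpha> = \<alpha>)"


section \<open>Integration of top degree forms\<close>

definition coord_vectors ::
  "('m, 'e::euclidean_space) atlas \<Rightarrow> ('m, 'e) chart \<Rightarrow> 'm \<Rightarrow> 'm tvec list" where
  "coord_vectors A c p = map
     (\<lambda>b f. if f \<in> smooth_functions A
             then frechet_derivative (f \<circ> inv_into (fst c) (snd c)) (at (snd c p)) b else 0)
     (SOME bs. distinct bs \<and> set bs = (Basis :: 'e set))"

definition partition_of_unity ::
  "('m, 'e::euclidean_space) atlas \<Rightarrow> nat set \<Rightarrow> (nat \<Rightarrow> ('m, 'e) chart) \<Rightarrow> (nat \<Rightarrow> 'm \<Rightarrow> real) \<Rightarrow> bool"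
where
  "partition_of_unity A I c \<theta> \<longleftrightarrow>
     finite I \<and>
     (\<forall>i\<in>I. c i \<in> A \<and> \<theta> i \<in> smooth_functions A \<and> (\<forall>p\<in>carrier A. 0 \<le> \<theta> i p) \<and>
        manifold_topology A closure_of {p \<in> carrier A. \<theta> i p \<noteq> 0} \<subseteq> fst (c i)) \<and>
     (\<forall>p\<in>carrier A. (\<Sum>i\<in>I. \<theta> i p) = 1)"

text \<open>
  Integral of \<open>\<eta>\<close> over a compact manifold oriented by the volume form \<open>\<mu>\<close>. The sign of \<open>\<mu>\<close> on the
  coordinate frame corrects for charts, and enumerations of the basis, that are not positively
  oriented.
\<close>

definition form_integral ::
  "('m, 'e::euclidean_space) atlas \<Rightarrow> 'm form \<Rightarrow> 'm form \<Rightarrow> real" where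
  "form_integral A \<mu> \<eta> = (THE r. \<forall>I c \<theta>. partition_of_unity A I c \<theta> \<longrightarrow>
     r = (\<Sum>i\<in>I. LINT y : snd (c i) ` fst (c i) | lborel.
           (let p = inv_into (fst (c i)) (snd (c i)) y; bs = coord_vectors A (c i) p
            in sgn (\<mu> p bs) * \<theta> i p * \<eta> p bs)))"


section \<open>Riemannian metrics\<close>

type_synonym 'm metric = "'m \<Rightarrow> 'm tvec \<Rightarrow> 'm tvec \<Rightarrow> real"

definition riemannian_metric :: "('m, 'e::euclidean_space) atlas \<Rightarrow> 'm metric \<Rightarrow> bool" where
  "riemannian_metric A g \<longleftrightarrow>
     (\<forall>p. \<forall>u\<in>tangent A p. \<forall>v\<in>tangent A p. \<forall>w\<in>tangent A p. \<forall>c.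
        g p u v = g p v u \<and>
        g p (\<lambda>f. c * u f + w f) v = c * g p u v + g p w v \<and>
        (u \<noteq> 0 \<longrightarrow> g p u u > 0)) \<and>
     (\<forall>X Y. vector_field A X \<and> vector_field A Y \<longrightarrow>
        (\<lambda>p. g p (X p) (Y p)) \<in> smooth_functions A)"

type_synonym 'm connection = "'m vfield \<Rightarrow> 'm vfield \<Rightarrow> 'm vfield"

definition affine_connection :: "('m, 'e::euclidean_space) atlas \<Rightarrow> 'm connection \<Rightarrow> bool" where
  "affine_connection A D \<longleftrightarrow>
     (\<forall>X Y. vector_field A X \<and> vector_field A Y \<longrightarrow>
        vector_field A (D X Y) \<and>
        (\<forall>Z h. vector_field A Z \<and> h \<in> smooth_functions A \<longrightarrow>
           D (fscale h X + Z) Y = fscale h (D X Y) + D Z Y \<and>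
           D X (fscale h Y + Z) = fscale (\<lambda>p. X p h) Y + fscale h (D X Y) + D X Z))"

definition is_levi_civita ::
  "('m, 'e::euclidean_space) atlas \<Rightarrow> 'm metric \<Rightarrow> 'm connection \<Rightarrow> bool" where
  "is_levi_civita A g D \<longleftrightarrow>
     affine_connection A D \<and>
     (\<forall>X Y. vector_field A X \<and> vector_field A Y \<longrightarrow> D X Y - D Y X = lie_bracket X Y) \<and>
     (\<forall>X Y Z. vector_field A X \<and> vector_field A Y \<and> vector_field A Z \<longrightarrow>
        (\<forall>p. X p (\<lambda>q. g q (Y q) (Z q)) = g p (D X Y p) (Z p) + g p (Y p) (D X Z p)))"

text \<open>Off the smooth vector fields the connection is set to 0, to make it unique.\<close>

definition levi_civita ::
  "('m, 'e::euclidean_space) atlas \<Rightarrow> 'm metric \<Rightarrow> 'm connection" where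
  "levi_civita A g = (THE D. is_levi_civita A g D \<and>
     (\<forall>X Y. \<not> (vector_field A X \<and> vector_field A Y) \<longrightarrow> D X Y = 0))"

text \<open>
  A local orthonormal frame on a neighbourhood \<open>U\<close> of \<open>p\<close>, given by globally defined smooth fields
  \<open>e 0, e 1, \<dots>\<close> (after shrinking \<open>U\<close>, every local frame extends).
\<close>

definition orthonormal_frame ::
  "('m, 'e::euclidean_space) atlas \<Rightarrow> 'm metric \<Rightarrow> 'm \<Rightarrow> 'm set \<Rightarrow> (nat \<Rightarrow> 'm vfield) \<Rightarrow> bool" where
  "orthonormal_frame A g p U e \<longleftrightarrow>
     openin (manifold_topology A) U \<and> p \<in> U \<and>
     (\<forall>i<DIM('e). vector_field A (e i)) \<and>
     (\<forall>q\<in>U. \<forall>i<DIM('e). \<forall>j<DIM('e). g q (e i q) (e j q) = (if i = j then 1 else 0))"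

definition cov_deriv :: "'m connection \<Rightarrow> 'm vfield \<Rightarrow> 'm form \<Rightarrow> 'm vfield list \<Rightarrow> 'm \<Rightarrow> real" where
  "cov_deriv D X \<alpha> Ys p =
     X p (\<lambda>q. \<alpha> q (map (\<lambda>Y. Y q) Ys))
     - (\<Sum>i<length Ys. \<alpha> p ((map (\<lambda>Y. Y p) Ys)[i := D X (Ys ! i) p]))"

text \<open>\<open>\<delta>\<alpha> = - \<Sum>\<^sub>i \<iota>(e\<^sub>i) D(e\<^sub>i) \<alpha>\<close> for any local orthonormal frame.\<close>

definition codiff :: "('m, 'e::euclidean_space) atlas \<Rightarrow> 'm metric \<Rightarrow> 'm form \<Rightarrow> 'm form" where
  "codiff A g \<alpha> = (\<lambda>p vs. if set vs \<subseteq> tangent A p then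
     (THE r. \<forall>U e Xs. orthonormal_frame A g p U e \<and> extends A p Xs vs \<longrightarrow>
        r = - (\<Sum>i<DIM('e). cov_deriv (levi_civita A g) (e i) \<alpha> (e i # Xs) p))
     else 0)"

definition hodge_laplacian ::
  "('m, 'e::euclidean_space) atlas \<Rightarrow> 'm metric \<Rightarrow> 'm form \<Rightarrow> 'm form" where
  "hodge_laplacian A g \<alpha> = codiff A g (ext_d A \<alpha>) + ext_d A (codiff A g \<alpha>)"

definition laplacian ::
  "('m, 'e::euclidean_space) atlas \<Rightarrow> 'm metric \<Rightarrow> ('m \<Rightarrow> real) \<Rightarrow> 'm \<Rightarrow> real" where
  "laplacian A g f p = hodge_laplacian A g (fun_form f) p []"

definition covector_norm_sq ::
  "('m, 'e::euclidean_space) atlas \<Rightarrow> 'm metric \<Rightarrow> 'm form \<Rightarrow> 'm \<Rightarrow> real" where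
  "covector_norm_sq A g \<alpha> p = (THE r. \<forall>U e. orthonormal_frame A g p U e \<longrightarrow>
     r = (\<Sum>i<DIM('e). (\<alpha> p [e i p])\<^sup>2))"


section \<open>Symplectic manifolds and compatible almost-complex structures\<close>

definition symplectic_form :: "('m, 'e::euclidean_space) atlas \<Rightarrow> 'm form \<Rightarrow> bool" where
  "symplectic_form A \<omega> \<longleftrightarrow>
     \<omega> \<in> forms A 2 \<and> ext_d A \<omega> = 0 \<and>
     (\<forall>p. \<forall>u\<in>tangent A p. u \<noteq> 0 \<longrightarrow> (\<exists>v\<in>tangent A p. \<omega> p [u, v] \<noteq> 0))"

type_synonym 'm endo = "'m \<Rightarrow> 'm tvec \<Rightarrow> 'm tvec"

definition almost_complex :: "('m, 'e::euclidean_space) atlas \<Rightarrow> 'm endo \<Rightarrow> bool" where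
  "almost_complex A J \<longleftrightarrow>
     (\<forall>p. \<forall>u\<in>tangent A p. J p u \<in> tangent A p \<and> J p (J p u) = - u \<and>
        (\<forall>w\<in>tangent A p. \<forall>c. J p (\<lambda>f. c * u f + w f) = (\<lambda>f. c * J p u f + J p w f))) \<and>
     (\<forall>X. vector_field A X \<longrightarrow> vector_field A (\<lambda>p. J p (X p)))"

definition ak_metric :: "'m form \<Rightarrow> 'm endo \<Rightarrow> 'm metric" where
  "ak_metric \<omega> J = (\<lambda>p u v. \<omega> p [u, J p v])"

definition compatible ::
  "('m, 'e::euclidean_space) atlas \<Rightarrow> 'm form \<Rightarrow> 'm endo \<Rightarrow> bool" where
  "compatible A \<omega> J \<longleftrightarrow>
     almost_complex A J \<and>
     (\<forall>p. \<forall>u\<in>tangent A p. \<forall>v\<in>tangent A p. \<omega> p [J p u, J p v] = \<omega> p [u, v]) \<and>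
     riemannian_metric A (ak_metric \<omega> J)"

definition AK ::
  "('m, 'e::euclidean_space) atlas \<Rightarrow> 'm form \<Rightarrow> ('m \<Rightarrow> 'm) set \<Rightarrow> 'm endo set" where
  "AK A \<omega> G = {J. compatible A \<omega> J \<and>
     (\<forall>F\<in>G. \<forall>p. \<forall>u\<in>tangent A p. push A F (J p u) = J (F p) (push A F u))}"

definition J_field :: "'m endo \<Rightarrow> 'm vfield \<Rightarrow> 'm vfield" where
  "J_field J X = (\<lambda>p. J p (X p))"

text \<open>\<open>\<nabla>\<^sub>X Y = D\<^sub>X Y - (1/2) J ((D\<^sub>X J) Y)\<close>, where \<open>(D\<^sub>X J) Y = D\<^sub>X (J Y) - J (D\<^sub>X Y)\<close>.\<close>

definition hermitian_connection ::
  "('m, 'e::euclidean_space) atlas \<Rightarrow> 'm form \<Rightarrow> 'm endo \<Rightarrow> 'm connection" where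
  "hermitian_connection A \<omega> J X Y =
     (let D = levi_civita A (ak_metric \<omega> J)
      in D X Y - fscale (\<lambda>_. 1 / 2) (J_field J (D X (J_field J Y) - J_field J (D X Y))))"

text \<open>The sign convention is \<open>R\<^sub>X\<^sub>,\<^sub>Y = \<nabla>\<^sub>[\<^sub>X\<^sub>,\<^sub>Y\<^sub>] - [\<nabla>\<^sub>X, \<nabla>\<^sub>Y]\<close>.\<close>

definition curvature :: "'m connection \<Rightarrow> 'm vfield \<Rightarrow> 'm vfield \<Rightarrow> 'm vfield \<Rightarrow> 'm vfield" where
  "curvature C X Y Z = C (lie_bracket X Y) Z - (C X (C Y Z) - C Y (C X Z))"

text \<open>\<open>J\<close>-adapted frames are ordered as \<open>e 0, J (e 0), e 2, J (e 2), \<dots>\<close>.\<close>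

definition adapted_frame ::
  "('m, 'e::euclidean_space) atlas \<Rightarrow> 'm form \<Rightarrow> 'm endo \<Rightarrow> 'm \<Rightarrow> 'm set \<Rightarrow> (nat \<Rightarrow> 'm vfield) \<Rightarrow> bool"
where
  "adapted_frame A \<omega> J p U e \<longleftrightarrow>
     orthonormal_frame A (ak_metric \<omega> J) p U e \<and>
     (\<forall>q\<in>U. \<forall>i<DIM('e). even i \<longrightarrow> e (Suc i) q = J q (e i q))"

definition chern_ricci ::
  "('m, 'e::euclidean_space) atlas \<Rightarrow> 'm form \<Rightarrow> 'm endo \<Rightarrow> 'm form" where
  "chern_ricci A \<omega> J = (\<lambda>p vs. if length vs = 2 \<and> set vs \<subseteq> tangent A p then
     (THE r. \<forall>X Y U e. extends A p [X, Y] vs \<and> adapted_frame A \<omega> J p U e \<longrightarrow>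
        r = 1 / 2 * (\<Sum>i<DIM('e). ak_metric \<omega> J p
              (curvature (hermitian_connection A \<omega> J) X Y (e i) p) (J p (e i p))))
     else 0)"

definition chern_scalar ::
  "('m, 'e::euclidean_space) atlas \<Rightarrow> nat \<Rightarrow> 'm form \<Rightarrow> 'm endo \<Rightarrow> 'm \<Rightarrow> real" where
  "chern_scalar A n \<omega> J = (THE s.
     fscale s (form_power \<omega> n) =
     fscale (\<lambda>_. real n) (wedge (chern_ricci A \<omega> J) (form_power \<omega> (n - 1))))"

text \<open>
  The class \<open>2 \<pi> c\<^sub>1\<close> in de Rham cohomology, in its Chern-Weil description: it is the class of the
  first Chern-Ricci form of any compatible almost-complex structure.
\<close>

definition represents_2pi_c1 ::
  "('m, 'e::euclidean_space) atlas \<Rightarrow> 'm form \<Rightarrow> 'm form \<Rightarrow> bool" where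
  "represents_2pi_c1 A \<omega> \<beta> \<longleftrightarrow>
     \<beta> \<in> forms A 2 \<and> ext_d A \<beta> = 0 \<and>
     (\<exists>J. compatible A \<omega> J \<and> (\<exists>b\<in>forms A 1. chern_ricci A \<omega> J - \<beta> = ext_d A b))"

definition symplectic_fano :: "('m, 'e::euclidean_space) atlas \<Rightarrow> 'm form \<Rightarrow> bool" where
  "symplectic_fano A \<omega> \<longleftrightarrow> represents_2pi_c1 A \<omega> \<omega>"


section \<open>Hamiltonian symplectomorphisms and Lie subgroups\<close>

definition hamiltonian_field ::
  "('m, 'e::euclidean_space) atlas \<Rightarrow> 'm form \<Rightarrow> ('m \<Rightarrow> real) \<Rightarrow> 'm vfield \<Rightarrow> bool" where
  "hamiltonian_field A \<omega> f X \<longleftrightarrow>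
     vector_field A X \<and> f \<in> smooth_functions A \<and>
     (\<forall>p. \<forall>v\<in>tangent A p. \<omega> p [X p, v] = - ext_d A (fun_form f) p [v])"

text \<open>Time-one maps of the flows \<open>\<Phi>\<close> of smooth time-dependent Hamiltonians \<open>H\<close>.\<close>

definition Ham :: "('m, 'e::euclidean_space) atlas \<Rightarrow> 'm form \<Rightarrow> ('m \<Rightarrow> 'm) set" where
  "Ham A \<omega> = {F. \<exists>H X \<Phi>.
     H \<in> smooth_functions (prod_atlas real_atlas A) \<and>
     smooth_map (prod_atlas real_atlas A) A \<Phi> \<and>
     (\<forall>t. hamiltonian_field A \<omega> (\<lambda>x. H (t, x)) (X t)) \<and>
     (\<forall>x. \<Phi> (0, x) = x) \<and>
     (\<forall>t x. \<forall>f\<in>smooth_functions A.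
        ((\<lambda>s. f (\<Phi> (s, x))) has_real_derivative X t (\<Phi> (t, x)) f) (at t)) \<and>
     F = (\<lambda>x. \<Phi> (1, x))}"

text \<open>
  A Lie subgroup is a group \<open>G\<close> of Hamiltonian symplectomorphisms carrying a Lie group structure,
  given by an atlas \<open>B\<close> of the set \<open>G\<close>, that acts smoothly. Since Euclidean spaces in HOL have positive
  dimension, the connected zero-dimensional Lie group is treated separately, with empty atlas; then
  \<open>tangent B id = {0}\<close>.
\<close>

definition compact_connected_Lie_subgroup ::
  "('m, 'e::euclidean_space) atlas \<Rightarrow> 'm form \<Rightarrow> ('m \<Rightarrow> 'm) set \<Rightarrow> ('m \<Rightarrow> 'm, 'f::euclidean_space) atlas \<Rightarrow> bool"
where
  "compact_connected_Lie_subgroup A \<omega> G B \<longleftrightarrow>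
     G \<subseteq> Ham A \<omega> \<and> id \<in> G \<and> (\<forall>F\<in>G. bij F \<and> inv F \<in> G) \<and> (\<forall>F\<in>G. \<forall>F'\<in>G. F \<circ> F' \<in> G) \<and>
     (G = {id} \<and> B = {} \<or>
      carrier B = G \<and> compact_manifold B \<and> connected_space (manifold_topology B) \<and>
      smooth_map (prod_atlas B B) B (\<lambda>(F, F'). F \<circ> F') \<and>
      smooth_map B B inv \<and>
      smooth_map (prod_atlas B A) A (\<lambda>(F, x). F x))"

text \<open>
  The Lie algebra, as the set of vector fields on the manifold that are induced by the tangent
  vectors \<open>v\<close> of the group at the identity: \<open>p \<mapsto> d/dt (exp (t v) p)\<close> at \<open>t = 0\<close>.
\<close>

definition Lie_algebra ::
  "('m, 'e::euclidean_space) atlas \<Rightarrow> ('m \<Rightarrow> 'm, 'f::euclidean_space) atlas \<Rightarrow> 'm vfield set" where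
  "Lie_algebra A B = {X. \<exists>v\<in>tangent B id.
     X = (\<lambda>p f. if f \<in> smooth_functions A then v (\<lambda>F. f (F p)) else 0)}"

definition Lie_center ::
  "('m, 'e::euclidean_space) atlas \<Rightarrow> ('m \<Rightarrow> 'm, 'f::euclidean_space) atlas \<Rightarrow> 'm vfield set" where
  "Lie_center A B = {\<xi>\<in>Lie_algebra A B. \<forall>\<eta>\<in>Lie_algebra A B. lie_bracket \<xi> \<eta> = 0}"

definition is_potential ::
  "('m, 'e::euclidean_space) atlas \<Rightarrow> nat \<Rightarrow> 'm form \<Rightarrow> 'm vfield \<Rightarrow> ('m \<Rightarrow> real) \<Rightarrow> bool" where
  "is_potential A n \<omega> \<xi> f \<longleftrightarrow>
     hamiltonian_field A \<omega> f \<xi> \<and>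
     form_integral A (form_power \<omega> n)
       (fscale (\<lambda>p. f p * exp (- 2 * f p)) (form_power \<omega> n)) = 0"


section \<open>Solitons and the twisted Hodge decomposition\<close>

text \<open>Here \<open>f\<close> is the normalised potential of \<open>\<xi>\<close>.\<close>

definition GeAKRS ::
  "('m, 'e::euclidean_space) atlas \<Rightarrow> nat \<Rightarrow> 'm form \<Rightarrow> 'm endo \<Rightarrow> ('m \<Rightarrow> real) \<Rightarrow> bool" where
  "GeAKRS A n \<omega> J f \<longleftrightarrow> (let g = ak_metric \<omega> J in
     \<forall>p. chern_scalar A n \<omega> J p - real n - 2 * laplacian A g f p + 2 * f p
         - 2 * covector_norm_sq A g (ext_d A (fun_form f)) p = 0)"

definition conformal_metric :: "nat \<Rightarrow> ('m \<Rightarrow> real) \<Rightarrow> 'm metric \<Rightarrow> 'm metric" where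
  "conformal_metric n f g = (\<lambda>p u v. exp (- (2 * f p / (real n - 1))) * g p u v)"

text \<open>The action of \<open>J\<close> on forms and its inverse; \<open>J\<close> has inverse \<open>- J\<close> on tangent vectors.\<close>

definition J_form ::
  "('m, 'e::euclidean_space) atlas \<Rightarrow> 'm endo \<Rightarrow> 'm form \<Rightarrow> 'm form" where
  "J_form A J \<psi> =
     (\<lambda>p vs. if set vs \<subseteq> tangent A p then \<psi> p (map (\<lambda>v. - J p v) vs) else 0)"

definition J_form_inv ::
  "('m, 'e::euclidean_space) atlas \<Rightarrow> 'm endo \<Rightarrow> 'm form \<Rightarrow> 'm form" where
  "J_form_inv A J \<psi> =
     (\<lambda>p vs. if set vs \<subseteq> tangent A p then \<psi> p (map (J p) vs) else 0)"

definition d_c :: "('m, 'e::euclidean_space) atlas \<Rightarrow> 'm endo \<Rightarrow> 'm form \<Rightarrow> 'm form" where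
  "d_c A J \<alpha> = J_form A J (ext_d A (J_form_inv A J \<alpha>))"

definition codiff_c ::
  "('m, 'e::euclidean_space) atlas \<Rightarrow> 'm endo \<Rightarrow> 'm metric \<Rightarrow> 'm form \<Rightarrow> 'm form" where
  "codiff_c A J g \<alpha> = J_form A J (codiff A g (J_form_inv A J \<alpha>))"

definition laplacian_c ::
  "('m, 'e::euclidean_space) atlas \<Rightarrow> 'm endo \<Rightarrow> 'm metric \<Rightarrow> 'm form \<Rightarrow> 'm form" where
  "laplacian_c A J g \<alpha> = codiff_c A J g (d_c A J \<alpha>) + d_c A J (codiff_c A J g \<alpha>)"

definition twisted_hodge_decomposition ::
  "('m, 'e::euclidean_space) atlas \<Rightarrow> 'm endo \<Rightarrow> 'm metric \<Rightarrow>
     'm form \<Rightarrow> 'm form \<Rightarrow> ('m \<Rightarrow> real) \<Rightarrow> 'm form \<Rightarrow> bool" where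
  "twisted_hodge_decomposition A J g a aH h \<psi> \<longleftrightarrow>
     aH \<in> forms A 1 \<and> laplacian_c A J g aH = 0 \<and>
     h \<in> smooth_functions A \<and> \<psi> \<in> forms A 2 \<and>
     a = aH + d_c A J (fun_form h) + codiff_c A J g \<psi>"

end

theory Submission
  imports Defs
begin

text \<open>
  Write \<open>b\<close> for the 1-form \<open>a \<circ> J\<close>, let gradient and divergence be those of \<open>g\<close>, and put
  \<open>W u = dv (grad u) - 2 (grad u) f\<close>; the weight \<open>exp (- 2 f)\<close> turns \<open>W u\<close> into the divergence of
  \<open>exp (- 2 f) grad u\<close>. The theorem holds because its hypotheses turn the soliton expression into
  \<open>W (h + f) + 2 c\<close> with a constant \<open>c\<close>. Three computations give this.

  The Chern scalar curvature: since the Chern-Ricci form is \<open>\<omega> + da\<close>, its trace exceeds \<open>n\<close> by the trace of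
  \<open>da\<close> with respect to \<open>\<omega>\<close>. That trace is the divergence of the field dual to \<open>b\<close>: the correction by the
  derivative of \<open>J\<close> is traced over a frame, and this trace vanishes because \<open>\<omega>\<close> is closed
  (\<open>J_coclosed\<close>, \<open>chern_scalar_divergence\<close>).

  The function \<open>a \<xi>\<close>: here \<open>\<xi> = J grad f\<close>. As a Hamiltonian field \<open>\<xi>\<close> preserves \<open>\<omega>\<close>, and
  as an infinitesimal motion of the group it preserves \<open>J\<close> and \<open>a\<close> (\<open>infinitesimal_invariance\<close>); thus it
  preserves \<open>g\<close> and both connections (\<open>killing_connection\<close>). For such a field the Chern-Ricci form contracted with \<open>\<xi>\<close> is exact with primitive
  \<open>1/2 dv (grad f)\<close> (\<open>ricci_killing\<close>). The contractions of \<open>\<omega>\<close> and \<open>da\<close> are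
  \<open>- df\<close> and \<open>- d (a \<xi>)\<close>, so on a connected manifold \<open>a \<xi> = - 1/2 dv (grad f) - f + c\<close>. The left side is \<open>b (grad f)\<close>.

  The Hodge decomposition: conjugation with \<open>J\<close> turns it into the decomposition of \<open>b\<close> for the
  ordinary Laplacian of the conformal metric. Its harmonic and its coexact part are coclosed for that metric, so
  \<open>b\<close> and \<open>dh\<close> have the same codifferential. The conformal factor is the one for which this codifferential is, up to
  a factor without zeros, the divergence weighted by \<open>exp (- 2 f)\<close> (\<open>conf_codiff\<close>, \<open>twisted_coclosed\<close>).

  It remains to integrate. If the expression vanishes, integration against \<open>exp (- 2 f)\<close> gives \<open>c = 0\<close>,
  and then \<open>W (h + f) = 0\<close> forces the square norm of \<open>d (h + f)\<close> to have integral zero. If conversely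
  \<open>d (h + f) = 0\<close>, the expression is the constant \<open>2 c\<close>; integrating the formula for \<open>a \<xi>\<close>
  against \<open>exp (- 2 f)\<close> and using the normalisation of \<open>f\<close> gives \<open>c = 0\<close> (\<open>soliton_iff\<close>).

  Only three properties of the integral enter: linearity, definiteness, and that divergences integrate
  to zero (locale \<open>riem_integral\<close>). They hold for the integral defined by charts and partitions of
  unity, with any volume form that is constant on suitable orthonormal frames (locale \<open>volume\<close>); the top power
  of \<open>\<omega>\<close> is constant on adapted frames. Tangent vectors are derivations, and all fields are globally defined: local objects are
  cut off, and an operator that is linear over the smooth functions is evaluated at a point by extending
  tangent vectors arbitrarily (\<open>tensorial\<close>).
\<close>

section \<open>Functions of class Ck\<close>

abbreviation "Lie \<equiv> lie_bracket"
abbreviation "FD \<equiv> frechet_derivative"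

lemma Ck_on_cong:
 assumes "open S" "!!x. x : S ==> f x = g x" "Ck_on k S f"
 shows "Ck_on k S g"
 using assms(2,3)
proof (induction k arbitrary: f g)
 case 0
 then show ?case by (simp cong: continuous_on_cong)
next
 case (Suc k)
 have d: "f differentiable (at x)" if "x : S" for x using Suc that by simp
 have e: "FD f (at x) = FD g (at x)" if "x : S" for x
  using frechet_derivative_transform_within_open[OF d[OF that] assms(1) that] Suc(2) by blast
 have "g differentiable (at x)" if x: "x : S" for x
 proof -
  obtain D where D: "(f has_derivative D) (at x)" using d[OF x] unfolding differentiable_def by blast
  from has_derivative_transform_within_open[OF D assms(1) x] Suc(2)
  show ?thesis unfolding differentiable_def by blast
 qed
 moreover have "Ck_on k S (%x. FD g (at x) v)" for v
  by (rule Suc.IH[of "%x. FD f (at x) v"]) (use e Suc in auto)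
 ultimately show ?case by simp
qed

lemma Ck_on_subset: "Ck_on k S f ==> T <= S ==> Ck_on k T f"
 by (induction k arbitrary: f) (auto intro: continuous_on_subset)

lemma Ck_on_SucD: "Ck_on (Suc k) S f ==> Ck_on k S f"
proof (induction k arbitrary: f)
 case 0
 then show ?case
  by (auto intro!: differentiable_imp_continuous_on simp: differentiable_on_def differentiable_at_withinI)
next
 case (Suc k)
 then show ?case by simp
qed

lemma Ck_on_SucI:
 assumes "!!x. x : S ==> (f has_derivative f' x) (at x)"
  and "!!v. Ck_on k S (%x. f' x v)" "open S"
 shows "Ck_on (Suc k) S f"
proof -
 have "Ck_on k S (%x. FD f (at x) v)" for v
  by (rule Ck_on_cong[OF assms(3) _ assms(2)[of v]]) (use assms(1) frechet_derivative_at in fastforce)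
 then show ?thesis using assms(1) by (auto simp: differentiable_def)
qed

lemma Ck_on_const [simp]: "Ck_on k S (%x. c)"
 by (induction k arbitrary: c) auto

lemma Ck_on_bounded_linear:
 assumes "bounded_linear L" "open S" "Ck_on k S f"
 shows "Ck_on k S (%x. L (f x))"
 using assms(3)
proof (induction k arbitrary: f)
 case 0
 then show ?case using assms(1) bounded_linear.continuous_on by fastforce
next
 case (Suc k)
 show ?case
  by (rule Ck_on_SucI[where f'="%x v. L (FD f (at x) v)"])
   (use Suc assms in \<open>auto intro: bounded_linear.has_derivative simp: frechet_derivative_works\<close>)
qed

lemma Ck_on_ident: "open S ==> Ck_on k S (%x. x)"
 by (cases k) (auto simp: continuous_on_id)

lemma Ck_on_linear: "bounded_linear L ==> open S ==> Ck_on k S L"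
 using Ck_on_bounded_linear[OF _ _ Ck_on_ident] by auto

lemma Ck_on_add:
 assumes "open S" "Ck_on k S f" "Ck_on k S g"
 shows "Ck_on k S (%x. f x + g x)"
 using assms(2,3)
proof (induction k arbitrary: f g)
 case 0
 then show ?case by (auto intro: continuous_intros)
next
 case (Suc k)
 show ?case
  by (rule Ck_on_SucI[where f'="%x v. FD f (at x) v + FD g (at x) v"])
   (use Suc assms in \<open>auto intro: has_derivative_add simp: frechet_derivative_works\<close>)
qed

lemma Ck_on_scaleR:
 fixes f :: "'a::real_normed_vector => real"
 assumes "open S" "Ck_on k S f" "Ck_on k S g"
 shows "Ck_on k S (%x. f x *\<^sub>R g x)"
 using assms(2,3)
proof (induction k arbitrary: f g)
 case 0
 then show ?case by (auto intro: continuous_intros)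
next
 case (Suc k)
 note S = Suc.prems Suc.prems[THEN Ck_on_SucD]
 show ?case
 proof (rule Ck_on_SucI[OF _ _ assms(1)])
  show "((%x. f x *\<^sub>R g x) has_derivative
    (%v. f x *\<^sub>R FD g (at x) v + FD f (at x) v *\<^sub>R g x)) (at x)"
   if "x : S" for x
   using S that by (auto intro: has_derivative_scaleR simp: frechet_derivative_works)
  show "Ck_on k S (%x. f x *\<^sub>R FD g (at x) v + FD f (at x) v *\<^sub>R g x)" for v
   by (intro Ck_on_add assms Suc.IH) (use S in auto)
 qed
qed

lemma Ck_on_mult:
 fixes f g :: "'a::real_normed_vector => real"
 assumes "open S" "Ck_on k S f" "Ck_on k S g"
 shows "Ck_on k S (%x. f x * g x)"
 using Ck_on_scaleR[OF assms] by simp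

lemma Ck_on_sum:
 assumes "open S" "!!i. i : I ==> Ck_on k S (f i)"
 shows "Ck_on k S (%x. \<Sum>i\<in>I. f i x)"
 using assms(2) by (induction I rule: infinite_finite_induct) (auto intro: Ck_on_add[OF assms(1)])

lemma Ck_on_open_cover:
 assumes "!!x. x : S ==> EX T. open T & x : T & Ck_on k T f"
 shows "Ck_on k S f"
 using assms
proof (induction k arbitrary: f)
 case 0
 then show ?case
  by (metis Ck_on.simps(1) continuous_on_eq_continuous_at continuous_at_imp_continuous_on)
next
 case (Suc k)
 then show ?case
 proof (simp, intro conjI ballI allI)
  fix x assume "x : S"
  then show "f differentiable (at x)" using Suc.prems by fastforce
 next
  fix v
  show "Ck_on k S (%x. FD f (at x) v)"
   by (rule Suc.IH) (use Suc.prems in fastforce)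
 qed
qed

lemma Ck_on_compose:
 fixes f :: "'a::real_normed_vector => 'b::euclidean_space" and g :: "'b => 'c::real_normed_vector"
 assumes "open S" "open T" "f ` S <= T" "Ck_on k S f" "Ck_on k T g"
 shows "Ck_on k S (%x. g (f x))"
 using assms(4,5)
proof (induction k arbitrary: g)
 case 0
 then show ?case using continuous_on_compose2[of T g S f] assms(3) by simp
next
 case (Suc k)
 note S = Suc.prems Suc.prems[THEN Ck_on_SucD]
 show ?case
 proof (rule Ck_on_SucI[OF _ _ assms(1)])
  fix x assume x: "x : S"
  have df: "(f has_derivative FD f (at x)) (at x)"
   using S x by (auto simp: frechet_derivative_works)
  have dg: "(g has_derivative FD g (at (f x))) (at (f x))"
   using S x assms(3) by (auto simp: frechet_derivative_works[symmetric])
  have lg: "linear (FD g (at (f x)))"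
   using dg has_derivative_linear by blast
  have "(%v. FD g (at (f x)) (FD f (at x) v))
    = (%v. \<Sum>b\<in>Basis. (FD f (at x) v \<bullet> b) *\<^sub>R FD g (at (f x)) b)"
  proof
   fix v
   have "FD g (at (f x)) (\<Sum>b\<in>Basis. (FD f (at x) v \<bullet> b) *\<^sub>R b) =
    (\<Sum>b\<in>Basis. (FD f (at x) v \<bullet> b) *\<^sub>R FD g (at (f x)) b)"
    using lg by (simp add: linear_sum linear_scale)
   then show "FD g (at (f x)) (FD f (at x) v) =
     (\<Sum>b\<in>Basis. (FD f (at x) v \<bullet> b) *\<^sub>R FD g (at (f x)) b)"
    by (simp add: euclidean_representation)
  qed
  then show "((%x. g (f x)) has_derivative
    (%v. \<Sum>b\<in>Basis. (FD f (at x) v \<bullet> b) *\<^sub>R FD g (at (f x)) b)) (at x)"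
   using diff_chain_at[OF df dg] by (simp add: o_def)
 next
  fix v
  have "Ck_on k S (%x. FD g (at (f x)) b)" for b
   using Suc.IH[of "%y. FD g (at y) b"] S by auto
  then show "Ck_on k S (%x. \<Sum>b\<in>Basis. (FD f (at x) v \<bullet> b) *\<^sub>R FD g (at (f x)) b)"
   using S(1) by (intro Ck_on_sum Ck_on_scaleR assms(1) Ck_on_bounded_linear[where L="%y. y \<bullet> _"] bounded_linear_inner_left) auto
 qed
qed

lemma Ck_on_exp: "Ck_on k UNIV (exp :: real => real)"
proof (induction k)
 case (Suc k)
 show ?case
  by (rule Ck_on_SucI[where f'="%x v. exp x * v"])
   (use Suc in \<open>auto intro!: Ck_on_mult derivative_eq_intros\<close>)
qed (auto intro: continuous_intros)

lemma Ck_on_inverse: "Ck_on k (- {0}) (inverse :: real => real)"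
proof (induction k)
 case 0
 then show ?case by (auto intro!: continuous_intros)
next
 case (Suc k)
 have "Ck_on k (- {0}) (%x. (inverse x * inverse x) * - v)" for v :: real
  by (intro Ck_on_mult Suc) (auto simp: open_Compl)
 then show ?case
  by (intro Ck_on_SucI[where f'="%x v. (inverse x * inverse x) * - v"])
   (auto intro!: derivative_eq_intros simp: open_Compl)
qed

lemma Ck_on_sqrt: "Ck_on k {0<..} sqrt"
proof (induction k)
 case 0
 then show ?case by (auto intro!: continuous_intros)
next
 case (Suc k)
 have "Ck_on k {0<..} (%x. inverse (sqrt x))"
  by (rule Ck_on_compose[OF _ _ _ Suc Ck_on_inverse]) auto
 then have "Ck_on k {0<..} (%x. inverse (sqrt x) * (v / 2))" for v
  by (intro Ck_on_mult) auto
 then show ?case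
  by (intro Ck_on_SucI[where f'="%x v. inverse (sqrt x) * (v / 2)"])
   (auto intro!: derivative_eq_intros simp: field_simps)
qed

section \<open>Bump functions\<close>

text \<open>
 The functions \<open>x\<^sup>-\<^sup>m exp (- 1 / x)\<close>, extended by zero, form a family whose
 span is closed under differentiation.
\<close>
definition flat :: "nat => real => real" where
 "flat m x = (if 0 < x then (1 / x) ^ m * exp (- (1 / x)) else 0)"

lemma flat_limit: "((%x. flat m x / x) \<longlongrightarrow> 0) (at 0)"
proof -
 have t: "((%y::real. y ^ Suc m / exp y) \<longlongrightarrow> 0) at_top"
  by (rule tendsto_power_div_exp_0)
 have r: "((%x. flat m x / x) \<longlongrightarrow> 0) (at_right 0)"
 proof (rule Lim_transform_eventually)
  show "((%x::real. inverse x ^ Suc m / exp (inverse x)) \<longlongrightarrow> 0) (at_right 0)"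
   using filterlim_compose[OF t filterlim_inverse_at_top_right] by simp
  show "eventually (%x. inverse x ^ Suc m / exp (inverse x) = flat m x / x) (at_right 0)"
   by (auto simp: eventually_at_filter flat_def field_simps exp_minus)
 qed
 have l: "((%x. flat m x / x) \<longlongrightarrow> 0) (at_left 0)"
  by (rule tendsto_eventually) (auto simp: eventually_at_filter flat_def)
 show ?thesis using l r by (simp add: filterlim_split_at)
qed

lemma flat_deriv:
 "(flat m has_derivative (%v. (flat (m + 2) x - real m * flat (Suc m) x) * v)) (at x)"
proof -
 consider "x < 0" | "x = 0" | "x > 0" by linarith
 then have "(flat m has_real_derivative (flat (m + 2) x - real m * flat (Suc m) x)) (at x)"
 proof cases
  case 1
  have "((%x. 0) has_real_derivative 0) (at x)" by simp
  then have "(flat m has_real_derivative 0) (at x)"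
   by (rule has_field_derivative_transform_within_open[where S="{..<0}"]) (use 1 in \<open>auto simp: flat_def\<close>)
  then show ?thesis using 1 by (simp add: flat_def)
 next
  case 2
  have "(flat m has_real_derivative 0) (at 0)"
   unfolding has_field_derivative_iff using flat_limit[of m] by (simp add: flat_def)
  then show ?thesis using 2 by (simp add: flat_def)
 next
  case 3
  have "((%x. (1 / x) ^ m * exp (- (1 / x))) has_real_derivative
    (real m * (1 / x) ^ (m - 1) * (- (1 / x\<^sup>2))) * exp (- (1 / x)) + (1 / x) ^ m * (exp (- (1 / x)) * (1 / x\<^sup>2))) (at x)"
   using 3 by (auto intro!: derivative_eq_intros simp: power2_eq_square)
  also have "(real m * (1 / x) ^ (m - 1) * (- (1 / x\<^sup>2))) * exp (- (1 / x)) + (1 / x) ^ m * (exp (- (1 / x)) * (1 / x\<^sup>2))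
    = flat (m + 2) x - real m * flat (Suc m) x"
   using 3 by (cases m) (simp_all add: flat_def field_simps power2_eq_square)
  finally have "((%x. (1 / x) ^ m * exp (- (1 / x))) has_real_derivative
    (flat (m + 2) x - real m * flat (Suc m) x)) (at x)" .
  then show ?thesis
   by (rule has_field_derivative_transform_within_open[where S="{0<..}"]) (use 3 in \<open>auto simp: flat_def\<close>)
 qed
 then show ?thesis by (simp add: has_field_derivative_def)
qed

lemma Ck_on_flat: "Ck_on k UNIV (flat m)"
proof (induction k arbitrary: m)
 case 0
 have "continuous (at x) (flat m)" for x using flat_deriv has_derivative_continuous by blast
 then show ?case by (simp add: continuous_at_imp_continuous_on)
next
 case (Suc k)
 have "Ck_on k UNIV (%x. (flat (m + 2) x + (- real m) * flat (Suc m) x) * v)" for v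
  by (intro Ck_on_mult Ck_on_add Suc) auto
 then show ?case by (intro Ck_on_SucI[OF flat_deriv]) auto
qed

definition ramp :: "real => real" where
 "ramp t = flat 0 t / (flat 0 t + flat 0 (1 - t))"

lemma flat0_nonneg: "flat 0 t \<ge> 0" and flat0_pos: "t > 0 ==> flat 0 t > 0"
 and flat0_zero: "t \<le> 0 ==> flat 0 t = 0"
 by (auto simp: flat_def)

lemma ramp_denominator_pos: "flat 0 t + flat 0 (1 - t) > 0"
 using flat0_nonneg[of t] flat0_nonneg[of "1 - t"] flat0_pos[of t] flat0_pos[of "1 - t"]
 by (cases "t > 0") (auto intro: add_pos_nonneg add_nonneg_pos)

lemma ramp_range: "0 \<le> ramp t" "ramp t \<le> 1"
 using ramp_denominator_pos[of t] flat0_nonneg[of t] flat0_nonneg[of "1-t"] by (auto simp: ramp_def)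

lemma ramp_0: "t \<le> 0 ==> ramp t = 0" and ramp_1: "t \<ge> 1 ==> ramp t = 1"
 using flat0_zero[of "1-t"] flat0_pos[of t] by (auto simp: ramp_def flat0_zero)

lemma Ck_on_ramp: "Ck_on k UNIV ramp"
proof -
 have l: "Ck_on k UNIV (%t. flat 0 (1 - t))"
 proof (rule Ck_on_compose[OF _ _ _ _ Ck_on_flat])
  have "Ck_on k UNIV (%t::real. 1 + (- 1) * t)"
   by (intro Ck_on_add Ck_on_mult Ck_on_ident) auto
  then show "Ck_on k UNIV (%t::real. 1 - t)" by simp
 qed auto
 have "Ck_on k UNIV (%t. inverse (flat 0 t + flat 0 (1 - t)))"
  by (rule Ck_on_compose[OF _ _ _ Ck_on_add[OF _ Ck_on_flat l] Ck_on_inverse])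
   (use ramp_denominator_pos less_irrefl in \<open>auto, metis less_irrefl\<close>)
 then have "Ck_on k UNIV (%t. flat 0 t * inverse (flat 0 t + flat 0 (1 - t)))"
  by (intro Ck_on_mult Ck_on_flat) auto
 then show ?thesis by (simp add: ramp_def[abs_def] divide_inverse)
qed

definition bump_at :: "'e::euclidean_space => real => 'e => real" where
 "bump_at c r y = ramp (2 - 2 * ((y - c) \<bullet> (y - c)) / r\<^sup>2)"

lemma bump_at:
 assumes "r > 0"
 shows "0 \<le> bump_at c r y" "bump_at c r y \<le> 1"
  and "y ~: cball c r ==> bump_at c r y = 0"
  and "!!y. y : ball c (r / 2) ==> bump_at c r y = 1"
  and "!!k. Ck_on k UNIV (bump_at c r)"
proof -
 show "0 \<le> bump_at c r y" "bump_at c r y \<le> 1" by (simp_all add: bump_at_def ramp_range)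
 have n: "(y - c) \<bullet> (y - c) = (dist c y)\<^sup>2" for y
  by (simp add: dist_norm norm_minus_commute[of c] power2_norm_eq_inner)
 show "bump_at c r y = 0" if "y ~: cball c r"
 proof -
  have "r\<^sup>2 \<le> (dist c y)\<^sup>2" using that assms by (intro power_mono) auto
  then show ?thesis using assms unfolding bump_at_def n by (intro ramp_0) (simp add: field_simps)
 qed
 show "bump_at c r y = 1" if "y : ball c (r / 2)" for y
 proof -
  have "(dist c y)\<^sup>2 \<le> (r/2)\<^sup>2" using that assms by (intro power_mono) auto
  then have "4 * (dist c y)\<^sup>2 \<le> r\<^sup>2" by (simp add: power_divide)
  then have "2 * (dist c y)\<^sup>2 \<le> r\<^sup>2" using zero_le_power2[of "dist c y"] by linarith
  then show ?thesis using assms unfolding bump_at_def n by (intro ramp_1) (simp add: field_simps)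
 qed
 show "Ck_on k UNIV (bump_at c r)" for k
 proof -
  have i: "Ck_on k UNIV (%y. (y - c) \<bullet> (y - c))"
  proof -
   have "Ck_on k UNIV (%y. \<Sum>b\<in>Basis. (y \<bullet> b + - (c \<bullet> b)) * (y \<bullet> b + - (c \<bullet> b)))"
    by (intro Ck_on_sum Ck_on_mult Ck_on_add Ck_on_const Ck_on_linear bounded_linear_inner_left) auto
   then show ?thesis by (subst euclidean_inner) (simp add: inner_diff_left)
  qed
  have "Ck_on k UNIV (%y. 2 + (- 2 / r\<^sup>2) * ((y - c) \<bullet> (y - c)))"
   by (intro Ck_on_add Ck_on_mult i) auto
  then have "Ck_on k UNIV (%y. 2 - 2 * ((y - c) \<bullet> (y - c)) / r\<^sup>2)" by simp
  from Ck_on_compose[OF _ _ _ this Ck_on_ramp] show ?thesis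
   by (simp add: bump_at_def[abs_def])
 qed
qed

section \<open>Hadamard and Clairaut\<close>

text \<open>
 Differentiation under the integral reproduces an integral of the same kind with one more factor
 \<open>t\<close>; the exponent \<open>j\<close> is there to let the induction go through.
\<close>
lemma Ck_on_ray_average:
 fixes F :: "'e::euclidean_space => real"
 assumes "!!k. Ck_on k UNIV F"
 shows "Ck_on k UNIV (%y. integral (cbox 0 1) (%t. t ^ j * F (c + t *\<^sub>R (y - c))))"
 using assms
proof (induction k arbitrary: F j)
 case 0
 have "continuous_on UNIV F" using 0[of 0] by simp
 moreover have i: "continuous_on (UNIV \<times> cbox 0 1) (%z::'e \<times> real. c + snd z *\<^sub>R (fst z - c))"
  by (intro continuous_intros)
 ultimately have f: "continuous_on (UNIV \<times> cbox 0 1) (%z::'e \<times> real. F (c + snd z *\<^sub>R (fst z - c)))"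
  by (rule continuous_on_compose2) simp
 have p: "continuous_on (UNIV \<times> cbox 0 1) (%z::'e \<times> real. snd z ^ j)"
  by (intro continuous_intros)
 have "continuous_on (UNIV \<times> cbox 0 1) (%(y, t::real). t ^ j * F (c + t *\<^sub>R (y - c)))"
  using continuous_on_mult[OF p f] by (simp add: split_beta)
 then show ?case
  using integral_continuous_on_param[of UNIV 0 1 "%y t. t ^ j * F (c + t *\<^sub>R (y - c))"] by simp
next
 case (Suc k)
 let ?D = "%y. FD F (at y)"
 have dF: "(F has_derivative ?D y) (at y)" for y
  using Suc.prems[of 1] by (simp add: frechet_derivative_works)
 have bl: "bounded_linear (?D y)" for y using dF has_derivative_bounded_linear by blast
 have sD: "Ck_on i UNIV (%y. ?D y v)" for i v using Suc.prems[of "Suc i"] by simp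
 define B where "B = (%y t. (t ^ Suc j) *\<^sub>R Blinfun (?D (c + t *\<^sub>R (y - c))))"
 have B: "blinfun_apply (B y t) v = t ^ Suc j * ?D (c + t *\<^sub>R (y - c)) v" for y t v
  unfolding B_def by (simp add: scaleR_blinfun.rep_eq bounded_linear_Blinfun_apply[OF bl])
 have cB: "continuous_on (UNIV \<times> cbox 0 1) (%(y, t). B y t)"
 proof (rule continuous_on_blinfun_componentwise)
  fix i :: 'e assume "i : Basis"
  have "continuous_on UNIV (%y. ?D y i)" using sD[of 0 i] by (simp only: Ck_on.simps)
  moreover have "continuous_on (UNIV \<times> cbox 0 1) (%z::'e \<times> real. c + snd z *\<^sub>R (fst z - c))"
   by (intro continuous_intros)
  ultimately have f: "continuous_on (UNIV \<times> cbox 0 1) (%z::'e \<times> real. ?D (c + snd z *\<^sub>R (fst z - c)) i)"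
   by (rule continuous_on_compose2) simp
  have p: "continuous_on (UNIV \<times> cbox 0 1) (%z::'e \<times> real. snd z ^ Suc j)"
   by (intro continuous_intros)
  have "continuous_on (UNIV \<times> cbox 0 1) (%(y, t::real). t ^ Suc j * ?D (c + t *\<^sub>R (y - c)) i)"
   using continuous_on_mult[OF p f] unfolding split_beta .
  then show "continuous_on (UNIV \<times> cbox 0 1) (%z. blinfun_apply (case z of (y, t) => B y t) i)"
   by (simp add: split_beta B)
 qed
 have cF: "continuous_on UNIV F" using Suc.prems[of 0] by simp
 have int: "(%t::real. t ^ j * F (c + t *\<^sub>R (y - c))) integrable_on cbox 0 1" for y
 proof (rule integrable_continuous, rule continuous_on_mult)
  have "continuous_on (cbox 0 1) (%t::real. c + t *\<^sub>R (y - c))" by (intro continuous_intros)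
  then show "continuous_on (cbox 0 1) (%t::real. F (c + t *\<^sub>R (y - c)))"
   by (rule continuous_on_compose2[OF cF]) simp
 qed (intro continuous_intros)
 have der: "((%y. t ^ j * F (c + t *\<^sub>R (y - c))) has_derivative blinfun_apply (B y t)) (at y within UNIV)" for y t
 proof -
  have "((%y. c + t *\<^sub>R (y - c)) has_derivative (%v. t *\<^sub>R v)) (at y)"
   by (auto intro!: derivative_eq_intros)
  from diff_chain_at[OF this dF]
  have "((%y. F (c + t *\<^sub>R (y - c))) has_derivative (%v. ?D (c + t *\<^sub>R (y - c)) (t *\<^sub>R v))) (at y)"
   by (simp add: o_def)
  then have "((%y. t ^ j * F (c + t *\<^sub>R (y - c))) has_derivative
    (%v. t ^ j * ?D (c + t *\<^sub>R (y - c)) (t *\<^sub>R v))) (at y)"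
   by (rule has_derivative_mult_right)
  moreover have "(%v. t ^ j * ?D (c + t *\<^sub>R (y - c)) (t *\<^sub>R v)) = blinfun_apply (B y t)"
   by (simp add: B fun_eq_iff linear_scale[OF bounded_linear.linear[OF bl]])
  ultimately show ?thesis by (simp only: UNIV_I)
 qed
 have L: "((%y. integral (cbox 0 1) (%t. t ^ j * F (c + t *\<^sub>R (y - c)))) has_derivative
   blinfun_apply (integral (cbox 0 1) (B y))) (at y)" for y
  using leibniz_rule[of UNIV 0 1 "%y t. t ^ j * F (c + t *\<^sub>R (y - c))" B y, OF der int cB] by simp
 have "blinfun_apply (integral (cbox 0 1) (B y)) v
   = integral (cbox 0 1) (%t. t ^ Suc j * ?D (c + t *\<^sub>R (y - c)) v)" for y v
 proof -
  have "continuous_on (cbox 0 1) (B y)"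
   using continuous_on_compose2[OF cB, of "cbox 0 1" "%t. (y, t)"]
   by (simp add: continuous_on_Pair continuous_on_const continuous_on_id image_subset_iff)
  then have "B y integrable_on cbox 0 1" by (rule integrable_continuous)
  from integral_linear[OF this, of "%z. blinfun_apply z v"] show ?thesis
   by (simp add: o_def B blinfun.bounded_linear_left)
 qed
 then show ?case
  using Suc.IH[OF sD, of "Suc j"] by (intro Ck_on_SucI[OF L]) auto
qed

text \<open>
 Hadamard: integrate the derivative of \<open>F\<close> along the segment from \<open>c\<close> to
 \<open>y\<close>. This makes derivations of smooth functions computable, see
 \<open>tangent_chart\<close>.
\<close>
lemma hadamard:
 fixes F :: "'e::euclidean_space => real"
 assumes "!!k. Ck_on k UNIV F"
 obtains G where "!!b k. Ck_on k UNIV (G b)"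
  and "!!y. F y = F c + (\<Sum>b\<in>Basis. ((y - c) \<bullet> b) * G b y)"
  and "!!b. G b c = FD F (at c) b"
proof
 let ?D = "%y. FD F (at y)"
 define G where "G = (%b y. integral (cbox 0 1) (%t. ?D (c + t *\<^sub>R (y - c)) b))"
 have dF: "(F has_derivative ?D y) (at y)" for y
  using assms[of 1] by (simp add: frechet_derivative_works)
 have lin: "linear (?D y)" for y using dF has_derivative_linear by blast
 have sD: "Ck_on k UNIV (%y. ?D y v)" for k v using assms[of "Suc k"] by simp
 show "Ck_on k UNIV (G b)" for b k
  using Ck_on_ray_average[OF sD, of k 0 c b] by (simp add: G_def)
 show "G b c = ?D c b" for b by (simp add: G_def)
 fix y
 have c: "continuous_on UNIV (%y. ?D y b)" for b using sD[of 0] by simp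
 have int: "(%t. ?D (c + t *\<^sub>R (y - c)) b) integrable_on {0..1}" for b
  unfolding cbox_interval[symmetric]
 proof (rule integrable_continuous)
  have "continuous_on (cbox 0 1) (%t::real. c + t *\<^sub>R (y - c))" by (intro continuous_intros)
  then show "continuous_on (cbox 0 1) (%t::real. ?D (c + t *\<^sub>R (y - c)) b)"
   by (rule continuous_on_compose2[OF c]) simp
 qed
 have "((%t. ?D (c + t *\<^sub>R (y - c)) (y - c)) has_integral
   F (c + 1 *\<^sub>R (y - c)) - F (c + 0 *\<^sub>R (y - c))) {0..1}"
 proof (rule fundamental_theorem_of_calculus)
  fix t :: real
  have "((%t. c + t *\<^sub>R (y - c)) has_derivative (%s. s *\<^sub>R (y - c))) (at t)"
   by (auto intro!: derivative_eq_intros)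
  from diff_chain_at[OF this dF]
  have "((%t. F (c + t *\<^sub>R (y - c))) has_derivative
    (%s. s *\<^sub>R ?D (c + t *\<^sub>R (y - c)) (y - c))) (at t)"
   by (simp only: o_def linear_scale[OF lin])
  then show "((%t. F (c + t *\<^sub>R (y - c))) has_vector_derivative ?D (c + t *\<^sub>R (y - c)) (y - c)) (at t within {0..1})"
   unfolding has_vector_derivative_def by (rule has_derivative_at_withinI)
 qed simp
 then have "F y - F c = integral {0..1} (%t. ?D (c + t *\<^sub>R (y - c)) (y - c))"
  by (simp add: integral_unique)
 also have "(%t. ?D (c + t *\<^sub>R (y - c)) (y - c)) =
   (%t. \<Sum>b\<in>Basis. ((y - c) \<bullet> b) * ?D (c + t *\<^sub>R (y - c)) b)"
 proof
  fix t
  have "?D (c + t *\<^sub>R (y - c)) (\<Sum>b\<in>Basis. ((y - c) \<bullet> b) *\<^sub>R b) =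
    (\<Sum>b\<in>Basis. ((y - c) \<bullet> b) * ?D (c + t *\<^sub>R (y - c)) b)"
   using lin by (simp add: linear_sum linear_scale)
  then show "?D (c + t *\<^sub>R (y - c)) (y - c) = (\<Sum>b\<in>Basis. ((y - c) \<bullet> b) * ?D (c + t *\<^sub>R (y - c)) b)"
   by (simp add: euclidean_representation)
 qed
 also have "integral {0..1} ... = (\<Sum>b\<in>Basis. ((y - c) \<bullet> b) * G b y)"
  using int by (subst integral_sum) (auto simp: G_def intro: integrable_on_mult_right)
 finally show "F y = F c + (\<Sum>b\<in>Basis. ((y - c) \<bullet> b) * G b y)" by simp
qed

text \<open>
 Two applications of the mean value theorem, first in the direction \<open>u\<close>, then in the
 direction \<open>v\<close>.
\<close>
lemma second_difference:
 fixes f :: "'a::euclidean_space => real"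
 assumes S: "!!s r. 0 \<le> s ==> s \<le> t ==> 0 \<le> r ==> r \<le> t ==> x + s *\<^sub>R u + r *\<^sub>R v : S"
  and C: "Ck_on 2 S f" and t: "0 < t"
 obtains s r where "0 \<le> s" "s \<le> t" "0 \<le> r" "r \<le> t"
  "f (x + t *\<^sub>R u + t *\<^sub>R v) - f (x + t *\<^sub>R u) - f (x + t *\<^sub>R v) + f x =
   t * t * FD (%y. FD f (at y) u) (at (x + s *\<^sub>R u + r *\<^sub>R v)) v"
proof -
 let ?D = "%y. FD f (at y)"
 have C': "!!y. y : S ==> f differentiable at y"
  "!!y w. y : S ==> (%y. ?D y w) differentiable at y"
  using C by (auto simp: numeral_2_eq_2)
 have d: "((%s. g (a + s *\<^sub>R w)) has_real_derivative FD g (at (a + s *\<^sub>R w)) w) (at s)"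
  if "g differentiable at (a + s *\<^sub>R w)" for g :: "'a => real" and a w s
 proof -
  have 1: "((%s. a + s *\<^sub>R w) has_derivative (%s. s *\<^sub>R w)) (at s)"
   by (auto intro!: derivative_eq_intros)
  have 2: "(g has_derivative FD g (at (a + s *\<^sub>R w))) (at (a + s *\<^sub>R w))"
   using that by (simp add: frechet_derivative_works)
  show ?thesis using diff_chain_at[OF 1 2] linear_scale[OF has_derivative_linear[OF 2]]
   by (simp add: has_field_derivative_def o_def mult.commute[of _ "FD _ _ _"])
 qed
 have "EX s>0. s < t & (f (x + t *\<^sub>R v + t *\<^sub>R u) - f (x + t *\<^sub>R u)) - (f (x + t *\<^sub>R v + 0 *\<^sub>R u) - f (x + 0 *\<^sub>R u))
  = (t - 0) * (?D (x + t *\<^sub>R v + s *\<^sub>R u) u - ?D (x + s *\<^sub>R u) u)"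
 proof (rule MVT2)
  fix s assume s: "0 \<le> s" "s \<le> t"
  have "x + s *\<^sub>R u + t *\<^sub>R v : S" "x + s *\<^sub>R u + 0 *\<^sub>R v : S" using S s t by (simp_all only:)
  then have "x + t *\<^sub>R v + s *\<^sub>R u : S" "x + s *\<^sub>R u : S" by (simp_all add: ac_simps)
  then show "((%s. f (x + t *\<^sub>R v + s *\<^sub>R u) - f (x + s *\<^sub>R u)) has_real_derivative
   (?D (x + t *\<^sub>R v + s *\<^sub>R u) u - ?D (x + s *\<^sub>R u) u)) (at s)"
   by (intro DERIV_diff d C')
 qed (use t in auto)
 then obtain s where s: "0 < s" "s < t" and
  e: "f (x + t *\<^sub>R u + t *\<^sub>R v) - f (x + t *\<^sub>R u) - f (x + t *\<^sub>R v) + f x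
   = t * (?D (x + s *\<^sub>R u + t *\<^sub>R v) u - ?D (x + s *\<^sub>R u) u)"
  by (auto simp: ac_simps)
 have "EX r>0. r < t & ?D (x + s *\<^sub>R u + t *\<^sub>R v) u - ?D (x + s *\<^sub>R u + 0 *\<^sub>R v) u
  = (t - 0) * FD (%y. ?D y u) (at (x + s *\<^sub>R u + r *\<^sub>R v)) v"
 proof (rule MVT2[OF t, where f="%r. ?D (x + s *\<^sub>R u + r *\<^sub>R v) u"
    and f'="%r. FD (%y. ?D y u) (at (x + s *\<^sub>R u + r *\<^sub>R v)) v"])
  fix r assume "0 \<le> r" "r \<le> t"
  then have "x + s *\<^sub>R u + r *\<^sub>R v : S" using S s by simp
  then show "((%r. ?D (x + s *\<^sub>R u + r *\<^sub>R v) u) has_real_derivative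
    FD (%y. ?D y u) (at (x + s *\<^sub>R u + r *\<^sub>R v)) v) (at r)"
   by (intro d C')
 qed
 then obtain r where r: "0 < r" "r < t" and
  "?D (x + s *\<^sub>R u + t *\<^sub>R v) u - ?D (x + s *\<^sub>R u) u
  = t * FD (%y. ?D y u) (at (x + s *\<^sub>R u + r *\<^sub>R v)) v"
  by auto
 then show thesis using that[of s r] s e by simp
qed

text \<open>
 The second difference quotient is symmetric in \<open>u\<close> and \<open>v\<close> and converges
 to either mixed derivative.
\<close>
lemma mixed_second_derivatives:
 fixes f :: "'a::euclidean_space => real"
 assumes "open S" "x : S" "Ck_on 2 S f"
 shows "FD (%y. FD f (at y) u) (at x) v =
  FD (%y. FD f (at y) v) (at x) u"
proof -
 define P where "P = (%u v y. FD (%y. FD f (at y) u) (at y) v)"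
 have c: "continuous_on S (P u v)" for u v
  using assms(3) by (simp add: numeral_2_eq_2 P_def)
 have "\<bar>P u v x - P v u x\<bar> \<le> e" if "e > 0" for e
 proof -
  obtain d1 where d1: "d1 > 0" "!!y. y : S ==> dist y x < d1 ==> \<bar>P u v y - P u v x\<bar> < e / 2"
   using c[of u v] assms(2) \<open>e > 0\<close> unfolding continuous_on_iff dist_real_def by (meson half_gt_zero)
  obtain d2 where d2: "d2 > 0" "!!y. y : S ==> dist y x < d2 ==> \<bar>P v u y - P v u x\<bar> < e / 2"
   using c[of v u] assms(2) \<open>e > 0\<close> unfolding continuous_on_iff dist_real_def by (meson half_gt_zero)
  obtain d3 where d3: "d3 > 0" "ball x d3 <= S" using assms open_contains_ball by blast
  define d where "d = min d1 (min d2 d3)"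
  have d: "d > 0" "d \<le> d1" "d \<le> d2" "d \<le> d3" using d1 d2 d3 by (auto simp: d_def)
  define t where "t = d / (2 * (norm u + norm v + 1))"
  have t: "t > 0" using d by (auto simp: t_def intro!: divide_pos_pos add_nonneg_pos)
  have near: "dist (x + s *\<^sub>R u + r *\<^sub>R v) x < d" if "0 \<le> s" "s \<le> t" "0 \<le> r" "r \<le> t" for s r
  proof -
   have "dist (x + s *\<^sub>R u + r *\<^sub>R v) x = norm (s *\<^sub>R u + r *\<^sub>R v)"
    by (simp add: dist_norm algebra_simps)
   also have "... \<le> s * norm u + r * norm v"
    using norm_triangle_ineq[of "s *\<^sub>R u" "r *\<^sub>R v"] that by simp
   also have "... \<le> t * norm u + t * norm v" using that by (intro add_mono mult_right_mono) auto
   also have "... \<le> t * (norm u + norm v + 1)" using t by (simp add: algebra_simps)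
   also have "... = d / 2"
   proof -
    define q where "q = norm u + norm v + 1"
    have "q > 0" unfolding q_def by (intro add_nonneg_pos) auto
    then show ?thesis unfolding t_def q_def[symmetric] by simp
   qed
   finally show ?thesis using d by simp
  qed
  have inS: "x + s *\<^sub>R u + r *\<^sub>R v : S" if "0 \<le> s" "s \<le> t" "0 \<le> r" "r \<le> t" for s r
   using near[OF that] d d3 by (auto simp: dist_commute subset_iff)
  obtain s r where sr: "0 \<le> s" "s \<le> t" "0 \<le> r" "r \<le> t" and
   1: "f (x + t *\<^sub>R u + t *\<^sub>R v) - f (x + t *\<^sub>R u) - f (x + t *\<^sub>R v) + f x = t * t * P u v (x + s *\<^sub>R u + r *\<^sub>R v)"
   using second_difference[of t x u v S f] inS assms(3) t by (auto simp: P_def)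
  have inS': "x + s *\<^sub>R v + r *\<^sub>R u : S" if "0 \<le> s" "s \<le> t" "0 \<le> r" "r \<le> t" for s r
   using inS[of r s] that by (simp add: ac_simps)
  obtain s' r' where sr': "0 \<le> s'" "s' \<le> t" "0 \<le> r'" "r' \<le> t" and
   2: "f (x + t *\<^sub>R v + t *\<^sub>R u) - f (x + t *\<^sub>R v) - f (x + t *\<^sub>R u) + f x = t * t * P v u (x + s' *\<^sub>R v + r' *\<^sub>R u)"
   using second_difference[of t x v u S f] inS' assms(3) t by (auto simp: P_def)
  have "x + t *\<^sub>R v + t *\<^sub>R u = x + t *\<^sub>R u + t *\<^sub>R v" by simp
  with 1 2 have "t * t * P u v (x + s *\<^sub>R u + r *\<^sub>R v) = t * t * P v u (x + s' *\<^sub>R v + r' *\<^sub>R u)"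
   by (metis add.commute diff_diff_eq)
  then have eq: "P u v (x + s *\<^sub>R u + r *\<^sub>R v) = P v u (x + r' *\<^sub>R u + s' *\<^sub>R v)"
   using t by (simp add: ac_simps)
  have "\<bar>P u v (x + s *\<^sub>R u + r *\<^sub>R v) - P u v x\<bar> < e / 2"
   by (rule d1(2)) (use inS[OF sr] near[OF sr] d in auto)
  moreover have "\<bar>P v u (x + r' *\<^sub>R u + s' *\<^sub>R v) - P v u x\<bar> < e / 2"
   by (rule d2(2)) (use inS[of r' s'] near[of r' s'] sr' d in auto)
  ultimately show ?thesis using eq by linarith
 qed
 then have "P u v x = P v u x" using field_le_epsilon[of "\<bar>P u v x - P v u x\<bar>" 0] by auto
 then show ?thesis by (simp add: P_def)
qed

section \<open>Manifolds\<close>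

locale hausdorff_manifold =
 fixes A :: "('m, 'e::euclidean_space) atlas"
 assumes atlas: "smooth_atlas A" and hausdorff: "Hausdorff_space (manifold_topology A)"
begin

abbreviation "SF \<equiv> smooth_functions A"
abbreviation "T \<equiv> manifold_topology A"
abbreviation "C \<equiv> carrier A"

lemma chart_inj: "(U, \<phi>) : A ==> inj_on \<phi> U"
 and chart_open: "(U, \<phi>) : A ==> open (\<phi> ` U)"
 and transition_open: "(U, \<phi>) : A ==> (V, \<psi>) : A ==> open (\<phi> ` (U \<inter> V))"
 and transition_smooth: "(U, \<phi>) : A ==> (V, \<psi>) : A ==> Ck_on k (\<phi> ` (U \<inter> V)) (\<psi> \<circ> inv_into U \<phi>)"
 using atlas by (fastforce simp: smooth_atlas_def smooth_on_def)+

lemma chart_carrier: "(U, \<phi>) : A ==> U <= C"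
 by (force simp: carrier_def)

lemma openin_iff: "openin T W \<longleftrightarrow> W <= C & (ALL (U, \<phi>):A. open (\<phi> ` (W \<inter> U)))"
proof -
 have "istopology (%W. W <= C & (ALL (U, \<phi>):A. open (\<phi> ` (W \<inter> U))))"
  unfolding istopology_def
 proof (intro conjI allI impI; clarify?)
  fix S S' U \<phi> assume S: "ALL (U, \<phi>):A. open (\<phi> ` (S \<inter> U))" "ALL (U, \<phi>):A. open (\<phi> ` (S' \<inter> U))" and U: "(U, \<phi>) : A"
  have "\<phi> ` (S \<inter> S' \<inter> U) = \<phi> ` (S \<inter> U) \<inter> \<phi> ` (S' \<inter> U)"
   using chart_inj[OF U] by (auto simp: inj_on_def)
  moreover have "open (\<phi> ` (S \<inter> U))" "open (\<phi> ` (S' \<inter> U))" using S U by auto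
  ultimately show "open (\<phi> ` (S \<inter> S' \<inter> U))" by (simp add: open_Int)
 next
  fix K U \<phi> assume K: "ALL W:K. W <= C & (ALL (U, \<phi>):A. open (\<phi> ` (W \<inter> U)))" and U: "(U, \<phi>) : A"
  have "\<phi> ` (\<Union> K \<inter> U) = (\<Union>W\<in>K. \<phi> ` (W \<inter> U))" by blast
  moreover have "open (\<phi> ` (W \<inter> U))" if "W : K" for W using K U that by auto
  ultimately show "open (\<phi> ` (\<Union> K \<inter> U))" by auto
 qed blast+
 then show ?thesis unfolding manifold_topology_def by simp
qed

lemma openin_chart_image: "openin T W ==> (U, \<phi>) : A ==> open (\<phi> ` (W \<inter> U))"
 by (auto simp: openin_iff)

lemma openin_chart: "(U, \<phi>) : A ==> openin T U"
 using transition_open by (auto simp: openin_iff chart_carrier Int_commute dest: chart_carrier)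

lemma topspace_T [simp]: "topspace T = C"
proof
 show "topspace T <= C" using openin_topspace[of T] unfolding openin_iff by (rule conjunct1)
 have "openin T C" unfolding openin_iff
  using chart_open chart_carrier by (auto simp: Int_absorb1)
 then show "C <= topspace T" by (rule openin_subset)
qed

lemma openin_C: "openin T C"
 using openin_topspace[of T] unfolding topspace_T .

lemma carrier_chart: assumes "p : C" obtains U \<phi> where "(U, \<phi>) : A" "p : U"
 using assms by (auto simp: carrier_def)

lemma inv_chart: "(U, \<phi>) : A ==> p : U ==> inv_into U \<phi> (\<phi> p) = p"
 using chart_inj inv_into_f_f by metis

lemma smooth_chart: "f : SF ==> (U, \<phi>) : A ==> Ck_on k (\<phi> ` U) (f \<circ> inv_into U \<phi>)"
 by (auto simp: smooth_functions_def smooth_on_def)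

lemma smoothI: "(!!U \<phi> k. (U, \<phi>) : A ==> Ck_on k (\<phi> ` U) (f \<circ> inv_into U \<phi>)) ==> f : SF"
 by (auto simp: smooth_functions_def smooth_on_def)

lemma smooth_local:
 assumes "!!p. p : C ==> EX W s. openin T W & p : W & s : SF & (ALL q:W. f q = s q)"
 shows "f : SF"
proof (rule smoothI, rule Ck_on_open_cover)
 fix U \<phi> k y assume c: "(U, \<phi>) : A" and "y : \<phi> ` U"
 then obtain p where p: "p : U" "y = \<phi> p" by blast
 then obtain W s where W: "openin T W" "p : W" "s : SF" "!!q. q : W ==> f q = s q"
  using assms[of p] chart_carrier[OF c] by blast
 have "Ck_on k (\<phi> ` (W \<inter> U)) (f \<circ> inv_into U \<phi>)"
  by (rule Ck_on_cong[OF openin_chart_image[OF W(1) c] _ Ck_on_subset[OF smooth_chart[OF W(3) c]]])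
   (use W inv_chart[OF c] in auto)
 then show "EX V. open V & y : V & Ck_on k V (f \<circ> inv_into U \<phi>)"
  using openin_chart_image[OF W(1) c] p W by blast
qed

lemma smooth_const [simp]: "(%_. c) : SF"
 by (rule smoothI) (simp add: o_def)

lemma smooth_add: "f : SF ==> g : SF ==> (%p. f p + g p) : SF"
 by (rule smoothI) (use smooth_chart chart_open in \<open>auto simp: o_def intro!: Ck_on_add\<close>)

lemma smooth_mult: "f : SF ==> g : SF ==> (%p. f p * g p) : SF"
 by (rule smoothI) (use smooth_chart chart_open in \<open>auto simp: o_def intro!: Ck_on_mult\<close>)

lemma smooth_minus: "f : SF ==> (%p. - f p) : SF"
 using smooth_mult[OF smooth_const[of "-1"]] by simp

lemma smooth_diff: "f : SF ==> g : SF ==> (%p. f p - g p) : SF"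
 using smooth_add[OF _ smooth_minus] by simp

lemma smooth_sum: "(!!i. i : I ==> f i : SF) ==> (%p. \<Sum>i\<in>I. f i p) : SF"
 by (induction I rule: infinite_finite_induct) (auto intro: smooth_add)

lemma smooth_comp:
 assumes f: "f : SF" and "open S" "!!p. p : C ==> f p : S" "!!k. Ck_on k S (g :: real => real)"
 shows "(%p. g (f p)) : SF"
proof (rule smoothI)
 fix U \<phi> k assume c: "(U, \<phi>) : A"
 have "(f \<circ> inv_into U \<phi>) ` (\<phi> ` U) <= S"
  using assms(3) inv_chart[OF c] chart_carrier[OF c] by auto
 from Ck_on_compose[OF chart_open[OF c] assms(2) this smooth_chart[OF f c] assms(4)]
 show "Ck_on k (\<phi> ` U) ((%p. g (f p)) \<circ> inv_into U \<phi>)" by (simp add: o_def)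
qed

lemma smooth_exp: "f : SF ==> (%p. exp (f p :: real)) : SF"
 by (rule smooth_comp[OF _ _ _ Ck_on_exp]) auto

lemma chart_extend:
 assumes c: "(U, \<phi>) : A" and K: "closedin T K" "K <= U"
  and h: "!!k. Ck_on k (\<phi> ` U) h" and F: "!!q. q : U ==> F q = h (\<phi> q)"
  and 0: "!!q. q : C ==> q ~: K ==> F q = 0"
 shows "F : SF"
proof (rule smoothI, rule Ck_on_open_cover)
 fix V \<psi> k y assume d: "(V, \<psi>) : A" and "y : \<psi> ` V"
 then obtain p where p: "p : V" "y = \<psi> p" by blast
 show "EX W. open W & y : W & Ck_on k W (F \<circ> inv_into V \<psi>)"
 proof (cases "p : U")
  case True
  have "(\<phi> \<circ> inv_into V \<psi>) ` (\<psi> ` (V \<inter> U)) <= \<phi> ` U"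
   using inv_chart[OF d] by auto
  from Ck_on_compose[OF transition_open[OF d c] chart_open[OF c] this transition_smooth[OF d c] h]
  have "Ck_on k (\<psi> ` (V \<inter> U)) (%y. h ((\<phi> \<circ> inv_into V \<psi>) y))" .
  then have "Ck_on k (\<psi> ` (V \<inter> U)) (F \<circ> inv_into V \<psi>)"
   by (rule Ck_on_cong[OF transition_open[OF d c], rotated]) (use F inv_chart[OF d] in auto)
  then show ?thesis using transition_open[OF d c] p True by blast
 next
  case False
  have o: "openin T (C - K)" using K by (metis closedin_def topspace_T)
  have "Ck_on k (\<psi> ` ((C - K) \<inter> V)) (F \<circ> inv_into V \<psi>)"
   by (rule Ck_on_cong[OF openin_chart_image[OF o d], of "%_. 0"]) (use 0 inv_chart[OF d] in auto)
  then show ?thesis using openin_chart_image[OF o d] p False K chart_carrier[OF d] by blast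
 qed
qed

text \<open>
 Compact subsets of a chart are closed in the manifold; this is where the Hausdorff property enters.
\<close>
lemma chart_cball_closed:
 assumes c: "(U, \<phi>) : A" and r: "cball y r <= \<phi> ` U"
 shows "closedin T (inv_into U \<phi> ` cball y r)"
proof -
 have "continuous_map (top_of_set (\<phi> ` U)) T (inv_into U \<phi>)"
  unfolding continuous_map_def
 proof (intro conjI allI impI)
  show "inv_into U \<phi> : topspace (top_of_set (\<phi> ` U)) \<rightarrow> topspace T"
   using chart_carrier[OF c] inv_chart[OF c] by auto
 next
  fix W assume W: "openin T W"
  have "{x : topspace (top_of_set (\<phi> ` U)). inv_into U \<phi> x : W} = \<phi> ` (W \<inter> U)"
   using inv_chart[OF c] by auto
  moreover have "openin (top_of_set (\<phi> ` U)) (\<phi> ` (W \<inter> U))"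
   using openin_chart_image[OF W c] chart_open[OF c] by (simp add: openin_open_eq image_mono)
  ultimately show "openin (top_of_set (\<phi> ` U)) {x : topspace (top_of_set (\<phi> ` U)). inv_into U \<phi> x : W}"
   by simp
 qed
 moreover have "compactin (top_of_set (\<phi> ` U)) (cball y r)"
  using r by (simp add: compactin_subtopology)
 ultimately have "compactin T (inv_into U \<phi> ` cball y r)"
  using image_compactin by blast
 then show ?thesis using hausdorff compactin_imp_closedin by blast
qed

lemma openin_chart_vimage:
 assumes c: "(U, \<phi>) : A" and S: "open S"
 shows "openin T {q : U. \<phi> q : S}"
 unfolding openin_iff
proof (intro conjI ballI)
 show "{q : U. \<phi> q : S} <= C" using chart_carrier[OF c] by blast
 fix z assume "z : A"
 then obtain X \<psi> where d: "(X, \<psi>) : A" and z: "z = (X, \<psi>)" by (cases z) auto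
 have cont: "continuous_on (\<psi> ` (X \<inter> U)) (\<phi> \<circ> inv_into X \<psi>)"
  using transition_smooth[OF d c, of 0] by simp
 have "open ((\<phi> \<circ> inv_into X \<psi>) -` S \<inter> \<psi> ` (X \<inter> U))"
  using cont S unfolding continuous_on_open_vimage[OF transition_open[OF d c]] by blast
 moreover have "(\<phi> \<circ> inv_into X \<psi>) -` S \<inter> \<psi> ` (X \<inter> U) = \<psi> ` ({q : U. \<phi> q : S} \<inter> X)"
  using inv_chart[OF d] by auto
 ultimately show "case z of (Ua, \<phi>') => open (\<phi>' ` ({q : U. \<phi> q : S} \<inter> Ua))"
  using z by simp
qed

text \<open>The bump function of a small ball in a chart, extended by zero.\<close>
lemma bump:
 assumes W: "openin T W" and p: "p : W"
 obtains th K V where "th : SF" "closedin T K" "K <= W" "openin T V" "p : V" "V <= K"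
  "!!q. q : V ==> th q = 1" "!!q. q ~: K ==> th q = 0" "!!q. 0 \<le> th q" "!!q. th q \<le> 1"
proof -
 have "p : C" using W p by (auto simp: openin_iff)
 then obtain U \<phi> where c: "(U, \<phi>) : A" "p : U" by (rule carrier_chart)
 obtain r where r: "r > 0" "cball (\<phi> p) r <= \<phi> ` (W \<inter> U)"
  using open_contains_cball openin_chart_image[OF W c(1)] p c(2) by (metis IntI imageI)
 define K where "K = inv_into U \<phi> ` cball (\<phi> p) r"
 define V where "V = {q : U. \<phi> q : ball (\<phi> p) (r / 2)}"
 define th where "th q = (if q : U then bump_at (\<phi> p) r (\<phi> q) else 0)" for q
 have K: "closedin T K" unfolding K_def by (rule chart_cball_closed[OF c(1)]) (use r in auto)
 have KW: "K <= W \<inter> U"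
 proof
  fix q assume "q : K"
  then obtain y where "y : cball (\<phi> p) r" "q = inv_into U \<phi> y" by (auto simp: K_def)
  then show "q : W \<inter> U" using r inv_chart[OF c(1)] by (metis (no_types, lifting) IntD2 imageE subsetD)
 qed
 have VK: "V <= K"
 proof
  fix q assume q: "q : V"
  then have "q = inv_into U \<phi> (\<phi> q)" "\<phi> q : cball (\<phi> p) r"
   using inv_chart[OF c(1)] r by (auto simp: V_def)
  then show "q : K" unfolding K_def by (rule image_eqI)
 qed
 have oV: "openin T V" unfolding V_def by (rule openin_chart_vimage[OF c(1)]) simp
 have pV: "p : V" using c(2) r by (simp add: V_def)
 have 0: "th q = 0" if "q ~: K" for q
 proof (cases "q : U")
  case True
  have "\<phi> q ~: cball (\<phi> p) r"
   using that inv_chart[OF c(1) True] unfolding K_def by (metis imageI)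
  then show ?thesis using bump_at(3)[OF r(1), of "\<phi> q" "\<phi> p"] by (simp add: th_def)
 qed (simp add: th_def)
 have s: "th : SF"
  by (rule chart_extend[OF c(1) K, of "bump_at (\<phi> p) r"])
   (use KW 0 in \<open>auto simp: th_def intro: Ck_on_subset[OF bump_at(5)[OF r(1)]]\<close>)
 have 1: "th q = 1" if "q : V" for q
 proof -
  have "\<phi> q : ball (\<phi> p) (r / 2)" "q : U" using that by (auto simp: V_def)
  then show ?thesis using bump_at(4)[OF r(1)] by (simp add: th_def)
 qed
 show thesis
  by (rule that[of th K V]) (use s K KW oV pV VK 0 1 bump_at(1,2)[OF r(1)] in \<open>auto simp: th_def\<close>)
qed

section \<open>Tangent vectors\<close>

lemma tangent_lin: "v : tangent A p ==> f : SF ==> h : SF ==> v (%x. c * f x + h x) = c * v f + v h"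
 and tangent_mult: "v : tangent A p ==> f : SF ==> h : SF ==> v (%x. f x * h x) = f p * v h + h p * v f"
 and tangent_nonsmooth: "v : tangent A p ==> f ~: SF ==> v f = 0"
 by (auto simp: tangent_def)

lemma tangent_add: "v : tangent A p ==> f : SF ==> h : SF ==> v (%x. f x + h x) = v f + v h"
 using tangent_lin[of v p f h 1] by simp

lemma tangent_zero: "v : tangent A p ==> v (%x. 0) = 0"
 using tangent_add[of v p "%_. 0" "%_. 0"] by simp

lemma tangent_const: assumes v: "v : tangent A p" shows "v (%x. c) = 0"
proof -
 have "v (%x. 1) = 0" using tangent_mult[OF v, of "%_. 1" "%_. 1"] by simp
 then show ?thesis using tangent_lin[OF v, of "%_. 1" "%_. 0" c] tangent_zero[OF v] by simp
qed

lemma tangent_cmult: "v : tangent A p ==> f : SF ==> v (%x. c * f x) = c * v f"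
 using tangent_lin[of v p f "%_. 0" c] tangent_zero by simp

lemma tangent_minus: "v : tangent A p ==> f : SF ==> v (%x. - f x) = - v f"
 using tangent_cmult[of v p f "-1"] by simp

lemma tangent_diff: "v : tangent A p ==> f : SF ==> h : SF ==> v (%x. f x - h x) = v f - v h"
 using tangent_add[of v p f "%x. - h x"] tangent_minus[of v p h] smooth_minus by simp

lemma tangent_sum:
 assumes v: "v : tangent A p" and "!!i. i : I ==> f i : SF"
 shows "v (%x. \<Sum>i\<in>I. f i x) = (\<Sum>i\<in>I. v (f i))"
 using assms(2)
proof (induction I rule: infinite_finite_induct)
 case (insert i I)
 then show ?case using tangent_add[OF v, of "f i" "%x. \<Sum>i\<in>I. f i x"] smooth_sum[of I f] by simp
qed (auto simp: tangent_zero[OF v])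

text \<open>
 Multiply the difference of the functions by a bump function at \<open>p\<close> and apply the
 product rule.
\<close>
lemma tangent_local:
 assumes v: "v : tangent A p" and fh: "f : SF" "h : SF"
  and W: "openin T W" "p : W" "!!q. q : W ==> f q = h q"
 shows "v f = v h"
proof -
 obtain th K V where th: "th : SF" "K <= W" "p : V" "!!q. q : V ==> th q = 1"
  "!!q. q ~: K ==> th q = 0" using bump[OF W(1,2)] by metis
 have "th x * (f x - h x) = 0" for x
 proof (cases "x : K")
  case True
  then have "f x = h x" using W(3) th(2) by blast
  then show ?thesis by simp
 qed (use th in simp)
 then have "(%x. th x * (f x - h x)) = (%x. 0)" by blast
 then have "v (%x. th x * (f x - h x)) = 0" using tangent_zero[OF v] by (simp only:)
 then have "v (%x. f x - h x) = 0"
  using tangent_mult[OF v th(1) smooth_diff[OF fh]] th(3,4) W by simp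
 then show ?thesis using tangent_diff[OF v fh] by simp
qed

lemma tangent_comb: "u : tangent A p ==> w : tangent A p ==> (%f. c * u f + w f) : tangent A p"
 unfolding tangent_def mem_Collect_eq by (intro conjI ballI allI impI; simp add: algebra_simps)

lemma zero_tangent: "(%f. 0) : tangent A p"
 by (auto simp: tangent_def)

lemma frechet_mult:
 assumes "f differentiable at x" "g differentiable at x"
 shows "FD (%y. f y * g y :: real) (at x) b
  = f x * FD g (at x) b + g x * FD f (at x) b"
proof -
 have "((%y. f y * g y) has_derivative (%b. f x * FD g (at x) b + FD f (at x) b * g x)) (at x)"
  using assms by (intro has_derivative_mult) (auto simp: frechet_derivative_works)
 from fun_cong[OF frechet_derivative_at[OF this], of b] show ?thesis
  by (simp only: mult.commute[of "g x"])
qed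

lemma frechet_lin:
 assumes "f differentiable at x" "g differentiable at x"
 shows "FD (%y. c * f y + g y :: real) (at x) b
  = c * FD f (at x) b + FD g (at x) b"
proof -
 have "((%y. c * f y + g y) has_derivative (%b. c * FD f (at x) b + FD g (at x) b)) (at x)"
  using assms by (intro has_derivative_add has_derivative_mult_right) (auto simp: frechet_derivative_works)
 from fun_cong[OF frechet_derivative_at[OF this], of b] show ?thesis by (rule sym)
qed

lemma smooth_chart_differentiable:
 "f : SF ==> (U, \<phi>) : A ==> y : \<phi> ` U ==> (f \<circ> inv_into U \<phi>) differentiable at y"
 using smooth_chart[of f U \<phi> 1] unfolding One_nat_def Ck_on.simps by blast

definition cvec :: "'m set => ('m => 'e) => 'm => 'e => 'm tvec" where
 "cvec U \<phi> q b = (%f. if f : SF then FD (f \<circ> inv_into U \<phi>) (at (\<phi> q)) b else 0)"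

lemma cvec_tangent:
 assumes c: "(U, \<phi>) : A" "q : U"
 shows "cvec U \<phi> q b : tangent A q"
proof -
 have d: "(f \<circ> inv_into U \<phi>) differentiable at (\<phi> q)" if "f : SF" for f
  using smooth_chart_differentiable[OF that c(1)] c(2) by blast
 have "cvec U \<phi> q b (%x. r * f x + h x) = r * cvec U \<phi> q b f + cvec U \<phi> q b h"
  if "f : SF" "h : SF" for f h r
  using that frechet_lin[OF d d, of f h r b] smooth_add[OF smooth_mult[OF smooth_const[of r]], of f h]
  by (simp add: cvec_def o_def)
 moreover have "cvec U \<phi> q b (%x. f x * h x) = f q * cvec U \<phi> q b h + h q * cvec U \<phi> q b f"
  if "f : SF" "h : SF" for f h
  using that frechet_mult[OF d d, of f h b] smooth_mult[of f h] inv_chart[OF c]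
  by (simp add: cvec_def o_def)
 ultimately show ?thesis by (auto simp: tangent_def cvec_def)
qed

text \<open>
 Every derivation is a combination of partial derivatives: by \<open>hadamard\<close> a function is,
 near \<open>p\<close>, its value plus a sum of products \<open>(x b - x b p) * H b\<close>, and the
 product rule leaves only \<open>v (x b)\<close> and the values \<open>H b p\<close>.
\<close>
lemma tangent_chart:
 assumes c: "(U, \<phi>) : A" and p: "p : W" and W: "openin T W" "W <= U"
  and x: "!!b. b : Basis ==> x b : SF" "!!b q. b : Basis ==> q : W ==> x b q = \<phi> q \<bullet> b"
  and v: "v : tangent A p"
 shows "v f = (\<Sum>b\<in>Basis. v (x b) * cvec U \<phi> p b f)"
proof (cases "f : SF")
 case False
 then show ?thesis using tangent_nonsmooth[OF v] by (simp add: cvec_def)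
next
 case f: True
 have pU: "p : U" using p W by blast
 have oW: "open (\<phi> ` (W \<inter> U))" by (rule openin_chart_image[OF W(1) c])
 obtain r where r: "r > 0" "cball (\<phi> p) r <= \<phi> ` (W \<inter> U)"
  using open_contains_cball oW p pU by (metis IntI imageI)
 define F where "F y = bump_at (\<phi> p) r y * (f \<circ> inv_into U \<phi>) y" for y
 have F: "Ck_on k UNIV F" for k
 proof (rule Ck_on_open_cover)
  fix y
  show "EX S. open S & y : S & Ck_on k S F"
  proof (cases "y : \<phi> ` U")
   case True
   have "Ck_on k (\<phi> ` U) F" unfolding F_def
    by (rule Ck_on_mult[OF chart_open[OF c] Ck_on_subset[OF bump_at(5)[OF r(1)]] smooth_chart[OF f c]]) simp
   then show ?thesis using True chart_open[OF c] by blast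
  next
   case False
   have o: "open (- cball (\<phi> p) r)" by (simp add: open_Compl)
   have "Ck_on k (- cball (\<phi> p) r) F"
    by (rule Ck_on_cong[OF o, of "%_. 0"]) (use bump_at(3)[OF r(1)] in \<open>auto simp: F_def\<close>)
   then show ?thesis using False r o by blast
  qed
 qed
 obtain G where G: "!!b k. Ck_on k UNIV (G b)"
  "!!y. F y = F (\<phi> p) + (\<Sum>b\<in>Basis. ((y - \<phi> p) \<bullet> b) * G b y)"
  "!!b. G b (\<phi> p) = FD F (at (\<phi> p)) b"
  using hadamard[of F "\<phi> p"] F by metis
 have Fe: "F y = (f \<circ> inv_into U \<phi>) y" if "y : ball (\<phi> p) (r / 2)" for y
  using bump_at(4)[OF r(1) that] by (simp add: F_def)
 have Gp: "G b (\<phi> p) = cvec U \<phi> p b f" for b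
 proof -
  have dF: "F differentiable at (\<phi> p)" using F[of 1] by simp
  have "FD F (at (\<phi> p)) = FD (f \<circ> inv_into U \<phi>) (at (\<phi> p))"
   by (rule frechet_derivative_transform_within_open[OF dF, of "ball (\<phi> p) (r / 2)"]) (use Fe r in auto)
  then show ?thesis unfolding G(3) using f by (simp add: cvec_def)
 qed
 obtain th K V where th: "th : SF" "closedin T K" "K <= W" "openin T V" "p : V" "V <= K"
  "!!q. q : V ==> th q = 1" "!!q. q ~: K ==> th q = 0" using bump[OF W(1) p] by metis
 define H where "H b q = (if q : U then th q * G b (\<phi> q) else 0)" for b q
 have H: "H b : SF" for b
 proof (rule chart_extend[OF c th(2), of "%y. (th \<circ> inv_into U \<phi>) y * G b y"])
  show "Ck_on k (\<phi> ` U) (%y. (th \<circ> inv_into U \<phi>) y * G b y)" for k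
   by (rule Ck_on_mult[OF chart_open[OF c] smooth_chart[OF th(1) c] Ck_on_subset[OF G(1)]]) simp
 qed (use th W inv_chart[OF c] in \<open>auto simp: H_def\<close>)
 have pb: "\<phi> p \<bullet> b = x b p" if "b : Basis" for b using x(2)[OF that p] by simp
 have "openin T (V \<inter> {q : U. \<phi> q : ball (\<phi> p) (r / 2)})"
  by (intro openin_Int th(4) openin_chart_vimage[OF c]) simp
 moreover have "p : V \<inter> {q : U. \<phi> q : ball (\<phi> p) (r / 2)}" using pU th(5) r by simp
 ultimately obtain N where N: "openin T N" "p : N" "!!q. q : N ==> q : V" "!!q. q : N ==> \<phi> q : ball (\<phi> p) (r / 2)"
  by (metis (no_types, lifting) IntD1 IntD2 mem_Collect_eq)
 let ?R = "%q. F (\<phi> p) + (\<Sum>b\<in>Basis. (x b q - x b p) * H b q)"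
 have sR: "(%q. (x b q - x b p) * H b q) : SF" if "b : Basis" for b
  by (intro smooth_mult smooth_diff x that H smooth_const)
 have "v f = v ?R"
 proof (rule tangent_local[OF v f _ N(1,2)])
  show "?R : SF" by (intro smooth_add smooth_const smooth_sum sR)
  fix q assume q: "q : N"
  have qU: "q : U" "q : W" using N(3)[OF q] th W by blast+
  have "f q = F (\<phi> q)" using Fe[OF N(4)[OF q]] inv_chart[OF c qU(1)] by simp
  also have "... = F (\<phi> p) + (\<Sum>b\<in>Basis. ((\<phi> q - \<phi> p) \<bullet> b) * G b (\<phi> q))" by (rule G(2))
  also have "(\<Sum>b\<in>Basis. ((\<phi> q - \<phi> p) \<bullet> b) * G b (\<phi> q)) = (\<Sum>b\<in>Basis. (x b q - x b p) * H b q)"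
   by (rule sum.cong) (use qU th(7)[OF N(3)[OF q]] x(2) p in \<open>auto simp: H_def inner_diff_left\<close>)
  finally show "f q = ?R q" .
 qed
 also have "... = (\<Sum>b\<in>Basis. v (%q. (x b q - x b p) * H b q))"
 proof -
  have s: "(%q. \<Sum>b\<in>Basis. (x b q - x b p) * H b q) : SF" by (rule smooth_sum[OF sR])
  show ?thesis
   using tangent_add[OF v smooth_const s, of "F (\<phi> p)"] tangent_const[OF v, of "F (\<phi> p)"]
    tangent_sum[OF v, of Basis "%b q. (x b q - x b p) * H b q"] sR by simp
 qed
 also have "... = (\<Sum>b\<in>Basis. v (x b) * cvec U \<phi> p b f)"
 proof (rule sum.cong[OF refl])
  fix b :: 'e assume b: "b : Basis"
  have "v (%q. (x b q - x b p) * H b q) = (x b p - x b p) * v (H b) + H b p * v (%q. x b q - x b p)"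
   by (rule tangent_mult[OF v smooth_diff[OF x(1)[OF b] smooth_const] H])
  also have "v (%q. x b q - x b p) = v (x b)"
   using tangent_diff[OF v x(1)[OF b] smooth_const] tangent_const[OF v] by simp
  also have "H b p = cvec U \<phi> p b f" using Gp pU th(5,7) by (simp add: H_def)
  finally show "v (%q. (x b q - x b p) * H b q) = v (x b) * cvec U \<phi> p b f" by simp
 qed
 finally show ?thesis .
qed

lemma cutoff_coordinates:
 assumes c: "(U, \<phi>) : A" and p: "p : U"
 obtains x W where "openin T W" "p : W" "W <= U" "!!b. x b : SF" "!!b q. q : W ==> x b q = \<phi> q \<bullet> b"
proof -
 obtain th K W where th: "th : SF" "closedin T K" "K <= U" "openin T W" "p : W" "W <= K"
  "!!q. q : W ==> th q = 1" "!!q. q ~: K ==> th q = 0" using bump[OF openin_chart[OF c] p] by metis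
 define x where "x b q = th q * (\<phi> q \<bullet> b)" for b q
 have "x b : SF" for b
 proof (rule chart_extend[OF c th(2,3), of "%y. (th \<circ> inv_into U \<phi>) y * (y \<bullet> b)"])
  show "Ck_on k (\<phi> ` U) (%y. (th \<circ> inv_into U \<phi>) y * (y \<bullet> b))" for k
   by (rule Ck_on_mult[OF chart_open[OF c] smooth_chart[OF th(1) c] Ck_on_linear])
    (auto simp: chart_open[OF c] bounded_linear_inner_left)
 qed (use th inv_chart[OF c] in \<open>auto simp: x_def\<close>)
 then show thesis using that[of W x] th by (auto simp: x_def)
qed

lemma smooth_cvec:
 assumes c: "(U, \<phi>) : A" and th: "th : SF" "closedin T K" "K <= U" "!!q. q ~: K ==> th q = 0" and f: "f : SF"
 shows "(%q. th q * cvec U \<phi> q b f) : SF"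
proof (rule chart_extend[OF c th(2,3),
   of "%y. (th \<circ> inv_into U \<phi>) y * FD (f \<circ> inv_into U \<phi>) (at y) b"])
 show "Ck_on k (\<phi> ` U) (%y. (th \<circ> inv_into U \<phi>) y * FD (f \<circ> inv_into U \<phi>) (at y) b)" for k
  using Ck_on_mult[OF chart_open[OF c] smooth_chart[OF th(1) c], of k
    "%y. FD (f \<circ> inv_into U \<phi>) (at y) b"] smooth_chart[OF f c, of "Suc k"] by simp
qed (use th inv_chart[OF c] f in \<open>auto simp: cvec_def\<close>)

end

section \<open>Vector fields and tensorial expressions\<close>

context hausdorff_manifold begin

lemma openin_smooth_positive:
 assumes "u : SF" shows "openin T {q : C. u q > 0}"
 unfolding openin_iff
proof (intro conjI ballI)
 fix z assume "z : A"
 then obtain U \<phi> where c: "(U, \<phi>) : A" and z: "z = (U, \<phi>)" by (cases z) auto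
 have cont: "continuous_on (\<phi> ` U) (u \<circ> inv_into U \<phi>)" using smooth_chart[OF assms c, of 0] by simp
 have "open ((u \<circ> inv_into U \<phi>) -` {0<..} \<inter> \<phi> ` U)"
  using cont unfolding continuous_on_open_vimage[OF chart_open[OF c]] by simp
 moreover have "(u \<circ> inv_into U \<phi>) -` {0<..} \<inter> \<phi> ` U = \<phi> ` ({q : C. u q > 0} \<inter> U)"
  using inv_chart[OF c] chart_carrier[OF c] by auto
 ultimately show "case z of (U, \<phi>) => open (\<phi> ` ({q : C. u q > 0} \<inter> U))" using z by simp
qed auto

end

locale total_manifold = hausdorff_manifold A for A :: "('m, 'e::euclidean_space) atlas" +
 assumes total: "carrier A = UNIV"
begin

abbreviation "VF \<equiv> vector_field A"
abbreviation "TS \<equiv> tangent A"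

lemma in_C [simp]: "p : C" by (simp add: total)

lemma bump_ex:
 assumes "openin T W" "p : W"
 shows "EX th K V. th : SF & closedin T K & K <= W & openin T V & p : V & V <= K &
  (ALL q. q : V --> th q = 1) & (ALL q. q ~: K --> th q = 0) & (ALL q. 0 \<le> th q) & (ALL q. th q \<le> 1)"
proof (rule bump[OF assms])
 fix th K V
 assume "th : SF" "closedin T K" "K <= W" "openin T V" "p : V" "V <= K"
  "!!q. q : V ==> th q = 1" "!!q. q ~: K ==> th q = 0" "!!q. 0 \<le> th q" "!!q. th q \<le> 1"
 then show ?thesis by (intro exI[of _ th] exI[of _ K] exI[of _ V]) simp
qed

lemma local_inverse_sqrt:
 assumes u: "u : SF" and p: "u p > 0"
 obtains s V where "s : SF" "openin T V" "p : V" "!!q. s q > 0" "!!q. q : V ==> s q * s q * u q = 1"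
proof -
 have o: "openin T {q : C. u q > 0}" by (rule openin_smooth_positive[OF u])
 have pin: "p : {q : C. u q > 0}" using p by simp
 obtain th K V where th0: "th : SF" "closedin T K" "K <= {q : C. u q > 0}" "openin T V" "p : V" "V <= K"
  "!!q. q : V ==> th q = 1" "!!q. q ~: K ==> th q = 0" "!!q. 0 \<le> th q" "!!q. th q \<le> 1"
  using bump_ex[OF o pin] by blast
 note th = th0(1,3-)
 define w where "w q = th q * u q + (1 - th q)" for q
 have w: "w : SF" unfolding w_def by (intro smooth_add smooth_mult smooth_diff th u smooth_const)
 have pos: "w q > 0" for q
 proof (cases "q : K")
  case True
  then have uq: "u q > 0" using th(2) by blast
  show ?thesis
  proof (cases "th q = 0")
   case False
   then have "th q * u q > 0" using uq th(8)[of q] by simp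
   then show ?thesis using th(9)[of q] by (simp add: w_def)
  qed (simp add: w_def)
 qed (simp add: th w_def)
 have ck: "Ck_on k {0<..} (%x. inverse (sqrt x))" for k
  by (rule Ck_on_compose[OF _ _ _ Ck_on_sqrt Ck_on_inverse]) auto
 have s: "(%q. inverse (sqrt (w q))) : SF"
  by (rule smooth_comp[OF w _ _ ck]) (use pos in auto)
 have "inverse (sqrt (w q)) * inverse (sqrt (w q)) * u q = 1" if "q : V" for q
  using pos[of q] th(6)[OF that] by (simp add: w_def field_simps)
 then show thesis using that[OF s th(3,4)] pos by simp
qed

lemma VF_tangent: "VF X ==> X p : TS p"
 and VF_smooth: "VF X ==> f : SF ==> (%p. X p f) : SF"
 by (auto simp: vector_field_def)

lemma VF_I: "(!!p. X p : TS p) ==> (!!f. f : SF ==> (%p. X p f) : SF) ==> VF X"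
 by (auto simp: vector_field_def)

lemma tangent_eqI: "u : TS p ==> w : TS p ==> (!!f. f : SF ==> u f = w f) ==> u = w"
 by (rule ext) (metis tangent_nonsmooth)

lemma VF_eqI: "VF X ==> VF Y ==> (!!p f. f : SF ==> X p f = Y p f) ==> X = Y"
 by (rule ext) (metis tangent_eqI VF_tangent)

lemma tangent_plus: "u : TS p ==> w : TS p ==> u + w : TS p"
 using tangent_comb[of u p w 1] by (simp add: plus_fun_def)

lemma tangent_scale: "u : TS p ==> (%f. c * u f) : TS p"
 using tangent_comb[OF _ zero_tangent, of u p c] by simp

lemma tangent_uminus: "u : TS p ==> - u : TS p"
 using tangent_scale[of u p "-1"] by (simp add: fun_Compl_def)

lemma tangent_zero' [simp]: "0 : TS p"
 using zero_tangent by (simp add: zero_fun_def)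

lemma VF_add: "VF X ==> VF Y ==> VF (X + Y)"
 by (rule VF_I) (auto simp: VF_tangent tangent_plus intro: smooth_add VF_smooth)

lemma VF_fscale: "h : SF ==> VF X ==> VF (fscale h X)"
 by (rule VF_I) (auto simp: fscale_def intro: VF_tangent tangent_scale smooth_mult VF_smooth)

lemma VF_zero: "VF 0"
 by (rule VF_I) auto

lemma VF_uminus: "VF X ==> VF (- X)"
 by (rule VF_I) (auto simp: VF_tangent tangent_uminus intro: smooth_minus VF_smooth)

lemma VF_diff: "VF X ==> VF Y ==> VF (X - Y)"
 using VF_add[OF _ VF_uminus] by (metis add_uminus_conv_diff)

lemma VF_sum: "(!!i. i : I ==> VF (X i)) ==> VF (\<Sum>i\<in>I. X i)"
 by (induction I rule: infinite_finite_induct) (auto simp: VF_zero intro: VF_add)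

lemma sum_field_apply: "(\<Sum>i\<in>I. X i) p f = (\<Sum>i\<in>I. X i p (f :: 'm => real) :: real)"
 by (induction I rule: infinite_finite_induct) auto

lemma sum_tvec_apply: "(\<Sum>i\<in>I. u i) f = (\<Sum>i\<in>I. u i (f :: 'm => real) :: real)"
 by (induction I rule: infinite_finite_induct) auto

lemma sum_field_at: "(\<Sum>i\<in>I. X i) p = (\<Sum>i\<in>I. X i p)" for X :: "'i => 'm vfield"
 by (induction I rule: infinite_finite_induct) auto

lemma tangent_vsum: "(!!i. i : I ==> u i : TS p) ==> (\<Sum>i\<in>I. u i) : TS p"
 by (induction I rule: infinite_finite_induct) (auto intro: tangent_plus)

text \<open>
 Cut-off coordinate functions and coordinate fields. The expansion of a tangent vector, multiplied by
 the cut-off function, holds on the whole manifold; this avoids case distinctions about the domain of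
 the frame.
\<close>
definition is_local_frame ::
 "'m => ('m => real) => 'm set => ('e => 'm => real) => ('e => 'm vfield) => bool" where
 "is_local_frame p th V x E \<longleftrightarrow> th : SF & openin T V & p : V & (ALL q. q : V --> th q = 1) &
  (ALL b. x b : SF) & (ALL b :: 'e. VF (E b)) &
  (ALL q u f. u : TS q --> th q * u f = (\<Sum>b\<in>Basis. u (x b) * E b q f)) &
  (ALL q:V. ALL b:Basis. ALL b':Basis. E b q (x b') = (if b = b' then 1 else 0))"

lemma is_local_frameD:
 assumes "is_local_frame p th V x E"
 shows "th : SF" "openin T V" "p : V" "!!q. q : V ==> th q = 1"
  "!!b. x b : SF" "!!b. VF (E b)"
  "!!q u f. u : TS q ==> th q * u f = (\<Sum>b\<in>Basis. u (x b) * E b q f)"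
  "!!q b b'. q : V ==> b : Basis ==> b' : Basis ==> E b q (x b') = (if b = b' then 1 else 0)"
 using assms unfolding is_local_frame_def by simp_all

lemma chart_frame:
 assumes c: "(U, \<phi>) : A" "p : U"
 shows "EX th V x E. is_local_frame p th V x E & V <= U & (ALL q:V. ALL b. x b q = \<phi> q \<bullet> b & E b q = cvec U \<phi> q b)"
proof -
 obtain x W where x: "openin T W" "p : W" "W <= U" "!!b. x b : SF" "!!b q. q : W ==> x b q = \<phi> q \<bullet> b"
  using cutoff_coordinates[OF c] by metis
 obtain th K V where th: "th : SF" "closedin T K" "K <= W" "openin T V" "p : V" "V <= K"
  "!!q. q : V ==> th q = 1" "!!q. q ~: K ==> th q = 0" using bump[OF x(1,2)] by metis
 define E where "E b q = (if q : U then (%f. th q * cvec U \<phi> q b f) else (%f. 0))" for b q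
 have KU: "K <= U" using th x by blast
 have E: "E b q = (%f. th q * cvec U \<phi> q b f)" for b q
  using th(8)[of q] KU by (cases "q : K") (auto simp: E_def)
 have "VF (E b)" for b
 proof (rule VF_I)
  show "E b q : TS q" for q
   unfolding E_def using cvec_tangent[OF c(1), of q b] by (auto intro: tangent_scale zero_tangent)
  show "(%q. E b q f) : SF" if "f : SF" for f
   unfolding E by (rule smooth_cvec[OF c(1) th(1,2) KU th(8) that])
 qed
 moreover have "th q * u f = (\<Sum>b\<in>Basis. u (x b) * E b q f)" if u: "u : TS q" for q u f
 proof (cases "q : W")
  case True
  have "u f = (\<Sum>b\<in>Basis. u (x b) * cvec U \<phi> q b f)"
   by (rule tangent_chart[OF c(1) True x(1,3) x(4,5) u])
  then show ?thesis by (simp add: E sum_distrib_left ac_simps)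
 next
  case False
  then have "th q = 0" using th by blast
  then show ?thesis by (simp add: E)
 qed
 moreover have "E b q (x b') = (if b = b' then 1 else 0)" if q: "q : V" and b: "b : Basis" "b' : Basis" for q b b'
 proof -
  have qW: "q : W" "q : U" using th(3,6) x(3) q by blast+
  have "FD (x b' \<circ> inv_into U \<phi>) (at (\<phi> q)) = FD (%y. y \<bullet> b') (at (\<phi> q))"
  proof (rule frechet_derivative_transform_within_open[of _ _ "\<phi> ` (W \<inter> U)"])
   show "(x b' \<circ> inv_into U \<phi>) differentiable at (\<phi> q)"
    by (rule smooth_chart_differentiable[OF x(4) c(1)]) (use qW in blast)
  qed (use openin_chart_image[OF x(1) c(1)] qW x(5) inv_chart[OF c(1)] in auto)
  also have "... = (%v. v \<bullet> b')"
   by (rule frechet_derivative_at[symmetric]) (auto intro!: derivative_eq_intros)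
  finally show ?thesis using th(7)[OF q] x(4)[of b'] b by (simp add: E cvec_def inner_Basis)
 qed
 moreover have "V <= U" "ALL q:V. ALL b. x b q = \<phi> q \<bullet> b & E b q = cvec U \<phi> q b" using th(3,6,7) x(3,5) by (auto simp: E)
 ultimately show ?thesis
  by (intro exI[of _ th] exI[of _ V] exI[of _ x] exI[of _ E]) (simp add: is_local_frame_def th x)
qed

lemma local_frame: "EX th V x E. is_local_frame p th V x E"
proof -
 obtain U \<phi> where "(U, \<phi>) : A" "p : U" using carrier_chart[of p] by auto
 from chart_frame[OF this] show ?thesis by blast
qed

lemma tangent_extends:
 assumes u: "u : TS p" obtains X where "VF X" "X p = u"
proof -
 obtain th V x E where "is_local_frame p th V x E" using local_frame[of p] by blast
 note l = is_local_frameD[OF this]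
 let ?X = "\<Sum>b\<in>Basis. fscale (%_. u (x b)) (E b)"
 have "VF ?X" by (intro VF_sum VF_fscale smooth_const l)
 moreover have "?X p = u"
 proof (rule ext)
  fix f
  show "?X p f = u f" using l(7)[OF u, of f] l(4)[OF l(3)] by (simp add: sum_field_apply fscale_def)
 qed
 ultimately show thesis using that by blast
qed

lemma extends_exist: "set vs <= TS p ==> EX Xs. extends A p Xs vs"
proof (induction vs)
 case Nil
 then show ?case by (auto simp: extends_def)
next
 case (Cons v vs)
 then obtain Xs where "extends A p Xs vs" by auto
 moreover obtain X where "VF X" "X p = v" using tangent_extends[of v p] Cons by auto
 ultimately have "extends A p (X # Xs) (v # vs)" by (auto simp: extends_def)
 then show ?case by blast
qed

text \<open>
 Linearity over the smooth functions, the criterion for \<open>L\<close> to depend only on the value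
 of the field at \<open>p\<close>.
\<close>
definition tensorial :: "'m => ('m vfield => real) => bool" where
 "tensorial p L \<longleftrightarrow> (ALL X Y. VF X --> VF Y --> L (X + Y) = L X + L Y) &
   (ALL X h. VF X --> h : SF --> L (fscale h X) = h p * L X)"

lemma tensorialI:
 assumes "!!X Y. VF X ==> VF Y ==> L (X + Y) = L X + L Y"
  "!!X h. VF X ==> h : SF ==> L (fscale h X) = h p * L X"
 shows "tensorial p L"
 using assms by (auto simp: tensorial_def)

lemma tensorial_add: "tensorial p L ==> VF X ==> VF Y ==> L (X + Y) = L X + L Y"
 and tensorial_fscale: "tensorial p L ==> VF X ==> h : SF ==> L (fscale h X) = h p * L X"
 by (auto simp: tensorial_def)

lemma fscale_0 [simp]: "fscale (%_. 0) X = 0"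
 and fscale_1 [simp]: "fscale (%_. 1) X = X"
 and fscale_m1: "fscale (%_. -1) X = - X"
 by (auto simp: fscale_def fun_eq_iff)

lemma tensorial_0: "tensorial p L ==> L 0 = 0"
 using tensorial_fscale[OF _ VF_zero smooth_const[of 0]] by simp

lemma tensorial_sum:
 "tensorial p L ==> (!!i. i : I ==> VF (X i)) ==> L (\<Sum>i\<in>I. X i) = (\<Sum>i\<in>I. L (X i))"
 by (induction I rule: infinite_finite_induct) (auto simp: tensorial_0 tensorial_add VF_sum)

text \<open>Expand the field in a local frame: its coefficients vanish at \<open>p\<close>.\<close>
lemma tensorial_zero_at:
 assumes L: "tensorial p L" and X: "VF X" "X p = 0"
 shows "L X = 0"
proof -
 obtain th V x E where "is_local_frame p th V x E" using local_frame[of p] by blast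
 note l = is_local_frameD[OF this]
 have e: "fscale th X = (\<Sum>b\<in>Basis. fscale (%q. X q (x b)) (E b))"
  using l(7)[OF VF_tangent[OF X(1)]] by (auto simp: fun_eq_iff sum_field_apply fscale_def)
 have "L X = L (fscale th X)" using tensorial_fscale[OF L X(1) l(1)] l(3,4) by simp
 also have "... = (\<Sum>b\<in>Basis. L (fscale (%q. X q (x b)) (E b)))"
  unfolding e by (rule tensorial_sum[OF L]) (intro VF_fscale VF_smooth[OF X(1)] l)
 also have "... = (\<Sum>b\<in>Basis. X p (x b) * L (E b))"
  by (rule sum.cong[OF refl]) (rule tensorial_fscale[OF L l(6) VF_smooth[OF X(1) l(5)]])
 finally show ?thesis using X(2) by simp
qed

lemma tensorial_uminus: "tensorial p L ==> VF X ==> L (- X) = - L X"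
 using tensorial_fscale[OF _ _ smooth_const[of "-1"]] by (simp add: fscale_m1)

lemma tensorial_diff: "tensorial p L ==> VF X ==> VF Y ==> L (X - Y) = L X - L Y"
 using tensorial_add[of p L X "- Y"] tensorial_uminus[of p L Y] VF_uminus by simp

lemma tensorial_cong:
 assumes L: "tensorial p L" and X: "VF X" "VF Y" "X p = Y p"
 shows "L X = L Y"
 using tensorial_zero_at[OF L VF_diff[OF X(1,2)]] X tensorial_diff[OF L X(1,2)] by simp

section \<open>Lie brackets\<close>

lemma VF_add_arg: "VF X ==> f : SF ==> g : SF ==> X p (%q. f q + g q) = X p f + X p g"
 and VF_mult_arg: "VF X ==> f : SF ==> g : SF ==> X p (%q. f q * g q) = f p * X p g + g p * X p f"
 and VF_diff_arg: "VF X ==> f : SF ==> g : SF ==> X p (%q. f q - g q) = X p f - X p g"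
 and VF_minus_arg: "VF X ==> f : SF ==> X p (%q. - f q) = - X p f"
 and VF_cmult_arg: "VF X ==> f : SF ==> X p (%q. c * f q) = c * X p f"
 and VF_const_arg: "VF X ==> X p (%q. c) = 0"
 and VF_zero_arg: "VF X ==> X p (%q. 0) = 0"
 by (simp_all add: VF_tangent tangent_add[of _ p] tangent_mult[of _ p] tangent_diff[of _ p]
   tangent_minus[of _ p] tangent_cmult[of _ p] tangent_const[of _ p])

lemma VF_sum_arg: "VF X ==> (!!i. i : I ==> f i : SF) ==> X p (%q. \<Sum>i\<in>I. f i q) = (\<Sum>i\<in>I. X p (f i))"
 by (rule tangent_sum[OF VF_tangent])

lemma VF_local_arg:
 "VF X ==> f : SF ==> g : SF ==> openin T W ==> p : W ==> (!!q. q : W ==> f q = g q) ==> X p f = X p g"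
 by (rule tangent_local[OF VF_tangent])

lemma bracket_apply: "Lie X Y p f = X p (%q. Y q f) - Y p (%q. X q f)"
 by (simp add: lie_bracket_def)

lemma VF_nonsmooth: "VF X ==> f ~: SF ==> X p f = 0"
 using tangent_nonsmooth VF_tangent by blast

lemma VF_bracket:
 assumes X: "VF X" and Y: "VF Y" shows "VF (Lie X Y)"
proof (rule VF_I)
 fix p
 show "Lie X Y p : TS p"
  unfolding tangent_def mem_Collect_eq
 proof (intro conjI ballI allI impI)
  fix f assume "f ~: SF"
  then have "X q f = 0" "Y q f = 0" for q
   using VF_nonsmooth[OF X, of f q] VF_nonsmooth[OF Y, of f q] by auto
  then show "Lie X Y p f = 0"
   by (simp add: bracket_apply VF_zero_arg[OF X] VF_zero_arg[OF Y])
 next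
  fix f h c assume fh: "f : SF" "h : SF"
  have "X q (%x. c * f x + h x) = c * X q f + X q h" "Y q (%x. c * f x + h x) = c * Y q f + Y q h" for q
   by (rule tangent_lin[OF VF_tangent]; intro X Y fh)+
  moreover have "X p (%q. c * Y q f + Y q h) = c * X p (%q. Y q f) + X p (%q. Y q h)"
   "Y p (%q. c * X q f + X q h) = c * Y p (%q. X q f) + Y p (%q. X q h)"
   by (rule tangent_lin[OF VF_tangent]; intro X Y VF_smooth[OF X] VF_smooth[OF Y] fh)+
  ultimately show "Lie X Y p (%x. c * f x + h x) = c * Lie X Y p f + Lie X Y p h"
   by (simp add: bracket_apply algebra_simps)
 next
  fix f h assume fh: "f : SF" "h : SF"
  note s = VF_smooth[OF X] VF_smooth[OF Y]
  show "Lie X Y p (%x. f x * h x) = f p * Lie X Y p h + h p * Lie X Y p f"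
   by (simp add: bracket_apply VF_mult_arg[OF X] VF_mult_arg[OF Y] VF_add_arg[OF X] VF_add_arg[OF Y]
     fh s smooth_mult algebra_simps)
 qed
next
 fix f assume "f : SF"
 then show "(%p. Lie X Y p f) : SF"
  unfolding bracket_apply by (intro smooth_diff VF_smooth[OF X] VF_smooth[OF Y])
qed

lemma bracket_antisym: "Lie Y X = - Lie X Y"
 by (auto simp: fun_eq_iff bracket_apply)

lemma bracket_add_right: assumes "VF X" "VF Y" "VF Z"
 shows "Lie X (Y + Z) = Lie X Y + Lie X Z"
proof (rule VF_eqI)
 fix p f assume "f : SF"
 then show "Lie X (Y + Z) p f = (Lie X Y + Lie X Z) p f"
  by (simp add: bracket_apply VF_add_arg[OF assms(1)] VF_smooth[OF assms(2)] VF_smooth[OF assms(3)])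
qed (intro VF_bracket VF_add assms)+

lemma bracket_add_left: assumes "VF X" "VF Y" "VF Z"
 shows "Lie (Y + Z) X = Lie Y X + Lie Z X"
 using bracket_add_right[OF assms] by (auto simp: fun_eq_iff bracket_apply)

lemma bracket_fscale_right: assumes "VF X" "VF Y" "h : SF"
 shows "Lie X (fscale h Y) = fscale h (Lie X Y) + fscale (%p. X p h) Y"
proof (rule VF_eqI)
 fix p f assume "f : SF"
 then show "Lie X (fscale h Y) p f = (fscale h (Lie X Y) + fscale (%p. X p h) Y) p f"
  by (simp add: bracket_apply fscale_def VF_mult_arg[OF assms(1)] VF_smooth[OF assms(2)] assms(3) algebra_simps)
qed (intro VF_bracket VF_add VF_fscale VF_smooth[OF assms(1,3)] assms)+

lemma bracket_fscale_left: assumes "VF X" "VF Y" "h : SF"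
 shows "Lie (fscale h Y) X = fscale h (Lie Y X) - fscale (%p. X p h) Y"
proof -
 have "Lie (fscale h Y) X = - Lie X (fscale h Y)" by (rule bracket_antisym)
 also have "... = fscale h (- Lie X Y) - fscale (%p. X p h) Y"
  unfolding bracket_fscale_right[OF assms] by (auto simp: fun_eq_iff fscale_def)
 also have "- Lie X Y = Lie Y X" by (rule bracket_antisym[symmetric])
 finally show ?thesis .
qed

lemma jacobi: assumes "VF X" "VF Y" "VF Z"
 shows "Lie X (Lie Y Z) = Lie (Lie X Y) Z + Lie Y (Lie X Z)"
proof (rule VF_eqI)
 fix p f assume "f : SF"
 then show "Lie X (Lie Y Z) p f = (Lie (Lie X Y) Z + Lie Y (Lie X Z)) p f"
  by (simp add: bracket_apply VF_diff_arg[OF assms(1)] VF_diff_arg[OF assms(2)] VF_diff_arg[OF assms(3)]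
    VF_smooth[OF assms(1)] VF_smooth[OF assms(2)] VF_smooth[OF assms(3)])
qed (intro VF_bracket VF_add assms)+

section \<open>Constant functions\<close>

text \<open>The level sets are open by the mean value theorem in charts, hence closed.\<close>
lemma zero_derivative_constant:
 assumes conn: "connected_space T" and f: "f : SF" and d: "!!X p. VF X ==> X p f = 0"
 shows "f p = f q"
proof -
 have loc: "EX N. openin T N & p : N & (ALL q:N. f q = f p)" for p
 proof -
  obtain U \<phi> where c: "(U, \<phi>) : A" "p : U" using carrier_chart[of p] by auto
  obtain r where r: "r > 0" "ball (\<phi> p) r <= \<phi> ` U"
   using chart_open[OF c(1)] c(2) open_contains_ball by (metis imageI)
  let ?g = "f \<circ> inv_into U \<phi>"
  have D: "(?g has_derivative (%v. 0)) (at y)" if "y : \<phi> ` U" for y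
  proof -
   obtain s where s: "s : U" "y = \<phi> s" using \<open>y : \<phi> ` U\<close> by blast
   have "(?g has_derivative FD ?g (at y)) (at y)"
    using smooth_chart_differentiable[OF f c(1) that] by (simp add: frechet_derivative_works)
   moreover have "FD ?g (at y) v = 0" for v
   proof -
    obtain X where "VF X" "X s = cvec U \<phi> s v" using tangent_extends[OF cvec_tangent[OF c(1) s(1)]] by metis
    then show ?thesis using d[of X s] f s by (simp add: cvec_def)
   qed
   ultimately show ?thesis by (simp add: fun_eq_iff[symmetric] ext[of "FD ?g (at y)" "%v. 0"])
  qed
  have "?g y = ?g (\<phi> p)" if "y : ball (\<phi> p) r" for y
  proof (rule has_derivative_zero_unique[of "ball (\<phi> p) r"])
   show "(?g has_derivative (%h. 0)) (at x within ball (\<phi> p) r)" if "x : ball (\<phi> p) r" for x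
    using D[of x] that r by (blast intro: has_derivative_at_withinI)
  qed (use that r in auto)
  then have "f q = f p" if "q : {q : U. \<phi> q : ball (\<phi> p) r}" for q
   using that inv_chart[OF c(1), of q] inv_chart[OF c] by (metis (mono_tags, lifting) comp_apply mem_Collect_eq)
  moreover have "openin T {q : U. \<phi> q : ball (\<phi> p) r}" by (rule openin_chart_vimage[OF c(1)]) simp
  moreover have "p : {q : U. \<phi> q : ball (\<phi> p) r}" using c(2) r by simp
  ultimately show ?thesis by blast
 qed
 have o: "openin T {q. P (f q)}" for P
 proof (subst openin_subopen, intro ballI)
  fix x assume x: "x : {q. P (f q)}"
  obtain N where N: "openin T N" "x : N" "ALL q:N. f q = f x" using loc[of x] by blast
  have "N <= {q. P (f q)}"
  proof
   fix q assume "q : N"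
   then have "f q = f x" using N(3) by blast
   then show "q : {q. P (f q)}" using x by simp
  qed
  then show "EX N. openin T N & x : N & N <= {q. P (f q)}" using N(1,2) by blast
 qed
 have "closedin T {x. f x = f p}"
  unfolding closedin_def using o[of "%y. y ~= f p"] total
  by (simp add: Collect_neg_eq[symmetric] Compl_eq_Diff_UNIV[symmetric])
 moreover have "openin T {x. f x = f p}" using o[of "%y. y = f p"] .
 ultimately have "{x. f x = f p} = {} \<or> {x. f x = f p} = C"
  using conn unfolding connected_space_clopen_in by (metis topspace_T)
 moreover have "p : {x. f x = f p}" by simp
 ultimately have "q : {x. f x = f p}" using total by (metis UNIV_I empty_iff)
 then show ?thesis by simp
qed

end

context total_manifold begin

section \<open>Forms of degree one and two\<close>

lemma form_zero: "al : forms A k ==> ~ (length vs = k & set vs <= TS p) ==> al p vs = 0"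
 by (simp add: forms_def)

lemma form_slot:
 assumes "al : forms A k" "length vs = k" "set vs <= TS p" "i < k" "u : TS p" "w : TS p"
 shows "al p (vs[i := (%f. c * u f + w f)]) = c * al p (vs[i := u]) + al p (vs[i := w])"
 using assms by (simp add: forms_def)

lemma form_alt:
 assumes "al : forms A k" "length vs = k" "set vs <= TS p" "i < k" "j < k" "i ~= j" "vs ! i = vs ! j"
 shows "al p vs = 0"
 using assms unfolding forms_def by blast

lemma form_smooth:
 assumes "al : forms A k" "length Xs = k" "!!X. X : set Xs ==> VF X"
 shows "(%p. al p (map (%X. X p) Xs)) : SF"
 using assms by (simp add: forms_def)

lemma form1_smooth: "al : forms A 1 ==> VF X ==> (%p. al p [X p]) : SF"
 using form_smooth[of al 1 "[X]"] by simp

lemma form2_smooth: "al : forms A 2 ==> VF X ==> VF Y ==> (%p. al p [X p, Y p]) : SF"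
 using form_smooth[of al 2 "[X, Y]"] by auto

lemma form1_lin: "al : forms A 1 ==> u : TS p ==> w : TS p ==>
  al p [%f. c * u f + w f] = c * al p [u] + al p [w]"
 using form_slot[of al 1 "[u]" p 0 u w c] by simp

lemma form2_lin1: "al : forms A 2 ==> u : TS p ==> w : TS p ==> v : TS p ==>
  al p [%f. c * u f + w f, v] = c * al p [u, v] + al p [w, v]"
 using form_slot[of al 2 "[u, v]" p 0 u w c] by simp

lemma form2_lin2: "al : forms A 2 ==> u : TS p ==> w : TS p ==> v : TS p ==>
  al p [v, %f. c * u f + w f] = c * al p [v, u] + al p [v, w]"
 using form_slot[of al 2 "[v, u]" p 1 u w c] by simp

lemma form2_same: "al : forms A 2 ==> u : TS p ==> al p [u, u] = 0"
 using form_alt[of al 2 "[u, u]" p 0 1] by simp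

lemma form2_skew: assumes "al : forms A 2" "u : TS p" "w : TS p"
 shows "al p [w, u] = - al p [u, w]"
proof -
 have s: "(%f. 1 * u f + w f) : TS p" using assms tangent_comb by blast
 have "0 = al p [%f. 1 * u f + w f, %f. 1 * u f + w f]" using form2_same[OF assms(1) s] by (rule sym)
 also have "... = al p [u, u] + al p [u, w] + (al p [w, u] + al p [w, w])"
  using form2_lin1[OF assms(1,2,3) s, where c=1] form2_lin2[OF assms(1,2,3) assms(2), where c=1] form2_lin2[OF assms(1,2,3) assms(3), where c=1]
  by (simp only: mult_1)
 finally show ?thesis using form2_same[OF assms(1,2)] form2_same[OF assms(1,3)] by simp
qed

lemma form1I:
 assumes "!!p vs. ~ (length vs = 1 & set vs <= TS p) ==> al p vs = 0"
  and "!!p u w c. u : TS p ==> w : TS p ==> al p [%f. c * u f + w f] = c * al p [u] + al p [w]"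
  and "!!X. VF X ==> (%p. al p [X p]) : SF"
 shows "al : forms A 1"
proof -
 have "al p (vs[i := (%f. c * u f + w f)]) = c * al p (vs[i := u]) + al p (vs[i := w])"
  if "length vs = 1" "i < 1" "u : TS p" "w : TS p" for p vs i u w c
 proof -
  obtain v where "vs = [v]" using \<open>length vs = 1\<close> by (auto simp: length_Suc_conv)
  then show ?thesis using assms(2) that by simp
 qed
 moreover have "(%p. al p (map (%X. X p) Xs)) : SF" if "length Xs = 1" "ALL X:set Xs. VF X" for Xs
 proof -
  obtain X where "Xs = [X]" using \<open>length Xs = 1\<close> by (auto simp: length_Suc_conv)
  then show ?thesis using assms(3) that by simp
 qed
 ultimately show ?thesis using assms(1) unfolding forms_def by auto
qed

lemma form2I:
 assumes "!!p vs. ~ (length vs = 2 & set vs <= TS p) ==> al p vs = 0"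
  and "!!p u w v c. u : TS p ==> w : TS p ==> v : TS p ==> al p [%f. c * u f + w f, v] = c * al p [u, v] + al p [w, v]"
  and "!!p u w v c. u : TS p ==> w : TS p ==> v : TS p ==> al p [v, %f. c * u f + w f] = c * al p [v, u] + al p [v, w]"
  and "!!p u. u : TS p ==> al p [u, u] = 0"
  and "!!X Y. VF X ==> VF Y ==> (%p. al p [X p, Y p]) : SF"
 shows "al : forms A 2"
proof -
 have two: "EX a b. xs = [a, b]" if "length xs = 2" for xs :: "'z list"
  using that by (auto simp: length_Suc_conv numeral_2_eq_2)
 have "al p (vs[i := (%f. c * u f + w f)]) = c * al p (vs[i := u]) + al p (vs[i := w])"
  if v: "length vs = 2" "set vs <= TS p" "i < 2" "u : TS p" "w : TS p" for p vs i u w c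
 proof -
  obtain a b where ab: "vs = [a, b]" using two[OF v(1)] by blast
  have "i = 0 \<or> i = 1" using v(3) by auto
  then show ?thesis using assms(2,3) v ab by auto
 qed
 moreover have "al p vs = 0" if v: "length vs = 2" "set vs <= TS p" "i < 2" "j < 2" "i ~= j & vs ! i = vs ! j" for p vs i j
 proof -
  obtain a b where ab: "vs = [a, b]" using two[OF v(1)] by blast
  have "i = 0 & j = 1 \<or> i = 1 & j = 0" using v by auto
  then have "a = b" using v ab by auto
  then show ?thesis using assms(4) v ab by auto
 qed
 moreover have "(%p. al p (map (%X. X p) Xs)) : SF" if X: "length Xs = 2" "ALL X:set Xs. VF X" for Xs
 proof -
  obtain a b where ab: "Xs = [a, b]" using two[OF X(1)] by blast
  then show ?thesis using assms(5) X by simp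
 qed
 ultimately show ?thesis using assms(1) unfolding forms_def by blast
qed

lemma form1_tensorial: assumes "al : forms A 1" shows "tensorial p (%X. al p [X p])"
proof (rule tensorialI)
 fix X Y assume XY: "VF X" "VF Y"
 show "al p [(X + Y) p] = al p [X p] + al p [Y p]"
  using form1_lin[OF assms VF_tangent[OF XY(1)] VF_tangent[OF XY(2)], where c=1 and p=p] by (simp add: plus_fun_def)
next
 fix X h assume X: "VF X" "h : SF"
 show "al p [fscale h X p] = h p * al p [X p]"
  using form1_lin[OF assms VF_tangent[OF X(1)] tangent_zero', where c="h p" and p=p] form1_lin[OF assms tangent_zero' tangent_zero', where c=1 and p=p]
  by (simp add: fscale_def zero_fun_def)
qed

lemma form2_tensorial1: assumes a: "al : forms A 2" and v: "v : TS p" shows "tensorial p (%X. al p [X p, v])"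
proof (rule tensorialI)
 fix X Y assume XY: "VF X" "VF Y"
 show "al p [(X + Y) p, v] = al p [X p, v] + al p [Y p, v]"
  using form2_lin1[OF a VF_tangent[OF XY(1)] VF_tangent[OF XY(2)] v, where c=1] by (simp add: plus_fun_def)
next
 fix X h assume X: "VF X" "h : SF"
 show "al p [fscale h X p, v] = h p * al p [X p, v]"
  using form2_lin1[OF a VF_tangent[OF X(1)] tangent_zero' v, where c="h p"] form2_lin1[OF a tangent_zero' tangent_zero' v, where c=1]
  by (simp add: fscale_def zero_fun_def)
qed

lemma form2_tensorial2: assumes a: "al : forms A 2" and v: "v : TS p" shows "tensorial p (%X. al p [v, X p])"
proof (rule tensorialI)
 fix X Y assume XY: "VF X" "VF Y"
 show "al p [v, (X + Y) p] = al p [v, X p] + al p [v, Y p]"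
  using form2_lin2[OF a VF_tangent[OF XY(1)] VF_tangent[OF XY(2)] v, where c=1] by (simp add: plus_fun_def)
next
 fix X h assume X: "VF X" "h : SF"
 show "al p [v, fscale h X p] = h p * al p [v, X p]"
  using form2_lin2[OF a VF_tangent[OF X(1)] tangent_zero' v, where c="h p"] form2_lin2[OF a tangent_zero' tangent_zero' v, where c=1]
  by (simp add: fscale_def zero_fun_def)
qed

section \<open>Exterior derivative\<close>

text \<open>
 The pattern by which every definite description over arbitrary extensions is evaluated: its value
 does not depend on the extension, and extensions exist.
\<close>
lemma the_extends:
 assumes "set vs <= TS p" "!!Xs. extends A p Xs vs ==> F Xs = c"
 shows "(THE r. ALL Xs. extends A p Xs vs --> r = F Xs) = (c :: real)"
proof (rule the_equality)
 show "ALL Xs. extends A p Xs vs --> c = F Xs" using assms(2) by auto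
 fix r assume "ALL Xs. extends A p Xs vs --> r = F Xs"
 then show "r = c" using extends_exist[OF assms(1)] assms(2) by auto
qed

lemma extends_length: "extends A p Xs vs ==> length Xs = length vs"
 and extends_VF: "extends A p Xs vs ==> X : set Xs ==> VF X"
 by (auto simp: extends_def)

lemma length_del_nth: "i < length xs ==> length (del_nth i xs) = length xs - 1"
 by (auto simp: del_nth_def)

lemma ext_d_degree:
 assumes a: "!!q us. length us ~= k ==> al q us = 0" and l: "length vs ~= Suc k"
 shows "ext_d A al p vs = 0"
proof (cases "set vs <= TS p")
 case True
 have "(THE r. ALL Xs. extends A p Xs vs -->
    r = (\<Sum>i<length vs. (-1) ^ i * (Xs ! i) p (%q. al q (map (%X. X q) (del_nth i Xs))))
     + (\<Sum>j<length vs. \<Sum>i<j. (-1) ^ (i + j) *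
        al p (Lie (Xs ! i) (Xs ! j) p # del_nth i (del_nth j vs)))) = 0"
 proof (rule the_extends[OF True])
  fix Xs assume X: "extends A p Xs vs"
  have "(-1) ^ i * (Xs ! i) p (%q. al q (map (%X. X q) (del_nth i Xs))) = 0" if "i < length vs" for i
  proof -
   have "VF (Xs ! i)" using that extends_VF[OF X] extends_length[OF X] by simp
   moreover have "length (del_nth i Xs) ~= k"
    using that l extends_length[OF X] length_del_nth[of i Xs] by auto
   ultimately show ?thesis using a VF_zero_arg by simp
  qed
  moreover have "al p (Lie (Xs ! i) (Xs ! j) p # del_nth i (del_nth j vs)) = 0"
   if "j < length vs" "i < j" for i j
  proof -
   have "length (Lie (Xs ! i) (Xs ! j) p # del_nth i (del_nth j vs)) ~= k"
    using that l length_del_nth[of j vs] length_del_nth[of i "del_nth j vs"] by auto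
   then show ?thesis by (rule a)
  qed
  ultimately show "(\<Sum>i<length vs. (-1) ^ i * (Xs ! i) p (%q. al q (map (%X. X q) (del_nth i Xs))))
     + (\<Sum>j<length vs. \<Sum>i<j. (-1) ^ (i + j) *
        al p (Lie (Xs ! i) (Xs ! j) p # del_nth i (del_nth j vs))) = 0"
   by simp
 qed
 then show ?thesis using True by (simp add: ext_d_def)
qed (simp add: ext_d_def)

lemma ext_d_nontangent: "~ set vs <= TS p ==> ext_d A al p vs = 0"
 by (simp add: ext_d_def)

lemma ext_d_fun:
 assumes f: "f : SF" and v: "v : TS p"
 shows "ext_d A (fun_form f) p [v] = v f"
proof -
 have "(THE r. ALL Xs. extends A p Xs [v] -->
    r = (\<Sum>i<length [v]. (-1) ^ i * (Xs ! i) p (%q. fun_form f q (map (%X. X q) (del_nth i Xs))))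
     + (\<Sum>j<length [v]. \<Sum>i<j. (-1) ^ (i + j) *
        fun_form f p (Lie (Xs ! i) (Xs ! j) p # del_nth i (del_nth j [v])))) = v f"
 proof (rule the_extends)
  fix Xs assume X: "extends A p Xs [v]"
  then obtain X where "Xs = [X]" "X p = v" by (auto simp: extends_def)
  then show "(\<Sum>i<length [v]. (-1) ^ i * (Xs ! i) p (%q. fun_form f q (map (%X. X q) (del_nth i Xs))))
     + (\<Sum>j<length [v]. \<Sum>i<j. (-1) ^ (i + j) *
        fun_form f p (Lie (Xs ! i) (Xs ! j) p # del_nth i (del_nth j [v]))) = v f"
   by (simp add: fun_form_def del_nth_def)
 qed (use v in simp)
 then show ?thesis using v by (simp add: ext_d_def)
qed

lemma ext_d_fun_degree: "length vs ~= 1 ==> ext_d A (fun_form f) p vs = 0"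
 by (rule ext_d_degree[of 0]) (auto simp: fun_form_def)

lemma ext_d_fun_form: assumes f: "f : SF" shows "ext_d A (fun_form f) : forms A 1"
proof (rule form1I)
 fix p vs assume "~ (length vs = 1 & set vs <= TS p)"
 then show "ext_d A (fun_form f) p vs = 0" using ext_d_fun_degree ext_d_nontangent by blast
next
 fix p u w c assume "u : TS p" "w : TS p"
 then show "ext_d A (fun_form f) p [%f. c * u f + w f] = c * ext_d A (fun_form f) p [u] + ext_d A (fun_form f) p [w]"
  using f tangent_comb by (simp add: ext_d_fun)
next
 fix X assume X: "VF X"
 show "(%p. ext_d A (fun_form f) p [X p]) : SF"
  using VF_smooth[OF X f] by (simp add: ext_d_fun[OF f VF_tangent[OF X]])
qed

definition d1 :: "'m form => 'm => 'm vfield => 'm vfield => real" where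
 "d1 al p X Y = X p (%q. al q [Y q]) - Y p (%q. al q [X q]) - al p [Lie X Y p]"

lemma form1_at_add: "al : forms A 1 ==> VF X ==> VF Y ==> al q [(X + Y) q] = al q [X q] + al q [Y q]"
 by (rule tensorial_add[OF form1_tensorial])

lemma form1_at_fscale: "al : forms A 1 ==> VF X ==> h : SF ==> al q [fscale h X q] = h q * al q [X q]"
 by (rule tensorial_fscale[OF form1_tensorial])

lemma form1_at_uminus: "al : forms A 1 ==> VF X ==> al q [(- X) q] = - al q [X q]"
 by (rule tensorial_uminus[OF form1_tensorial])

lemma fscale_apply: "fscale h X p f = h p * X p f"
 by (simp add: fscale_def)

lemma d1_tensorial2:
 assumes a: "al : forms A 1" and X: "VF X" shows "tensorial p (%Y. d1 al p X Y)"
proof (rule tensorialI)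
 fix Y Z assume Y: "VF Y" "VF Z"
 show "d1 al p X (Y + Z) = d1 al p X Y + d1 al p X Z"
  unfolding d1_def bracket_add_right[OF X Y] form1_at_add[OF a VF_bracket[OF X Y(1)] VF_bracket[OF X Y(2)]]
   form1_at_add[OF a Y] VF_add_arg[OF X form1_smooth[OF a Y(1)] form1_smooth[OF a Y(2)]]
  by simp
next
 fix Y h assume Y: "VF Y" and h: "h : SF"
 note s = VF_bracket[OF X Y]
 show "d1 al p X (fscale h Y) = h p * d1 al p X Y"
  unfolding d1_def bracket_fscale_right[OF X Y h] form1_at_add[OF a VF_fscale[OF h s] VF_fscale[OF VF_smooth[OF X h] Y]]
   form1_at_fscale[OF a s h] form1_at_fscale[OF a Y VF_smooth[OF X h]] form1_at_fscale[OF a Y h]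
   VF_mult_arg[OF X h form1_smooth[OF a Y]] fscale_apply
  by (simp add: algebra_simps)
qed

lemma d1_skew: assumes a: "al : forms A 1" and X: "VF X" "VF Y" shows "d1 al p Y X = - d1 al p X Y"
 unfolding d1_def bracket_antisym[of Y X] form1_at_uminus[OF a VF_bracket[OF X(1,2)]] by simp

lemma d1_cong:
 assumes a: "al : forms A 1" and X: "VF X" "VF Y" "VF X'" "VF Y'" "X p = X' p" "Y p = Y' p"
 shows "d1 al p X Y = d1 al p X' Y'"
proof -
 have "d1 al p X Y = d1 al p X Y'" by (rule tensorial_cong[OF d1_tensorial2[OF a X(1)] X(2,4,6)])
 also have "... = - d1 al p Y' X" by (rule d1_skew[OF a X(4,1)])
 also have "d1 al p Y' X = d1 al p Y' X'" by (rule tensorial_cong[OF d1_tensorial2[OF a X(4)] X(1,3,5)])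
 also have "- d1 al p Y' X' = d1 al p X' Y'" by (rule d1_skew[OF a X(4,3), symmetric])
 finally show ?thesis .
qed

text \<open>
 The definition of \<open>ext_d\<close> refers to arbitrary extensions of the tangent vectors; since
 \<open>d1\<close> is tensorial, given fields may be used.
\<close>
lemma ext_d_form1:
 assumes a: "al : forms A 1" and X: "VF X" "VF Y"
 shows "ext_d A al p [X p, Y p] = d1 al p X Y"
proof -
 have v: "set [X p, Y p] <= TS p" using X VF_tangent by simp
 have "(THE r. ALL Xs. extends A p Xs [X p, Y p] -->
    r = (\<Sum>i<length [X p, Y p]. (-1) ^ i * (Xs ! i) p (%q. al q (map (%X. X q) (del_nth i Xs))))
     + (\<Sum>j<length [X p, Y p]. \<Sum>i<j. (-1) ^ (i + j) *
        al p (Lie (Xs ! i) (Xs ! j) p # del_nth i (del_nth j [X p, Y p])))) = d1 al p X Y"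
 proof (rule the_extends[OF v])
  fix Xs assume e: "extends A p Xs [X p, Y p]"
  then obtain X' Y' where Xs: "Xs = [X', Y']" and e': "X' p = X p" "Y' p = Y p" by (auto simp: extends_def)
  have V: "VF X'" "VF Y'" using extends_VF[OF e] Xs by auto
  have "(\<Sum>i<length [X p, Y p]. (-1) ^ i * (Xs ! i) p (%q. al q (map (%X. X q) (del_nth i Xs))))
     + (\<Sum>j<length [X p, Y p]. \<Sum>i<j. (-1) ^ (i + j) *
        al p (Lie (Xs ! i) (Xs ! j) p # del_nth i (del_nth j [X p, Y p]))) = d1 al p X' Y'"
   by (simp add: Xs d1_def del_nth_def lessThan_Suc numeral_2_eq_2)
  also have "... = d1 al p X Y" by (rule d1_cong[OF a V X e'])
  finally show "(\<Sum>i<length [X p, Y p]. (-1) ^ i * (Xs ! i) p (%q. al q (map (%X. X q) (del_nth i Xs))))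
     + (\<Sum>j<length [X p, Y p]. \<Sum>i<j. (-1) ^ (i + j) *
        al p (Lie (Xs ! i) (Xs ! j) p # del_nth i (del_nth j [X p, Y p]))) = d1 al p X Y" .
 qed
 then show ?thesis using v by (simp add: ext_d_def)
qed

lemma VF_comb: "VF X ==> VF Y ==> VF (fscale (%_. c) X + Y)"
 by (intro VF_add VF_fscale smooth_const)

lemma comb_at: "(fscale (%_. c) X + Y) p = (%f. c * X p f + Y p f)"
 by (auto simp: fscale_def fun_eq_iff)

lemma ext_d_form2: assumes a: "al : forms A 1" shows "ext_d A al : forms A 2"
proof (rule form2I)
 fix p vs assume n: "~ (length vs = 2 & set vs <= TS p)"
 show "ext_d A al p vs = 0"
 proof (cases "set vs <= TS p")
  case True
  then have l: "length vs ~= Suc 1" using n by simp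
  show ?thesis by (rule ext_d_degree[OF _ l]) (use form_zero[OF a] in auto)
 qed (rule ext_d_nontangent)
next
 fix p u w v c assume u: "u : TS p" "w : TS p" "v : TS p"
 obtain X where X: "VF X" "X p = u" using tangent_extends[OF u(1)] .
 obtain Y where Y: "VF Y" "Y p = w" using tangent_extends[OF u(2)] .
 obtain Z where Z: "VF Z" "Z p = v" using tangent_extends[OF u(3)] .
 let ?W = "fscale (%_. c) X + Y"
 have W: "VF ?W" "?W p = (%f. c * u f + w f)" using VF_comb X Y comb_at[of c X Y p] by auto
 have t: "d1 al p Z ?W = c * d1 al p Z X + d1 al p Z Y"
  using tensorial_add[OF d1_tensorial2[OF a Z(1)] VF_fscale[OF smooth_const X(1)] Y(1)]
   tensorial_fscale[OF d1_tensorial2[OF a Z(1)] X(1) smooth_const] by simp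
 then show "ext_d A al p [v, %f. c * u f + w f] = c * ext_d A al p [v, u] + ext_d A al p [v, w]"
  using ext_d_form1[OF a Z(1) W(1), of p] ext_d_form1[OF a Z(1) X(1), of p] ext_d_form1[OF a Z(1) Y(1), of p] W X Y Z by simp
 have "d1 al p ?W Z = c * d1 al p X Z + d1 al p Y Z"
  using t d1_skew[OF a W(1) Z(1), of p] d1_skew[OF a X(1) Z(1), of p] d1_skew[OF a Y(1) Z(1), of p] by simp
 then show "ext_d A al p [%f. c * u f + w f, v] = c * ext_d A al p [u, v] + ext_d A al p [w, v]"
  using ext_d_form1[OF a W(1) Z(1), of p] ext_d_form1[OF a X(1) Z(1), of p] ext_d_form1[OF a Y(1) Z(1), of p] W X Y Z by simp
next
 fix p u assume u: "u : TS p"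
 obtain X where X: "VF X" "X p = u" using tangent_extends[OF u] .
 show "ext_d A al p [u, u] = 0"
  using ext_d_form1[OF a X(1) X(1), of p] d1_skew[OF a X(1) X(1), of p] X by simp
next
 fix X Y assume X: "VF X" "VF Y"
 show "(%p. ext_d A al p [X p, Y p]) : SF"
  unfolding ext_d_form1[OF a X] d1_def
  by (intro smooth_diff VF_smooth[OF X(1) form1_smooth[OF a X(2)]] VF_smooth[OF X(2) form1_smooth[OF a X(1)]]
    form1_smooth[OF a VF_bracket[OF X]])
qed

definition d2 :: "'m form => 'm => 'm vfield => 'm vfield => 'm vfield => real" where
 "d2 al p X Y Z = X p (%q. al q [Y q, Z q]) - Y p (%q. al q [X q, Z q]) + Z p (%q. al q [X q, Y q])
   - al p [Lie X Y p, Z p] + al p [Lie X Z p, Y p] - al p [Lie Y Z p, X p]"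

lemma form2_at:
 assumes a: "al : forms A 2" and X: "VF X" "VF Y" "VF Z"
 shows "al q [(X + Y) q, Z q] = al q [X q, Z q] + al q [Y q, Z q]"
  "al q [Z q, (X + Y) q] = al q [Z q, X q] + al q [Z q, Y q]"
  "h : SF ==> al q [fscale h X q, Z q] = h q * al q [X q, Z q]"
  "h : SF ==> al q [Z q, fscale h X q] = h q * al q [Z q, X q]"
  "al q [(X - Y) q, Z q] = al q [X q, Z q] - al q [Y q, Z q]"
  "al q [Z q, (X - Y) q] = al q [Z q, X q] - al q [Z q, Y q]"
  "al q [(- X) q, Z q] = - al q [X q, Z q]"
  "al q [Z q, (- X) q] = - al q [Z q, X q]"
 using tensorial_add[OF form2_tensorial1[OF a VF_tangent[OF X(3)]] X(1,2)]
  tensorial_add[OF form2_tensorial2[OF a VF_tangent[OF X(3)]] X(1,2)]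
  tensorial_fscale[OF form2_tensorial1[OF a VF_tangent[OF X(3)]] X(1)]
  tensorial_fscale[OF form2_tensorial2[OF a VF_tangent[OF X(3)]] X(1)]
  tensorial_diff[OF form2_tensorial1[OF a VF_tangent[OF X(3)]] X(1,2)]
  tensorial_diff[OF form2_tensorial2[OF a VF_tangent[OF X(3)]] X(1,2)]
  tensorial_uminus[OF form2_tensorial1[OF a VF_tangent[OF X(3)]] X(1)]
  tensorial_uminus[OF form2_tensorial2[OF a VF_tangent[OF X(3)]] X(1)]
 by auto

lemma form2_swap: "al : forms A 2 ==> VF X ==> VF Y ==> al q [Y q, X q] = - al q [X q, Y q]"
 by (rule form2_skew) (auto intro: VF_tangent)

lemma d2_tensorial3:
 assumes a: "al : forms A 2" and X: "VF X" "VF Y" shows "tensorial p (%Z. d2 al p X Y Z)"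
proof (rule tensorialI)
 fix Z W assume Z: "VF Z" "VF W"
 note b = VF_bracket[OF X(1) Z(1)] VF_bracket[OF X(1) Z(2)] VF_bracket[OF X(2) Z(1)] VF_bracket[OF X(2) Z(2)]
 show "d2 al p X Y (Z + W) = d2 al p X Y Z + d2 al p X Y W"
  unfolding d2_def bracket_add_right[OF X(1) Z] bracket_add_right[OF X(2) Z]
   form2_at(2)[OF a Z X(2)] form2_at(2)[OF a Z X(1)] form2_at(2)[OF a Z VF_bracket[OF X]]
   form2_at(1)[OF a b(1,2) X(2)] form2_at(1)[OF a b(3,4) X(1)]
   VF_add_arg[OF X(1) form2_smooth[OF a X(2) Z(1)] form2_smooth[OF a X(2) Z(2)]]
   VF_add_arg[OF X(2) form2_smooth[OF a X(1) Z(1)] form2_smooth[OF a X(1) Z(2)]]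
  by simp
next
 fix Z h assume Z: "VF Z" and h: "h : SF"
 note b = VF_bracket[OF X(1) Z] VF_bracket[OF X(2) Z]
 have 1: "al p [Lie X (fscale h Z) p, Y p] = h p * al p [Lie X Z p, Y p] + X p h * al p [Z p, Y p]"
  unfolding bracket_fscale_right[OF X(1) Z h] form2_at(1)[OF a VF_fscale[OF h b(1)] VF_fscale[OF VF_smooth[OF X(1) h] Z] X(2)]
   form2_at(3)[OF a b(1) X(2) X(2) h] form2_at(3)[OF a Z X(2) X(2) VF_smooth[OF X(1) h]] ..
 have 2: "al p [Lie Y (fscale h Z) p, X p] = h p * al p [Lie Y Z p, X p] + Y p h * al p [Z p, X p]"
  unfolding bracket_fscale_right[OF X(2) Z h] form2_at(1)[OF a VF_fscale[OF h b(2)] VF_fscale[OF VF_smooth[OF X(2) h] Z] X(1)]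
   form2_at(3)[OF a b(2) X(1) X(1) h] form2_at(3)[OF a Z X(1) X(1) VF_smooth[OF X(2) h]] ..
 show "d2 al p X Y (fscale h Z) = h p * d2 al p X Y Z"
  unfolding d2_def 1 2 form2_at(4)[OF a Z Z X(1) h] form2_at(4)[OF a Z Z X(2) h] form2_at(4)[OF a Z Z VF_bracket[OF X] h]
   VF_mult_arg[OF X(1) h form2_smooth[OF a X(2) Z]] VF_mult_arg[OF X(2) h form2_smooth[OF a X(1) Z]]
   form2_swap[OF a X(1) Z] form2_swap[OF a X(2) Z] fscale_apply
  by (simp add: algebra_simps)
qed

lemma d2_swap12: assumes a: "al : forms A 2" and X: "VF X" "VF Y" "VF Z" shows "d2 al p Y X Z = - d2 al p X Y Z"
 unfolding d2_def bracket_antisym[of Y X] form2_at(7)[OF a VF_bracket[OF X(1,2)] X(3) X(3)]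
  form2_swap[OF a X(1,2)] VF_minus_arg[OF X(3) form2_smooth[OF a X(1,2)]] by simp

lemma d2_swap23: assumes a: "al : forms A 2" and X: "VF X" "VF Y" "VF Z" shows "d2 al p X Z Y = - d2 al p X Y Z"
 unfolding d2_def bracket_antisym[of Z Y] form2_at(7)[OF a VF_bracket[OF X(2,3)] X(1) X(1)]
  form2_swap[OF a X(2,3)] VF_minus_arg[OF X(1) form2_smooth[OF a X(2,3)]] by simp

lemma d2_cong:
 assumes a: "al : forms A 2" and X: "VF X" "VF Y" "VF Z" "VF X'" "VF Y'" "VF Z'"
  and e: "X p = X' p" "Y p = Y' p" "Z p = Z' p"
 shows "d2 al p X Y Z = d2 al p X' Y' Z'"
proof -
 have "d2 al p X Y Z = d2 al p X Y Z'" by (rule tensorial_cong[OF d2_tensorial3[OF a X(1,2)] X(3,6) e(3)])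
 also have "... = - d2 al p X Z' Y" by (rule d2_swap23[OF a X(1,6,2)])
 also have "d2 al p X Z' Y = d2 al p X Z' Y'" by (rule tensorial_cong[OF d2_tensorial3[OF a X(1,6)] X(2,5) e(2)])
 also have "d2 al p X Z' Y' = - d2 al p Z' X Y'" by (rule d2_swap12[OF a X(6,1,5)])
 also have "d2 al p Z' X Y' = - d2 al p Z' Y' X" by (rule d2_swap23[OF a X(6,5,1)])
 also have "d2 al p Z' Y' X = d2 al p Z' Y' X'" by (rule tensorial_cong[OF d2_tensorial3[OF a X(6,5)] X(1,4) e(1)])
 also have "... = - d2 al p Z' X' Y'" by (rule d2_swap23[OF a X(6,4,5)])
 also have "d2 al p Z' X' Y' = - d2 al p X' Z' Y'" by (rule d2_swap12[OF a X(4,6,5)])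
 also have "d2 al p X' Z' Y' = - d2 al p X' Y' Z'" by (rule d2_swap23[OF a X(4,5,6)])
 finally show ?thesis by simp
qed

lemma ext_d_2:
 assumes a: "al : forms A 2" and X: "VF X" "VF Y" "VF Z"
 shows "ext_d A al p [X p, Y p, Z p] = d2 al p X Y Z"
proof -
 let ?v = "[X p, Y p, Z p]"
 have v: "set ?v <= TS p" using X VF_tangent by simp
 have "(THE r. ALL Xs. extends A p Xs ?v -->
    r = (\<Sum>i<length ?v. (-1) ^ i * (Xs ! i) p (%q. al q (map (%X. X q) (del_nth i Xs))))
     + (\<Sum>j<length ?v. \<Sum>i<j. (-1) ^ (i + j) *
        al p (Lie (Xs ! i) (Xs ! j) p # del_nth i (del_nth j ?v)))) = d2 al p X Y Z"
 proof (rule the_extends[OF v])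
  fix Xs assume e: "extends A p Xs ?v"
  then obtain X' Y' Z' where Xs: "Xs = [X', Y', Z']" and e': "X' p = X p" "Y' p = Y p" "Z' p = Z p"
   by (auto simp: extends_def)
  have V: "VF X'" "VF Y'" "VF Z'" using extends_VF[OF e] Xs by auto
  have "(\<Sum>i<length ?v. (-1) ^ i * (Xs ! i) p (%q. al q (map (%X. X q) (del_nth i Xs))))
     + (\<Sum>j<length ?v. \<Sum>i<j. (-1) ^ (i + j) *
        al p (Lie (Xs ! i) (Xs ! j) p # del_nth i (del_nth j ?v))) = d2 al p X' Y' Z'"
   using e' by (simp add: Xs d2_def del_nth_def lessThan_Suc numeral_3_eq_3 numeral_2_eq_2)
  also have "... = d2 al p X Y Z" by (rule d2_cong[OF a V X e'])
  finally show "(\<Sum>i<length ?v. (-1) ^ i * (Xs ! i) p (%q. al q (map (%X. X q) (del_nth i Xs))))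
     + (\<Sum>j<length ?v. \<Sum>i<j. (-1) ^ (i + j) *
        al p (Lie (Xs ! i) (Xs ! j) p # del_nth i (del_nth j ?v))) = d2 al p X Y Z" .
 qed
 then show ?thesis using v by (simp add: ext_d_def)
qed

end

section \<open>Riemannian metrics and frames\<close>

locale riem = total_manifold A for A :: "('m, 'e::euclidean_space) atlas" +
 fixes g :: "'m metric"
 assumes metric: "riemannian_metric A g"
begin

lemma g_sym: "u : TS p ==> v : TS p ==> g p u v = g p v u"
 using metric unfolding riemannian_metric_def by blast

lemma g_lin1: "u : TS p ==> v : TS p ==> w : TS p ==> g p (%f. c * u f + w f) v = c * g p u v + g p w v"
 using metric unfolding riemannian_metric_def by blast

lemma g_pos: "u : TS p ==> u ~= 0 ==> g p u u > 0"
 using metric unfolding riemannian_metric_def by blast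

lemma g_smooth: "VF X ==> VF Y ==> (%p. g p (X p) (Y p)) : SF"
 using metric unfolding riemannian_metric_def by blast

lemma g_add1: "u : TS p ==> v : TS p ==> w : TS p ==> g p (u + w) v = g p u v + g p w v"
 using g_lin1[of u p v w 1] by (simp add: plus_fun_def)

lemma g_zero1: "v : TS p ==> g p 0 v = 0"
 using g_add1[of 0 p v 0] by simp

lemma g_scale1: "u : TS p ==> v : TS p ==> g p (%f. c * u f) v = c * g p u v"
 using g_lin1[of u p v 0 c] g_zero1[of v p] by simp

lemma g_uminus1: "u : TS p ==> v : TS p ==> g p (- u) v = - g p u v"
 using g_scale1[of u p v "-1"] by (simp add: fun_Compl_def)

lemma g_diff1: "u : TS p ==> v : TS p ==> w : TS p ==> g p (u - w) v = g p u v - g p w v"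
 using g_add1[of u p v "- w"] g_uminus1[of w p v] tangent_uminus[of w p] by simp

lemma g_sum1: "v : TS p ==> (!!i. i : I ==> u i : TS p) ==> g p (\<Sum>i\<in>I. u i) v = (\<Sum>i\<in>I. g p (u i) v)"
 by (induction I rule: infinite_finite_induct) (auto simp: g_zero1 g_add1 tangent_vsum)

lemma g_nonneg: "u : TS p ==> g p u u \<ge> 0"
 using g_pos[of u p] g_zero1[of 0 p] by (cases "u = 0") auto

lemma g_zeroD: "u : TS p ==> g p u u = 0 ==> u = 0"
 using g_pos[of u p] by force

lemma orthogonal_bound:
 assumes w: "!!i. i < m ==> w i : TS p" and o: "!!i j. i < m ==> j < m ==> i ~= j ==> g p (w i) (w j) = 0"
  and nz: "!!i. i < m ==> w i ~= 0"
 shows "m \<le> DIM('e)"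
proof -
 obtain th V x E where "is_local_frame p th V x E" using local_frame[of p] by blast
 note l = is_local_frameD[OF this]
 define \<kappa> where "\<kappa> u = (\<Sum>b\<in>Basis. u (x b) *\<^sub>R b)" for u :: "'m tvec"
 have inj0: "u = 0" if "u : TS p" "\<kappa> u = 0" for u
 proof (rule ext)
  fix f
  have "u (x b) = 0" if "b : Basis" for b
  proof -
   have "\<kappa> u \<bullet> b = u (x b)" using that unfolding \<kappa>_def by (rule inner_sum_left_Basis)
   then show ?thesis using \<open>\<kappa> u = 0\<close> by simp
  qed
  then show "u f = 0 f" using l(7)[OF \<open>u : TS p\<close>, of f] l(4)[OF l(3)] by simp
 qed
 have comb: "c i = 0" if "(\<Sum>i<m. c i *\<^sub>R \<kappa> (w i)) = 0" "i < m" for c i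
 proof -
  let ?u = "\<Sum>i<m. (%f. c i * w i f)"
  have tu: "?u : TS p" by (rule tangent_vsum) (use w tangent_scale in auto)
  have "\<kappa> ?u = (\<Sum>i<m. c i *\<^sub>R \<kappa> (w i))"
   unfolding \<kappa>_def sum_tvec_apply by (simp add: scaleR_sum_left scaleR_sum_right sum.swap[of _ Basis])
  then have "?u = 0" using inj0[OF tu] that by simp
  then have "0 = g p ?u (w i)" using g_zero1[OF w[OF that(2)]] by simp
  also have "... = (\<Sum>j<m. g p (%f. c j * w j f) (w i))"
   by (rule g_sum1) (use w that tangent_scale in auto)
  also have "... = (\<Sum>j<m. if j = i then c i * g p (w i) (w i) else 0)"
   by (rule sum.cong) (use w that g_scale1 o in auto)
  also have "... = c i * g p (w i) (w i)" using that by simp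
  finally show ?thesis using g_pos[OF w nz] that by force
 qed
 have ij: "inj_on (%i. \<kappa> (w i)) {..<m}"
 proof (rule inj_onI, rule ccontr)
  fix i j assume ij: "i : {..<m}" "j : {..<m}" "\<kappa> (w i) = \<kappa> (w j)" "i ~= j"
  have "(\<Sum>k<m. (if k = i then 1 else if k = j then -1 else 0) *\<^sub>R \<kappa> (w k))
    = (\<Sum>k<m. (if k = i then \<kappa> (w i) else 0) + (if k = j then - \<kappa> (w j) else 0))"
   by (rule sum.cong) (use ij in auto)
  also have "... = 0" using ij by (simp add: sum.distrib)
  finally show False using comb[of "%k. if k = i then 1 else if k = j then -1 else 0" i] ij by simp
 qed
 have "independent ((%i. \<kappa> (w i)) ` {..<m})"
 proof (rule independent_if_scalars_zero)
  fix f y assume 0: "(\<Sum>y\<in>(%i. \<kappa> (w i)) ` {..<m}. f y *\<^sub>R y) = 0" and y: "y : (%i. \<kappa> (w i)) ` {..<m}"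
  have "(\<Sum>i<m. f (\<kappa> (w i)) *\<^sub>R \<kappa> (w i)) = 0" using 0 by (simp add: sum.reindex[OF ij])
  then show "f y = 0" using comb[of "%i. f (\<kappa> (w i))"] y by auto
 qed simp
 then have "card ((%i. \<kappa> (w i)) ` {..<m}) \<le> DIM('e)" using independent_bound by blast
 then show ?thesis by (simp add: card_image[OF ij])
qed

lemma orthonormal_complement:
 assumes w: "!!i. i < k ==> w i : TS p" and o: "!!i j. i < k ==> j < k ==> g p (w i) (w j) = (if i = j then 1 else 0)"
  and k: "k < DIM('e)"
 obtains u where "u : TS p" "u ~= 0" "!!i. i < k ==> g p u (w i) = 0"
proof -
 obtain th V x E where "is_local_frame p th V x E" using local_frame[of p] by blast
 note l = is_local_frameD[OF this]
 define \<kappa> where "\<kappa> u = (\<Sum>b\<in>Basis. u (x b) *\<^sub>R b)" for u :: "'m tvec"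
 let ?S = "(%i. \<kappa> (w i)) ` {..<k}"
 have "dim ?S \<le> card ?S" by (rule dim_le_card'[OF finite_imageI[OF finite_lessThan]])
 also have "... \<le> k" using card_image_le[of "{..<k}" "%i. \<kappa> (w i)"] by simp
 finally have "dim ?S < DIM('e)" using k by simp
 then have "span ?S ~= UNIV" by (metis dim_UNIV dim_span less_irrefl)
 then obtain z where z: "z ~: span ?S" by blast
 define v where "v = (\<Sum>b\<in>Basis. (%f. (z \<bullet> b) * E b p f))"
 have v: "v : TS p" unfolding v_def by (rule tangent_vsum) (intro tangent_scale VF_tangent l)
 have vx: "v (x b) = z \<bullet> b" if "b : Basis" for b
 proof -
  have "v (x b) = (\<Sum>i\<in>Basis. if i = b then z \<bullet> b else 0)"
   unfolding v_def sum_tvec_apply by (rule sum.cong) (use l(8)[OF l(3) _ that] in auto)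
  then show ?thesis using that by simp
 qed
 have kv: "\<kappa> v = z" unfolding \<kappa>_def using vx by (simp add: euclidean_representation)
 define s where "s = (\<Sum>i<k. (%f. g p v (w i) * w i f))"
 have s: "s : TS p" unfolding s_def by (rule tangent_vsum) (use w tangent_scale in auto)
 have gs: "g p s (w i) = g p v (w i)" if "i < k" for i
 proof -
  have "g p s (w i) = (\<Sum>j<k. g p (%f. g p v (w j) * w j f) (w i))"
   unfolding s_def by (rule g_sum1) (use w that tangent_scale in auto)
  also have "... = (\<Sum>j<k. if j = i then g p v (w i) else 0)"
   by (rule sum.cong) (use w that g_scale1 o in auto)
  finally show ?thesis using that by simp
 qed
 have "\<kappa> s = (\<Sum>i<k. g p v (w i) *\<^sub>R \<kappa> (w i))"
  unfolding \<kappa>_def s_def sum_tvec_apply by (simp add: scaleR_sum_left scaleR_sum_right sum.swap[of _ Basis])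
 also have "... : span ?S" by (intro span_sum span_scale span_base) auto
 finally have "v ~= s" using kv z by auto
 show thesis
 proof (rule that[of "v - s"])
  show "v - s : TS p" using tangent_plus[OF v tangent_uminus[OF s]] by simp
  show "v - s ~= 0" using \<open>v ~= s\<close> by simp
  show "g p (v - s) (w i) = 0" if "i < k" for i
   using g_diff1[OF v w[OF that] s] gs[OF that] by simp
 qed
qed

text \<open>
 Gram-Schmidt: extend a vector orthogonal to the given ones at \<open>p\<close>, project off the
 given fields, and normalise where the norm is positive. One step at a time, so that the same lemma
 yields orthonormal and adapted frames.
\<close>
lemma frame_step:
 assumes U: "openin T U" "p : U" and e: "!!i. i < k ==> VF (e i)"
  and o: "!!q i j. q : U ==> i < k ==> j < k ==> g q (e i q) (e j q) = (if i = j then 1 else 0)"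
  and k: "k < DIM('e)"
 shows "EX Z W. VF Z & openin T W & p : W & W <= U & (ALL q:W. g q (Z q) (Z q) = 1) &
  (ALL q:W. ALL i<k. g q (Z q) (e i q) = 0)"
proof -
 obtain u where u: "u : TS p" "u ~= 0" "!!i. i < k ==> g p u (e i p) = 0"
  using orthonormal_complement[of k "%i. e i p" p] e o[OF U(2)] k VF_tangent by metis
 obtain X where X: "VF X" "X p = u" using tangent_extends[OF u(1)] .
 define S where "S = (\<Sum>i<k. fscale (%q. g q (X q) (e i q)) (e i))"
 have S: "VF S" unfolding S_def by (intro VF_sum VF_fscale g_smooth X) (use e in auto)
 have S_at: "S q = (\<Sum>i<k. (%f. g q (X q) (e i q) * e i q f))" for q
  unfolding S_def sum_field_at by (simp add: fscale_def)
 define Y where "Y = X - S"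
 have Y: "VF Y" unfolding Y_def by (rule VF_diff[OF X(1) S])
 have Yo: "g q (Y q) (e i q) = 0" if "q : U" "i < k" for q i
 proof -
  have "g q (S q) (e i q) = (\<Sum>j<k. g q (%f. g q (X q) (e j q) * e j q f) (e i q))"
   unfolding S_at by (rule g_sum1) (use e that tangent_scale VF_tangent in auto)
  also have "... = (\<Sum>j<k. if j = i then g q (X q) (e i q) else 0)"
   by (rule sum.cong) (use e that g_scale1 o VF_tangent in auto)
  also have "... = g q (X q) (e i q)" using that by simp
  finally show ?thesis
   using g_diff1[OF VF_tangent[OF X(1)] VF_tangent[OF e[OF that(2)]] VF_tangent[OF S], of q] by (simp add: Y_def)
 qed
 have "S p = 0" unfolding S_at using u(3) X(2) by (simp add: zero_fun_def[symmetric])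
 then have "Y p = u" using X(2) by (simp add: Y_def)
 then have pos: "g p (Y p) (Y p) > 0" using g_pos u by simp
 obtain s V where s: "s : SF" "openin T V" "p : V" "!!q. q : V ==> s q * s q * g q (Y q) (Y q) = 1"
  using local_inverse_sqrt[OF g_smooth[OF Y Y] pos] by metis
 have sc: "g q (fscale s Y q) w = s q * g q (Y q) w" if "w : TS q" for q w
  using g_scale1[OF VF_tangent[OF Y] that] by (simp add: fscale_def)
 show ?thesis
 proof (intro exI[of _ "fscale s Y"] exI[of _ "U \<inter> V"] conjI ballI allI impI)
  show Z: "VF (fscale s Y)" by (rule VF_fscale[OF s(1) Y])
  fix q assume that: "q : U \<inter> V"
  show "g q (fscale s Y q) (fscale s Y q) = 1"
  proof -
   have "g q (fscale s Y q) (fscale s Y q) = s q * g q (fscale s Y q) (Y q)"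
    using sc[OF VF_tangent[OF Z]] g_sym[OF VF_tangent[OF Y] VF_tangent[OF Z]] by simp
   also have "... = s q * s q * g q (Y q) (Y q)" using sc[OF VF_tangent[OF Y]] by simp
   finally show ?thesis using s(4) that by simp
  qed
  fix i assume "i < k"
  then show "g q (fscale s Y q) (e i q) = 0"
   using sc[OF VF_tangent[OF e]] Yo that by simp
 qed (use U s in \<open>auto intro: openin_Int\<close>)
qed

abbreviation "frame \<equiv> orthonormal_frame A g"

lemma frame_exists: "EX U e. frame p U e"
proof -
 have "EX U e. openin T U & p : U & (ALL i<k. VF (e i)) &
   (ALL q:U. ALL i<k. ALL j<k. g q (e i q) (e j q) = (if i = j then 1 else 0))" if "k \<le> DIM('e)" for k
  using that
 proof (induction k)
  case 0
  show ?case by (intro exI[of _ C] exI[of _ "%_. 0"]) (use openin_C in auto)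
 next
  case (Suc k)
  then obtain U e where U: "openin T U" "p : U" and e: "!!i. i < k ==> VF (e i)"
   and o: "!!q i j. q : U ==> i < k ==> j < k ==> g q (e i q) (e j q) = (if i = j then 1 else 0)"
   by (metis Suc_leD)
  have k: "k < DIM('e)" using Suc by simp
  have "EX Z W. VF Z & openin T W & p : W & W <= U & (ALL q:W. g q (Z q) (Z q) = 1) &
    (ALL q:W. ALL i<k. g q (Z q) (e i q) = 0)"
   by (rule frame_step[OF U _ _ k]) (use e o in auto)
  then obtain Z W where Z: "VF Z" "openin T W" "p : W" "W <= U" "ALL q:W. g q (Z q) (Z q) = 1"
   "ALL q:W. ALL i<k. g q (Z q) (e i q) = 0"
   by blast
  have sy: "g q (e i q) (Z q) = 0" if "q : W" "i < k" for q i
   using Z(6) that g_sym[OF VF_tangent[OF Z(1)] VF_tangent[OF e[OF that(2)]], of q] by simp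
  show ?case
  proof (intro exI[of _ W] exI[of _ "e(k := Z)"] conjI ballI allI impI)
   fix i assume "i < Suc k"
   then show "VF ((e(k := Z)) i)" using e Z(1) by (cases "i = k") auto
  next
   fix q i j assume q: "q : W" and ij: "i < Suc k" "j < Suc k"
   have "q : U" using Z(4) q by blast
   then show "g q ((e(k := Z)) i q) ((e(k := Z)) j q) = (if i = j then 1 else 0)"
    using o[of q i j] Z(5,6) q sy[OF q] ij by (cases "i = k"; cases "j = k") auto
  qed (use Z in auto)
 qed
 then show ?thesis unfolding orthonormal_frame_def by auto
qed

lemma frameD:
 assumes "frame p U e"
 shows "openin T U" "p : U" "i < DIM('e) ==> VF (e i)"
  "q : U ==> i < DIM('e) ==> j < DIM('e) ==> g q (e i q) (e j q) = (if i = j then 1 else 0)"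
 using assms by (auto simp: orthonormal_frame_def)

lemma frame_move: "frame p U e ==> q : U ==> frame q U e"
 by (simp add: orthonormal_frame_def)

lemma frame_expand:
 assumes e: "frame p U e" and u: "u : TS p"
 shows "u = (\<Sum>i<DIM('e). (%f. g p u (e i p) * e i p f))"
proof (rule ccontr)
 note e' = frameD[OF e]
 define s where "s = (\<Sum>i<DIM('e). (%f. g p u (e i p) * e i p f))"
 assume "u ~= (\<Sum>i<DIM('e). (%f. g p u (e i p) * e i p f))"
 then have ne: "u - s ~= 0" by (simp add: s_def)
 have te: "e i p : TS p" if "i < DIM('e)" for i using e'(3)[OF that] VF_tangent by blast
 have s: "s : TS p" unfolding s_def by (rule tangent_vsum) (use te tangent_scale in auto)
 have us: "u - s : TS p" using tangent_plus[OF u tangent_uminus[OF s]] by simp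
 have gs: "g p (u - s) (e i p) = 0" if "i < DIM('e)" for i
 proof -
  have "g p s (e i p) = (\<Sum>j<DIM('e). g p (%f. g p u (e j p) * e j p f) (e i p))"
   unfolding s_def by (rule g_sum1) (use te that tangent_scale in auto)
  also have "... = (\<Sum>j<DIM('e). if j = i then g p u (e i p) else 0)"
   by (rule sum.cong) (use te that g_scale1 e'(4)[OF e'(2)] in auto)
  finally show ?thesis using that g_diff1[OF u te[OF that] s] by simp
 qed
 have "Suc DIM('e) \<le> DIM('e)"
 proof (rule orthogonal_bound[of _ "%i. if i < DIM('e) then e i p else u - s" p])
  fix i j assume ij: "i < Suc DIM('e)" "j < Suc DIM('e)" "i ~= j"
  show "g p (if i < DIM('e) then e i p else u - s) (if j < DIM('e) then e j p else u - s) = 0"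
   using ij gs e'(4)[OF e'(2)] g_sym[OF us te] by (cases "i < DIM('e)"; cases "j < DIM('e)") auto
 next
  fix i
  show "(if i < DIM('e) then e i p else u - s) ~= 0"
   using ne e'(4)[OF e'(2), of i i] g_zero1[of 0 p] by auto
 qed (use te us in auto)
 then show False by simp
qed

lemma tensorial_frame:
 assumes e: "frame p U e" and L: "tensorial p L" and X: "VF X"
 shows "L X = (\<Sum>i<DIM('e). g p (X p) (e i p) * L (e i))"
proof -
 note e' = frameD[OF e]
 let ?Y = "\<Sum>i<DIM('e). fscale (%_. g p (X p) (e i p)) (e i)"
 have Y: "VF ?Y" by (intro VF_sum VF_fscale smooth_const) (use e' in auto)
 have "X p = ?Y p"
  using frame_expand[OF e VF_tangent[OF X]] unfolding sum_field_at by (simp add: fscale_def)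
 then have "L X = L ?Y" by (rule tensorial_cong[OF L X Y])
 also have "... = (\<Sum>i<DIM('e). L (fscale (%_. g p (X p) (e i p)) (e i)))"
  by (rule tensorial_sum[OF L]) (use e' in \<open>auto intro: VF_fscale\<close>)
 also have "... = (\<Sum>i<DIM('e). g p (X p) (e i p) * L (e i))"
  by (rule sum.cong) (use e' in \<open>auto intro: tensorial_fscale[OF L]\<close>)
 finally show ?thesis .
qed

lemma g_tensorial1: "VF Y ==> tensorial p (%X. g p (X p) (Y p))"
 by (rule tensorialI) (auto simp: VF_tangent g_add1 fscale_def g_scale1)

lemma g_tensorial2: assumes Y: "VF Y" shows "tensorial p (%X. g p (Y p) (X p))"
 using g_tensorial1[OF Y, of p] unfolding tensorial_def
 by (simp add: g_sym[OF VF_tangent[OF Y]] VF_tangent VF_add VF_fscale plus_fun_apply[symmetric] del: plus_fun_apply)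

lemma g_at:
 assumes X: "VF X" "VF Y" "VF Z"
 shows "g q ((X + Y) q) (Z q) = g q (X q) (Z q) + g q (Y q) (Z q)"
  "g q (Z q) ((X + Y) q) = g q (Z q) (X q) + g q (Z q) (Y q)"
  "h : SF ==> g q (fscale h X q) (Z q) = h q * g q (X q) (Z q)"
  "h : SF ==> g q (Z q) (fscale h X q) = h q * g q (Z q) (X q)"
  "g q ((X - Y) q) (Z q) = g q (X q) (Z q) - g q (Y q) (Z q)"
  "g q (Z q) ((X - Y) q) = g q (Z q) (X q) - g q (Z q) (Y q)"
  "g q ((- X) q) (Z q) = - g q (X q) (Z q)"
  "g q (Z q) ((- X) q) = - g q (Z q) (X q)"
 using tensorial_add[OF g_tensorial1[OF X(3)] X(1,2)] tensorial_add[OF g_tensorial2[OF X(3)] X(1,2)]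
  tensorial_fscale[OF g_tensorial1[OF X(3)] X(1)] tensorial_fscale[OF g_tensorial2[OF X(3)] X(1)]
  tensorial_diff[OF g_tensorial1[OF X(3)] X(1,2)] tensorial_diff[OF g_tensorial2[OF X(3)] X(1,2)]
  tensorial_uminus[OF g_tensorial1[OF X(3)] X(1)] tensorial_uminus[OF g_tensorial2[OF X(3)] X(1)]
 by auto

lemma g_field_sym: "VF X ==> VF Y ==> g q (X q) (Y q) = g q (Y q) (X q)"
 by (rule g_sym) (auto intro: VF_tangent)

lemma g_nondegenerate:
 assumes X: "VF X" "VF Y" and e: "!!Z p. VF Z ==> g p (X p) (Z p) = g p (Y p) (Z p)"
 shows "X = Y"
proof (rule ext)
 fix p
 have "g p ((X - Y) p) ((X - Y) p) = 0"
  using g_at(5)[OF X VF_diff[OF X], of p] e[OF VF_diff[OF X], of p] by simp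
 then have "(X - Y) p = 0" using g_zeroD VF_tangent[OF VF_diff[OF X]] by blast
 then show "X p = Y p" by simp
qed

lemma frame_trace:
 assumes e: "frame p U e" and e': "frame p U' e'"
  and T1: "!!Y. VF Y ==> tensorial p (%X. B X Y)" and T2: "!!X. VF X ==> tensorial p (%Y. B X Y)"
 shows "(\<Sum>i<DIM('e). B (e i) (e i)) = (\<Sum>i<DIM('e). B (e' i) (e' i))"
proof -
 note d = frameD[OF e] and d' = frameD[OF e']
 have "(\<Sum>i<DIM('e). B (e i) (e i)) = (\<Sum>i<DIM('e). \<Sum>j<DIM('e). g p (e i p) (e' j p) * B (e' j) (e i))"
  by (rule sum.cong) (use tensorial_frame[OF e' T1] d in auto)
 also have "... = (\<Sum>j<DIM('e). \<Sum>i<DIM('e). g p (e' j p) (e i p) * B (e' j) (e i))"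
  by (subst sum.swap, intro sum.cong refl) (use g_field_sym d d' in auto)
 also have "... = (\<Sum>j<DIM('e). B (e' j) (e' j))"
  by (rule sum.cong) (use tensorial_frame[OF e T2] d' in auto)
 finally show ?thesis .
qed

definition some_frame :: "'m => nat => 'm vfield" where
 "some_frame p = (SOME e. EX U. frame p U e)"

text \<open>
 The trace of a bilinear expression, which by \<open>frame_trace\<close> may be computed in any
 frame.
\<close>
definition tr :: "'m => ('m vfield => 'm vfield => real) => real" where
 "tr p B = (\<Sum>i<DIM('e). B (some_frame p i) (some_frame p i))"

lemma tr_frame:
 assumes e: "frame p U e"
  and "!!Y. VF Y ==> tensorial p (%X. B X Y)" "!!X. VF X ==> tensorial p (%Y. B X Y)"
 shows "tr p B = (\<Sum>i<DIM('e). B (e i) (e i))"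
proof -
 have "EX e U. frame p U e" using frame_exists by blast
 then have "EX U. frame p U (some_frame p)" unfolding some_frame_def by (rule someI_ex)
 then show ?thesis unfolding tr_def using frame_trace[OF _ e] assms by blast
qed

section \<open>Dual vector fields\<close>

text \<open>
 The components of the field in a local orthonormal frame are the values of the functional on the
 frame.
\<close>
lemma sharp_exists:
 assumes L: "!!p. tensorial p (L p)" and s: "!!X. VF X ==> (%p. L p X) : SF"
 shows "EX Z. VF Z & (ALL p X. VF X --> g p (Z p) (X p) = L p X)"
proof -
 define Z where "Z p = (\<Sum>i<DIM('e). (%f. L p (some_frame p i) * some_frame p i p f))" for p
 have sf: "EX U. frame p U (some_frame p)" for p
  using frame_exists[of p] someI_ex[of "%e. EX U. frame p U e"] unfolding some_frame_def by blast
 have Zt: "Z p : TS p" for p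
  unfolding Z_def by (rule tangent_vsum) (use sf frameD(3) VF_tangent tangent_scale in blast)
 have Zg: "g p (Z p) (X p) = L p X" if X: "VF X" for p X
 proof -
  obtain U where U: "frame p U (some_frame p)" using sf by blast
  note d = frameD[OF U]
  have te: "some_frame p i p : TS p" if "i < DIM('e)" for i using d(3)[OF that] VF_tangent by blast
  have "g p (Z p) (X p) = (\<Sum>i<DIM('e). g p (%f. L p (some_frame p i) * some_frame p i p f) (X p))"
   unfolding Z_def by (rule g_sum1) (use te tangent_scale VF_tangent[OF X] in auto)
  also have "... = (\<Sum>i<DIM('e). g p (X p) (some_frame p i p) * L p (some_frame p i))"
   by (rule sum.cong) (use te g_scale1 g_sym VF_tangent[OF X] in auto)
  also have "... = L p X" by (rule tensorial_frame[OF U L X, symmetric])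
  finally show ?thesis .
 qed
 have "VF Z"
 proof (rule VF_I[OF Zt])
  fix f assume f: "f : SF"
  show "(%p. Z p f) : SF"
  proof (rule smooth_local)
   fix p
   obtain U e where e: "frame p U e" using frame_exists by blast
   note d = frameD[OF e]
   have s1: "(%q. \<Sum>i<DIM('e). L q (e i) * e i q f) : SF"
    by (intro smooth_sum smooth_mult s VF_smooth[OF _ f]) (use d in auto)
   have "Z q f = (\<Sum>i<DIM('e). L q (e i) * e i q f)" if "q : U" for q
   proof -
    have "Z q f = (\<Sum>i<DIM('e). (%f. g q (Z q) (e i q) * e i q f)) f"
     using frame_expand[OF frame_move[OF e that] Zt] by (rule fun_cong)
    also have "... = (\<Sum>i<DIM('e). L q (e i) * e i q f)"
     unfolding sum_tvec_apply by (rule sum.cong) (use Zg d in auto)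
    finally show ?thesis .
   qed
   then show "EX W s. openin T W & p : W & s : SF & (ALL q:W. Z q f = s q)"
    using d s1 by blast
  qed
 qed
 then show ?thesis using Zg by blast
qed

end

context total_manifold begin
lemmas VF_args = VF_add_arg VF_mult_arg VF_diff_arg VF_minus_arg VF_cmult_arg VF_const_arg

lemma fscale_at: "fscale h X q = (%f. h q * X q f)"
 by (simp add: fscale_def)

lemma affine_connectionD:
 assumes c: "affine_connection A K" and X: "VF X" and Y: "VF Y"
 shows "VF (K X Y)"
  and "VF Z ==> h : SF ==> K (fscale h X + Z) Y = fscale h (K X Y) + K Z Y"
  and "VF Z ==> h : SF ==> K X (fscale h Y + Z) = fscale (%p. X p h) Y + fscale h (K X Y) + K X Z"
proof -
 have *: "VF (K X Y) & (ALL Z h. VF Z & h : SF -->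
      K (fscale h X + Z) Y = fscale h (K X Y) + K Z Y &
      K X (fscale h Y + Z) = fscale (%p. X p h) Y + fscale h (K X Y) + K X Z)"
  by (rule c[unfolded affine_connection_def, THEN spec, THEN spec, THEN mp, of X Y, OF conjI[OF X Y]])
 show "VF (K X Y)" using * by (rule conjunct1)
 show "VF Z ==> h : SF ==> K (fscale h X + Z) Y = fscale h (K X Y) + K Z Y"
  "VF Z ==> h : SF ==> K X (fscale h Y + Z) = fscale (%p. X p h) Y + fscale h (K X Y) + K X Z"
  using * by simp_all
qed

lemma levi_civita_affine: "is_levi_civita A g K ==> affine_connection A K"
 by (simp add: is_levi_civita_def)
end

context riem begin

section \<open>The Levi-Civita connection\<close>

lemma g_add2: "u : TS p ==> v : TS p ==> w : TS p ==> g p v (u + w) = g p v u + g p v w"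
 using g_add1[of u p v w] g_sym[of v p "u + w"] g_sym[of v p u] g_sym[of v p w] tangent_plus[of u p w] by simp

lemma g_scale2: "u : TS p ==> v : TS p ==> g p v (%f. c * u f) = c * g p v u"
 using g_scale1[of u p v c] g_sym[of v p "%f. c * u f"] g_sym[of v p u] tangent_scale[of u p c] by simp

lemma g_uminus2: "u : TS p ==> v : TS p ==> g p v (- u) = - g p v u"
 using g_scale2[of u p v "-1"] by (simp add: fun_Compl_def)

lemma g_diff2: "u : TS p ==> v : TS p ==> w : TS p ==> g p v (u - w) = g p v u - g p v w"
 using g_add2[of u p v "- w"] g_uminus2[of w p v] tangent_uminus[of w p] by simp

lemmas g_simps = g_add1 g_add2 g_scale1 g_scale2 g_uminus1 g_uminus2 g_diff1 g_diff2 VF_tangent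
 tangent_scale tangent_plus tangent_uminus fscale_at

text \<open>
 Twice the metric product of \<open>D\<^sub>X Y\<close> with \<open>Z\<close>, by the Koszul formula.
\<close>
definition kos :: "'m => 'm vfield => 'm vfield => 'm vfield => real" where
 "kos p X Y Z = X p (%q. g q (Y q) (Z q)) + Y p (%q. g q (X q) (Z q)) - Z p (%q. g q (X q) (Y q))
   + g p (Lie X Y p) (Z p) - g p (Lie X Z p) (Y p) - g p (Lie Y Z p) (X p)"

lemma kos_tensorial3:
 assumes X: "VF X" and Y: "VF Y" shows "tensorial p (kos p X Y)"
proof (rule tensorialI)
 fix Z W assume Z: "VF Z" and W: "VF W"
 show "kos p X Y (Z + W) = kos p X Y Z + kos p X Y W"
  by (simp add: kos_def g_simps bracket_add_right X Y Z W VF_args[OF X] VF_args[OF Y] g_smooth VF_bracket)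
next
 fix Z h assume Z: "VF Z" and h: "h : SF"
 show "kos p X Y (fscale h Z) = h p * kos p X Y Z"
  using g_field_sym[OF X Z, of p] g_field_sym[OF Y Z, of p] g_field_sym[OF X Y, of p]
  by (simp add: kos_def g_simps bracket_fscale_right X Y Z h VF_args[OF X] VF_args[OF Y] g_smooth VF_bracket)
   (simp add: algebra_simps)
qed

lemma kos_smooth: assumes X: "VF X" "VF Y" "VF Z" shows "(%p. kos p X Y Z) : SF"
 unfolding kos_def
 by (intro smooth_add smooth_diff VF_smooth[OF X(1) g_smooth[OF X(2,3)]] VF_smooth[OF X(2) g_smooth[OF X(1,3)]]
   VF_smooth[OF X(3) g_smooth[OF X(1,2)]] g_smooth VF_bracket X)

lemma kos_add1: assumes X: "VF X" and X': "VF X'" and Y: "VF Y" and Z: "VF Z"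
 shows "kos p (X + X') Y Z = kos p X Y Z + kos p X' Y Z"
 by (simp add: kos_def g_simps bracket_add_left X Y Z X' VF_args[OF Y] VF_args[OF Z] g_smooth VF_bracket)

lemma kos_add2: assumes X: "VF X" and Y': "VF Y'" and Y: "VF Y" and Z: "VF Z"
 shows "kos p X (Y + Y') Z = kos p X Y Z + kos p X Y' Z"
 by (simp add: kos_def g_simps bracket_add_left bracket_add_right X Y Z Y' VF_args[OF X] VF_args[OF Z] g_smooth VF_bracket)

lemma kos_fscale1: assumes X: "VF X" and h: "h : SF" and Y: "VF Y" and Z: "VF Z"
 shows "kos p (fscale h X) Y Z = h p * kos p X Y Z"
 using g_field_sym[OF X Z, of p] g_field_sym[OF X Y, of p]
 by (simp add: kos_def g_simps bracket_fscale_left X Y Z h VF_args[OF Y] VF_args[OF Z] g_smooth VF_bracket VF_smooth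
   VF_fscale) (simp add: algebra_simps)

lemma kos_fscale2: assumes X: "VF X" and h: "h : SF" and Y: "VF Y" and Z: "VF Z"
 shows "kos p X (fscale h Y) Z = h p * kos p X Y Z + 2 * X p h * g p (Y p) (Z p)"
 using g_field_sym[OF X Z, of p] g_field_sym[OF X Y, of p] g_field_sym[OF Y Z, of p]
 by (simp add: kos_def g_simps bracket_fscale_left bracket_fscale_right X Y Z h VF_args[OF X] VF_args[OF Z] g_smooth VF_bracket VF_smooth
   VF_fscale) (simp add: algebra_simps)

lemma kos_torsion: assumes X: "VF X" and Y: "VF Y" and Z: "VF Z"
 shows "kos p X Y Z - kos p Y X Z = 2 * g p (Lie X Y p) (Z p)"
proof -
 have "(%q. g q (Y q) (X q)) = (%q. g q (X q) (Y q))" using g_field_sym[OF X Y] by (intro ext) simp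
 then show ?thesis
  by (simp add: kos_def bracket_antisym[of Y X] g_simps X Y Z VF_bracket)
qed

lemma kos_compat: assumes X: "VF X" and Y: "VF Y" and Z: "VF Z"
 shows "kos p X Y Z + kos p X Z Y = 2 * X p (%q. g q (Y q) (Z q))"
proof -
 have "(%q. g q (Z q) (Y q)) = (%q. g q (Y q) (Z q))" using g_field_sym[OF Z Y] by (intro ext) simp
 then show ?thesis
  by (simp add: kos_def bracket_antisym[of Z Y] g_simps X Y Z VF_bracket)
qed

lemma koszul_field:
 assumes X: "VF X" "VF Y"
 shows "EX D. VF D & (ALL p Z. VF Z --> g p (D p) (Z p) = kos p X Y Z / 2)"
proof (rule sharp_exists)
 show "tensorial p (%Z. kos p X Y Z / 2)" for p
  using kos_tensorial3[OF X] unfolding tensorial_def by (simp add: add_divide_distrib)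
 show "(%p. kos p X Y Z / 2) : SF" if "VF Z" for Z
  using smooth_mult[OF kos_smooth[OF X that] smooth_const[of "1/2"]] by simp
qed

lemma levi_civita_koszul:
 assumes D: "is_levi_civita A g D" and X: "VF X" and Y: "VF Y" and Z: "VF Z"
 shows "2 * g p (D X Y p) (Z p) = kos p X Y Z"
proof -
 have V: "VF (D U V)" if "VF U" "VF V" for U V
  using affine_connectionD(1)[OF levi_civita_affine[OF D] that] .
 have c: "U p (%q. g q (V q) (W q)) = g p (D U V p) (W p) + g p (V p) (D U W p)"
  if "VF U" "VF V" "VF W" for U V W
  using D that unfolding is_levi_civita_def by blast
 have t: "g p (Lie U V p) (W p) = g p (D U V p) (W p) - g p (D V U p) (W p)"
  if "VF U" "VF V" "VF W" for U V W
 proof -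
  have "D U V - D V U = Lie U V" using D that unfolding is_levi_civita_def by blast
  then show ?thesis using g_at(5)[OF V[OF that(1,2)] V[OF that(2,1)] that(3), of p] by (simp only:)
 qed
 show ?thesis
  unfolding kos_def c[OF X Y Z] c[OF Y X Z] c[OF Z X Y] t[OF X Y Z] t[OF X Z Y] t[OF Y Z X]
  using g_field_sym[OF V[OF X Z] Y, of p] g_field_sym[OF V[OF Y Z] X, of p] g_field_sym[OF V[OF Y X] Z, of p]
   g_field_sym[OF V[OF Z Y] X, of p]
  by simp
qed

lemma levi_civita_unique:
 assumes D: "is_levi_civita A g D" "is_levi_civita A g D'" and X: "VF X" "VF Y"
 shows "D X Y = D' X Y"
proof (rule g_nondegenerate)
 show "VF (D X Y)" "VF (D' X Y)" using D[THEN levi_civita_affine] X by (simp_all add: affine_connectionD(1))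
 show "g p (D X Y p) (Z p) = g p (D' X Y p) (Z p)" if "VF Z" for Z p
  using levi_civita_koszul[OF D(1) X that, of p] levi_civita_koszul[OF D(2) X that, of p] by simp
qed

text \<open>
 The Koszul formula is tensorial in its last argument and so defines a field; its algebraic
 properties are those of the Levi-Civita connection.
\<close>
lemma levi_civita_exists: "EX D. is_levi_civita A g D & (ALL X Y. ~ (VF X & VF Y) --> D X Y = 0)"
proof -
 define D where "D X Y = (if VF X & VF Y then SOME D. VF D & (ALL p Z. VF Z --> g p (D p) (Z p) = kos p X Y Z / 2) else 0)" for X Y
 have D: "VF (D X Y) & (ALL p Z. VF Z --> g p (D X Y p) (Z p) = kos p X Y Z / 2)" if "VF X" "VF Y" for X Y
 proof -
  have e: "D X Y = (SOME D. VF D & (ALL p Z. VF Z --> g p (D p) (Z p) = kos p X Y Z / 2))"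
   unfolding D_def using that by (intro if_P conjI)
  show ?thesis unfolding e by (rule someI_ex[OF koszul_field[OF that]])
 qed
 have V: "VF (D X Y)" if "VF X" "VF Y" for X Y using D[OF that] by blast
 have k: "g p (D X Y p) (Z p) = kos p X Y Z / 2" if "VF X" "VF Y" "VF Z" for p X Y Z
  using D[OF that(1,2)] that(3) by blast
 have "affine_connection A D"
  unfolding affine_connection_def
 proof (intro allI impI conjI; (elim conjE)?)
  fix X Y assume X: "VF X" and Y: "VF Y"
  show "VF (D X Y)" by (rule V[OF X Y])
  fix Z h assume Z: "VF Z" and h: "h : SF"
  show "D (fscale h X + Z) Y = fscale h (D X Y) + D Z Y"
  proof (rule g_nondegenerate)
   fix W p assume W: "VF W"
   show "g p (D (fscale h X + Z) Y p) (W p) = g p ((fscale h (D X Y) + D Z Y) p) (W p)"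
    unfolding k[OF VF_add[OF VF_fscale[OF h X] Z] Y W] kos_add1[OF VF_fscale[OF h X] Z Y W] kos_fscale1[OF X h Y W]
     g_at(1)[OF VF_fscale[OF h V[OF X Y]] V[OF Z Y] W] g_at(3)[OF V[OF X Y] W W h] k[OF X Y W] k[OF Z Y W]
    by (simp add: field_simps)
  qed (intro V VF_add VF_fscale X Y Z h)+
  show "D X (fscale h Y + Z) = fscale (%p. X p h) Y + fscale h (D X Y) + D X Z"
  proof (rule g_nondegenerate)
   fix W p assume W: "VF W"
   note Xh = VF_smooth[OF X h]
   show "g p (D X (fscale h Y + Z) p) (W p) = g p ((fscale (%p. X p h) Y + fscale h (D X Y) + D X Z) p) (W p)"
    unfolding k[OF X VF_add[OF VF_fscale[OF h Y] Z] W] kos_add2[OF X Z VF_fscale[OF h Y] W] kos_fscale2[OF X h Y W]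
     g_at(1)[OF VF_add[OF VF_fscale[OF Xh Y] VF_fscale[OF h V[OF X Y]]] V[OF X Z] W]
     g_at(1)[OF VF_fscale[OF Xh Y] VF_fscale[OF h V[OF X Y]] W]
     g_at(3)[OF V[OF X Y] W W h] g_at(3)[OF Y W W Xh] k[OF X Y W] k[OF X Z W]
    by (simp add: field_simps)
  qed (intro V VF_add VF_fscale VF_smooth[OF X h] X Y Z h)+
 qed
 moreover have "D X Y - D Y X = Lie X Y" if X: "VF X" and Y: "VF Y" for X Y
 proof (rule g_nondegenerate)
  fix W p assume W: "VF W"
  show "g p ((D X Y - D Y X) p) (W p) = g p (Lie X Y p) (W p)"
   unfolding g_at(5)[OF V[OF X Y] V[OF Y X] W] k[OF X Y W] k[OF Y X W] using kos_torsion[OF X Y W, of p] by simp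
 qed (intro V VF_diff VF_bracket X Y)+
 moreover have "X p (%q. g q (Y q) (Z q)) = g p (D X Y p) (Z p) + g p (Y p) (D X Z p)"
  if X: "VF X" and Y: "VF Y" and Z: "VF Z" for X Y Z p
  using kos_compat[OF X Y Z, of p] k[OF X Y Z, of p] k[OF X Z Y, of p] g_field_sym[OF Y V[OF X Z], of p] by simp
 ultimately have "is_levi_civita A g D" unfolding is_levi_civita_def by blast
 moreover have "D X Y = 0" if "~ (VF X & VF Y)" for X Y
  unfolding D_def using that by (rule if_not_P)
 ultimately show ?thesis by blast
qed

abbreviation "D \<equiv> levi_civita A g"

lemma D_levi_civita: "is_levi_civita A g D"
proof -
 let ?P = "%D. is_levi_civita A g D & (ALL X Y. ~ (VF X & VF Y) --> D X Y = 0)"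
 have "\<exists>!D. ?P D"
 proof (rule ex_ex1I[OF levi_civita_exists])
  fix D D' assume a: "?P D" "?P D'"
  show "D = D'"
  proof (intro ext)
   fix X Y p f
   have "D X Y = D' X Y"
   proof (cases "VF X & VF Y")
    case True
    then show ?thesis using levi_civita_unique[of D D' X Y] a by blast
   next
    case False
    then show ?thesis using a by simp
   qed
   then show "D X Y p f = D' X Y p f" by simp
  qed
 qed
 then have "?P (THE D. ?P D)" by (rule theI')
 then show ?thesis unfolding levi_civita_def by blast
qed

lemma D_VF: "VF X ==> VF Y ==> VF (D X Y)"
 by (rule affine_connectionD(1)[OF levi_civita_affine[OF D_levi_civita]])

lemma D_compat: "VF X ==> VF Y ==> VF Z ==> X p (%q. g q (Y q) (Z q)) = g p (D X Y p) (Z p) + g p (Y p) (D X Z p)"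
 using D_levi_civita unfolding is_levi_civita_def by blast

lemma D_torsion: "VF X ==> VF Y ==> D X Y - D Y X = Lie X Y"
 using D_levi_civita unfolding is_levi_civita_def by blast

lemma D_lin1: "VF X ==> VF Y ==> VF Z ==> h : SF ==> D (fscale h X + Z) Y = fscale h (D X Y) + D Z Y"
 by (rule affine_connectionD(2)[OF levi_civita_affine[OF D_levi_civita]])

lemma D_lin2: "VF X ==> VF Y ==> VF Z ==> h : SF ==>
  D X (fscale h Y + Z) = fscale (%p. X p h) Y + fscale h (D X Y) + D X Z"
 by (rule affine_connectionD(3)[OF levi_civita_affine[OF D_levi_civita]])

lemma D_add1: "VF X ==> VF Y ==> VF Z ==> D (X + Z) Y = D X Y + D Z Y"
 using D_lin1[of X Y Z "%_. 1"] by simp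

lemma D_add2: assumes "VF X" "VF Y" "VF Z" shows "D X (Y + Z) = D X Y + D X Z"
 using D_lin2[OF assms, of "%_. 1"] VF_const_arg[OF assms(1)] by (simp add: fscale_0)

lemma D_zero1: assumes "VF Y" shows "D 0 Y = 0"
 using D_add1[OF VF_zero assms VF_zero] by simp

lemma D_zero2: assumes "VF X" shows "D X 0 = 0"
 using D_add2[OF assms VF_zero VF_zero] by simp

lemma D_fscale1: "VF X ==> VF Y ==> h : SF ==> D (fscale h X) Y = fscale h (D X Y)"
 using D_lin1[of X Y 0 h] VF_zero by (simp add: D_zero1)

lemma D_fscale2: "VF X ==> VF Y ==> h : SF ==> D X (fscale h Y) = fscale (%p. X p h) Y + fscale h (D X Y)"
 using D_lin2[of X Y 0 h] VF_zero by (simp add: D_zero2)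

lemma D_uminus2: "VF X ==> VF Y ==> D X (- Y) = - D X Y"
 using D_fscale2[of X Y "%_. -1"] smooth_const[of "-1"] VF_const_arg[of X] by (simp add: fscale_m1)

lemma D_tensorial:
 assumes Y: "VF Y" and w: "w : TS p" shows "tensorial p (%X. g p (D X Y p) w)"
 by (rule tensorialI) (simp_all add: D_add1 D_fscale1 Y w g_simps D_VF)

section \<open>Divergence\<close>

definition dv :: "'m vfield => 'm => real" where
 "dv Z p = tr p (%X Y. g p (D X Z p) (Y p))"

lemma dv_frame: assumes Z: "VF Z" and e: "frame p U e"
 shows "dv Z p = (\<Sum>i<DIM('e). g p (D (e i) Z p) (e i p))"
 unfolding dv_def
 by (rule tr_frame[OF e]) (auto intro: D_tensorial[OF Z] VF_tangent g_tensorial2[OF D_VF[OF _ Z]])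

lemma dv_smooth: assumes Z: "VF Z" shows "dv Z : SF"
proof (rule smooth_local)
 fix p
 obtain U e where e: "frame p U e" using frame_exists by blast
 note d = frameD[OF e]
 have "(%q. \<Sum>i<DIM('e). g q (D (e i) Z q) (e i q)) : SF"
  by (intro smooth_sum g_smooth D_VF Z) (use d in auto)
 moreover have "dv Z q = (\<Sum>i<DIM('e). g q (D (e i) Z q) (e i q))" if "q : U" for q
  by (rule dv_frame[OF Z frame_move[OF e that]])
 ultimately show "EX W s. openin T W & p : W & s : SF & (ALL q:W. dv Z q = s q)"
  using d(1,2) by blast
qed

text \<open>
 The connection drops out, since it is torsion free and \<open>e i\<close> is a unit field: \<open>g
 (D Z (e i)) (e i) = 0\<close>. The formula shows how the divergence changes under a conformal change
 of the metric.
\<close>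
lemma dv_bracket: assumes Z: "VF Z" and e: "frame p U e"
 shows "dv Z p = (\<Sum>i<DIM('e). g p (Lie (e i) Z p) (e i p))"
 unfolding dv_frame[OF assms]
proof (rule sum.cong[OF refl])
 fix i assume "i : {..<DIM('e)}"
 then have i: "i < DIM('e)" by simp
 note d = frameD[OF e]
 have ei: "VF (e i)" by (rule d(3)[OF i])
 have "0 = Z p (%q. 1)" using VF_const_arg[OF Z, of p 1] by simp
 also have "... = Z p (%q. g q (e i q) (e i q))"
  by (rule VF_local_arg[OF Z smooth_const g_smooth[OF ei ei] d(1,2)]) (use d(4) i in simp)
 also have "... = 2 * g p (D Z (e i) p) (e i p)"
  unfolding D_compat[OF Z ei ei] using g_field_sym[OF ei D_VF[OF Z ei], of p] by simp
 finally have 0: "g p (D Z (e i) p) (e i p) = 0" by simp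
 show "g p (D (e i) Z p) (e i p) = g p (Lie (e i) Z p) (e i p)"
  unfolding D_torsion[OF ei Z, symmetric] g_at(5)[OF D_VF[OF ei Z] D_VF[OF Z ei] ei] 0 by simp
qed

lemma dv_add: assumes X: "VF X" and Y: "VF Y" shows "dv (X + Y) p = dv X p + dv Y p"
proof -
 obtain U e where e: "frame p U e" using frame_exists by blast
 note d = frameD[OF e]
 show ?thesis
  unfolding dv_frame[OF X e] dv_frame[OF Y e] dv_frame[OF VF_add[OF X Y] e] sum.distrib[symmetric]
  by (rule sum.cong) (simp_all add: D_add2 X Y d g_simps D_VF)
qed

lemma dv_fscale: assumes X: "VF X" and h: "h : SF" shows "dv (fscale h X) p = h p * dv X p + X p h"
proof -
 obtain U e where e: "frame p U e" using frame_exists by blast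
 note d = frameD[OF e]
 have L: "tensorial p (%X. X p h)" by (rule tensorialI) (simp_all add: fscale_apply)
 have "dv (fscale h X) p = (\<Sum>i<DIM('e). h p * g p (D (e i) X p) (e i p) + g p (X p) (e i p) * e i p h)"
  unfolding dv_frame[OF VF_fscale[OF h X] e]
  by (rule sum.cong) (simp_all add: D_fscale2 X h d g_simps D_VF)
 also have "... = h p * dv X p + X p h"
  unfolding dv_frame[OF X e] tensorial_frame[OF e L X] by (simp add: sum.distrib sum_distrib_left)
 finally show ?thesis .
qed

definition sharp :: "'m form => 'm vfield" where
 "sharp b = (SOME Z. VF Z & (ALL p X. VF X --> g p (Z p) (X p) = b p [X p]))"

lemma sharp:
 assumes b: "b : forms A 1"
 shows "VF (sharp b)" "VF X ==> g p (sharp b p) (X p) = b p [X p]"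
proof -
 have "EX Z. VF Z & (ALL p X. VF X --> g p (Z p) (X p) = b p [X p])"
  by (rule sharp_exists[OF form1_tensorial[OF b] form1_smooth[OF b]])
 from someI_ex[OF this] show "VF (sharp b)" "VF X ==> g p (sharp b p) (X p) = b p [X p]"
  unfolding sharp_def by blast+
qed

lemma sharp_unique:
 assumes b: "b : forms A 1" and Z: "VF Z" "!!p X. VF X ==> g p (Z p) (X p) = b p [X p]"
 shows "sharp b = Z"
 by (rule g_nondegenerate[OF sharp(1)[OF b] Z(1)]) (use sharp(2)[OF b] Z(2) in simp)

abbreviation "dfun u \<equiv> ext_d A (fun_form u)"

definition grad :: "('m => real) => 'm vfield" where "grad u = sharp (dfun u)"

lemma grad: assumes u: "u : SF"
 shows "VF (grad u)" "VF X ==> g p (grad u p) (X p) = X p u"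
 unfolding grad_def using sharp[OF ext_d_fun_form[OF u]] ext_d_fun[OF u] VF_tangent by metis+

section \<open>Codifferential\<close>

lemma the_frame_extends:
 assumes v: "set vs <= TS p" and F: "!!U e Xs. frame p U e ==> extends A p Xs vs ==> F e Xs = c"
 shows "(THE r. ALL U e Xs. frame p U e & extends A p Xs vs --> r = F e Xs) = (c :: real)"
proof (rule the_equality)
 show "ALL U e Xs. frame p U e & extends A p Xs vs --> c = F e Xs" using F by auto
 fix r assume r: "ALL U e Xs. frame p U e & extends A p Xs vs --> r = F e Xs"
 obtain U e where e: "frame p U e" using frame_exists by blast
 obtain Xs where Xs: "extends A p Xs vs" using extends_exist[OF v] by blast
 show "r = c" using r e Xs F by blast
qed

lemma codiff_degree:
 assumes a: "!!q us. length us ~= k ==> al q us = 0" and l: "Suc (length vs) ~= k"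
 shows "codiff A g al p vs = 0"
proof (cases "set vs <= TS p")
 case True
 have "(THE r. ALL U e Xs. frame p U e & extends A p Xs vs -->
   r = - (\<Sum>i<DIM('e). cov_deriv D (e i) al (e i # Xs) p)) = 0"
 proof (rule the_frame_extends[OF True])
  fix U e Xs assume e: "frame p U e" and X: "extends A p Xs vs"
  have "cov_deriv D (e i) al (e i # Xs) p = 0" if "i < DIM('e)" for i
  proof -
   have 1: "al q (map (%Y. Y q) (e i # Xs)) = 0" for q
    by (rule a) (use l extends_length[OF X] in auto)
   have 2: "al p ((map (%Y. Y p) (e i # Xs))[j := u]) = 0" for j u
   proof (rule a)
    have "length ((map (%Y. Y p) (e i # Xs))[j := u]) = Suc (length vs)"
     unfolding length_list_update length_map using extends_length[OF X] by simp
    then show "length ((map (%Y. Y p) (e i # Xs))[j := u]) ~= k" using l by simp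
   qed
   show ?thesis unfolding cov_deriv_def 1 2 using VF_zero_arg[OF frameD(3)[OF e that]] by simp
  qed
  then show "- (\<Sum>i<DIM('e). cov_deriv D (e i) al (e i # Xs) p) = 0" by simp
 qed
 then show ?thesis using True by (simp add: codiff_def)
qed (simp add: codiff_def)

lemma codiff_nontangent: "~ set vs <= TS p ==> codiff A g al p vs = 0"
 by (simp add: codiff_def)

text \<open>
 All first order operators below are expressed by \<open>dv\<close>; on 1-forms this reduces the
 codifferential to it.
\<close>
lemma codiff_form1: assumes b: "b : forms A 1" shows "codiff A g b p [] = - dv (sharp b) p"
proof -
 note B = sharp[OF b]
 have "(THE r. ALL U e Xs. frame p U e & extends A p Xs [] -->
   r = - (\<Sum>i<DIM('e). cov_deriv D (e i) b (e i # Xs) p)) = - dv (sharp b) p"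
 proof (rule the_frame_extends)
  fix U e Xs assume e: "frame p U e" and X: "extends A p Xs []"
  have Xs: "Xs = []" using extends_length[OF X] by simp
  have "cov_deriv D (e i) b (e i # Xs) p = g p (D (e i) (sharp b) p) (e i p)" if "i < DIM('e)" for i
  proof -
   have ei: "VF (e i)" by (rule frameD(3)[OF e that])
   have "(%q. b q [e i q]) = (%q. g q (sharp b q) (e i q))" using B(2)[OF ei] by simp
   then have "e i p (%q. b q [e i q]) = g p (D (e i) (sharp b) p) (e i p) + g p (sharp b p) (D (e i) (e i) p)"
    using D_compat[OF ei B(1) ei] by simp
   moreover have "b p [D (e i) (e i) p] = g p (sharp b p) (D (e i) (e i) p)"
    using B(2)[OF D_VF[OF ei ei]] by simp
   ultimately show ?thesis unfolding cov_deriv_def Xs by simp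
  qed
  then show "- (\<Sum>i<DIM('e). cov_deriv D (e i) b (e i # Xs) p) = - dv (sharp b) p"
   unfolding dv_frame[OF B(1) e] by simp
 qed simp
 then show ?thesis by (simp add: codiff_def)
qed

lemma codiff_form1_fun: assumes b: "b : forms A 1" shows "codiff A g b = fun_form (%p. - dv (sharp b) p)"
proof (intro ext)
 fix p vs
 show "codiff A g b p vs = fun_form (%p. - dv (sharp b) p) p vs"
 proof (cases "vs = []")
  case True
  then show ?thesis using codiff_form1[OF b] by (simp add: fun_form_def)
 next
  case False
  then have l: "Suc (length vs) ~= 1" by simp
  show ?thesis using codiff_degree[OF _ l, of b] form_zero[OF b] False by (simp add: fun_form_def)
 qed
qed

definition nab2 :: "'m form => 'm => 'm vfield => 'm vfield => 'm vfield => real" where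
 "nab2 \<psi> p X Y Z = X p (%q. \<psi> q [Y q, Z q]) - \<psi> p [D X Y p, Z p] - \<psi> p [Y p, D X Z p]"

lemma nab2_tensorial1: assumes s: "\<psi> : forms A 2" and Y: "VF Y" and Z: "VF Z" shows "tensorial p (%X. nab2 \<psi> p X Y Z)"
proof (rule tensorialI)
 fix X X' assume X: "VF X" "VF X'"
 show "nab2 \<psi> p (X + X') Y Z = nab2 \<psi> p X Y Z + nab2 \<psi> p X' Y Z"
  unfolding nab2_def D_add1[OF X(1) Y X(2)] D_add1[OF X(1) Z X(2)]
   form2_at(1)[OF s D_VF[OF X(1) Y] D_VF[OF X(2) Y] Z] form2_at(2)[OF s D_VF[OF X(1) Z] D_VF[OF X(2) Z] Y] by simp
next
 fix X h assume X: "VF X" and h: "h : SF"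
 show "nab2 \<psi> p (fscale h X) Y Z = h p * nab2 \<psi> p X Y Z"
  unfolding nab2_def D_fscale1[OF X Y h] D_fscale1[OF X Z h] form2_at(3)[OF s D_VF[OF X Y] Z Z h]
   form2_at(4)[OF s D_VF[OF X Z] Y Y h] fscale_apply by (simp add: algebra_simps)
qed

lemma nab2_skew: assumes s: "\<psi> : forms A 2" and X: "VF X" and Y: "VF Y" and Z: "VF Z" shows "nab2 \<psi> p X Z Y = - nab2 \<psi> p X Y Z"
 unfolding nab2_def form2_swap[OF s Y Z] form2_swap[OF s Y D_VF[OF X Z]] form2_swap[OF s D_VF[OF X Y] Z]
  VF_minus_arg[OF X form2_smooth[OF s Y Z]] by simp

lemma nab2_tensorial3: assumes s: "\<psi> : forms A 2" and X: "VF X" and Y: "VF Y" shows "tensorial p (%Z. nab2 \<psi> p X Y Z)"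
proof (rule tensorialI)
 fix Z W assume Z: "VF Z" and W: "VF W"
 show "nab2 \<psi> p X Y (Z + W) = nab2 \<psi> p X Y Z + nab2 \<psi> p X Y W"
  unfolding nab2_def D_add2[OF X Z W] form2_at(2)[OF s Z W Y] form2_at(2)[OF s Z W D_VF[OF X Y]]
   form2_at(2)[OF s D_VF[OF X Z] D_VF[OF X W] Y] VF_add_arg[OF X form2_smooth[OF s Y Z] form2_smooth[OF s Y W]] by simp
next
 fix Z h assume Z: "VF Z" and h: "h : SF"
 note Xh = VF_smooth[OF X h]
 show "nab2 \<psi> p X Y (fscale h Z) = h p * nab2 \<psi> p X Y Z"
  unfolding nab2_def D_fscale2[OF X Z h] form2_at(4)[OF s Z Z Y h] form2_at(4)[OF s Z Z D_VF[OF X Y] h]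
   form2_at(2)[OF s VF_fscale[OF Xh Z] VF_fscale[OF h D_VF[OF X Z]] Y] form2_at(4)[OF s Z Z Y Xh]
   form2_at(4)[OF s D_VF[OF X Z] Y Y h] VF_mult_arg[OF X h form2_smooth[OF s Y Z]]
  by (simp add: algebra_simps)
qed

lemma nab2_tensorial2: assumes s: "\<psi> : forms A 2" and X: "VF X" and Z: "VF Z" shows "tensorial p (%Y. nab2 \<psi> p X Y Z)"
 using nab2_tensorial3[OF s X Z, of p] unfolding tensorial_def
 by (simp add: nab2_skew[OF s X Z] VF_add VF_fscale)

lemma codiff_form2: assumes s: "\<psi> : forms A 2" and Y: "VF Y" and e: "frame p U e"
 shows "codiff A g \<psi> p [Y p] = - (\<Sum>i<DIM('e). nab2 \<psi> p (e i) (e i) Y)"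
proof -
 have v: "set [Y p] <= TS p" using VF_tangent[OF Y] by simp
 have "(THE r. ALL U e Xs. frame p U e & extends A p Xs [Y p] -->
   r = - (\<Sum>i<DIM('e). cov_deriv D (e i) \<psi> (e i # Xs) p)) = - (\<Sum>i<DIM('e). nab2 \<psi> p (e i) (e i) Y)"
 proof (rule the_frame_extends[OF v])
  fix U' e' Xs assume e': "frame p U' e'" and X: "extends A p Xs [Y p]"
  obtain Z where Xs: "Xs = [Z]" and Zp: "Z p = Y p" using X by (auto simp: extends_def)
  have Z: "VF Z" using extends_VF[OF X] Xs by simp
  have "cov_deriv D (e' i) \<psi> (e' i # Xs) p = nab2 \<psi> p (e' i) (e' i) Z" for i
   unfolding cov_deriv_def Xs nab2_def by (simp add: lessThan_Suc numeral_2_eq_2)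
  then have "- (\<Sum>i<DIM('e). cov_deriv D (e' i) \<psi> (e' i # Xs) p) = - (\<Sum>i<DIM('e). nab2 \<psi> p (e' i) (e' i) Z)"
   by simp
  also have "... = - (\<Sum>i<DIM('e). nab2 \<psi> p (e' i) (e' i) Y)"
  proof -
   have "nab2 \<psi> p (e' i) (e' i) Z = nab2 \<psi> p (e' i) (e' i) Y" if "i < DIM('e)" for i
    by (rule tensorial_cong[OF nab2_tensorial3[OF s] Z Y Zp]) (use frameD(3)[OF e'] that in auto)
   then show ?thesis by simp
  qed
  also have "... = - (\<Sum>i<DIM('e). nab2 \<psi> p (e i) (e i) Y)"
   using frame_trace[OF e' e, of "%X W. nab2 \<psi> p X W Y"] nab2_tensorial1[OF s _ Y] nab2_tensorial2[OF s _ Y] by simp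
  finally show "- (\<Sum>i<DIM('e). cov_deriv D (e' i) \<psi> (e' i # Xs) p) = - (\<Sum>i<DIM('e). nab2 \<psi> p (e i) (e i) Y)" .
 qed
 then show ?thesis using v by (simp add: codiff_def)
qed

lemma codiff_form2_form: assumes s: "\<psi> : forms A 2" shows "codiff A g \<psi> : forms A 1"
proof (rule form1I)
 fix p vs assume n: "~ (length vs = 1 & set vs <= TS p)"
 show "codiff A g \<psi> p vs = 0"
 proof (cases "set vs <= TS p")
  case True
  then have l: "Suc (length vs) ~= 2" using n by simp
  show ?thesis by (rule codiff_degree[OF _ l]) (use form_zero[OF s] in auto)
 qed (rule codiff_nontangent)
next
 fix p u w c assume u: "u : TS p" "w : TS p"
 obtain X where X: "VF X" "X p = u" using tangent_extends[OF u(1)] .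
 obtain Y where Y: "VF Y" "Y p = w" using tangent_extends[OF u(2)] .
 obtain U e where e: "frame p U e" using frame_exists by blast
 note d = frameD[OF e]
 let ?W = "fscale (%_. c) X + Y"
 have W: "VF ?W" "?W p = (%f. c * u f + w f)" using VF_comb X Y comb_at[of c X Y p] by auto
 have "nab2 \<psi> p (e i) (e i) ?W = c * nab2 \<psi> p (e i) (e i) X + nab2 \<psi> p (e i) (e i) Y" if "i < DIM('e)" for i
  using tensorial_add[OF nab2_tensorial3[OF s d(3)[OF that] d(3)[OF that]] VF_fscale[OF smooth_const X(1)] Y(1)]
   tensorial_fscale[OF nab2_tensorial3[OF s d(3)[OF that] d(3)[OF that]] X(1) smooth_const] by simp
 then show "codiff A g \<psi> p [%f. c * u f + w f] = c * codiff A g \<psi> p [u] + codiff A g \<psi> p [w]"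
  using codiff_form2[OF s W(1) e] codiff_form2[OF s X(1) e] codiff_form2[OF s Y(1) e] W X Y
  by (simp add: sum.distrib sum_distrib_left)
next
 fix Y assume Y: "VF Y"
 show "(%p. codiff A g \<psi> p [Y p]) : SF"
 proof (rule smooth_local)
  fix p
  obtain U e where e: "frame p U e" using frame_exists by blast
  note d = frameD[OF e]
  have "(%q. nab2 \<psi> q (e i) (e i) Y) : SF" if "i < DIM('e)" for i
   unfolding nab2_def
   by (intro smooth_diff VF_smooth[OF d(3)[OF that] form2_smooth[OF s d(3)[OF that] Y]] form2_smooth[OF s] D_VF d(3)[OF that] Y)
  then have "(%q. - (\<Sum>i<DIM('e). nab2 \<psi> q (e i) (e i) Y)) : SF"
   by (intro smooth_minus smooth_sum) auto
  moreover have "codiff A g \<psi> q [Y q] = - (\<Sum>i<DIM('e). nab2 \<psi> q (e i) (e i) Y)" if "q : U" for q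
   by (rule codiff_form2[OF s Y frame_move[OF e that]])
  ultimately show "EX W s. openin T W & p : W & s : SF & (ALL q:W. codiff A g \<psi> q [Y q] = s q)"
   using d(1,2) by blast
 qed
qed

text \<open>
 The field dual to \<open>\<psi> (grad u, -)\<close> has this divergence: the additional term pairs
 the symmetric Hessian of \<open>u\<close> with the skew form \<open>\<psi>\<close>.
\<close>
lemma codiff_gradient_divergence:
 assumes s: "\<psi> : forms A 2" and u: "u : SF"
 shows "EX Z. VF Z & (ALL p. codiff A g \<psi> p [grad u p] = dv Z p)"
proof -
 note G = grad[OF u]
 have "EX Z. VF Z & (ALL p X. VF X --> g p (Z p) (X p) = \<psi> p [grad u p, X p])"
  by (rule sharp_exists[OF form2_tensorial2[OF s VF_tangent[OF G(1)]] form2_smooth[OF s G(1)]])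
 then obtain Z where Z: "VF Z" "!!p X. VF X ==> g p (Z p) (X p) = \<psi> p [grad u p, X p]" by blast
 have "codiff A g \<psi> p [grad u p] = dv Z p" for p
 proof -
  obtain U e where e: "frame p U e" using frame_exists by blast
  note d = frameD[OF e]
  have a: "g p (D (e i) Z p) (e i p) = - nab2 \<psi> p (e i) (e i) (grad u) + \<psi> p [D (e i) (grad u) p, e i p]" if "i < DIM('e)" for i
  proof -
   note ei = d(3)[OF that]
   have "(%q. \<psi> q [grad u q, e i q]) = (%q. g q (Z q) (e i q))" using Z(2)[OF ei] by simp
   then have "e i p (%q. \<psi> q [grad u q, e i q]) = g p (D (e i) Z p) (e i p) + \<psi> p [grad u p, D (e i) (e i) p]"
    using D_compat[OF ei Z(1) ei, of p] Z(2)[OF D_VF[OF ei ei], of p] by simp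
   then have "g p (D (e i) Z p) (e i p) = nab2 \<psi> p (e i) (grad u) (e i) + \<psi> p [D (e i) (grad u) p, e i p]"
    unfolding nab2_def by simp
   then show ?thesis using nab2_skew[OF s ei ei G(1), of p] by simp
  qed
  define H where "H i k = g p (D (e i) (grad u) p) (e k p)" for i k
  have Hs: "H i k = H k i" if ik: "i < DIM('e)" "k < DIM('e)" for i k
  proof -
   note ei = d(3)[OF ik(1)] and ek = d(3)[OF ik(2)]
   have h: "g p (D X (grad u) p) (Y p) = X p (%q. Y q u) - D X Y p u" if "VF X" "VF Y" for X Y
    using D_compat[OF that(1) G(1) that(2), of p] G(2)[OF that(2)] G(2)[OF D_VF[OF that], of p] by simp
   have "D (e i) (e k) p u - D (e k) (e i) p u = (D (e i) (e k) - D (e k) (e i)) p u" by simp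
   also have "... = Lie (e i) (e k) p u" unfolding D_torsion[OF ei ek] ..
   finally have "D (e i) (e k) p u - D (e k) (e i) p u = e i p (%q. e k q u) - e k p (%q. e i q u)"
    by (simp add: bracket_apply)
   then show ?thesis unfolding H_def using h[OF ei ek] h[OF ek ei] by simp
  qed
  have b: "\<psi> p [D (e i) (grad u) p, e i p] = (\<Sum>k<DIM('e). H i k * \<psi> p [e k p, e i p])" if "i < DIM('e)" for i
   unfolding H_def
   using tensorial_frame[OF e form2_tensorial1[OF s VF_tangent[OF d(3)[OF that]]] D_VF[OF d(3)[OF that] G(1)]] by simp
  let ?S = "\<Sum>i<DIM('e). \<Sum>k<DIM('e). H i k * \<psi> p [e k p, e i p]"
  have "?S = (\<Sum>k<DIM('e). \<Sum>i<DIM('e). H i k * \<psi> p [e k p, e i p])" by (rule sum.swap)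
  also have "... = (\<Sum>k<DIM('e). \<Sum>i<DIM('e). - (H k i * \<psi> p [e i p, e k p]))"
  proof (intro sum.cong refl)
   fix k i assume "k : {..<DIM('e)}" "i : {..<DIM('e)}"
   then show "H i k * \<psi> p [e k p, e i p] = - (H k i * \<psi> p [e i p, e k p])"
    using Hs[of i k] form2_swap[OF s d(3) d(3), of i k p] by simp
  qed
  also have "... = - ?S" by (simp add: sum_negf)
  finally have S0: "?S = 0" by simp
  have "dv Z p = (\<Sum>i<DIM('e). - nab2 \<psi> p (e i) (e i) (grad u)) + ?S"
   unfolding dv_frame[OF Z(1) e] sum.distrib[symmetric] by (rule sum.cong) (use a b in auto)
  then show ?thesis unfolding codiff_form2[OF s G(1) e] S0 by (simp add: sum_negf)
 qed
 then show ?thesis using Z(1) by blast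
qed

lemma laplacian_grad: assumes u: "u : SF" shows "laplacian A g u p = - dv (grad u) p"
proof -
 have "ext_d A (codiff A g (fun_form u)) p [] = 0"
  by (simp add: ext_d_def) (rule the_equality, auto simp: extends_def)
 then show ?thesis
  unfolding laplacian_def hodge_laplacian_def grad_def using codiff_form1[OF ext_d_fun_form[OF u], of p] by simp
qed

lemma covector_norm_grad: assumes u: "u : SF" shows "covector_norm_sq A g (dfun u) p = grad u p u"
proof -
 have val: "(\<Sum>i<DIM('e). (dfun u p [e i p])\<^sup>2) = grad u p u" if e: "frame p U e" for U e
 proof -
  note d = frameD[OF e]
  have L: "tensorial p (%X. X p u)" by (rule tensorialI) (simp_all add: fscale_apply)
  have "grad u p u = (\<Sum>i<DIM('e). g p (grad u p) (e i p) * e i p u)" by (rule tensorial_frame[OF e L grad(1)[OF u]])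
  also have "... = (\<Sum>i<DIM('e). (dfun u p [e i p])\<^sup>2)"
   by (rule sum.cong) (use d grad(2)[OF u] ext_d_fun[OF u VF_tangent] in \<open>auto simp: power2_eq_square\<close>)
  finally show ?thesis by simp
 qed
 show ?thesis unfolding covector_norm_sq_def
 proof (rule the_equality)
  show "ALL U e. frame p U e --> grad u p u = (\<Sum>i<DIM('e). (dfun u p [e i p])\<^sup>2)" using val by auto
  fix r assume "ALL U e. frame p U e --> r = (\<Sum>i<DIM('e). (dfun u p [e i p])\<^sup>2)"
  then show "r = grad u p u" using val frame_exists by metis
 qed
qed

lemma grad_nonneg: "u : SF ==> grad u p u \<ge> 0"
 using grad(2)[of u "grad u" p] grad(1)[of u] g_nonneg[of "grad u p" p] VF_tangent by simp

lemma grad_zero: assumes u: "u : SF" and z: "grad u p u = 0" and X: "VF X" shows "X p u = 0"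
proof -
 have "g p (grad u p) (grad u p) = 0" using grad(2)[OF u grad(1)[OF u], of p] z by simp
 then have "grad u p = 0" using g_zeroD VF_tangent[OF grad(1)[OF u]] by blast
 then show ?thesis using grad(2)[OF u X, of p] g_zero1[OF VF_tangent[OF X]] by simp
qed

end

section \<open>Integration by parts\<close>

text \<open>The functional \<open>I\<close> stands for integration against a volume form.\<close>
locale riem_integral = riem A g for A :: "('m, 'e::euclidean_space) atlas" and g +
 fixes I :: "('m => real) => real"
 assumes I_add: "u : SF ==> v : SF ==> I (%p. u p + v p) = I u + I v"
  and I_cmult: "u : SF ==> I (%p. c * u p) = c * I u"
  and I_definite: "u : SF ==> (!!p. u p \<ge> 0) ==> I u = 0 ==> u p = 0"
  and I_div: "VF Z ==> I (dv Z) = 0"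
begin

lemma I_parts:
 assumes Z: "VF Z" and u: "u : SF" shows "I (%p. u p * dv Z p) = - I (%p. Z p u)"
proof -
 have "0 = I (dv (fscale u Z))" using I_div[OF VF_fscale[OF u Z]] by simp
 also have "... = I (%p. u p * dv Z p + Z p u)" using dv_fscale[OF Z u] by (metis (no_types, lifting))
 also have "... = I (%p. u p * dv Z p) + I (%p. Z p u)"
  by (rule I_add[OF smooth_mult[OF u dv_smooth[OF Z]] VF_smooth[OF Z u]])
 finally show ?thesis by simp
qed

lemma harmonic_function:
 assumes u: "u : SF" and h: "!!p. dv (grad u) p = 0" and X: "VF X" shows "X p u = 0"
proof -
 have "(%p. u p * dv (grad u) p) = (%p. 0 * u p)" using h by simp
 then have "I (%p. u p * dv (grad u) p) = 0" using I_cmult[OF u, of 0] by simp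
 then have "I (%p. grad u p u) = 0" using I_parts[OF grad(1)[OF u] u] by simp
 then have "grad u p u = 0"
  using I_definite[OF VF_smooth[OF grad(1)[OF u] u]] grad_nonneg[OF u] by blast
 then show ?thesis by (rule grad_zero[OF u _ X])
qed

text \<open>
 Integrate the square of \<open>u = \<delta>\<delta>\<psi>\<close>: integration by parts gives, up to
 sign, the integral of \<open>\<delta>\<psi> (grad u)\<close>, a divergence by
 \<open>codiff_gradient_divergence\<close>.
\<close>
lemma codiff_codiff: assumes s: "\<psi> : forms A 2" shows "dv (sharp (codiff A g \<psi>)) p = 0"
proof -
 let ?b = "codiff A g \<psi>"
 note b = codiff_form2_form[OF s]
 let ?u = "dv (sharp ?b)"
 have u: "?u : SF" by (rule dv_smooth[OF sharp(1)[OF b]])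
 obtain Z where Z: "VF Z" "!!p. ?b p [grad ?u p] = dv Z p" using codiff_gradient_divergence[OF s u] by blast
 have "sharp ?b p ?u = dv Z p" for p
 proof -
  have "sharp ?b p ?u = g p (grad ?u p) (sharp ?b p)" using grad(2)[OF u sharp(1)[OF b]] by simp
  also have "... = g p (sharp ?b p) (grad ?u p)" by (rule g_field_sym[OF grad(1)[OF u] sharp(1)[OF b]])
  also have "... = dv Z p" using sharp(2)[OF b grad(1)[OF u]] Z(2) by simp
  finally show ?thesis .
 qed
 then have "I (%p. ?u p * ?u p) = - I (dv Z)" using I_parts[OF sharp(1)[OF b] u] by (simp add: eta_contract_eq)
 then have "I (%p. ?u p * ?u p) = 0" using I_div[OF Z(1)] by simp
 then have "?u p * ?u p = 0" using I_definite[OF smooth_mult[OF u u], of p] by simp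
 then show ?thesis by simp
qed

text \<open>
 Apply the codifferential to \<open>\<delta>db + d\<delta>b = 0\<close>: the function
 \<open>\<delta>b\<close> is harmonic, hence has zero gradient, and then its square integrates to
 zero.
\<close>
lemma harmonic_form_coclosed:
 assumes b: "b : forms A 1" and h: "!!p v. v : TS p ==> hodge_laplacian A g b p [v] = 0"
 shows "dv (sharp b) p = 0"
proof -
 let ?u = "%p. - dv (sharp b) p"
 have u: "?u : SF" by (rule smooth_minus[OF dv_smooth[OF sharp(1)[OF b]]])
 let ?c = "codiff A g (ext_d A b)"
 have c: "?c : forms A 1" by (rule codiff_form2_form[OF ext_d_form2[OF b]])
 have e: "?c p [X p] = - X p ?u" if "VF X" for X p
  using h[OF VF_tangent[OF that], of p] ext_d_fun[OF u VF_tangent[OF that], of p]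
  by (simp add: hodge_laplacian_def codiff_form1_fun[OF b])
 have "sharp ?c = - grad ?u"
  by (rule sharp_unique[OF c VF_uminus[OF grad(1)[OF u]]])
   (use e grad[OF u] g_at(7) in \<open>simp del: uminus_apply\<close>)
 moreover have "dv (- grad ?u) p = - dv (grad ?u) p" for p
  using dv_fscale[OF grad(1)[OF u] smooth_const[of "-1"], of p] VF_const_arg[OF grad(1)[OF u]] by (simp add: fscale_m1)
 ultimately have "dv (grad ?u) p = 0" for p using codiff_codiff[OF ext_d_form2[OF b], of p] by simp
 then have "X p ?u = 0" if "VF X" for X p using harmonic_function[OF u _ that] by blast
 then have "sharp b p ?u = 0" for p using sharp(1)[OF b] by blast
 then have "I (%p. ?u p * dv (sharp b) p) = - I (%p. 0 * ?u p)" using I_parts[OF sharp(1)[OF b] u] by simp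
 then have 0: "I (%p. ?u p * dv (sharp b) p) = 0" using I_cmult[OF u, of 0] by simp
 have "(%p. ?u p * ?u p) = (%p. (-1) * (?u p * dv (sharp b) p))" by auto
 then have "I (%p. ?u p * ?u p) = 0"
  using 0 I_cmult[OF smooth_mult[OF u dv_smooth[OF sharp(1)[OF b]]], of "-1"] by simp
 then have "?u p * ?u p = 0" using I_definite[OF smooth_mult[OF u u], of p] by simp
 then show ?thesis by simp
qed

end

section \<open>Alternating functions of lists\<close>

lemma swap_permutes: "i < n ==> j < n ==> Transposition.transpose i j permutes {..<n::nat}"
 by (rule permutes_swap_id) auto

lemma sign_from_transpositions:
 fixes \<phi> :: "'x list => real"
 assumes sw: "!!ys i j. length ys = n ==> set ys <= S ==> i : B ==> j : B ==> i ~= j ==>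
   \<phi> (permute_list (Transposition.transpose i j) ys) = - \<phi> ys"
  and B: "B <= {..<n}" and s: "sg permutes B" and xs: "length xs = n" "set xs <= S"
 shows "\<phi> (permute_list sg xs) = of_int (sign sg) * \<phi> xs"
proof -
 have fB: "finite B" using B finite_subset by blast
 show ?thesis
  using fB s
 proof (induction sg rule: permutes_rev_induct)
  case id
  then show ?case by (simp add: sign_id)
 next
  case (swap a b p)
  have tp: "Transposition.transpose a b permutes {..<length xs}" using swap B xs by (intro swap_permutes) auto
  have pp: "p permutes {..<n}" using swap(4) B by (rule permutes_subset)
  have "\<phi> (permute_list (p \<circ> Transposition.transpose a b) xs) = \<phi> (permute_list (Transposition.transpose a b) (permute_list p xs))"
   by (simp add: permute_list_compose[OF tp])
  also have "... = - \<phi> (permute_list p xs)"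
   by (rule sw) (use swap xs pp in auto)
  also have "... = - (of_int (sign p) * \<phi> xs)" using swap by simp
  also have "sign (p \<circ> Transposition.transpose a b) = - sign p"
   using swap fB by (simp add: sign_compose permutation_swap_id sign_swap_id permutes_imp_permutation)
  then have "- (of_int (sign p) * \<phi> xs) = of_int (sign (p \<circ> Transposition.transpose a b)) * \<phi> xs" by simp
  finally show ?case .
 qed
qed

lemma permute_list_transpose:
 assumes "i < length xs" "j < length xs" "i ~= j"
 shows "permute_list (Transposition.transpose i j) xs = xs[i := xs ! j, j := xs ! i]"
 by (rule nth_equalityI)
  (use assms in \<open>auto simp: permute_list_nth swap_permutes nth_list_update Transposition.transpose_def\<close>)

lemma take_two: "length xs \<ge> 2 ==> take 2 xs = [xs ! 0, xs ! 1]"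
 by (rule nth_equalityI) (auto simp: less_2_cases_iff)

text \<open>
 Expand all arguments in the basis; the terms with repeated basis elements vanish and the others
 agree up to sign with the value on the basis. The hypothesis \<open>slot\<close> allows coefficients
 that are values of functions, as for expressions that are linear over the smooth functions.
\<close>
lemma multilinear_vanishes:
 fixes \<Phi> :: "'x list => real" and e :: "nat => 'x"
 assumes slot: "!!xs i. length xs = n ==> set xs <= S ==> i < n ==> \<Phi> xs = (\<Sum>j<n. c (xs ! i) j * \<Phi> (xs[i := e j]))"
  and eS: "!!j. j < n ==> e j : S"
  and rep: "!!js. length js = n ==> set js <= {..<n} ==> ~ distinct js ==> \<Phi> (map e js) = 0"
  and sw: "!!js i j. length js = n ==> set js <= {..<n} ==> i < n ==> j < n ==> i ~= j ==>
   \<Phi> (map e (permute_list (Transposition.transpose i j) js)) = - \<Phi> (map e js)"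
  and base: "\<Phi> (map e [0..<n]) = 0"
  and xs: "length xs = n" "set xs <= S"
 shows "\<Phi> xs = 0"
proof -
 have basis: "\<Phi> (map e js) = 0" if js: "length js = n" "set js <= {..<n}" for js
 proof (cases "distinct js")
  case False
  then show ?thesis using rep js by blast
 next
  case True
  have "set js = {..<n}"
   by (rule card_subset_eq) (simp_all add: js distinct_card[OF True])
  then have "set js = set [0..<n]" by (simp add: atLeast0LessThan)
  then have "mset js = mset [0..<n]" using set_eq_iff_mset_eq_distinct[OF True distinct_upt] by blast
  then obtain sg where s: "sg permutes {..<length [0..<n]}" "permute_list sg [0..<n] = js"
   by (rule mset_eq_permutation)
  have "\<Phi> (map e (permute_list sg [0..<n])) = of_int (sign sg) * \<Phi> (map e [0..<n])"
   by (rule sign_from_transpositions[where \<phi>="%js. \<Phi> (map e js)" and B="{..<n}" and S="{..<n}" and n=n])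
    (use s sw in auto)
  then show ?thesis using s base by simp
 qed
 have "\<Phi> xs = 0" if "k \<le> n" "length xs = n" "set xs <= S" "!!i. k \<le> i ==> i < n ==> xs ! i : e ` {..<n}" for k xs
  using that
 proof (induction k arbitrary: xs)
  case 0
  then have "ALL i<n. EX j<n. xs ! i = e j" by force
  then obtain F where F: "!!i. i < n ==> F i < n & xs ! i = e (F i)" by metis
  have "xs = map e (map F [0..<n])" by (rule nth_equalityI) (use F 0 in auto)
  moreover have "\<Phi> (map e (map F [0..<n])) = 0" by (rule basis) (use F in auto)
  ultimately show ?case by simp
 next
  case (Suc k)
  have "\<Phi> (xs[k := e j]) = 0" if "j < n" for j
  proof (rule Suc.IH)
   show "set (xs[k := e j]) <= S" using Suc eS[OF that] set_update_subset_insert[of xs k "e j"] by blast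
   fix i assume "k \<le> i" "i < n"
   then show "xs[k := e j] ! i : e ` {..<n}" using Suc that by (cases "i = k") auto
  qed (use Suc in auto)
  then show ?case using slot[of xs k] Suc by simp
 qed
 from this[of n xs] show ?thesis using xs by simp
qed

context total_manifold begin

definition alt_form :: "'m => nat => ('m tvec list => real) => bool" where
 "alt_form p k \<phi> \<longleftrightarrow>
   (ALL vs. ~ (length vs = k & set vs <= TS p) --> \<phi> vs = 0) &
   (ALL vs i u w c. length vs = k & set vs <= TS p & i < k & u : TS p & w : TS p -->
    \<phi> (vs[i := (%f. c * u f + w f)]) = c * \<phi> (vs[i := u]) + \<phi> (vs[i := w])) &
   (ALL vs i j. length vs = k & set vs <= TS p & i < k & j < k & i ~= j & vs ! i = vs ! j --> \<phi> vs = 0)"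

lemma alt_form_zero: "alt_form p k \<phi> ==> ~ (length vs = k & set vs <= TS p) ==> \<phi> vs = 0"
 unfolding alt_form_def by blast

lemma alt_form_slot: "alt_form p k \<phi> ==> length vs = k ==> set vs <= TS p ==> i < k ==> u : TS p ==> w : TS p ==>
 \<phi> (vs[i := (%f. c * u f + w f)]) = c * \<phi> (vs[i := u]) + \<phi> (vs[i := w])"
 unfolding alt_form_def by simp

lemma alt_form_alt: "alt_form p k \<phi> ==> length vs = k ==> set vs <= TS p ==> i < k ==> j < k ==> i ~= j ==>
 vs ! i = vs ! j ==> \<phi> vs = 0"
 unfolding alt_form_def by blast

lemma alt_formI:
 assumes "!!vs. ~ (length vs = k & set vs <= TS p) ==> \<phi> vs = 0"
  "!!vs i u w c. length vs = k ==> set vs <= TS p ==> i < k ==> u : TS p ==> w : TS p ==>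
    \<phi> (vs[i := (%f. c * u f + w f)]) = c * \<phi> (vs[i := u]) + \<phi> (vs[i := w])"
  "!!vs i j. length vs = k ==> set vs <= TS p ==> i < k ==> j < k ==> i ~= j ==> vs ! i = vs ! j ==> \<phi> vs = 0"
 shows "alt_form p k \<phi>"
 unfolding alt_form_def
proof (intro conjI allI impI)
 show "\<phi> vs = 0" if "~ (length vs = k & set vs <= TS p)" for vs using that by (rule assms(1))
 show "\<phi> (vs[i := (%f. c * u f + w f)]) = c * \<phi> (vs[i := u]) + \<phi> (vs[i := w])"
  if "length vs = k & set vs <= TS p & i < k & u : TS p & w : TS p" for vs i u w c
  using that by (intro assms(2)) auto
 show "\<phi> vs = 0" if "length vs = k & set vs <= TS p & i < k & j < k & i ~= j & vs ! i = vs ! j" for vs i j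
  using that by (intro assms(3)[of vs i j]) auto
qed

lemma forms_alt_form: assumes a: "al : forms A k" shows "alt_form p k (al p)"
proof (rule alt_formI)
 show "al p vs = 0" if "~ (length vs = k & set vs <= TS p)" for vs by (rule form_zero[OF a that])
 show "al p (vs[i := (%f. c * u f + w f)]) = c * al p (vs[i := u]) + al p (vs[i := w])"
  if "length vs = k" "set vs <= TS p" "i < k" "u : TS p" "w : TS p" for vs i u w c
  by (rule form_slot[OF a that])
 show "al p vs = 0" if "length vs = k" "set vs <= TS p" "i < k" "j < k" "i ~= j" "vs ! i = vs ! j" for vs i j
  by (rule form_alt[OF a that])
qed

lemma alt_form_slot_zero: assumes a: "alt_form p k \<phi>" and v: "length vs = k" "set vs <= TS p" and i: "i < k"
 shows "\<phi> (vs[i := 0]) = 0"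
 using alt_form_slot[OF a v i tangent_zero' tangent_zero', of 1] by (simp add: zero_fun_def)

lemma alt_form_slot_sum: assumes a: "alt_form p k \<phi>" and v: "length vs = k" "set vs <= TS p" and i: "i < k"
  and u: "!!j. j : I ==> u j : TS p"
 shows "\<phi> (vs[i := (\<Sum>j\<in>I. (%f. c j * u j f))]) = (\<Sum>j\<in>I. c j * \<phi> (vs[i := u j]))"
 using u
proof (induction I rule: infinite_finite_induct)
 case (insert j I)
 let ?s = "\<Sum>j\<in>I. (%f. c j * u j f)"
 have s: "?s : TS p" by (rule tangent_vsum) (use insert tangent_scale in auto)
 have "(\<Sum>j\<in>insert j I. (%f. c j * u j f)) = (%f. c j * u j f + ?s f)" using insert by (simp add: plus_fun_def)
 then show ?case using alt_form_slot[OF a v i _ s, of "u j" "c j"] insert by simp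
qed (simp_all add: alt_form_slot_zero[OF a v i])

text \<open>All other terms of the combination repeat an argument.\<close>
lemma alt_form_slot_diag: assumes a: "alt_form p k \<phi>" and v: "length vs = k" "set vs <= TS p" and i: "i < k"
 shows "\<phi> (vs[i := (\<Sum>j<k. (%f. c j * (vs ! j) f))]) = c i * \<phi> vs"
proof -
 have t: "vs ! j : TS p" if "j < k" for j using v that by (metis nth_mem subsetD)
 have "\<phi> (vs[i := (\<Sum>j<k. (%f. c j * (vs ! j) f))]) = (\<Sum>j<k. c j * \<phi> (vs[i := vs ! j]))"
  by (rule alt_form_slot_sum[OF a v i]) (use t in auto)
 also have "... = (\<Sum>j<k. if j = i then c i * \<phi> vs else 0)"
 proof (rule sum.cong[OF refl])
  fix j assume j: "j : {..<k}"
  have "\<phi> (vs[i := vs ! j]) = 0" if "j ~= i"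
   by (rule alt_form_alt[OF a, of _ i j]) (use that i j v t[of j] set_update_subset_insert[of vs i "vs ! j"] in auto)
  then show "c j * \<phi> (vs[i := vs ! j]) = (if j = i then c i * \<phi> vs else 0)" by simp
 qed
 finally show ?thesis using i by simp
qed

lemma alt_form_swap: assumes a: "alt_form p k \<phi>" and v: "length vs = k" "set vs <= TS p" and ij: "i < k" "j < k" "i ~= j"
 shows "\<phi> (permute_list (Transposition.transpose i j) vs) = - \<phi> vs"
proof -
 have t: "vs ! i : TS p" "vs ! j : TS p" using v ij by (auto simp: subset_iff)
 let ?s = "%f. 1 * (vs ! i) f + (vs ! j) f"
 have s: "?s : TS p" by (rule tangent_comb[OF t])
 have sub: "set (vs[l := x]) <= TS p" if "x : TS p" for l x
  using that v set_update_subset_insert[of vs l x] by blast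
 have z: "\<phi> (vs[i := x, j := x]) = 0" if "x : TS p" for x
 proof (rule alt_form_alt[OF a, of _ i j])
  show "set (vs[i := x, j := x]) <= TS p"
   using sub[OF that, of i] that set_update_subset_insert[of "vs[i := x]" j x] by blast
 qed (use v ij in auto)
 have e1: "\<phi> (vs[i := ?s, j := x]) = \<phi> (vs[i := vs ! i, j := x]) + \<phi> (vs[i := vs ! j, j := x])" if "x : TS p" for x
 proof -
  have "vs[j := x, i := y] = vs[i := y, j := x]" for y using ij(3) by (simp add: list_update_swap)
  then show ?thesis using alt_form_slot[OF a _ sub[OF that] ij(1) t, of j 1] v by (simp del: list_update_id)
 qed
 have "0 = \<phi> (vs[i := ?s, j := ?s])" using z[OF s] by simp
 also have "... = \<phi> (vs[i := ?s, j := vs ! i]) + \<phi> (vs[i := ?s, j := vs ! j])"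
  using alt_form_slot[OF a _ sub[OF s] ij(2) t, of i 1] v by simp
 also have "... = \<phi> (vs[i := vs ! j, j := vs ! i]) + \<phi> vs"
  unfolding e1[OF t(1)] e1[OF t(2)] using z[OF t(1)] z[OF t(2)] by simp
 finally show ?thesis using permute_list_transpose[of i vs j] ij v by simp
qed

section \<open>Wedge products\<close>

lemma set_perm_nth: "sg permutes {..<length vs} ==> i < length vs ==> sg i < length vs"
 using permutes_in_image[of sg "{..<length vs}" i] by simp

lemma wedge_two:
 assumes a: "ALL us. length us ~= 2 --> al p us = 0"
 shows "wedge al \<gamma> p vs = (if length vs \<ge> 2 then 1 / (2 * fact (length vs - 2)) *
   (\<Sum>sg | sg permutes {..<length vs}. of_int (sign sg) *
    al p (take 2 (permute_list sg vs)) * \<gamma> p (drop 2 (permute_list sg vs))) else 0)"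
proof -
 let ?t = "%k. 1 / (fact k * fact (length vs - k)) *
   (\<Sum>sg | sg permutes {..<length vs}. of_int (sign sg) *
    al p (take k (permute_list sg vs)) * \<gamma> p (drop k (permute_list sg vs)))"
 have "?t k = 0" if "k \<le> length vs" "k ~= 2" for k
 proof -
  have "al p (take k (permute_list sg vs)) = 0" for sg
   using a[rule_format, of "take k (permute_list sg vs)"] that by simp
  then show ?thesis by simp
 qed
 then have "wedge al \<gamma> p vs = (\<Sum>k\<le>length vs. if k = 2 then ?t 2 else 0)"
  unfolding wedge_def by (intro sum.cong refl) auto
 then show ?thesis by (simp add: fact_2)
qed

text \<open>
 Linearity holds summand by summand. For equal arguments, a permutation and its composition with
 their exchange contribute with opposite signs.
\<close>
lemma alt_form_wedge:
 assumes a: "alt_form p 2 (al p)" and c: "alt_form p m (\<gamma> p)"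
 shows "alt_form p (m + 2) (wedge al \<gamma> p)"
proof (rule alt_formI)
 have a2: "ALL us. length us ~= 2 --> al p us = 0" using alt_form_zero[OF a] by blast
 note W = wedge_two[where al=al and p=p and \<gamma>=\<gamma>, OF a2]
 let ?f = "%sg vs. of_int (sign sg) * al p (take 2 (permute_list sg vs)) * \<gamma> p (drop 2 (permute_list sg vs))"
 fix vs
 {
  assume n: "~ (length vs = m + 2 & set vs <= TS p)"
  show "wedge al \<gamma> p vs = 0"
  proof (cases "length vs \<ge> 2")
   case True
   have "?f sg vs = 0" if s: "sg permutes {..<length vs}" for sg
   proof (cases "length vs = m + 2")
    case False
    then have "length (drop 2 (permute_list sg vs)) ~= m" using True by simp
    then have "\<gamma> p (drop 2 (permute_list sg vs)) = 0" using alt_form_zero[OF c] by blast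
    then show ?thesis by simp
   next
    case l: True
    then have "~ set (take 2 (permute_list sg vs) @ drop 2 (permute_list sg vs)) <= TS p"
     using n s by simp
    then consider "~ set (take 2 (permute_list sg vs)) <= TS p" | "~ set (drop 2 (permute_list sg vs)) <= TS p"
     unfolding set_append by blast
    then show ?thesis using alt_form_zero[OF a] alt_form_zero[OF c] by cases auto
   qed
   then have "(\<Sum>sg | sg permutes {..<length vs}. ?f sg vs) = 0" by (intro sum.neutral ballI) blast
   then show ?thesis unfolding W by simp
  qed (simp add: W)
 }
 {
  fix i u w r assume l: "length vs = m + 2" and v: "set vs <= TS p" and i: "i < m + 2" and u: "u : TS p" "w : TS p"
  have "?f sg (vs[i := (%f. r * u f + w f)]) = r * ?f sg (vs[i := u]) + ?f sg (vs[i := w])"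
   if s: "sg permutes {..<length vs}" for sg
  proof -
   define j where "j = inv sg i"
   have ij: "sg j = i" using s by (simp add: j_def permutes_inverses)
   have j: "j < m + 2" using permutes_in_image[OF s, of j] ij i l by simp
   define us where "us = permute_list sg vs"
   have us: "length us = m + 2" "set us <= TS p" using l v s by (simp_all add: us_def)
   have up: "permute_list sg (vs[i := x]) = us[j := x]" for x
   proof (rule nth_equalityI)
    fix k assume k: "k < length (permute_list sg (vs[i := x]))"
    have "sg k = i \<longleftrightarrow> k = j" using ij s by (metis permutes_inverses(2))
    then show "permute_list sg (vs[i := x]) ! k = us[j := x] ! k"
     using k s l set_perm_nth[OF s, of k] by (auto simp: us_def permute_list_nth nth_list_update)
   qed (simp add: us_def)
   have sub: "set (take 2 us) <= TS p" "set (drop 2 us) <= TS p" using order_trans[OF set_take_subset us(2)] order_trans[OF set_drop_subset us(2)] by simp_all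
   show ?thesis
   proof (cases "j < 2")
    case True
    have t: "take 2 (us[j := x]) = (take 2 us)[j := x]" "drop 2 (us[j := x]) = drop 2 us" for x
     using True by (simp_all add: take_update_swap)
    have "al p ((take 2 us)[j := (%f. r * u f + w f)]) = r * al p ((take 2 us)[j := u]) + al p ((take 2 us)[j := w])"
     by (rule alt_form_slot[OF a _ sub(1) True u]) (use us in simp)
    then show ?thesis unfolding up t by (simp add: algebra_simps)
   next
    case False
    have t: "take 2 (us[j := x]) = take 2 us" "drop 2 (us[j := x]) = (drop 2 us)[j - 2 := x]" for x
     using False by (simp_all add: drop_update_swap)
    have "\<gamma> p ((drop 2 us)[j - 2 := (%f. r * u f + w f)]) = r * \<gamma> p ((drop 2 us)[j - 2 := u]) + \<gamma> p ((drop 2 us)[j - 2 := w])"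
     by (rule alt_form_slot[OF c _ sub(2) _ u]) (use us j False in simp_all)
    then show ?thesis unfolding up t by (simp add: algebra_simps)
   qed
  qed
  then have "(\<Sum>sg | sg permutes {..<length vs}. ?f sg (vs[i := (%f. r * u f + w f)])) =
    r * (\<Sum>sg | sg permutes {..<length vs}. ?f sg (vs[i := u])) + (\<Sum>sg | sg permutes {..<length vs}. ?f sg (vs[i := w]))"
   by (simp add: sum.distrib sum_distrib_left)
  then show "wedge al \<gamma> p (vs[i := (%f. r * u f + w f)]) = r * wedge al \<gamma> p (vs[i := u]) + wedge al \<gamma> p (vs[i := w])"
   unfolding W using l by (simp add: algebra_simps)
 }
 {
  fix i j assume l: "length vs = m + 2" and v: "set vs <= TS p" and ij: "i < m + 2" "j < m + 2" "i ~= j" "vs ! i = vs ! j"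
  let ?\<tau> = "Transposition.transpose i j"
  have t: "?\<tau> permutes {..<length vs}" using ij l by (intro swap_permutes) auto
  have fix_vs: "permute_list ?\<tau> vs = vs"
   unfolding permute_list_transpose[of i vs j, OF ij(1)[folded l] ij(2)[folded l] ij(3)] using ij(4)
   by (metis list_update_id)
  have "(\<Sum>sg | sg permutes {..<length vs}. ?f sg vs) = (\<Sum>sg | sg permutes {..<length vs}. ?f (?\<tau> \<circ> sg) vs)"
   by (rule setum_permutations_compose_left[OF t])
  also have "... = (\<Sum>sg | sg permutes {..<length vs}. - ?f sg vs)"
  proof (rule sum.cong[OF refl])
   fix sg assume "sg : {sg. sg permutes {..<length vs}}"
   then have s: "sg permutes {..<length vs}" by simp
   have "permutation sg" using s by (rule permutes_imp_permutation[rotated]) simp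
   then have "sign (?\<tau> \<circ> sg) = - sign sg"
    using ij by (simp add: sign_compose permutation_swap_id sign_swap_id)
   moreover have "permute_list (?\<tau> \<circ> sg) vs = permute_list sg vs"
    using permute_list_compose[OF s, of ?\<tau>] fix_vs by simp
   ultimately show "?f (?\<tau> \<circ> sg) vs = - ?f sg vs" by simp
  qed
  also have "... = - (\<Sum>sg | sg permutes {..<length vs}. ?f sg vs)" by (simp add: sum_negf)
  finally have "(\<Sum>sg | sg permutes {..<length vs}. ?f sg vs) = 0" by simp
  then show "wedge al \<gamma> p vs = 0" unfolding W by simp
 }
qed

lemma alt_form_power: assumes w: "alt_form p 2 (\<omega> p)" shows "alt_form p (2 * k) (form_power \<omega> k p)"
proof (induction k)
 case 0
 show ?case by (rule alt_formI) (auto simp: fun_form_def)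
next
 case (Suc k)
 then show ?case using alt_form_wedge[where al=\<omega> and \<gamma>="form_power \<omega> k", OF w Suc] by simp
qed

text \<open>
 A power of a 2-form is a polynomial in the entries of the Gram matrix. The two lists may be tangent
 at different points: a power of \<open>\<omega>\<close> is therefore constant on adapted frames.
\<close>
lemma form_power_gram:
 assumes w: "alt_form p 2 (\<omega> p)" "alt_form q 2 (\<omega> q)" and l: "length us = length vs"
  and gr: "!!i j. i < length us ==> j < length us ==> \<omega> p [us ! i, us ! j] = \<omega> q [vs ! i, vs ! j]"
 shows "form_power \<omega> k p us = form_power \<omega> k q vs"
 using l gr
proof (induction k arbitrary: us vs)
 case 0
 then show ?case by (auto simp: fun_form_def)
next
 case (Suc k)
 have w2: "ALL xs. length xs ~= 2 --> \<omega> p xs = 0" "ALL xs. length xs ~= 2 --> \<omega> q xs = 0"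
  using alt_form_zero[OF w(1)] alt_form_zero[OF w(2)] by blast+
 show ?case
 proof (cases "length us \<ge> 2")
  case True
  note tk = take_two
  have "\<omega> p (take 2 (permute_list sg us)) = \<omega> q (take 2 (permute_list sg vs)) &
    form_power \<omega> k p (drop 2 (permute_list sg us)) = form_power \<omega> k q (drop 2 (permute_list sg vs))"
   if s: "sg permutes {..<length us}" for sg
  proof
   have s': "sg permutes {..<length vs}" using s Suc(2) by simp
   have gr': "\<omega> p [permute_list sg us ! i, permute_list sg us ! j] = \<omega> q [permute_list sg vs ! i, permute_list sg vs ! j]"
    if "i < length us" "j < length us" for i j
    using that Suc(2,3) set_perm_nth[OF s] by (simp add: permute_list_nth[OF s] permute_list_nth[OF s'])
   show "\<omega> p (take 2 (permute_list sg us)) = \<omega> q (take 2 (permute_list sg vs))"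
   proof -
    have "0 < length us" "1 < length us" using True by linarith+
    from gr'[OF this] show ?thesis using True Suc(2) by (simp add: tk)
   qed
   show "form_power \<omega> k p (drop 2 (permute_list sg us)) = form_power \<omega> k q (drop 2 (permute_list sg vs))"
    by (rule Suc.IH) (use Suc(2) gr' in auto)
  qed
  then show ?thesis unfolding form_power.simps wedge_two[where al=\<omega> and p=p, OF w2(1)] wedge_two[where al=\<omega> and p=q, OF w2(2)] Suc(2) by simp
 next
  case False
  then show ?thesis unfolding form_power.simps wedge_two[where al=\<omega> and p=p, OF w2(1)] wedge_two[where al=\<omega> and p=q, OF w2(2)] using Suc(2) by simp
 qed
qed

text \<open>In every summand the argument \<open>u\<close> is paired with some other argument.\<close>
lemma form_power_isolated:
 assumes w: "alt_form p 2 (\<omega> p)" and u: "u : set us" and o: "!!x. x : set us ==> \<omega> p [u, x] = 0 & \<omega> p [x, u] = 0"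
 shows "form_power \<omega> k p us = 0"
 using u o
proof (induction k arbitrary: us)
 case 0
 then show ?case by (auto simp: fun_form_def)
next
 case (Suc k)
 have w2: "ALL xs. length xs ~= 2 --> \<omega> p xs = 0" using alt_form_zero[OF w] by blast
 have "\<omega> p (take 2 (permute_list sg us)) = 0 \<or> form_power \<omega> k p (drop 2 (permute_list sg us)) = 0"
  if s: "sg permutes {..<length us}" and l: "length us \<ge> 2" for sg
 proof -
  have st: "set (permute_list sg us) = set us" using s by simp
  have "u : set (take 2 (permute_list sg us) @ drop 2 (permute_list sg us))" using Suc(2) st by simp
  then consider "u : set (take 2 (permute_list sg us))" | "u : set (drop 2 (permute_list sg us))"
   unfolding set_append by blast
  then show ?thesis
  proof cases
   case 1
   obtain x y where xy: "take 2 (permute_list sg us) = [x, y]"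
    using take_two[of "permute_list sg us"] l by auto
   have "set [x, y] <= set us" using xy st set_take_subset[of 2 "permute_list sg us"] by auto
   then show ?thesis using 1 xy Suc(3) by auto
  next
   case 2
   have "form_power \<omega> k p (drop 2 (permute_list sg us)) = 0"
   proof (rule Suc.IH[OF 2])
    fix x assume "x : set (drop 2 (permute_list sg us))"
    then have "x : set us" using st set_drop_subset[of 2 "permute_list sg us"] by auto
    then show "\<omega> p [u, x] = 0 & \<omega> p [x, u] = 0" by (rule Suc(3))
   qed
   then show ?thesis ..
  qed
 qed
 then show ?case unfolding form_power.simps wedge_two[where al=\<omega> and p=p, OF w2] by (auto intro!: sum.neutral)
qed

text \<open>The standard symplectic matrix, for a basis ordered in pairs.\<close>
definition J0 :: "nat => nat => real" where
 "J0 i j = (if even i & j = Suc i then 1 else if even j & i = Suc j then -1 else 0)"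

lemma J0_zero_iff: "J0 i j = 0 \<longleftrightarrow> ~ (even i & j = Suc i) & ~ (even j & i = Suc j)"
 by (simp add: J0_def)

definition symp_basis :: "'m form => 'm => nat => 'm tvec list => bool" where
 "symp_basis \<omega> p k es \<longleftrightarrow> length es = 2 * k & set es <= TS p &
   (ALL i<2*k. ALL j<2*k. \<omega> p [es ! i, es ! j] = J0 i j)"

text \<open>
 The part of a wedge product with a 2-form in which this 2-form receives the arguments
 \<open>i\<close> and \<open>j\<close>, without its value on them.
\<close>
definition minor_sum :: "('m tvec list => real) => 'm tvec list => nat => nat => real" where
 "minor_sum \<gamma> es i j = (\<Sum>sg | sg permutes {..<length es} & sg 0 = i & sg 1 = j.
   of_int (sign sg) * \<gamma> (drop 2 (permute_list sg es)))"

lemma wedge_minor_sum: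
 assumes a: "ALL us. length us ~= 2 --> \<beta> p us = 0" and l: "length es = m + 2"
 shows "wedge \<beta> \<gamma> p es = 1 / (2 * fact m) *
  (\<Sum>i<m+2. \<Sum>j<m+2. \<beta> p [es ! i, es ! j] * minor_sum (\<gamma> p) es i j)"
proof -
 let ?P = "{sg. sg permutes {..<length es}}"
 have fP: "finite ?P" by (rule finite_permutations) simp
 note tk = take_two
 define f where "f sg = of_int (sign sg) * \<gamma> p (drop 2 (permute_list sg es))" for sg
 have "(\<Sum>sg\<in>?P. of_int (sign sg) * \<beta> p (take 2 (permute_list sg es)) * \<gamma> p (drop 2 (permute_list sg es)))
   = (\<Sum>sg\<in>?P. \<Sum>i<m+2. \<Sum>j<m+2. if sg 0 = i & sg 1 = j then \<beta> p [es ! i, es ! j] * f sg else 0)"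
 proof (rule sum.cong[OF refl])
  fix sg assume "sg : ?P"
  then have s: "sg permutes {..<length es}" by simp
  have b: "sg 0 < m + 2" "sg 1 < m + 2" using set_perm_nth[OF s, of 0] set_perm_nth[OF s, of 1] l by auto
  have "(\<Sum>i<m+2. \<Sum>j<m+2. if sg 0 = i & sg 1 = j then \<beta> p [es ! i, es ! j] * f sg else 0)
    = (\<Sum>i<m+2. if sg 0 = i then (\<Sum>j<m+2. if sg 1 = j then \<beta> p [es ! i, es ! j] * f sg else 0) else 0)"
   by (intro sum.cong refl) auto
  also have "... = \<beta> p [es ! sg 0, es ! sg 1] * f sg" using b by simp
  finally show "of_int (sign sg) * \<beta> p (take 2 (permute_list sg es)) * \<gamma> p (drop 2 (permute_list sg es)) =
    (\<Sum>i<m+2. \<Sum>j<m+2. if sg 0 = i & sg 1 = j then \<beta> p [es ! i, es ! j] * f sg else 0)"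
   using l s by (simp add: tk permute_list_nth f_def)
 qed
 also have "... = (\<Sum>i<m+2. \<Sum>sg\<in>?P. \<Sum>j<m+2. if sg 0 = i & sg 1 = j then \<beta> p [es ! i, es ! j] * f sg else 0)"
  by (rule sum.swap)
 also have "... = (\<Sum>i<m+2. \<Sum>j<m+2. \<Sum>sg\<in>?P. if sg 0 = i & sg 1 = j then \<beta> p [es ! i, es ! j] * f sg else 0)"
  by (intro sum.cong refl sum.swap)
 also have "... = (\<Sum>i<m+2. \<Sum>j<m+2. \<beta> p [es ! i, es ! j] * minor_sum (\<gamma> p) es i j)"
 proof (intro sum.cong refl)
  fix i j
  have "(\<Sum>sg\<in>?P. if sg 0 = i & sg 1 = j then \<beta> p [es ! i, es ! j] * f sg else 0) =
    (\<Sum>sg\<in>{sg\<in>?P. sg 0 = i & sg 1 = j}. \<beta> p [es ! i, es ! j] * f sg)"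
   by (rule sum.inter_filter[OF fP, symmetric])
  also have "{sg\<in>?P. sg 0 = i & sg 1 = j} = {sg. sg permutes {..<length es} & sg 0 = i & sg 1 = j}" by auto
  finally show "(\<Sum>sg\<in>?P. if sg 0 = i & sg 1 = j then \<beta> p [es ! i, es ! j] * f sg else 0) =
    \<beta> p [es ! i, es ! j] * minor_sum (\<gamma> p) es i j"
   unfolding minor_sum_def sum_distrib_left f_def[symmetric] .
 qed
 finally show ?thesis
  unfolding wedge_two[where al=\<beta> and p=p and \<gamma>=\<gamma>, OF a] using l by simp
qed

lemma minor_sum_swap: assumes l: "length es \<ge> 2" shows "minor_sum \<gamma> es j i = - minor_sum \<gamma> es i j"
proof -
 let ?\<tau> = "Transposition.transpose 0 1 :: nat => nat"
 let ?S = "%i j. {sg. sg permutes {..<length es} & sg 0 = i & sg 1 = j}"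
 let ?f = "%sg. of_int (sign sg) * \<gamma> (drop 2 (permute_list sg es))"
 have t: "?\<tau> permutes {..<length es}" using l by (intro swap_permutes) auto
 have inv: "(sg \<circ> ?\<tau>) \<circ> ?\<tau> = sg" for sg :: "nat => nat" by (simp add: fun_eq_iff)
 have "sum ?f (?S j i) = (\<Sum>sg\<in>?S i j. ?f (sg \<circ> ?\<tau>))"
  by (rule sum.reindex_bij_witness[of _ "%sg. sg \<circ> ?\<tau>" "%sg. sg \<circ> ?\<tau>"])
   (use inv t permutes_compose[OF t] in \<open>auto simp: o_assoc[symmetric]\<close>)
 also have "... = (\<Sum>sg\<in>?S i j. - ?f sg)"
 proof (rule sum.cong[OF refl])
  fix sg assume "sg : ?S i j"
  then have s: "sg permutes {..<length es}" by simp
  have "permutation sg" using s by (rule permutes_imp_permutation[rotated]) simp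
  then have 1: "sign (sg \<circ> ?\<tau>) = - sign sg" by (simp add: sign_compose permutation_swap_id sign_swap_id)
  have "drop 2 (permute_list ?\<tau> xs) = drop 2 xs" if "length xs \<ge> 2" for xs :: "'m tvec list"
   using that by (subst permute_list_transpose) auto
  then have "drop 2 (permute_list (sg \<circ> ?\<tau>) es) = drop 2 (permute_list sg es)"
   unfolding permute_list_compose[OF t] using l by simp
  then show "?f (sg \<circ> ?\<tau>) = - ?f sg" using 1 by simp
 qed
 also have "... = - sum ?f (?S i j)" by (simp add: sum_negf)
 finally show ?thesis unfolding minor_sum_def .
qed

lemma minor_sum_01:
 assumes g: "alt_form p m \<gamma>" and l: "length es = m + 2" and s: "set es <= TS p"
 shows "minor_sum \<gamma> es 0 1 = real (card {sg. sg permutes {..<length es} & sg 0 = 0 & sg 1 = 1}) * \<gamma> (drop 2 es)"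
proof -
 have "of_int (sign sg) * \<gamma> (drop 2 (permute_list sg es)) = \<gamma> (drop 2 es)"
  if sg: "sg permutes {..<length es}" "sg 0 = 0" "sg 1 = 1" for sg
 proof -
  have pB: "sg permutes {2..<m+2}"
   by (rule permutes_superset[OF sg(1)]) (use sg l in \<open>auto simp: less_2_cases_iff not_le\<close>)
  have "\<gamma> (drop 2 (permute_list sg es)) = of_int (sign sg) * \<gamma> (drop 2 es)"
  proof (rule sign_from_transpositions[where \<phi>="%xs. \<gamma> (drop 2 xs)" and B="{2..<m+2}" and n="m+2" and S="TS p", OF _ _ pB l s])
   fix ys i j assume y: "length ys = m + 2" "set ys <= TS p" "i : {2..<m+2}" "j : {2..<m+2}" "i ~= j"
   have "drop 2 (permute_list (Transposition.transpose i j) ys) = permute_list (Transposition.transpose (i - 2) (j - 2)) (drop 2 ys)"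
   proof -
    have "2 + (i - 2) = i" "2 + (j - 2) = j" using y by auto
    then show ?thesis
     using y by (subst (1 2) permute_list_transpose) (auto simp only: drop_update_swap nth_drop
       length_drop atLeastLessThan_iff)
   qed
   then show "\<gamma> (drop 2 (permute_list (Transposition.transpose i j) ys)) = - \<gamma> (drop 2 ys)"
    using alt_form_swap[OF g, of "drop 2 ys" "i - 2" "j - 2"] y set_drop_subset[of 2 ys] by auto
  qed auto
  moreover have "of_int (sign sg) * (of_int (sign sg) :: real) = 1" by (simp add: sign_def)
  ultimately show ?thesis by (simp add: mult.assoc[symmetric])
 qed
 then show ?thesis unfolding minor_sum_def by simp
qed

lemma sum_pairs: "(\<Sum>i<2*(k::nat). h i) = (\<Sum>r<k. h (2*r) + h (2*r+1) :: real)"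
 by (induction k) (simp_all add: algebra_simps)

lemma J0_shift: "J0 (i + 2) (j + 2) = J0 i j"
 by (simp add: J0_def)

lemma symp_basis_drop: assumes b: "symp_basis \<omega> p (Suc k) es" shows "symp_basis \<omega> p k (drop 2 es)"
 using b J0_shift set_drop_subset[of 2 es] unfolding symp_basis_def by (auto simp: add.commute)

text \<open>
 Unless \<open>i\<close> and \<open>j\<close> are symplectically paired, the partner of
 \<open>i\<close> remains among the other arguments, and it is symplectically orthogonal to all of
 them.
\<close>
lemma minor_sum_off_pair:
 assumes w: "alt_form p 2 (\<omega> p)" and b: "symp_basis \<omega> p k es" and ij: "i < 2 * k" "j < 2 * k" and z: "J0 i j = 0"
 shows "minor_sum (form_power \<omega> m p) es i j = 0"
 unfolding minor_sum_def
proof (rule sum.neutral, rule ballI)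
 fix sg assume "sg : {sg. sg permutes {..<length es} & sg 0 = i & sg 1 = j}"
 then have s: "sg permutes {..<length es}" "sg 0 = i" "sg 1 = j" by auto
 have l: "length es = 2 * k" using b by (simp add: symp_basis_def)
 \<comment> \<open>the symplectic partner of \<open>i\<close>\<close>
 define i' where "i' = (if even i then Suc i else i - 1)"
 have i': "i' < 2 * k" "i' ~= i" "i' ~= j" "!!x. x ~= i ==> J0 i' x = 0 & J0 x i' = 0"
  unfolding J0_zero_iff using ij z[unfolded J0_zero_iff] i'_def by (cases "even i"; simp; presburger)+
 define a where "a = inv sg i'"
 have a: "sg a = i'" using s by (simp add: a_def permutes_inverses)
 have al: "a < 2 * k" using permutes_in_image[OF s(1), of a] a i' l by simp
 have a2: "a \<ge> 2" using a s i' by (metis One_nat_def Suc_1 less_Suc0 less_SucE not_le)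
 let ?us = "drop 2 (permute_list sg es)"
 have el: "EX x. x < 2 * k & x ~= i & y = es ! x" if y: "y : set ?us" for y
 proof -
  obtain c where c: "c < length ?us" "y = ?us ! c" using y by (metis in_set_conv_nth)
  then have "y = es ! sg (2 + c)" using s l by (simp add: permute_list_nth)
  moreover have "sg (2 + c) ~= i" using s permutes_inj[OF s(1)] by (metis add_2_eq_Suc injD old.nat.distinct(1))
  moreover have "sg (2 + c) < 2 * k" using set_perm_nth[OF s(1), of "2 + c"] c l by simp
  ultimately show ?thesis by blast
 qed
 have "2 + (a - 2) = a" using a2 by simp
 then have "es ! i' = ?us ! (a - 2)" using a al l s by (simp only: nth_drop length_permute_list permute_list_nth)
 then have mem: "es ! i' : set ?us" using a2 al l by (auto simp: in_set_conv_nth intro!: exI[of _ "a - 2"])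
 have "form_power \<omega> m p ?us = 0"
 proof (rule form_power_isolated[where \<omega>=\<omega> and p=p, OF w mem])
  fix y assume "y : set ?us"
  then obtain x where "x < 2 * k" "x ~= i" "y = es ! x" using el by blast
  then show "\<omega> p [es ! i', y] = 0 & \<omega> p [y, es ! i'] = 0"
   using b i' unfolding symp_basis_def by simp
 qed
 then show "of_int (sign sg) * form_power \<omega> m p ?us = 0" by simp
qed

text \<open>Exchanging two pairs is an even permutation that keeps the Gram matrix.\<close>
lemma minor_sum_pair:
 assumes w: "alt_form p 2 (\<omega> p)" and b: "symp_basis \<omega> p k es" and r: "r < k"
 shows "minor_sum (form_power \<omega> m p) es (2 * r) (2 * r + 1) = minor_sum (form_power \<omega> m p) es 0 1"
proof (cases "r = 0")
 case False
 let ?\<rho> = "Transposition.transpose 0 (2 * r) \<circ> Transposition.transpose 1 (2 * r + 1)"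
 let ?S = "%i j. {sg. sg permutes {..<length es} & sg 0 = i & sg 1 = j}"
 let ?f = "%sg. of_int (sign sg) * form_power \<omega> m p (drop 2 (permute_list sg es))"
 have l: "length es = 2 * k" and ses: "set es <= TS p" using b by (simp_all add: symp_basis_def)
 have t: "?\<rho> permutes {..<length es}"
  using r l by (intro permutes_compose swap_permutes) auto
 have idem: "?\<rho> (?\<rho> x) = x" for x using False by (auto simp: Transposition.transpose_def)
 have r0: "?\<rho> 0 = 2 * r" "?\<rho> 1 = 2 * r + 1" "?\<rho> (2 * r) = 0" "?\<rho> (2 * r + 1) = 1"
  using False by (auto simp: Transposition.transpose_def)
 have ev: "even (?\<rho> x) \<longleftrightarrow> even x" for x
  by (auto simp: Transposition.transpose_def)
 have sc: "?\<rho> (Suc x) = Suc (?\<rho> x)" if "even x" for x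
  using that False by (auto simp: Transposition.transpose_def)
 have inj: "?\<rho> x = ?\<rho> y \<longleftrightarrow> x = y" for x y using idem by metis
 have J: "J0 (?\<rho> x) (?\<rho> y) = J0 x y" for x y
  unfolding J0_def ev using sc[of x] sc[of y] inj[of y "Suc x"] inj[of x "Suc y"] by (auto simp del: comp_apply)
 have "sum ?f (?S (2 * r) (2 * r + 1)) = (\<Sum>sg\<in>?S 0 1. ?f (?\<rho> \<circ> sg))"
 proof (rule sum.reindex_bij_witness[of _ "%sg. ?\<rho> \<circ> sg" "%sg. ?\<rho> \<circ> sg"])
  show "?\<rho> \<circ> (?\<rho> \<circ> a) = a" for a using idem by (simp add: fun_eq_iff)
  show "?\<rho> \<circ> (?\<rho> \<circ> a) = a" for a using idem by (simp add: fun_eq_iff)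
  show "?f (?\<rho> \<circ> (?\<rho> \<circ> a)) = ?f a" for a
  proof -
   have "?\<rho> \<circ> (?\<rho> \<circ> a) = a" using idem by (simp add: fun_eq_iff)
   then show ?thesis by (simp only:)
  qed
  show "?\<rho> \<circ> a : ?S 0 1" if "a : ?S (2 * r) (2 * r + 1)" for a
   using that permutes_compose[OF _ t] r0 by auto
  show "?\<rho> \<circ> a : ?S (2 * r) (2 * r + 1)" if "a : ?S 0 1" for a
   using that permutes_compose[OF _ t] r0 by auto
 qed
 also have "... = (\<Sum>sg\<in>?S 0 1. ?f sg)"
 proof (rule sum.cong[OF refl])
  fix sg assume "sg : ?S 0 1"
  then have s: "sg permutes {..<length es}" by simp
  have ps: "permutation sg" using s by (rule permutes_imp_permutation[rotated]) simp
  have "sign ?\<rho> = 1" using False by (simp add: sign_compose permutation_swap_id sign_swap_id)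
  moreover have "permutation ?\<rho>" by (intro permutation_compose permutation_swap_id)
  ultimately have 1: "sign (?\<rho> \<circ> sg) = sign sg" using ps sign_compose[of ?\<rho> sg] by simp
  have s': "?\<rho> \<circ> sg permutes {..<length es}" by (rule permutes_compose[OF s t])
  have "form_power \<omega> m p (drop 2 (permute_list (?\<rho> \<circ> sg) es)) = form_power \<omega> m p (drop 2 (permute_list sg es))"
  proof (rule form_power_gram[where \<omega>=\<omega> and p=p and q=p, OF w w])
   fix i j assume "i < length (drop 2 (permute_list (?\<rho> \<circ> sg) es))" "j < length (drop 2 (permute_list (?\<rho> \<circ> sg) es))"
   then have ij: "i + 2 < length es" "j + 2 < length es" by auto
   have lt: "sg (i + 2) < 2 * k" "sg (j + 2) < 2 * k" "?\<rho> (sg (i + 2)) < 2 * k" "?\<rho> (sg (j + 2)) < 2 * k"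
    using set_perm_nth[OF s ij(1)] set_perm_nth[OF s ij(2)] set_perm_nth[OF s' ij(1)] set_perm_nth[OF s' ij(2)] l by auto
   have n: "drop 2 (permute_list \<tau> es) ! x = es ! \<tau> (x + 2)" if "\<tau> permutes {..<length es}" "x + 2 < length es" for \<tau> x
    using that by (simp add: permute_list_nth add.commute)
   show "\<omega> p [drop 2 (permute_list (?\<rho> \<circ> sg) es) ! i, drop 2 (permute_list (?\<rho> \<circ> sg) es) ! j] =
     \<omega> p [drop 2 (permute_list sg es) ! i, drop 2 (permute_list sg es) ! j]"
    unfolding n[OF s ij(1)] n[OF s ij(2)] n[OF s' ij(1)] n[OF s' ij(2)]
    using b lt J[of "sg (i + 2)" "sg (j + 2)"] unfolding symp_basis_def o_def by simp
  qed simp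
  then show "?f (?\<rho> \<circ> sg) = ?f sg" using 1 by simp
 qed
 finally show ?thesis unfolding minor_sum_def .
qed simp

lemma wedge_power_basis:
 assumes w: "alt_form p 2 (\<omega> p)" and b: "symp_basis \<omega> p (Suc k) es" and beta: "alt_form p 2 (\<beta> p)"
 shows "wedge \<beta> (form_power \<omega> k) p es =
  minor_sum (form_power \<omega> k p) es 0 1 / fact (2 * k) * (\<Sum>r<Suc k. \<beta> p [es ! (2 * r), es ! (2 * r + 1)])"
proof -
 have l: "length es = 2 * k + 2" and ses: "set es <= TS p" using b by (simp_all add: symp_basis_def)
 let ?M = "minor_sum (form_power \<omega> k p) es"
 have b2: "ALL xs. length xs ~= 2 --> \<beta> p xs = 0" using alt_form_zero[OF beta] by blast
 have sk: "\<beta> p [v, u] = - \<beta> p [u, v]" if "u : TS p" "v : TS p" for u v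
  using alt_form_swap[OF beta, of "[u, v]" 0 1] that by (simp add: permute_list_transpose)
 have t: "es ! i : TS p" if "i < 2 * Suc k" for i using ses l that by (auto simp: subset_iff)
 have off: "?M i j = 0" if "i < 2 * Suc k" "j < 2 * Suc k" "J0 i j = 0" for i j
  by (rule minor_sum_off_pair[OF w b that])
 have pr: "?M (2 * r) (2 * r + 1) = ?M 0 1" if "r < Suc k" for r by (rule minor_sum_pair[OF w b that])
 have pr': "?M (2 * r + 1) (2 * r) = - ?M 0 1" if "r < Suc k" for r
  using minor_sum_swap[of es "form_power \<omega> k p" "2 * r + 1" "2 * r"] l pr[OF that] by simp
 have row: "(\<Sum>j<2*Suc k. \<beta> p [es ! (2*r), es ! j] * ?M (2*r) j) = \<beta> p [es ! (2 * r), es ! (2 * r + 1)] * ?M 0 1"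
  if "r < Suc k" for r
 proof -
  have "(\<Sum>j<2*Suc k. \<beta> p [es ! (2*r), es ! j] * ?M (2*r) j) =
    (\<Sum>j<2*Suc k. if j = 2*r+1 then \<beta> p [es ! (2 * r), es ! (2 * r + 1)] * ?M 0 1 else 0)"
  proof (rule sum.cong[OF refl])
   fix j assume "j : {..<2*Suc k}"
   moreover have "J0 (2*r) j = 0" if "j ~= 2*r+1" using that unfolding J0_zero_iff by presburger
   ultimately show "\<beta> p [es ! (2*r), es ! j] * ?M (2*r) j = (if j = 2*r+1 then \<beta> p [es ! (2 * r), es ! (2 * r + 1)] * ?M 0 1 else 0)"
    using off[of "2*r" j] pr[OF that] that by auto
  qed
  then show ?thesis using that by simp
 qed
 have row': "(\<Sum>j<2*Suc k. \<beta> p [es ! (2*r+1), es ! j] * ?M (2*r+1) j) = \<beta> p [es ! (2 * r), es ! (2 * r + 1)] * ?M 0 1"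
  if "r < Suc k" for r
 proof -
  have "(\<Sum>j<2*Suc k. \<beta> p [es ! (2*r+1), es ! j] * ?M (2*r+1) j) =
    (\<Sum>j<2*Suc k. if j = 2*r then \<beta> p [es ! (2 * r), es ! (2 * r + 1)] * ?M 0 1 else 0)"
  proof (rule sum.cong[OF refl])
   fix j assume "j : {..<2*Suc k}"
   moreover have "J0 (2*r+1) j = 0" if "j ~= 2*r" using that unfolding J0_zero_iff by presburger
   moreover have "\<beta> p [es ! (2*r+1), es ! (2*r)] = - \<beta> p [es ! (2 * r), es ! (2 * r + 1)]"
    by (rule sk) (use t that in auto)
   ultimately show "\<beta> p [es ! (2*r+1), es ! j] * ?M (2*r+1) j = (if j = 2*r then \<beta> p [es ! (2 * r), es ! (2 * r + 1)] * ?M 0 1 else 0)"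
    using off[of "2*r+1" j] pr'[OF that] that by auto
  qed
  then show ?thesis using that by simp
 qed
 have "(\<Sum>i<2*k+2. \<Sum>j<2*k+2. \<beta> p [es ! i, es ! j] * ?M i j)
   = (\<Sum>i<2*Suc k. \<Sum>j<2*Suc k. \<beta> p [es ! i, es ! j] * ?M i j)" by simp
 also have "... = (\<Sum>r<Suc k. (\<Sum>j<2*Suc k. \<beta> p [es ! (2*r), es ! j] * ?M (2*r) j)
   + (\<Sum>j<2*Suc k. \<beta> p [es ! (2*r+1), es ! j] * ?M (2*r+1) j))" by (rule sum_pairs)
 also have "... = (\<Sum>r<Suc k. 2 * (\<beta> p [es ! (2 * r), es ! (2 * r + 1)] * ?M 0 1))"
 proof (rule sum.cong[OF refl])
  fix r assume "r : {..<Suc k}"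
  then have r: "r < Suc k" by simp
  show "(\<Sum>j<2*Suc k. \<beta> p [es ! (2*r), es ! j] * ?M (2*r) j)
   + (\<Sum>j<2*Suc k. \<beta> p [es ! (2*r+1), es ! j] * ?M (2*r+1) j) = 2 * (\<beta> p [es ! (2 * r), es ! (2 * r + 1)] * ?M 0 1)"
   unfolding row[OF r] row'[OF r] by (rule mult_2[symmetric])
 qed
 also have "... = 2 * ?M 0 1 * (\<Sum>r<Suc k. \<beta> p [es ! (2 * r), es ! (2 * r + 1)])"
  unfolding sum_distrib_left by (rule sum.cong[OF refl]) (simp only: mult.commute mult.left_commute)
 finally show ?thesis unfolding wedge_minor_sum[where \<beta>=\<beta> and p=p, OF b2 l] by simp
qed

text \<open>
 By induction: dropping the first pair changes the value of the power only by a positive factor.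
\<close>
lemma form_power_basis_pos:
 assumes w: "alt_form p 2 (\<omega> p)" and b: "symp_basis \<omega> p k es"
 shows "form_power \<omega> k p es > 0"
 using b
proof (induction k arbitrary: es)
 case 0
 then show ?case by (simp add: symp_basis_def fun_form_def)
next
 case (Suc k)
 have l: "length es = 2 * k + 2" and ses: "set es <= TS p" using Suc(2) by (simp_all add: symp_basis_def)
 let ?S = "{sg. sg permutes {..<length es} & sg 0 = 0 & sg 1 = 1}"
 have "finite ?S" by (rule finite_subset[OF _ finite_permutations[of "{..<length es}"]]) auto
 moreover have "id : ?S" by (simp add: permutes_id)
 ultimately have "card ?S > 0" unfolding card_gt_0_iff by blast
 moreover have "form_power \<omega> k p (drop 2 es) > 0" by (rule Suc.IH[OF symp_basis_drop[OF Suc(2)]])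
 ultimately have M: "minor_sum (form_power \<omega> k p) es 0 1 > 0"
  unfolding minor_sum_01[OF alt_form_power[where \<omega>=\<omega> and k=k, OF w] l ses] by simp
 have "\<omega> p [es ! (2 * r), es ! (2 * r + 1)] = 1" if "r < Suc k" for r
  using Suc(2) that unfolding symp_basis_def J0_def by simp
 then have "(\<Sum>r<Suc k. \<omega> p [es ! (2 * r), es ! (2 * r + 1)]) = real (Suc k)" by simp
 then show ?case unfolding form_power.simps wedge_power_basis[where \<omega>=\<omega> and \<beta>=\<omega>, OF w Suc(2) w] using M by simp
qed

text \<open>
 Both sides contain the same minor sum, by \<open>wedge_power_basis\<close> for
 \<open>\<beta>\<close> and for \<open>\<omega>\<close>. This identifies the Chern scalar curvature
 as a trace.
\<close>
lemma wedge_power_trace: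
 assumes w: "alt_form p 2 (\<omega> p)" and b: "symp_basis \<omega> p (Suc k) es" and beta: "alt_form p 2 (\<beta> p)"
 shows "real (Suc k) * wedge \<beta> (form_power \<omega> k) p es =
  (\<Sum>r<Suc k. \<beta> p [es ! (2 * r), es ! (2 * r + 1)]) * form_power \<omega> (Suc k) p es"
proof -
 have "\<omega> p [es ! (2 * r), es ! (2 * r + 1)] = 1" if "r < Suc k" for r
  using b that unfolding symp_basis_def J0_def by simp
 then have "(\<Sum>r<Suc k. \<omega> p [es ! (2 * r), es ! (2 * r + 1)]) = real (Suc k)" by simp
 then show ?thesis unfolding form_power.simps wedge_power_basis[where \<omega>=\<omega> and \<beta>=\<omega>, OF w b w] wedge_power_basis[where \<omega>=\<omega> and \<beta>=\<beta>, OF w b beta] by simp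
qed

lemma alt_form_basis_zero:
 assumes a: "alt_form p n \<phi>" and te: "!!j. j < n ==> w j : TS p"
  and ex: "!!u. u : TS p ==> u = (\<Sum>j<n. (%f. \<kappa> u j * w j f))"
  and z: "\<phi> (map w [0..<n]) = 0"
 shows "\<phi> vs = 0"
proof (cases "length vs = n & set vs <= TS p")
 case False
 then show ?thesis by (rule alt_form_zero[OF a])
next
 case True
 have sub: "set (map w js) <= TS p" if "set js <= {..<n}" for js using te that by auto
 show ?thesis
 proof (rule multilinear_vanishes[where e=w and S="TS p" and n=n and c=\<kappa>])
  fix xs i assume xs: "length xs = n" "set xs <= TS p" "i < n"
  have xi: "xs ! i : TS p" using xs by (auto simp: subset_iff)
  have "\<phi> xs = \<phi> (xs[i := xs ! i])" by simp
  also have "xs ! i = (\<Sum>j<n. (%f. \<kappa> (xs ! i) j * w j f))" by (rule ex[OF xi])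
  also have "\<phi> (xs[i := ...]) = (\<Sum>j<n. \<kappa> (xs ! i) j * \<phi> (xs[i := w j]))"
   by (rule alt_form_slot_sum[OF a xs]) (use te in auto)
  finally show "\<phi> xs = (\<Sum>j<n. \<kappa> (xs ! i) j * \<phi> (xs[i := w j]))" .
 next
  fix js assume js: "length js = n" "set js <= {..<n}" "~ distinct js"
  then obtain i j where ij: "i < length js" "j < length js" "i ~= j" "js ! i = js ! j"
   by (auto simp: distinct_conv_nth)
  show "\<phi> (map w js) = 0"
   by (rule alt_form_alt[OF a _ sub[OF js(2)], of i j]) (use ij js in auto)
 next
  fix js i j assume js: "length js = n" "set js <= {..<n}" and ij: "i < n" "j < n" "i ~= j"
  have "map w (permute_list (Transposition.transpose i j) js) = permute_list (Transposition.transpose i j) (map w js)"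
   by (rule permute_list_map[symmetric]) (use ij js in \<open>auto intro: swap_permutes\<close>)
  then show "\<phi> (map w (permute_list (Transposition.transpose i j) js)) = - \<phi> (map w js)"
   using alt_form_swap[OF a _ sub[OF js(2)] ij] js by simp
 qed (use te z True in auto)
qed

end

context riem begin

lemma alt_form_top_zero:
 assumes a: "alt_form p (DIM('e)) \<phi>" and e: "frame p U e" and z: "\<phi> (map (%i. e i p) [0..<DIM('e)]) = 0"
 shows "\<phi> vs = 0"
proof (rule alt_form_basis_zero[OF a, of "%i. e i p" "%v j. g p v (e j p)"])
 show "e j p : TS p" if "j < DIM('e)" for j using frameD(3)[OF e that] VF_tangent by blast
qed (use frame_expand[OF e] z in auto)

end

section \<open>Integration on Euclidean spaces\<close>

text \<open>
 An index type with as many elements as the basis: the change of variables theorem is about tuples.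
\<close>
typedef (overloaded) ('e::euclidean_space) dim_index = "{..<DIM('e)}"
 by (rule exI[of _ 0]) simp

instance dim_index :: (euclidean_space) finite
proof
 have "(UNIV :: 'a dim_index set) = Abs_dim_index ` {..<DIM('a)}"
  by (metis Rep_dim_index Rep_dim_index_inverse UNIV_eq_I image_eqI)
 then show "finite (UNIV :: 'a dim_index set)" by (metis finite_imageI finite_lessThan)
qed

instantiation dim_index :: (euclidean_space) wellorder
begin
definition less_eq_dim_index :: "'a dim_index => 'a dim_index => bool" where
 "less_eq_dim_index i j \<longleftrightarrow> Rep_dim_index i \<le> Rep_dim_index j"
definition less_dim_index :: "'a dim_index => 'a dim_index => bool" where
 "less_dim_index i j \<longleftrightarrow> Rep_dim_index i < Rep_dim_index j"
instance
proof
 fix P :: "'a dim_index => bool" and i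
 assume step: "!!i. (!!j. j < i ==> P j) ==> P i"
 show "P i"
 proof (induction "Rep_dim_index i" arbitrary: i rule: less_induct)
  case less
  then show ?case using step unfolding less_dim_index_def by blast
 qed
qed (auto simp: less_eq_dim_index_def less_dim_index_def Rep_dim_index_inject)
end

definition basis_list :: "'e::euclidean_space list" where
 "basis_list = (SOME bs. distinct bs & set bs = Basis)"

lemma basis_list: "distinct (basis_list :: 'e::euclidean_space list)" "set (basis_list :: 'e list) = Basis"
proof -
 have "EX bs :: 'e list. distinct bs & set bs = Basis" using finite_distinct_list[OF finite_Basis] by blast
 from someI_ex[OF this] show "distinct (basis_list :: 'e list)" "set (basis_list :: 'e list) = Basis"
  unfolding basis_list_def by blast+
qed

lemma length_basis_list [simp]: "length (basis_list :: 'e::euclidean_space list) = DIM('e)"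
proof -
 have "distinct (basis_list :: 'e list)" "set (basis_list :: 'e list) = Basis" by (rule basis_list)+
 then show ?thesis by (metis distinct_card)
qed

definition bvec :: "'e::euclidean_space dim_index => 'e" where
 "bvec i = basis_list ! Rep_dim_index i"

lemma bij_Rep: "bij_betw Rep_dim_index (UNIV :: 'e::euclidean_space dim_index set) {..<DIM('e)}"
proof -
 have "range (Rep_dim_index :: 'e dim_index => nat) = {..<DIM('e)}"
  by (rule type_definition.Rep_range[OF type_definition_dim_index])
 then show ?thesis by (auto simp: bij_betw_def inj_on_def Rep_dim_index_inject)
qed

lemma bij_bvec: "bij_betw bvec (UNIV :: 'e::euclidean_space dim_index set) Basis"
proof -
 have "bij_betw (%i. basis_list ! i) {..<DIM('e)} (Basis :: 'e set)"
  by (rule bij_betw_nth) (simp_all add: basis_list)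
 from bij_betw_trans[OF bij_Rep this] show ?thesis by (simp add: bvec_def[abs_def] o_def)
qed

lemma bvec_Basis [simp]: "bvec i : Basis" using bij_bvec by (auto simp: bij_betw_def)

lemma bvec_inj: "bvec i = bvec j \<longleftrightarrow> i = j" using bij_bvec by (auto simp: bij_betw_def inj_on_def)

lemma bvec_inner: "bvec i \<bullet> bvec j = (if i = j then 1 else 0)"
 by (simp add: inner_Basis bvec_inj)

lemma sum_bvec: "(\<Sum>b\<in>Basis. h b) = (\<Sum>i\<in>UNIV. h (bvec i))"
 using sum.reindex_bij_betw[OF bij_bvec, of h] by simp

lemma prod_bvec: "(\<Prod>b\<in>Basis. h b) = (\<Prod>i\<in>UNIV. h (bvec i))"
 using prod.reindex_bij_betw[OF bij_bvec, of h] by simp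

definition from_vec :: "real ^ ('e::euclidean_space dim_index) => 'e" where
 "from_vec x = (\<Sum>i\<in>UNIV. (x $ i) *\<^sub>R bvec i)"

definition to_vec :: "'e::euclidean_space => real ^ ('e dim_index)" where
 "to_vec y = (\<chi> i. y \<bullet> bvec i)"

lemma from_vec_inner: "from_vec x \<bullet> bvec i = x $ i"
 unfolding from_vec_def inner_sum_left by (simp add: bvec_inner if_distrib cong: if_cong)

lemma to_from_vec [simp]: "to_vec (from_vec x) = x"
 by (simp add: to_vec_def from_vec_inner vec_eq_iff)

lemma from_to_vec [simp]: "from_vec (to_vec y) = y"
proof -
 have "from_vec (to_vec y) = (\<Sum>b\<in>Basis. (y \<bullet> b) *\<^sub>R b)" unfolding from_vec_def to_vec_def sum_bvec by simp
 then show ?thesis by (simp add: euclidean_representation)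
qed

lemma bounded_linear_from_vec: "bounded_linear from_vec"
 unfolding from_vec_def by (intro bounded_linear_sum bounded_linear_scaleR_const bounded_linear_vec_nth)

lemma bounded_linear_to_vec: "bounded_linear to_vec"
 by (rule linear_conv_bounded_linear[THEN iffD1]) (rule linearI; simp add: to_vec_def vec_eq_iff inner_add_left)

lemma from_vec_axis: "from_vec (axis i 1) = bvec i"
proof -
 have "from_vec (axis i 1) = (\<Sum>j\<in>UNIV. if j = i then bvec i else 0)"
  unfolding from_vec_def by (rule sum.cong) (auto simp: axis_def)
 then show ?thesis by simp
qed

lemma lborel_from_vec: "distr lborel borel (from_vec :: real ^ ('e::euclidean_space dim_index) => 'e) = lborel"
proof (rule lborel_eqI[symmetric])
 let ?T = "from_vec :: real ^ ('e dim_index) => 'e"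
 have m: "?T : borel_measurable borel"
  by (rule borel_measurable_continuous_onI) (rule linear_continuous_on[OF bounded_linear_from_vec])
 fix l u :: 'e assume lu: "!!b. b : Basis ==> l \<bullet> b \<le> u \<bullet> b"
 have v: "?T -` box l u = box (to_vec l) (to_vec u)"
 proof (intro set_eqI)
  fix x
  have "x : ?T -` box l u \<longleftrightarrow> (ALL b:Basis. l \<bullet> b < ?T x \<bullet> b & ?T x \<bullet> b < u \<bullet> b)" by (simp add: mem_box)
  also have "... \<longleftrightarrow> (ALL i. l \<bullet> bvec i < x $ i & x $ i < u \<bullet> bvec i)"
  proof -
   have "(Basis :: 'e set) = range bvec" using bij_bvec by (auto simp: bij_betw_def)
   then show ?thesis unfolding from_vec_inner[symmetric] by (metis bvec_Basis imageE)
  qed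
  also have "... \<longleftrightarrow> x : box (to_vec l) (to_vec u)" by (simp add: mem_box_cart to_vec_def)
  finally show "x : ?T -` box l u \<longleftrightarrow> x : box (to_vec l) (to_vec u)" .
 qed
 have "emeasure (distr lborel borel ?T) (box l u) = emeasure lborel (box (to_vec l) (to_vec u))"
  using m v by (subst emeasure_distr) auto
 also have "... = (\<Prod>b\<in>Basis. (to_vec u - to_vec l) \<bullet> b)"
 proof (rule emeasure_lborel_box)
  fix b :: "real ^ ('e dim_index)" assume "b : Basis"
  then obtain i where "b = axis i 1" by (auto simp: Basis_vec_def)
  then show "to_vec l \<bullet> b \<le> to_vec u \<bullet> b" using lu[OF bvec_Basis, of i] by (simp add: inner_axis to_vec_def)
 qed
 also have "(\<Prod>b\<in>Basis. (to_vec u - to_vec l) \<bullet> b) = (\<Prod>i\<in>UNIV. (to_vec u - to_vec l) $ i)"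
 proof -
  have B: "(Basis :: (real ^ 'e dim_index) set) = (%i. axis i (1::real)) ` UNIV" by (auto simp: Basis_vec_def)
  have "inj (%i :: 'e dim_index. axis i (1::real))" by (auto simp: inj_on_def axis_eq_axis)
  then show ?thesis unfolding B by (simp add: prod.reindex inner_axis)
 qed
 also have "... = (\<Prod>b\<in>Basis. (u - l) \<bullet> b)"
  unfolding prod_bvec by (simp add: to_vec_def inner_diff_left)
 finally show "emeasure (distr lborel borel ?T) (box l u) = (\<Prod>b\<in>Basis. (u - l) \<bullet> b)" .
qed simp

lemma measurable_from_vec: "from_vec : borel_measurable borel"
 by (rule borel_measurable_continuous_onI) (rule linear_continuous_on[OF bounded_linear_from_vec])

lemma integral_from_vec:
 fixes h :: "'e::euclidean_space => real"
 assumes h: "h : borel_measurable borel"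
 shows "integral\<^sup>L lborel (%x. h (from_vec x)) = integral\<^sup>L lborel h"
proof -
 have "integral\<^sup>L lborel h = integral\<^sup>L (distr lborel borel (from_vec :: _ => 'e)) h" by (simp add: lborel_from_vec)
 also have "... = integral\<^sup>L lborel (%x. h (from_vec x))"
  by (rule integral_distr) (use h measurable_from_vec in auto)
 finally show ?thesis by simp
qed

lemma integrable_from_vec:
 fixes h :: "'e::euclidean_space => real"
 assumes h: "integrable lborel h"
 shows "integrable lborel (%x. h (from_vec x))"
proof -
 have "integrable (distr lborel borel from_vec) h" using h by (simp add: lborel_from_vec)
 then show ?thesis using integrable_distr[of from_vec lborel borel h] measurable_from_vec by simp
qed

definition matrix_of :: "('e::euclidean_space => 'e) => real ^ ('e dim_index) ^ ('e dim_index)" where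
 "matrix_of L = (\<chi> i j. L (bvec i) \<bullet> bvec j)"

text \<open>
 The change of variables theorem for tuples, transported along the isometry \<open>from_vec\<close>.
\<close>
lemma change_of_variables_euclidean:
 fixes \<tau> :: "'e::euclidean_space => 'e" and h k :: "'e => real"
 assumes d: "!!y. y : S ==> (\<tau> has_derivative \<tau>' y) (at y)" and inj: "inj_on \<tau> S" and S: "open S"
  and h: "integrable lborel h" "!!y. y ~: \<tau> ` S ==> h y = 0"
  and k: "integrable lborel k" "!!y. y : S ==> k y = \<bar>det (matrix_of (\<tau>' y))\<bar> * h (\<tau> y)" "!!y. y ~: S ==> k y = 0"
 shows "integral\<^sup>L lborel k = integral\<^sup>L lborel h"
proof -
 let ?S = "to_vec ` S" and ?g = "%x. to_vec (\<tau> (from_vec x))"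
 let ?g' = "%x v. to_vec (\<tau>' (from_vec x) (from_vec v))"
 have S': "?S = from_vec -` S"
  by (auto simp: image_iff) (metis to_from_vec)
 have oS: "open ?S" unfolding S'
  by (rule open_vimage[OF S]) (rule linear_continuous_on[OF bounded_linear_from_vec])
 have gd: "(?g has_derivative ?g' x) (at x within ?S)" if "x : ?S" for x
 proof -
  have xS: "from_vec x : S" using that S' by blast
  have "(from_vec has_derivative from_vec) (at x)"
   by (rule bounded_linear_imp_has_derivative[OF bounded_linear_from_vec])
  from diff_chain_at[OF this d[OF xS]]
  have "((%x. \<tau> (from_vec x)) has_derivative (%v. \<tau>' (from_vec x) (from_vec v))) (at x)" by (simp add: o_def)
  from bounded_linear.has_derivative[OF bounded_linear_to_vec this] show ?thesis
   by (rule has_derivative_at_withinI)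
 qed
 have gi: "inj_on ?g ?S"
 proof (rule inj_onI)
  fix x y assume xy: "x : ?S" "y : ?S" "?g x = ?g y"
  then have "from_vec (?g x) = (from_vec (?g y) :: 'e)" by simp
  then have "\<tau> (from_vec x) = \<tau> (from_vec y)" by simp
  then have "(from_vec x :: 'e) = from_vec y" using inj xy S' by (auto simp: inj_on_def)
  then have "to_vec (from_vec x :: 'e) = to_vec (from_vec y :: 'e)" by simp
  then show "x = y" by simp
 qed
 have gS: "?g ` ?S = from_vec -` (\<tau> ` S)"
  by (auto simp: image_iff) (metis to_from_vec from_to_vec)
 have dm: "det (matrix (?g' x)) = det (matrix_of (\<tau>' (from_vec x)))" for x
 proof -
  have "matrix (?g' x) = Finite_Cartesian_Product.transpose (matrix_of (\<tau>' (from_vec x)))"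
   by (simp add: vec_eq_iff matrix_def Finite_Cartesian_Product.transpose_def matrix_of_def from_vec_axis to_vec_def)
  then show ?thesis by (simp add: det_transpose)
 qed
 define f :: "real ^ ('e dim_index) => real ^ ('e dim_index)" where "f x = h (from_vec x) *\<^sub>R 1" for x
 have hb: "h : borel_measurable borel" and kb: "k : borel_measurable borel" using h(1) k(1) by auto
 have hv: "integrable lebesgue (%x :: real ^ ('e dim_index). h (from_vec x))"
  using integrable_from_vec[OF h(1)] by (subst integrable_completion) auto
 have kv: "integrable lebesgue (%x :: real ^ ('e dim_index). k (from_vec x))"
  using integrable_from_vec[OF k(1)] by (subst integrable_completion) auto
 have f_set: "(%x. indicat_real (?g ` ?S) x *\<^sub>R f x) = (%x. h (from_vec x) *\<^sub>R 1)"
  unfolding gS f_def using h(2) by (auto simp: fun_eq_iff indicator_def)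
 have fi: "f absolutely_integrable_on (?g ` ?S)"
  unfolding set_integrable_def f_set by (rule integrable_scaleR_left) (use hv in simp)
 have k_set: "(%x. indicat_real ?S x *\<^sub>R (\<bar>det (matrix (?g' x))\<bar> *\<^sub>R f (?g x))) = (%x. k (from_vec x) *\<^sub>R 1)"
 proof
  fix x
  show "indicat_real ?S x *\<^sub>R (\<bar>det (matrix (?g' x))\<bar> *\<^sub>R f (?g x)) = k (from_vec x) *\<^sub>R 1"
  proof (cases "x : ?S")
   case True
   then have "from_vec x : S" using S' by blast
   then show ?thesis using True k(2) by (simp add: dm f_def)
  next
   case False
   then have "from_vec x ~: S" using S' by blast
   then show ?thesis using False k(3) by simp
  qed
 qed
 have eq: "integral ?S (%x. \<bar>det (matrix (?g' x))\<bar> *\<^sub>R f (?g x)) = integral (?g ` ?S) f"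
  and ki: "(%x. \<bar>det (matrix (?g' x))\<bar> *\<^sub>R f (?g x)) absolutely_integrable_on ?S"
  using has_absolute_integral_change_of_variables[OF _ gd gi, of f "integral (?g ` ?S) f"] fi oS
  by (auto simp: borel_open)
 have 1: "integral (?g ` ?S) f = integral\<^sup>L lborel h *\<^sub>R 1"
 proof -
  have "integral (?g ` ?S) f = integral\<^sup>L lebesgue (%x. h (from_vec x) *\<^sub>R 1)"
   using set_lebesgue_integral_eq_integral(2)[OF fi] unfolding set_lebesgue_integral_def f_set by simp
  also have "... = integral\<^sup>L lebesgue (%x. h (from_vec x)) *\<^sub>R 1" by (rule integral_scaleR_left) (use hv in simp)
  also have "integral\<^sup>L lebesgue (%x. h (from_vec x)) = integral\<^sup>L lborel (%x :: real ^ ('e dim_index). h (from_vec x))"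
   by (rule integral_completion) (use integrable_from_vec[OF h(1)] in auto)
  also have "... = integral\<^sup>L lborel h" by (rule integral_from_vec[OF hb])
  finally show ?thesis .
 qed
 have 2: "integral ?S (%x. \<bar>det (matrix (?g' x))\<bar> *\<^sub>R f (?g x)) = integral\<^sup>L lborel k *\<^sub>R 1"
 proof -
  have "integral ?S (%x. \<bar>det (matrix (?g' x))\<bar> *\<^sub>R f (?g x)) = integral\<^sup>L lebesgue (%x. k (from_vec x) *\<^sub>R 1)"
   using set_lebesgue_integral_eq_integral(2)[OF ki] unfolding set_lebesgue_integral_def k_set by simp
  also have "... = integral\<^sup>L lebesgue (%x. k (from_vec x)) *\<^sub>R 1" by (rule integral_scaleR_left) (use kv in simp)
  also have "integral\<^sup>L lebesgue (%x. k (from_vec x)) = integral\<^sup>L lborel (%x :: real ^ ('e dim_index). k (from_vec x))"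
   by (rule integral_completion) (use integrable_from_vec[OF k(1)] in auto)
  also have "... = integral\<^sup>L lborel k" by (rule integral_from_vec[OF kb])
  finally show ?thesis .
 qed
 have "integral\<^sup>L lborel k *\<^sub>R (1 :: real ^ ('e dim_index)) = integral\<^sup>L lborel h *\<^sub>R 1" using eq 1 2 by simp
 then have "(integral\<^sup>L lborel k *\<^sub>R (1 :: real ^ ('e dim_index))) $ i = (integral\<^sup>L lborel h *\<^sub>R 1) $ i" for i by simp
 then show ?thesis by simp
qed

lemma compact_support_integrable:
 fixes F :: "'e::euclidean_space => real"
 assumes "continuous_on UNIV F" "compact K" "!!y. y ~: K ==> F y = 0"
 shows "integrable lborel F"
proof -
 have "F = (%x. indicator K x *\<^sub>R F x)" using assms(3) by (auto simp: indicator_def fun_eq_iff)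
 moreover have "integrable lborel (%x. indicator K x *\<^sub>R F x)"
  by (rule borel_integrable_compact[OF assms(2)]) (rule continuous_on_subset[OF assms(1)], simp)
 ultimately show ?thesis by simp
qed

text \<open>
 By translation invariance the difference quotients of \<open>F\<close> integrate to zero; dominated
 convergence passes to the derivative.
\<close>
lemma integral_partial_derivative:
 fixes F F' :: "'e::euclidean_space => real"
 assumes d: "!!y t. ((%t. F (y + t *\<^sub>R b)) has_real_derivative F' (y + t *\<^sub>R b)) (at t)"
  and c: "continuous_on UNIV F" "continuous_on UNIV F'"
  and K: "compact K" "!!y. y ~: K ==> F y = 0" "!!y. y ~: K ==> F' y = 0"
 shows "integral\<^sup>L lborel F' = 0"
proof -
 have iF: "integrable lborel F" by (rule compact_support_integrable[OF c(1) K(1,2)])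
 have bF: "F : borel_measurable borel" and bF': "F' : borel_measurable borel"
  using c by (auto intro: borel_measurable_continuous_onI)
 define q where "q n y = (F (y + (1 / real (Suc n)) *\<^sub>R b) - F y) * real (Suc n)" for n y
 have tr: "integrable lborel (%y. F (y + a))" "integral\<^sup>L lborel (%y. F (y + a)) = integral\<^sup>L lborel F" for a
 proof -
  have "integrable (distr lborel borel ((+) a)) F" using iF by (simp add: lborel_distr_plus)
  then have "integrable lborel (%y. F (a + y))" using integrable_distr[of "(+) a" lborel borel F] by simp
  then show "integrable lborel (%y. F (y + a))" by (simp add: add.commute)
  have "integral\<^sup>L lborel F = integral\<^sup>L (distr lborel borel ((+) a)) F" by (simp add: lborel_distr_plus)
  also have "... = integral\<^sup>L lborel (%y. F (a + y))" by (rule integral_distr) (use bF in auto)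
  finally show "integral\<^sup>L lborel (%y. F (y + a)) = integral\<^sup>L lborel F" by (simp add: add.commute)
 qed
 have q0: "integral\<^sup>L lborel (q n) = 0" for n
  unfolding q_def using tr iF by simp
 obtain B where B: "!!y. \<bar>F' y\<bar> \<le> B"
 proof -
  have "bounded (F' ` K)" using compact_continuous_image[OF continuous_on_subset[OF c(2)] K(1)] compact_imp_bounded by simp
  then obtain B where B: "!!y. y : K ==> \<bar>F' y\<bar> \<le> B" by (auto simp: bounded_iff)
  have "\<bar>F' y\<bar> \<le> max B 0" for y using B[of y] K(3)[of y] by (cases "y : K") auto
  then show thesis using that by blast
 qed
 obtain R where R: "!!y. y : K ==> norm y \<le> R" using compact_imp_bounded[OF K(1)] by (auto simp: bounded_iff)
 let ?w = "%y :: 'e. indicator (cball 0 (R + norm b)) y *\<^sub>R B"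
 have iw: "integrable lborel ?w" by (rule borel_integrable_compact) auto
 have qb: "norm (q n y) \<le> ?w y" for n y
 proof (cases "norm y \<le> R + norm b")
  case True
  let ?t = "1 / real (Suc n)"
  have "EX z>0. z < ?t & F (y + ?t *\<^sub>R b) - F (y + 0 *\<^sub>R b) = (?t - 0) * F' (y + z *\<^sub>R b)"
   by (rule MVT2) (use d in auto)
  then obtain z where "F (y + ?t *\<^sub>R b) - F y = ?t * F' (y + z *\<^sub>R b)" by auto
  then have "q n y = F' (y + z *\<^sub>R b)" unfolding q_def by (simp add: field_simps)
  then show ?thesis using B[of "y + z *\<^sub>R b"] True by simp
 next
  case False
  have "norm b / real (Suc n) \<le> norm b" by (simp add: divide_le_eq algebra_simps)
  moreover have "norm y \<le> norm (y + (1 / real (Suc n)) *\<^sub>R b) + norm ((1 / real (Suc n)) *\<^sub>R b)"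
   using norm_triangle_ineq4[of "y + (1 / real (Suc n)) *\<^sub>R b" "(1 / real (Suc n)) *\<^sub>R b"] by simp
  ultimately have "norm (y + (1 / real (Suc n)) *\<^sub>R b) > R" using False by simp
  then have "y + (1 / real (Suc n)) *\<^sub>R b ~: K" using R[of "y + (1 / real (Suc n)) *\<^sub>R b"] by linarith
  moreover have "y ~: K" using R[of y] False norm_ge_zero[of b] by linarith
  ultimately show ?thesis using K(2) False by (simp add: q_def)
 qed
 have "(%n. integral\<^sup>L lborel (q n)) \<longlonglongrightarrow> integral\<^sup>L lborel F'"
 proof (rule integral_dominated_convergence[where w="?w"])
  show "F' : borel_measurable lborel" using bF' by simp
  show "q n : borel_measurable lborel" for n
   unfolding q_def using borel_measurable_integrable[OF tr(1)] bF by simp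
  show "integrable lborel ?w" by (rule iw)
  show "AE y in lborel. (%n. q n y) \<longlonglongrightarrow> F' y"
  proof (rule AE_I2)
   fix y
   have "((%h. (F (y + (0 + h) *\<^sub>R b) - F (y + 0 *\<^sub>R b)) / h) \<longlongrightarrow> F' (y + 0 *\<^sub>R b)) (at 0)"
    using d[of y 0] unfolding DERIV_def by simp
   moreover have "filterlim (%n. 1 / real (Suc n)) (at 0) sequentially"
    unfolding filterlim_at by (auto intro: LIMSEQ_Suc[OF lim_1_over_n] simp del: of_nat_Suc)
   ultimately have "(%n. (F (y + (0 + 1 / real (Suc n)) *\<^sub>R b) - F (y + 0 *\<^sub>R b)) / (1 / real (Suc n))) \<longlonglongrightarrow> F' (y + 0 *\<^sub>R b)"
    by (rule filterlim_compose)
   then show "(%n. q n y) \<longlonglongrightarrow> F' y" by (simp add: q_def)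
  qed
  show "AE y in lborel. norm (q n y) \<le> ?w y" for n using qb by simp
 qed
 then show ?thesis using q0 by (simp add: LIMSEQ_const_iff)
qed

lemma continuous_nonneg_integral_zero:
 fixes F :: "'e::euclidean_space => real"
 assumes c: "continuous_on UNIV F" and i: "integrable lborel F" and n: "!!y. F y \<ge> 0" and z: "integral\<^sup>L lborel F = 0"
 shows "F y = 0"
proof (rule ccontr)
 assume ne: "F y ~= 0"
 have "AE x in lborel. F x = 0" using integral_nonneg_eq_0_iff_AE[OF i] n z by simp
 then have "emeasure lborel {x. F x ~= 0} = 0"
  using AE_iff_measurable[of "{x. F x ~= 0}" lborel "%x. F x = 0"] c
  by (simp add: borel_open open_Collect_neq continuous_on_const)
 moreover have o: "open {x. F x ~= 0}" using c by (simp add: open_Collect_neq continuous_on_const)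
 ultimately have "{x. F x ~= 0} : null_sets lborel" by (auto simp: null_sets_def borel_open)
 then have "negligible {x. F x ~= 0}"
  by (simp add: negligible_iff_null_sets null_sets_completionI)
 then show False using open_not_negligible[OF o] ne by blast
qed

section \<open>Coordinate frames\<close>

context total_manifold begin

lemma coord_vectors_eq: "coord_vectors A (U, \<phi>) p = map (cvec U \<phi> p) basis_list"
 unfolding coord_vectors_def basis_list_def cvec_def[abs_def] fst_conv snd_conv ..

definition coords_on :: "'m set => ('m => 'e) => 'm set => ('e => 'm => real) => ('e => 'm vfield) => bool" where
 "coords_on U \<phi> W x E \<longleftrightarrow> openin T W & W <= U & (ALL b. x b : SF) & (ALL b. VF (E b)) &
   (ALL q:W. ALL b. x b q = \<phi> q \<bullet> b & E b q = cvec U \<phi> q b)"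

lemma coords_onD:
 assumes "coords_on U \<phi> W x E"
 shows "openin T W" "W <= U" "x b : SF" "VF (E b)" "q : W ==> x b q = \<phi> q \<bullet> b" "q : W ==> E b q = cvec U \<phi> q b"
 using assms unfolding coords_on_def by simp_all

lemma coords_on_exists:
 assumes c: "(U, \<phi>) : A" and p: "p : U"
 shows "EX W x E. p : W & coords_on U \<phi> W x E"
proof -
 obtain th V x E where F: "is_local_frame p th V x E" and V: "V <= U" "ALL q:V. ALL b. x b q = \<phi> q \<bullet> b & E b q = cvec U \<phi> q b"
  using chart_frame[OF c p] by blast
 have "coords_on U \<phi> V x E" using is_local_frameD(2,5,6)[OF F] V by (simp add: coords_on_def)
 then show ?thesis using is_local_frameD(3)[OF F] by blast
qed

lemma cvec_coordinate:
 assumes c: "(U, \<phi>) : A" and d: "(V, \<psi>) : A" and W: "openin T W" "W <= V" "p : W" "p : U"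
  and x: "x : SF" "!!q. q : W ==> x q = \<psi> q \<bullet> b'"
 shows "cvec U \<phi> p b x = FD (\<psi> \<circ> inv_into U \<phi>) (at (\<phi> p)) b \<bullet> b'"
proof -
 let ?\<tau> = "\<psi> \<circ> inv_into U \<phi>"
 have pUV: "\<phi> p : \<phi> ` (U \<inter> V)" using W by blast
 have "?\<tau> differentiable at (\<phi> p)" using transition_smooth[OF c d, of 1] pUV unfolding One_nat_def Ck_on.simps by blast
 then have t: "(?\<tau> has_derivative FD ?\<tau> (at (\<phi> p))) (at (\<phi> p))" by (simp add: frechet_derivative_works)
 have "((%y. ?\<tau> y \<bullet> b') has_derivative (%v. FD ?\<tau> (at (\<phi> p)) v \<bullet> b')) (at (\<phi> p))"
  by (rule has_derivative_inner_left[OF t])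
 then have "((x \<circ> inv_into U \<phi>) has_derivative (%v. FD ?\<tau> (at (\<phi> p)) v \<bullet> b')) (at (\<phi> p))"
  by (rule has_derivative_transform_within_open[of _ _ _ _ "\<phi> ` (W \<inter> U)"])
   (use openin_chart_image[OF W(1) c] W x(2) inv_chart[OF c] in auto)
 from fun_cong[OF frechet_derivative_at[OF this], of b] show ?thesis using x(1) by (simp add: cvec_def)
qed

lemma cvec_own_coordinate:
 assumes c: "(U, \<phi>) : A" and W: "openin T W" "W <= U" "p : W" and x: "x : SF" "!!q. q : W ==> x q = \<phi> q \<bullet> b'"
 shows "cvec U \<phi> p b x = b \<bullet> b'"
proof -
 have pU: "p : U" using W by blast
 have "FD (\<phi> \<circ> inv_into U \<phi>) (at (\<phi> p)) = (%v. v)"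
 proof (rule frechet_derivative_at[symmetric], rule has_derivative_transform_within_open[OF has_derivative_ident chart_open[OF c]])
  show "\<phi> p : \<phi> ` U" using pU by blast
  show "x = (\<phi> \<circ> inv_into U \<phi>) x" if "x : \<phi> ` U" for x using that by (simp add: f_inv_into_f)
 qed
 then show ?thesis using cvec_coordinate[OF c c W pU x, of b] by simp
qed

lemma basis_list_sum: "(\<Sum>b\<in>Basis. h b) = (\<Sum>j<DIM('e). h (basis_list ! j :: 'e))"
proof -
 have "bij_betw (%i. basis_list ! i) {..<DIM('e)} (Basis :: 'e set)"
  by (rule bij_betw_nth) (simp_all add: basis_list)
 from sum.reindex_bij_betw[OF this, of h] show ?thesis by simp
qed

lemma map_basis_list: "map h (basis_list :: 'e list) = map (%j. h (basis_list ! j)) [0..<DIM('e)]"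
 by (rule nth_equalityI) auto

lemma coords_expand:
 assumes c: "(U, \<phi>) : A" and x: "coords_on U \<phi> W x E" and q: "q : W" and u: "u : TS q"
 shows "u = (\<Sum>j<DIM('e). (%f. u (x (basis_list ! j)) * cvec U \<phi> q (basis_list ! j) f))"
proof (rule ext)
 fix f
 have "u f = (\<Sum>b\<in>Basis. u (x b) * cvec U \<phi> q b f)"
  by (rule tangent_chart[OF c q coords_onD(1,2)[OF x] coords_onD(3)[OF x] coords_onD(5)[OF x] u])
 then show "u f = (\<Sum>j<DIM('e). (%f. u (x (basis_list ! j)) * cvec U \<phi> q (basis_list ! j) f)) f"
  unfolding sum_tvec_apply basis_list_sum .
qed

text \<open>
 The determinant of the coordinates is an alternating form of top degree; every other one is a
 multiple of it, which gives the transition rule for volume forms.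
\<close>
lemma alt_form_det:
 "alt_form p (DIM('e)) (%vs. if length vs = DIM('e) & set vs <= TS p then
   det (\<chi> i j. (vs ! Rep_dim_index i) (x (bvec j :: 'e)) :: real ^ ('e dim_index) ^ ('e dim_index)) else 0)"
  (is "alt_form p _ (%vs. if _ then det (?M vs) else 0)")
proof (rule alt_formI)
 fix vs :: "'m tvec list" and k and u w :: "'m tvec" and c
 assume l: "length vs = DIM('e)" and v: "set vs <= TS p" and k: "k < DIM('e)" and u: "u : TS p" "w : TS p"
 have sub: "set (vs[k := y]) <= TS p" if "y : TS p" for y
  using v set_update_subset_insert[of vs k y] that by blast
 let ?k = "Abs_dim_index k :: 'e dim_index"
 have Rk: "Rep_dim_index i = k \<longleftrightarrow> i = ?k" for i :: "'e dim_index"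
  using k by (metis Abs_dim_index_inverse Rep_dim_index_inverse lessThan_iff)
 have r: "?M (vs[k := y]) = (\<chi> i. if i = ?k then (\<chi> j. y (x (bvec j))) else (\<chi> j. (vs ! Rep_dim_index i) (x (bvec j))))" for y
  using l k by (auto simp: vec_eq_iff nth_list_update Rk[symmetric])
 have "det (?M (vs[k := (%f. c * u f + w f)])) = c * det (?M (vs[k := u])) + det (?M (vs[k := w]))"
 proof -
  have s: "(\<chi> j. (%f. c * u f + w f) (x (bvec j :: 'e))) = c *s (\<chi> j. u (x (bvec j))) + (\<chi> j. w (x (bvec j)))"
   by (simp add: vec_eq_iff)
  show ?thesis unfolding r s
   unfolding det_row_add[of ?k "%_. c *s (\<chi> j. u (x (bvec j)))"] det_row_mul[of ?k c "%_. (\<chi> j. u (x (bvec j)))"] ..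
 qed
 then show "(if length (vs[k := (%f. c * u f + w f)]) = DIM('e) & set (vs[k := (%f. c * u f + w f)]) <= TS p
   then det (?M (vs[k := (%f. c * u f + w f)])) else 0) =
  c * (if length (vs[k := u]) = DIM('e) & set (vs[k := u]) <= TS p then det (?M (vs[k := u])) else 0) +
  (if length (vs[k := w]) = DIM('e) & set (vs[k := w]) <= TS p then det (?M (vs[k := w])) else 0)"
  using sub[OF u(1)] sub[OF u(2)] sub[OF tangent_comb[OF u, of c]] l by simp
next
 fix vs :: "'m tvec list" and i j
 assume l: "length vs = DIM('e)" and ij: "i < DIM('e)" "j < DIM('e)" "i ~= j" "vs ! i = vs ! j"
 let ?i = "Abs_dim_index i :: 'e dim_index" and ?j = "Abs_dim_index j :: 'e dim_index"
 have R: "Rep_dim_index ?i = i" "Rep_dim_index ?j = j" using ij by (simp_all add: Abs_dim_index_inverse)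
 then have "?i ~= ?j" using ij by metis
 moreover have "row ?i (?M vs) = row ?j (?M vs)" using R ij by (simp add: row_def vec_eq_iff)
 ultimately have "det (?M vs) = 0" by (rule det_identical_rows)
 then show "(if length vs = DIM('e) & set vs <= TS p then det (?M vs) else 0) = 0" by simp
qed auto

lemma alt_form_diff_scale:
 assumes a: "alt_form p k \<phi>" and b: "alt_form p k \<psi>"
 shows "alt_form p k (%vs. \<phi> vs - r * \<psi> vs)"
proof (rule alt_formI)
 fix vs assume "~ (length vs = k & set vs <= TS p)"
 then show "\<phi> vs - r * \<psi> vs = 0" using alt_form_zero[OF a] alt_form_zero[OF b] by simp
next
 fix vs i u w c assume v: "length vs = k" "set vs <= TS p" "i < k" "u : TS p" "w : TS p"
 show "\<phi> (vs[i := (%f. c * u f + w f)]) - r * \<psi> (vs[i := (%f. c * u f + w f)]) =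
  c * (\<phi> (vs[i := u]) - r * \<psi> (vs[i := u])) + (\<phi> (vs[i := w]) - r * \<psi> (vs[i := w]))"
  unfolding alt_form_slot[OF a v] alt_form_slot[OF b v] by (simp add: algebra_simps)
next
 fix vs i j assume v: "length vs = k" "set vs <= TS p" "i < k" "j < k" "i ~= j" "vs ! i = vs ! j"
 show "\<phi> vs - r * \<psi> vs = 0" unfolding alt_form_alt[OF a v] alt_form_alt[OF b v] by simp
qed

lemma cvec_list_tangent: "(U, \<phi>) : A ==> p : U ==> set (map (cvec U \<phi> p) bs) <= TS p"
 using cvec_tangent by auto

lemma top_form_transition:
 assumes m: "alt_form p (DIM('e)) (\<mu> p)" and c: "(U, \<phi>) : A" and d: "(V, \<psi>) : A" and p: "p : U" "p : V"
 shows "\<mu> p (map (cvec U \<phi> p) basis_list) =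
  det (matrix_of (FD (\<psi> \<circ> inv_into U \<phi>) (at (\<phi> p)))) * \<mu> p (map (cvec V \<psi> p) basis_list)"
proof -
 obtain W x E where W: "p : W" "coords_on V \<psi> W x E" using coords_on_exists[OF d p(2)] by blast
 note x = coords_onD[OF W(2)]
 let ?M = "%vs. (\<chi> i j. (vs ! Rep_dim_index i) (x (bvec j :: 'e))) :: real ^ ('e dim_index) ^ ('e dim_index)"
 let ?D = "%vs. if length vs = DIM('e) & set vs <= TS p then det (?M vs) else 0"
 let ?v = "map (cvec U \<phi> p) (basis_list :: 'e list)" and ?w = "map (cvec V \<psi> p) (basis_list :: 'e list)"
 let ?P = "%vs. \<mu> p vs - \<mu> p ?w * ?D vs"
 have aP: "alt_form p (DIM('e)) ?P" by (rule alt_form_diff_scale[OF m alt_form_det])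
 have Ml: "?M (map h basis_list) = (\<chi> i j. h (bvec i) (x (bvec j)))" for h :: "'e => 'm tvec"
 proof -
  have "Rep_dim_index i < DIM('e)" for i :: "'e dim_index" using Rep_dim_index[of i] by simp
  then show ?thesis by (simp add: vec_eq_iff bvec_def)
 qed
 have Mw: "?M ?w = mat 1"
 proof -
  have "cvec V \<psi> p (bvec i) (x (bvec j)) = (if i = j then 1 else 0)" for i j
   using cvec_own_coordinate[OF d x(1,2) W(1) x(3) x(5)] by (simp add: bvec_inner)
  then show ?thesis unfolding Ml by (simp add: mat_def vec_eq_iff)
 qed
 have Mv: "?M ?v = matrix_of (FD (\<psi> \<circ> inv_into U \<phi>) (at (\<phi> p)))"
  unfolding Ml matrix_of_def using cvec_coordinate[OF c d x(1,2) W(1) p(1) x(3) x(5)] by (simp add: vec_eq_iff)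
 have "?P ?v = 0"
 proof (rule alt_form_basis_zero[OF aP, of "%j. cvec V \<psi> p (basis_list ! j)" "%u j. u (x (basis_list ! j))"])
  show "cvec V \<psi> p (basis_list ! j) : TS p" for j by (rule cvec_tangent[OF d p(2)])
  show "u = (\<Sum>j<DIM('e). (%f. u (x (basis_list ! j)) * cvec V \<psi> p (basis_list ! j) f))" if "u : TS p" for u
   by (rule coords_expand[OF d W(2,1) that])
  have "?P ?w = 0" using Mw cvec_list_tangent[OF d p(2)] by simp
  then show "?P (map (%j. cvec V \<psi> p (basis_list ! j)) [0..<DIM('e)]) = 0"
   unfolding map_basis_list[symmetric] .
 qed
 then show ?thesis unfolding Mv using cvec_list_tangent[OF c p(1)] by simp
qed

lemma coords_commute:
 assumes c: "(U, \<phi>) : A" and x: "coords_on U \<phi> W x E" and q: "q : W" and f: "f : SF"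
 shows "E b q (%r. E b' r f) = E b' q (%r. E b r f)"
proof -
 note x' = coords_onD[OF x]
 let ?F = "f \<circ> inv_into U \<phi>"
 have qU: "q : U" using q x'(2) by blast
 have oW: "open (\<phi> ` (W \<inter> U))" by (rule openin_chart_image[OF x'(1) c])
 have s2: "E b q (%r. E b' r f) = FD (%y. FD ?F (at y) b') (at (\<phi> q)) b" for b b'
 proof -
  have E'f: "(%r. E b' r f) : SF" by (rule VF_smooth[OF x'(4) f])
  have "E b q (%r. E b' r f) = FD ((%r. E b' r f) \<circ> inv_into U \<phi>) (at (\<phi> q)) b"
   unfolding x'(6)[OF q] cvec_def using E'f by simp
  also have "FD ((%r. E b' r f) \<circ> inv_into U \<phi>) (at (\<phi> q)) =
    FD (%y. FD ?F (at y) b') (at (\<phi> q))"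
  proof (rule frechet_derivative_transform_within_open[OF _ oW])
   show "((%r. E b' r f) \<circ> inv_into U \<phi>) differentiable at (\<phi> q)"
    by (rule smooth_chart_differentiable[OF E'f c]) (use qU in blast)
   show "((%r. E b' r f) \<circ> inv_into U \<phi>) y = FD ?F (at y) b'" if y: "y : \<phi> ` (W \<inter> U)" for y
   proof -
    obtain r where "r : W" "r : U" "y = \<phi> r" using y by blast
    then show ?thesis using x'(6)[of r] inv_chart[OF c, of r] f by (simp add: cvec_def)
   qed
  qed (use q qU in blast)
  finally show ?thesis .
 qed
 show ?thesis unfolding s2
  by (rule mixed_second_derivatives[OF chart_open[OF c] _ smooth_chart[OF f c]]) (use qU in blast)
qed

lemma bracket_coords:
 assumes c: "(U, \<phi>) : A" and x: "coords_on U \<phi> W x E" and q: "q : W" and Z: "VF Z"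
 shows "Lie Z (E b) q = (\<Sum>j<DIM('e). (%f. - E b q (%r. Z r (x (basis_list ! j))) * E (basis_list ! j) q f))"
proof (rule tangent_eqI)
 note x' = coords_onD[OF x]
 show "Lie Z (E b) q : TS q" by (rule VF_tangent[OF VF_bracket[OF Z x'(4)]])
 show "(\<Sum>j<DIM('e). (%f. - E b q (%r. Z r (x (basis_list ! j))) * E (basis_list ! j) q f)) : TS q"
  by (rule tangent_vsum) (intro tangent_scale VF_tangent x')
 fix f assume f: "f : SF"
 let ?e = "%j. E (basis_list ! j)" and ?z = "%j r. Z r (x (basis_list ! j))"
 have zs: "?z j : SF" for j by (rule VF_smooth[OF Z x'(3)])
 have es: "(%r. ?e j r f) : SF" for j by (rule VF_smooth[OF x'(4) f])
 have exp: "Z r u = (\<Sum>j<DIM('e). ?z j r * ?e j r u)" if "r : W" for r u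
  using fun_cong[OF coords_expand[OF c x that VF_tangent[OF Z]], of u] x'(6)[OF that] by (simp add: sum_tvec_apply)
 have "E b q (%r. Z r f) = E b q (%r. \<Sum>j<DIM('e). ?z j r * ?e j r f)"
  by (rule VF_local_arg[OF x'(4) VF_smooth[OF Z f] _ x'(1) q exp]) (intro smooth_sum smooth_mult zs es)
 also have "... = (\<Sum>j<DIM('e). E b q (%r. ?z j r * ?e j r f))"
  by (rule VF_sum_arg[OF x'(4)]) (intro smooth_mult zs es)
 also have "... = (\<Sum>j<DIM('e). ?z j q * E b q (%r. ?e j r f) + ?e j q f * E b q (?z j))"
  by (rule sum.cong[OF refl]) (rule VF_mult_arg[OF x'(4) zs es])
 also have "... = (\<Sum>j<DIM('e). ?z j q * ?e j q (%r. E b r f)) + (\<Sum>j<DIM('e). ?e j q f * E b q (?z j))"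
  unfolding sum.distrib[symmetric] by (rule sum.cong[OF refl]) (simp add: coords_commute[OF c x q f, of b])
 also have "(\<Sum>j<DIM('e). ?z j q * ?e j q (%r. E b r f)) = Z q (%r. E b r f)" by (rule exp[OF q, symmetric])
 finally show "Lie Z (E b) q f = (\<Sum>j<DIM('e). (%f. - E b q (?z j) * ?e j q f)) f"
  unfolding bracket_apply sum_tvec_apply by (simp add: sum_negf mult.commute)
qed

end

section \<open>Lie derivative of a volume form\<close>

context riem begin

text \<open>
 The difference of the two sides is linear over the smooth functions in every field and changes sign
 under transpositions, so that it suffices to evaluate it on an orthonormal frame on which the volume
 form is constant. There it vanishes by \<open>dv_bracket\<close>.
\<close>
lemma lie_derivative_volume:
 assumes alt: "!!q. alt_form q (DIM('e)) (\<mu> q)"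
  and sm: "!!Xs. length Xs = DIM('e) ==> (!!X. X : set Xs ==> VF X) ==> (%q. \<mu> q (map (%X. X q) Xs)) : SF"
  and e: "frame p U e" and const: "!!q. q : U ==> \<mu> q (map (%i. e i q) [0..<DIM('e)]) = k"
  and Z: "VF Z" and Xs: "length Xs = DIM('e)" "!!X. X : set Xs ==> VF X"
 shows "Z p (%q. \<mu> q (map (%X. X q) Xs)) =
  (\<Sum>i<DIM('e). \<mu> p ((map (%X. X p) Xs)[i := Lie Z (Xs ! i) p])) + dv Z p * \<mu> p (map (%X. X p) Xs)"
proof -
 note d = frameD[OF e]
 let ?at = "%Xs q. map (%X :: 'm vfield. X q) Xs"
 define \<Phi> where "\<Phi> Ys = Z p (%q. \<mu> q (?at Ys q)) - (\<Sum>i<DIM('e). \<mu> p ((?at Ys p)[i := Lie Z (Ys ! i) p]))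
   - dv Z p * \<mu> p (?at Ys p)" for Ys
 have tang: "set (?at Ys q) <= TS q" if "set Ys <= {X. VF X}" for Ys q using that VF_tangent by auto
 have upd: "?at (Ys[i := Y]) q = (?at Ys q)[i := Y q]" for Ys i Y q by (simp add: map_update)
 have subu: "set ((?at Ys q)[i := v]) <= TS q" if "set Ys <= {X. VF X}" "v : TS q" for Ys q i v
  using tang[OF that(1), of q] that(2) set_update_subset_insert[of "?at Ys q" i v] by blast
 have add: "\<mu> q (vs[i := u + w]) = \<mu> q (vs[i := u]) + \<mu> q (vs[i := w])"
  if "length vs = DIM('e)" "set vs <= TS q" "i < DIM('e)" "u : TS q" "w : TS q" for q vs i u w
  using alt_form_slot[OF alt that, of 1] by (simp add: plus_fun_def)
 have scl: "\<mu> q (vs[i := (%f. c * u f)]) = c * \<mu> q (vs[i := u])"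
  if "length vs = DIM('e)" "set vs <= TS q" "i < DIM('e)" "u : TS q" for q vs i u c
  using alt_form_slot[OF alt that tangent_zero', of c] alt_form_slot_zero[OF alt that(1-3)] by simp
 have addF: "\<mu> q (vs[i := (X + Y) q]) = \<mu> q (vs[i := X q]) + \<mu> q (vs[i := Y q])"
  if "length vs = DIM('e)" "set vs <= TS q" "i < DIM('e)" "VF X" "VF Y" for q vs i X Y
  using add[OF that(1-3) VF_tangent[OF that(4)] VF_tangent[OF that(5)]] by simp
 have smu: "(%q. \<mu> q ((?at Ys q)[i := Y q])) : SF" if "length Ys = DIM('e)" "set Ys <= {X. VF X}" "VF Y" for Ys i Y
 proof -
  have "(%q. \<mu> q (?at (Ys[i := Y]) q)) : SF"
   by (rule sm) (use that set_update_subset_insert[of Ys i Y] in auto)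
  then show ?thesis by (simp add: upd)
 qed
 have tens: "tensorial p (%Y. \<Phi> (Ys[i := Y]))" if Ys: "length Ys = DIM('e)" "set Ys <= {X. VF X}" and i: "i < DIM('e)" for Ys i
 proof -
  let ?v = "%q. ?at Ys q"
  have lv: "length (?v q) = DIM('e)" for q using Ys by simp
  have b: "Lie Z (Ys ! j) p : TS p" if "j < DIM('e)" for j
   using that Ys by (intro VF_tangent VF_bracket Z) (auto simp: subset_iff)
  have P: "\<Phi> (Ys[i := Y]) = Z p (%q. \<mu> q ((?v q)[i := Y q]))
    - (\<mu> p ((?v p)[i := Lie Z Y p]) + (\<Sum>j\<in>{..<DIM('e)} - {i}. \<mu> p ((?v p)[j := Lie Z (Ys ! j) p, i := Y p])))
    - dv Z p * \<mu> p ((?v p)[i := Y p])" for Y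
  proof -
   have "(\<Sum>j<DIM('e). \<mu> p ((?at (Ys[i := Y]) p)[j := Lie Z (Ys[i := Y] ! j) p])) =
     \<mu> p ((?v p)[i := Lie Z Y p]) +
     (\<Sum>j\<in>{..<DIM('e)} - {i}. \<mu> p ((?at (Ys[i := Y]) p)[j := Lie Z (Ys[i := Y] ! j) p]))"
    using i Ys by (subst sum.remove[of _ i]) (auto simp: upd)
   also have "(\<Sum>j\<in>{..<DIM('e)} - {i}. \<mu> p ((?at (Ys[i := Y]) p)[j := Lie Z (Ys[i := Y] ! j) p])) =
     (\<Sum>j\<in>{..<DIM('e)} - {i}. \<mu> p ((?v p)[j := Lie Z (Ys ! j) p, i := Y p]))"
    by (rule sum.cong) (auto simp: upd list_update_swap)
   finally show ?thesis unfolding \<Phi>_def upd by simp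
  qed
  show ?thesis
  proof (rule tensorialI)
   fix X Y assume X: "VF X" and Y: "VF Y"
   have 1: "(%q. \<mu> q ((?v q)[i := (X + Y) q])) = (%q. \<mu> q ((?v q)[i := X q]) + \<mu> q ((?v q)[i := Y q]))"
    using add[OF lv tang[OF Ys(2)] i VF_tangent[OF X] VF_tangent[OF Y]] by simp
   have 2: "\<mu> p ((?v p)[i := Lie Z (X + Y) p]) = \<mu> p ((?v p)[i := Lie Z X p]) + \<mu> p ((?v p)[i := Lie Z Y p])"
    unfolding bracket_add_right[OF Z X Y]
    by (rule addF[OF lv tang[OF Ys(2)] i VF_bracket[OF Z X] VF_bracket[OF Z Y]])
   have 3: "(\<Sum>j\<in>{..<DIM('e)} - {i}. \<mu> p ((?v p)[j := Lie Z (Ys ! j) p, i := (X + Y) p])) =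
     (\<Sum>j\<in>{..<DIM('e)} - {i}. \<mu> p ((?v p)[j := Lie Z (Ys ! j) p, i := X p])) +
     (\<Sum>j\<in>{..<DIM('e)} - {i}. \<mu> p ((?v p)[j := Lie Z (Ys ! j) p, i := Y p]))"
    unfolding sum.distrib[symmetric]
    by (rule sum.cong[OF refl], rule addF)
     (use lv i X Y subu[OF Ys(2) b] in auto)
   show "\<Phi> (Ys[i := X + Y]) = \<Phi> (Ys[i := X]) + \<Phi> (Ys[i := Y])"
    unfolding P 1 2 3 VF_add_arg[OF Z smu[OF Ys X] smu[OF Ys Y]] fun_cong[OF 1]
    by (simp add: algebra_simps)
  next
   fix X h assume X: "VF X" and h: "h : SF"
   have 1: "(%q. \<mu> q ((?v q)[i := fscale h X q])) = (%q. h q * \<mu> q ((?v q)[i := X q]))"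
    using scl[OF lv tang[OF Ys(2)] i VF_tangent[OF X]] by (simp add: fscale_def)
   have 2: "\<mu> p ((?v p)[i := Lie Z (fscale h X) p]) = h p * \<mu> p ((?v p)[i := Lie Z X p]) + Z p h * \<mu> p ((?v p)[i := X p])"
   proof -
    note bX = VF_bracket[OF Z X]
    have "\<mu> p ((?v p)[i := Lie Z (fscale h X) p]) =
      \<mu> p ((?v p)[i := fscale h (Lie Z X) p]) + \<mu> p ((?v p)[i := fscale (%p. Z p h) X p])"
     unfolding bracket_fscale_right[OF Z X h]
     by (rule addF[OF lv tang[OF Ys(2)] i VF_fscale[OF h bX] VF_fscale[OF VF_smooth[OF Z h] X]])
    then show ?thesis unfolding fscale_at scl[OF lv tang[OF Ys(2)] i VF_tangent[OF bX]] scl[OF lv tang[OF Ys(2)] i VF_tangent[OF X]] .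
   qed
   have 3: "(\<Sum>j\<in>{..<DIM('e)} - {i}. \<mu> p ((?v p)[j := Lie Z (Ys ! j) p, i := fscale h X p])) =
     h p * (\<Sum>j\<in>{..<DIM('e)} - {i}. \<mu> p ((?v p)[j := Lie Z (Ys ! j) p, i := X p]))"
    unfolding sum_distrib_left fscale_at
    by (rule sum.cong[OF refl], rule scl)
     (use lv i VF_tangent[OF X] subu[OF Ys(2) b] in auto)
   show "\<Phi> (Ys[i := fscale h X]) = h p * \<Phi> (Ys[i := X])"
    unfolding P 1 2 3 VF_mult_arg[OF Z h smu[OF Ys X]] fun_cong[OF 1]
    by (simp add: algebra_simps)
  qed
 qed
 have sw: "\<Phi> (permute_list (Transposition.transpose a b) Ys) = - \<Phi> Ys"
  if Ys: "length Ys = DIM('e)" "set Ys <= {X. VF X}" and ab: "a < DIM('e)" "b < DIM('e)" "a ~= b" for Ys a b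
 proof -
  let ?t = "Transposition.transpose a b"
  have t: "?t permutes {..<length Ys}" using ab Ys by (intro swap_permutes) auto
  have m: "?at (permute_list ?t Ys) q = permute_list ?t (?at Ys q)" for q by (rule permute_list_map[OF t, symmetric])
  have s: "\<mu> q (permute_list ?t vs) = - \<mu> q vs" if "length vs = DIM('e)" "set vs <= TS q" for q vs
   by (rule alt_form_swap[OF alt that ab])
  have 1: "(%q. \<mu> q (?at (permute_list ?t Ys) q)) = (%q. - \<mu> q (?at Ys q))"
   unfolding m using s tang[OF Ys(2)] Ys by simp
  have sY: "(%q. \<mu> q (?at Ys q)) : SF" by (rule sm) (use Ys in auto)
  have term_eq: "\<mu> p ((?at (permute_list ?t Ys) p)[j := Lie Z (permute_list ?t Ys ! j) p]) =
    - \<mu> p ((?at Ys p)[?t j := Lie Z (Ys ! ?t j) p])" if j: "j < DIM('e)" for j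
  proof -
   have tj: "?t j < DIM('e)" using permutes_in_image[OF t, of j] j Ys by simp
   have VFj: "VF (Ys ! ?t j)" using Ys tj by (auto simp: subset_iff)
   have "(?at (permute_list ?t Ys) p)[j := Lie Z (permute_list ?t Ys ! j) p] =
     permute_list ?t ((?at Ys p)[?t j := Lie Z (Ys ! ?t j) p])"
   proof (rule nth_equalityI)
    fix l assume l: "l < length ((?at (permute_list ?t Ys) p)[j := Lie Z (permute_list ?t Ys ! j) p])"
    have tl: "?t l < length Ys" using permutes_in_image[OF t, of l] l by simp
    have eq: "?t j = ?t l \<longleftrightarrow> j = l" by (rule inj_eq[OF permutes_inj[OF t]])
    have t': "?t permutes {..<length ((?at Ys p)[?t j := Lie Z (Ys ! ?t j) p])}" using t by simp
    show "(?at (permute_list ?t Ys) p)[j := Lie Z (permute_list ?t Ys ! j) p] ! l =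
      permute_list ?t ((?at Ys p)[?t j := Lie Z (Ys ! ?t j) p]) ! l"
     using l tl eq Ys j tj by (simp add: permute_list_nth[OF t] permute_list_nth[OF t'] nth_list_update)
   qed simp
   then show ?thesis
    using s[of "(?at Ys p)[?t j := Lie Z (Ys ! ?t j) p]" p] Ys subu[OF Ys(2) VF_tangent[OF VF_bracket[OF Z VFj]]] by simp
  qed
  have "(\<Sum>j<DIM('e). \<mu> p ((?at (permute_list ?t Ys) p)[j := Lie Z (permute_list ?t Ys ! j) p])) =
    (\<Sum>j<DIM('e). - \<mu> p ((?at Ys p)[?t j := Lie Z (Ys ! ?t j) p]))"
   by (rule sum.cong[OF refl]) (use term_eq in simp)
  also have "... = (\<Sum>j<DIM('e). - \<mu> p ((?at Ys p)[j := Lie Z (Ys ! j) p]))"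
   using sum.permute[of ?t "{..<DIM('e)}" "%j. - \<mu> p ((?at Ys p)[j := Lie Z (Ys ! j) p])"] t Ys
   by (simp add: o_def)
  finally show ?thesis
   unfolding \<Phi>_def 1 VF_minus_arg[OF Z sY] fun_cong[OF 1] by (simp add: sum_negf)
 qed
 have "\<Phi> Xs = 0"
 proof (rule multilinear_vanishes[where e=e and S="{X. VF X}" and n="DIM('e)" and c="%X j. g p (X p) (e j p)"])
  fix Ys i assume Ys: "length Ys = DIM('e)" "set Ys <= {X. VF X}" and i: "i < DIM('e)"
  have "VF (Ys ! i)" using Ys i by (auto simp: subset_iff)
  from tensorial_frame[OF e tens[OF Ys i] this]
  show "\<Phi> Ys = (\<Sum>j<DIM('e). g p ((Ys ! i) p) (e j p) * \<Phi> (Ys[i := e j]))" by simp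
 next
  fix js assume js: "length js = DIM('e)" "set js <= {..<DIM('e)}" "~ distinct js"
  then obtain i j where ij: "i < DIM('e)" "j < DIM('e)" "i ~= j" "js ! i = js ! j"
   by (auto simp: distinct_conv_nth)
  have l: "length (map e js) = DIM('e)" "set (map e js) <= {X. VF X}" using js d(3) by auto
  have "permute_list (Transposition.transpose i j) (map e js) = map e js"
   by (rule nth_equalityI) (use ij js in \<open>auto simp: permute_list_transpose nth_list_update\<close>)
  then show "\<Phi> (map e js) = 0" using sw[OF l ij(1-3)] by simp
 next
  fix js i j assume js: "length js = DIM('e)" "set js <= {..<DIM('e)}" and ij: "i < DIM('e)" "j < DIM('e)" "i ~= j"
  have l: "length (map e js) = DIM('e)" "set (map e js) <= {X. VF X}" using js d(3) by auto
  have "map e (permute_list (Transposition.transpose i j) js) = permute_list (Transposition.transpose i j) (map e js)"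
   by (rule permute_list_map[symmetric]) (use ij js in \<open>auto intro: swap_permutes\<close>)
  then show "\<Phi> (map e (permute_list (Transposition.transpose i j) js)) = - \<Phi> (map e js)" using sw[OF l ij] by simp
 next
  let ?es = "map e [0..<DIM('e)]"
  have at: "?at ?es q = map (%i. e i q) [0..<DIM('e)]" for q by (simp add: o_def)
  have les: "length ?es = DIM('e)" "set ?es <= {X. VF X}" using d(3) by auto
  have s: "(%q. \<mu> q (?at ?es q)) : SF" by (rule sm) (use les in auto)
  have 1: "Z p (%q. \<mu> q (?at ?es q)) = 0"
   using VF_local_arg[OF Z s smooth_const[of k] d(1,2)] const VF_const_arg[OF Z, of p k] unfolding at by simp
  have 2: "\<mu> p ((?at ?es p)[i := Lie Z (?es ! i) p]) = - g p (Lie (e i) Z p) (e i p) * \<mu> p (?at ?es p)"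
   if i: "i < DIM('e)" for i
  proof -
   have ei: "VF (e i)" by (rule d(3)[OF i])
   let ?w = "Lie Z (e i) p"
   have w: "?w : TS p" by (rule VF_tangent[OF VF_bracket[OF Z ei]])
   have "?w = (\<Sum>j<DIM('e). (%f. g p ?w (e j p) * (?at ?es p ! j) f))"
    by (subst frame_expand[OF e w]) (rule sum.cong, auto)
   then have "\<mu> p ((?at ?es p)[i := ?w]) = \<mu> p ((?at ?es p)[i := (\<Sum>j<DIM('e). (%f. g p ?w (e j p) * (?at ?es p ! j) f))])" by simp
   also have "... = g p ?w (e i p) * \<mu> p (?at ?es p)" by (rule alt_form_slot_diag[OF alt _ tang[OF les(2)] i]) simp
   also have "g p ?w (e i p) = - g p (Lie (e i) Z p) (e i p)"
    unfolding bracket_antisym[of Z "e i"] using g_at(7)[OF VF_bracket[OF ei Z] ei ei, of p] by simp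
   finally show ?thesis using i by simp
  qed
  have "(\<Sum>i<DIM('e). \<mu> p ((?at ?es p)[i := Lie Z (?es ! i) p])) = - dv Z p * \<mu> p (?at ?es p)"
   unfolding dv_bracket[OF Z e] sum_distrib_right sum_negf[symmetric] by (rule sum.cong[OF refl]) (use 2 in simp)
  then show "\<Phi> (map e [0..<DIM('e)]) = 0" unfolding \<Phi>_def 1 by simp
 qed (use Xs d(3) in auto)
 then show ?thesis unfolding \<Phi>_def by simp
qed

end

section \<open>The integral of a volume form\<close>

context total_manifold begin

definition ext0 :: "'m set => ('m => 'e) => ('m => real) => 'e => real" where
 "ext0 U \<phi> a y = (if y : \<phi> ` U then a (inv_into U \<phi> y) else 0)"

definition supp_in :: "'m set => ('m => real) => bool" where
 "supp_in K a \<longleftrightarrow> a : SF & closedin T K & (ALL q. q ~: K --> a q = 0)"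

lemma chart_continuous_map: assumes c: "(U, \<phi>) : A" shows "continuous_map (subtopology T U) euclidean \<phi>"
 unfolding continuous_map_def
proof (intro conjI allI impI)
 fix S :: "'e set" assume "openin euclidean S"
 then have "openin T {q : U. \<phi> q : S}" using openin_chart_vimage[OF c] by simp
 moreover have "{x : topspace (subtopology T U). \<phi> x : S} = {q : U. \<phi> q : S}" by auto
 ultimately show "openin (subtopology T U) {x : topspace (subtopology T U). \<phi> x : S}"
  by (auto simp: openin_open_subtopology[OF openin_chart[OF c]])
qed simp

lemma chart_image_compact:
 assumes comp: "compact_space T" and c: "(U, \<phi>) : A" and K: "closedin T K" "K <= U"
 shows "compact (\<phi> ` K)"
proof -
 have "compactin T K" by (rule closedin_compact_space[OF comp K(1)])
 then have "compactin (subtopology T U) K" using K by (simp add: compactin_subtopology)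
 from image_compactin[OF this chart_continuous_map[OF c]] show ?thesis by simp
qed

lemma ext0_smooth:
 assumes comp: "compact_space T" and c: "(U, \<phi>) : A" and a: "supp_in K a" and K: "K <= U"
 shows "Ck_on k UNIV (ext0 U \<phi> a)" "compact (\<phi> ` K)" "y ~: \<phi> ` K ==> ext0 U \<phi> a y = 0"
proof -
 have a': "a : SF" "closedin T K" "!!q. q ~: K ==> a q = 0" using a by (auto simp: supp_in_def)
 show co: "compact (\<phi> ` K)" by (rule chart_image_compact[OF comp c a'(2) K])
 have z: "ext0 U \<phi> a y = 0" if "y ~: \<phi> ` K" for y
 proof (cases "y : \<phi> ` U")
  case True
  then obtain q where q: "q : U" "y = \<phi> q" by blast
  then have "q ~: K" using that by blast
  then show ?thesis using q inv_chart[OF c q(1)] a'(3) by (simp add: ext0_def)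
 qed (simp add: ext0_def)
 then show "y ~: \<phi> ` K ==> ext0 U \<phi> a y = 0" .
 show "Ck_on k UNIV (ext0 U \<phi> a)"
 proof (rule Ck_on_open_cover)
  fix y :: 'e
  show "EX S. open S & y : S & Ck_on k S (ext0 U \<phi> a)"
  proof (cases "y : \<phi> ` U")
   case True
   have "Ck_on k (\<phi> ` U) (ext0 U \<phi> a)"
    by (rule Ck_on_cong[OF chart_open[OF c] _ smooth_chart[OF a'(1) c]]) (simp add: ext0_def)
   then show ?thesis using True chart_open[OF c] by blast
  next
   case False
   have o: "open (- \<phi> ` K)" by (rule open_Compl[OF compact_imp_closed[OF co]])
   have "Ck_on k (- \<phi> ` K) (ext0 U \<phi> a)"
    by (rule Ck_on_cong[OF o, of "%_. 0"]) (use z in auto)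
   then show ?thesis using False K o by blast
  qed
 qed
qed

lemma ext0_integrable:
 assumes "compact_space T" "(U, \<phi>) : A" "supp_in K a" "K <= U"
 shows "integrable lborel (ext0 U \<phi> a)" "continuous_on UNIV (ext0 U \<phi> a)"
proof -
 show co: "continuous_on UNIV (ext0 U \<phi> a)" using ext0_smooth(1)[OF assms, of 0] by simp
 show "integrable lborel (ext0 U \<phi> a)" by (rule compact_support_integrable[OF co ext0_smooth(2,3)[OF assms]])
qed

definition chart_int :: "'m set => ('m => 'e) => ('m => real) => real" where
 "chart_int U \<phi> a = integral\<^sup>L lborel (ext0 U \<phi> a)"

lemma chart_int_derivative:
 assumes comp: "compact_space T" and c: "(U, \<phi>) : A" and a: "supp_in K a" and K: "K <= U"
 shows "chart_int U \<phi> (%q. cvec U \<phi> q b a) = 0"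
  and "integrable lborel (ext0 U \<phi> (%q. cvec U \<phi> q b a))"
proof -
 let ?F = "ext0 U \<phi> a"
 note E = ext0_smooth[OF comp c a K]
 have as: "a : SF" using a by (simp add: supp_in_def)
 let ?F' = "%y. FD ?F (at y) b"
 have dF: "(?F has_derivative FD ?F (at y)) (at y)" for y
  using E(1)[of 1] by (simp add: frechet_derivative_works)
 have dd: "?F differentiable at y" for y using dF by (rule differentiableI)
 have cF': "continuous_on UNIV ?F'" using E(1)[of 1] by simp
 have off: "?F' y = 0" if "y ~: \<phi> ` K" for y
 proof -
  have o: "open (- \<phi> ` K)" by (rule open_Compl[OF compact_imp_closed[OF E(2)]])
  have "FD ?F (at y) = FD (%_. 0) (at y)"
   by (rule frechet_derivative_transform_within_open[OF _ o]) (use that E(3) dd in auto)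
  then show ?thesis by simp
 qed
 have eq: "ext0 U \<phi> (%q. cvec U \<phi> q b a) = ?F'"
 proof
  fix y
  show "ext0 U \<phi> (%q. cvec U \<phi> q b a) y = ?F' y"
  proof (cases "y : \<phi> ` U")
   case True
   have "FD ?F (at y) = FD (a \<circ> inv_into U \<phi>) (at y)"
    by (rule frechet_derivative_transform_within_open[OF _ chart_open[OF c] True])
     (use dd in \<open>auto simp: ext0_def\<close>)
   then show ?thesis using True as by (simp add: ext0_def cvec_def f_inv_into_f)
  next
   case False
   then show ?thesis using off[of y] K by (auto simp: ext0_def)
  qed
 qed
 show "integrable lborel (ext0 U \<phi> (%q. cvec U \<phi> q b a))"
  unfolding eq by (rule compact_support_integrable[OF cF' E(2) off])
 show "chart_int U \<phi> (%q. cvec U \<phi> q b a) = 0"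
  unfolding chart_int_def eq
 proof (rule integral_partial_derivative[where F="?F" and b=b, OF _ _ cF' E(2,3) off])
  show "continuous_on UNIV ?F" using E(1)[of 0] by simp
  fix y t
  have "((%t. y + t *\<^sub>R b) has_derivative (%s. s *\<^sub>R b)) (at t)" by (auto intro!: derivative_eq_intros)
  from diff_chain_at[OF this dF]
  have "((%t. ?F (y + t *\<^sub>R b)) has_derivative (%s. FD ?F (at (y + t *\<^sub>R b)) (s *\<^sub>R b))) (at t)"
   by (simp add: o_def)
  moreover have "FD ?F (at (y + t *\<^sub>R b)) (s *\<^sub>R b) = ?F' (y + t *\<^sub>R b) * s" for s
   using linear_scale[OF has_derivative_linear[OF dF]] by simp
  ultimately show "((%t. ?F (y + t *\<^sub>R b)) has_real_derivative ?F' (y + t *\<^sub>R b)) (at t)"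
   by (simp add: has_field_derivative_def)
 qed
qed

lemma ext0_sum: "ext0 U \<phi> (%q. \<Sum>i\<in>I. a i q) = (%y. \<Sum>i\<in>I. ext0 U \<phi> (a i) y)"
 by (rule ext) (simp add: ext0_def)

end

text \<open>A nowhere vanishing form of top degree that is constant on suitable orthonormal frames.\<close>
locale volume = riem A g for A :: "('m, 'e::euclidean_space) atlas" and g +
 fixes \<mu> :: "'m form"
 assumes comp: "compact_space (manifold_topology A)"
  and alt: "alt_form q (DIM('e)) (\<mu> q)"
  and vsm: "length Xs = DIM('e) ==> (!!X. X : set Xs ==> vector_field A X) ==>
   (%q. \<mu> q (map (%X. X q) Xs)) : smooth_functions A"
  and unimod: "EX U e k. orthonormal_frame A g p U e & k ~= 0 & (ALL q:U. \<mu> q (map (%i. e i q) [0..<DIM('e)]) = k)"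
begin

text \<open>
 The density of the volume form in a chart. Its sign may vary from chart to chart; the integral uses
 its absolute value.
\<close>
definition dens :: "'m set => ('m => 'e) => 'm => real" where
 "dens U \<phi> q = \<mu> q (map (cvec U \<phi> q) basis_list)"

lemma dens_nonzero: assumes c: "(U, \<phi>) : A" and q: "q : U" shows "dens U \<phi> q ~= 0"
proof
 assume 0: "dens U \<phi> q = 0"
 obtain W x E where W: "q : W" "coords_on U \<phi> W x E" using coords_on_exists[OF c q] by blast
 have z: "\<mu> q vs = 0" for vs
 proof (rule alt_form_basis_zero[OF alt, of "%j. cvec U \<phi> q (basis_list ! j)" q "%u j. u (x (basis_list ! j))"])
  show "cvec U \<phi> q (basis_list ! j) : TS q" for j by (rule cvec_tangent[OF c q])
  show "u = (\<Sum>j<DIM('e). (%f. u (x (basis_list ! j)) * cvec U \<phi> q (basis_list ! j) f))" if "u : TS q" for u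
   by (rule coords_expand[OF c W(2,1) that])
  show "\<mu> q (map (%j. cvec U \<phi> q (basis_list ! j)) [0..<DIM('e)]) = 0"
   using 0 unfolding dens_def map_basis_list .
 qed
 obtain V e k where "frame q V e" "k ~= 0" "ALL r:V. \<mu> r (map (%i. e i r) [0..<DIM('e)]) = k" using unimod by blast
 then show False using z frameD(2) by metis
qed

lemma dens_smooth:
 assumes x: "coords_on U \<phi> W x E"
 obtains m where "m : SF" "!!q. q : W ==> dens U \<phi> q = m q" "m = (%q. \<mu> q (map (%X. X q) (map E basis_list)))"
proof -
 let ?m = "%q. \<mu> q (map (%X. X q) (map E basis_list))"
 have "?m : SF" by (rule vsm) (use coords_onD(4)[OF x] in auto)
 moreover have "dens U \<phi> q = ?m q" if "q : W" for q
  unfolding dens_def using coords_onD(6)[OF x that] by (simp add: o_def)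
 ultimately show thesis using that by blast
qed

lemma abs_locally_smooth:
 assumes m: "m : SF" and q: "m q ~= 0"
 shows "EX V sg. openin T V & q : V & (ALL r:V. \<bar>m r\<bar> = sg * m r)"
proof (cases "m q > 0")
 case True
 then show ?thesis using openin_smooth_positive[OF m]
  by (intro exI[of _ "{q : C. m q > 0}"] exI[of _ 1]) auto
next
 case False
 then show ?thesis using openin_smooth_positive[OF smooth_minus[OF m]] q
  by (intro exI[of _ "{q : C. - m q > 0}"] exI[of _ "-1"]) auto
qed

lemma supp_times_dens:
 assumes c: "(U, \<phi>) : A" and a: "supp_in K a" and K: "K <= U"
 shows "supp_in K (%q. a q * \<bar>dens U \<phi> q\<bar>)"
proof -
 have a': "a : SF" "closedin T K" "!!q. q ~: K ==> a q = 0" using a by (auto simp: supp_in_def)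
 have "(%q. a q * \<bar>dens U \<phi> q\<bar>) : SF"
 proof (rule smooth_local)
  fix p
  show "EX W s. openin T W & p : W & s : SF & (ALL q:W. a q * \<bar>dens U \<phi> q\<bar> = s q)"
  proof (cases "p : K")
   case True
   then have p: "p : U" using K by blast
   obtain W x E where W: "p : W" "coords_on U \<phi> W x E" using coords_on_exists[OF c p] by blast
   obtain m where m: "m : SF" "!!q. q : W ==> dens U \<phi> q = m q" using dens_smooth[OF W(2)] by metis
   have "m p ~= 0" using m(2)[OF W(1)] dens_nonzero[OF c p] by simp
   then obtain V sg where V: "openin T V" "p : V" "ALL r:V. \<bar>m r\<bar> = sg * m r" using abs_locally_smooth[OF m(1)] by blast
   have "(%q. a q * (sg * m q)) : SF" by (intro smooth_mult a'(1) m(1) smooth_const)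
   then show ?thesis using V W coords_onD(1)[OF W(2)] m(2)
    by (intro exI[of _ "V \<inter> W"] exI[of _ "%q. a q * (sg * m q)"]) (auto intro: openin_Int)
  next
   case False
   have "openin T (C - K)" using a'(2) by (metis closedin_def topspace_T)
   then show ?thesis using False a'(3) by (intro exI[of _ "C - K"] exI[of _ "%q. 0"]) auto
  qed
 qed
 then show ?thesis using a' by (simp add: supp_in_def)
qed

definition vint :: "('m, 'e) chart => ('m => real) => real" where
 "vint c a = chart_int (fst c) (snd c) (%q. a q * \<bar>dens (fst c) (snd c) q\<bar>)"

lemma vint_integrable:
 assumes c: "c : A" and a: "supp_in K a" and K: "K <= fst c"
 shows "integrable lborel (ext0 (fst c) (snd c) (%q. a q * \<bar>dens (fst c) (snd c) q\<bar>))"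
  "continuous_on UNIV (ext0 (fst c) (snd c) (%q. a q * \<bar>dens (fst c) (snd c) q\<bar>))"
proof -
 have c': "(fst c, snd c) : A" using c by simp
 show "integrable lborel (ext0 (fst c) (snd c) (%q. a q * \<bar>dens (fst c) (snd c) q\<bar>))"
  "continuous_on UNIV (ext0 (fst c) (snd c) (%q. a q * \<bar>dens (fst c) (snd c) q\<bar>))"
  using ext0_integrable[OF comp c' supp_times_dens[OF c' a K] K] by blast+
qed

lemma vint_sum:
 assumes c: "c : A" and a: "!!i. i : I ==> supp_in (K i) (a i)" "!!i. i : I ==> K i <= fst c"
 shows "vint c (%q. \<Sum>i\<in>I. a i q) = (\<Sum>i\<in>I. vint c (a i))"
proof -
 have "ext0 (fst c) (snd c) (%q. (\<Sum>i\<in>I. a i q) * \<bar>dens (fst c) (snd c) q\<bar>) =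
   (%y. \<Sum>i\<in>I. ext0 (fst c) (snd c) (%q. a i q * \<bar>dens (fst c) (snd c) q\<bar>) y)"
  by (rule ext) (simp add: ext0_def sum_distrib_right)
 then show ?thesis unfolding vint_def chart_int_def
  using Bochner_Integration.integral_sum[of I lborel "%i. ext0 (fst c) (snd c) (%q. a i q * \<bar>dens (fst c) (snd c) q\<bar>)"]
   vint_integrable(1)[OF c a] by simp
qed

lemma vint_cmult: "vint c (%q. r * a q) = r * vint c a"
proof -
 have "ext0 (fst c) (snd c) (%q. r * a q * \<bar>dens (fst c) (snd c) q\<bar>) =
   (%y. r * ext0 (fst c) (snd c) (%q. a q * \<bar>dens (fst c) (snd c) q\<bar>) y)"
  by (rule ext) (simp add: ext0_def)
 then show ?thesis unfolding vint_def chart_int_def by simp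
qed

lemma vint_add:
 assumes c: "c : A" and a: "supp_in K a" "K <= fst c" and b: "supp_in L b" "L <= fst c"
 shows "vint c (%q. a q + b q) = vint c a + vint c b"
proof -
 have "ext0 (fst c) (snd c) (%q. (a q + b q) * \<bar>dens (fst c) (snd c) q\<bar>) =
   (%y. ext0 (fst c) (snd c) (%q. a q * \<bar>dens (fst c) (snd c) q\<bar>) y + ext0 (fst c) (snd c) (%q. b q * \<bar>dens (fst c) (snd c) q\<bar>) y)"
  by (rule ext) (simp add: ext0_def distrib_right)
 then show ?thesis unfolding vint_def chart_int_def using vint_integrable(1)[OF c a] vint_integrable(1)[OF c b] by simp
qed

text \<open>
 Both sides are integrals over the overlap of the two charts, related by a change of variables.
\<close>
lemma vint_chart_independent:
 assumes c: "c : A" and d: "d : A" and a: "supp_in K a" and K: "K <= fst c" "K <= fst d"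
 shows "vint c a = vint d a"
proof -
 obtain U \<phi> V \<psi> where cd: "c = (U, \<phi>)" "d = (V, \<psi>)" by (cases c; cases d) auto
 have c': "(U, \<phi>) : A" and d': "(V, \<psi>) : A" using c d cd by auto
 let ?S = "\<phi> ` (U \<inter> V)" and ?\<tau> = "\<psi> \<circ> inv_into U \<phi>"
 let ?h = "ext0 V \<psi> (%q. a q * \<bar>dens V \<psi> q\<bar>)" and ?k = "ext0 U \<phi> (%q. a q * \<bar>dens U \<phi> q\<bar>)"
 have im: "?\<tau> ` ?S = \<psi> ` (U \<inter> V)" using inv_chart[OF c'] by (auto simp: image_iff)
 have "integral\<^sup>L lborel ?k = integral\<^sup>L lborel ?h"
 proof (rule change_of_variables_euclidean[where \<tau>="?\<tau>" and S="?S" and \<tau>'="%y. FD ?\<tau> (at y)"])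
  show "(?\<tau> has_derivative FD ?\<tau> (at y)) (at y)" if "y : ?S" for y
  proof -
   have "?\<tau> differentiable at y" using transition_smooth[OF c' d', of 1] that unfolding One_nat_def Ck_on.simps by blast
   then show ?thesis by (simp add: frechet_derivative_works)
  qed
  show "inj_on ?\<tau> ?S"
  proof (rule inj_onI)
   fix y z assume yz: "y : ?S" "z : ?S" "?\<tau> y = ?\<tau> z"
   then obtain q r where q: "q : U" "q : V" "y = \<phi> q" "r : U" "r : V" "z = \<phi> r" by blast
   then have "\<psi> q = \<psi> r" using yz inv_chart[OF c'] by simp
   then have "q = r" using chart_inj[OF d'] q by (auto simp: inj_on_def)
   then show "y = z" using q by simp
  qed
  show "open ?S" by (rule transition_open[OF c' d'])
  show "integrable lborel ?h" "integrable lborel ?k"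
   using vint_integrable(1)[OF d a K(2)] vint_integrable(1)[OF c a K(1)] cd by auto
  show "?h y = 0" if "y ~: ?\<tau> ` ?S" for y
   by (rule ext0_smooth(3)[OF comp d' supp_times_dens[OF d' a] _]) (use that[unfolded im] K cd in auto)
  show "?k y = 0" if "y ~: ?S" for y
   by (rule ext0_smooth(3)[OF comp c' supp_times_dens[OF c' a] _]) (use that K cd in auto)
  show "?k y = \<bar>det (matrix_of (FD ?\<tau> (at y)))\<bar> * ?h (?\<tau> y)" if y: "y : ?S" for y
  proof -
   obtain q where q: "q : U" "q : V" "y = \<phi> q" using y by blast
   have t: "?\<tau> y = \<psi> q" using q inv_chart[OF c' q(1)] by simp
   have "dens U \<phi> q = det (matrix_of (FD ?\<tau> (at y))) * dens V \<psi> q"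
    unfolding dens_def q(3) by (rule top_form_transition[where \<mu>=\<mu> and p=q, OF alt c' d' q(1,2)])
   then show ?thesis unfolding t using q inv_chart[OF c' q(1)] inv_chart[OF d' q(2)]
    by (simp add: ext0_def abs_mult)
  qed
 qed
 then show ?thesis unfolding vint_def chart_int_def cd by simp
qed

lemma dv_zero: "dv 0 p = 0"
proof -
 have "fscale (%_. 0) 0 = (0 :: 'm vfield)" by (intro ext) (simp add: fscale_def)
 then show ?thesis using dv_fscale[OF VF_zero smooth_const[of 0]] by simp
qed

lemma dv_zero_off:
 assumes Z: "VF Z" and K: "closedin T K" "!!q. q ~: K ==> Z q = 0" and q: "q ~: K"
 shows "dv Z q = 0"
proof -
 have o: "openin T (C - K)" using K(1) by (metis closedin_def topspace_T)
 have qin: "q : C - K" using q by simp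
 obtain th L V where th: "th : SF" "L <= C - K" "q : V" "!!r. r : V ==> th r = 1" "!!r. r ~: L ==> th r = 0"
  using bump[OF o qin] by metis
 have "fscale th Z = 0"
 proof (intro ext)
  fix r f
  show "fscale th Z r f = 0 r f" using th(2) th(5)[of r] K(2)[of r] by (cases "r : K") (auto simp: fscale_def)
 qed
 then show ?thesis using dv_fscale[OF Z th(1), of q] dv_zero th(3,4) K(2)[OF q] by simp
qed

text \<open>
 The divergence formula \<open>dv Z = 1/m \<Sum>\<^sub>i \<partial>\<^sub>i (m z\<^sub>i)\<close>. It
 follows from \<open>lie_derivative_volume\<close>, because coordinate fields commute and so
 \<open>Lie Z \<partial>\<^sub>i\<close> only involves the derivatives of the components of
 \<open>Z\<close>.
\<close>
lemma divergence_in_coords: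
 assumes c: "(U, \<phi>) : A" and x: "coords_on U \<phi> W x E" and q: "q : W" and Z: "VF Z"
  and m: "m = (%q. \<mu> q (map (%X. X q) (map E basis_list)))"
 shows "dv Z q * m q = (\<Sum>i<DIM('e). E (basis_list ! i) q (%r. Z r (x (basis_list ! i)) * m r))"
proof -
 note x' = coords_onD[OF x]
 let ?e = "%i. E (basis_list ! i)" and ?z = "%i r. Z r (x (basis_list ! i))"
 let ?Xs = "map E basis_list"
 have VXs: "length ?Xs = DIM('e)" "!!X. X : set ?Xs ==> VF X" using x'(4) by auto
 have ms: "m : SF" unfolding m by (rule vsm[OF VXs])
 have zs: "?z i : SF" for i by (rule VF_smooth[OF Z x'(3)])
 obtain V e k where e: "frame q V e" "!!r. r : V ==> \<mu> r (map (%i. e i r) [0..<DIM('e)]) = k" using unimod by blast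
 have L: "Z q m = (\<Sum>i<DIM('e). \<mu> q ((map (%X. X q) ?Xs)[i := Lie Z (?Xs ! i) q])) + dv Z q * m q"
  unfolding m by (rule lie_derivative_volume[OF alt vsm e Z VXs])
 have sub: "set (map (%X. X q) ?Xs) <= TS q" using VXs(2) VF_tangent by auto
 have slot: "\<mu> q ((map (%X. X q) ?Xs)[i := Lie Z (?Xs ! i) q]) = - ?e i q (?z i) * m q" if i: "i < DIM('e)" for i
 proof -
  let ?vs = "map (%X. X q) ?Xs"
  have "Lie Z (?Xs ! i) q = (\<Sum>j<DIM('e). (%f. - ?e i q (?z j) * (?vs ! j) f))"
   using bracket_coords[OF c x q Z, of "basis_list ! i"] i by simp
  then have "\<mu> q (?vs[i := Lie Z (?Xs ! i) q]) = \<mu> q (?vs[i := (\<Sum>j<DIM('e). (%f. - ?e i q (?z j) * (?vs ! j) f))])" by simp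
  also have "... = - ?e i q (?z i) * \<mu> q ?vs" by (rule alt_form_slot_diag[OF alt _ sub i]) simp
  finally show ?thesis by (simp add: m)
 qed
 have "Z q m = (\<Sum>i<DIM('e). ?z i q * ?e i q m)"
  using fun_cong[OF coords_expand[OF c x q VF_tangent[OF Z]], of m] x'(6)[OF q] by (simp add: sum_tvec_apply)
 then have "dv Z q * m q = (\<Sum>i<DIM('e). ?z i q * ?e i q m) + (\<Sum>i<DIM('e). ?e i q (?z i) * m q)"
  using L slot by (simp add: sum_negf)
 also have "... = (\<Sum>i<DIM('e). ?e i q (%r. ?z i r * m r))"
  unfolding sum.distrib[symmetric]
  by (rule sum.cong[OF refl]) (simp only: VF_mult_arg[OF x'(4) zs ms], simp add: algebra_simps)
 finally show ?thesis .
qed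

text \<open>A divergence is a sum of partial derivatives of compactly supported functions.\<close>
lemma vint_divergence:
 assumes c: "(U, \<phi>) : A" and x: "coords_on U \<phi> W x E" and K: "closedin T K" "K <= W"
  and Z: "VF Z" "!!q. q ~: K ==> Z q = 0"
 shows "vint (U, \<phi>) (dv Z) = 0"
proof -
 note x' = coords_onD[OF x]
 obtain m where m: "m : SF" "!!q. q : W ==> dens U \<phi> q = m q" and md: "m = (%q. \<mu> q (map (%X. X q) (map E basis_list)))"
  by (rule dens_smooth[OF x], rule that)
 have m0: "m q ~= 0" if "q : W" for q using m(2)[OF that] dens_nonzero[OF c] that x'(2) by force
 let ?b = "%i. basis_list ! i :: 'e"
 let ?z = "%i r. Z r (x (?b i))"
 have zs: "?z i : SF" for i by (rule VF_smooth[OF Z(1) x'(3)])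
 have z0: "?z i r = 0" if "r ~: K" for i r using Z(2)[OF that] by simp
 define a where "a i q = ?z i q * \<bar>m q\<bar>" for i q
 have oK: "openin T (C - K)" using K(1) by (metis closedin_def topspace_T)
 have as: "a i : SF" for i
 proof (rule smooth_local)
  fix p
  show "EX N s. openin T N & p : N & s : SF & (ALL q:N. a i q = s q)"
  proof (cases "p : K")
   case True
   then have "m p ~= 0" using m0 K by blast
   then obtain V sg where V: "openin T V" "p : V" "ALL r:V. \<bar>m r\<bar> = sg * m r" using abs_locally_smooth[OF m(1)] by blast
   have "(%q. ?z i q * (sg * m q)) : SF" by (intro smooth_mult zs m(1) smooth_const)
   then show ?thesis using V by (intro exI[of _ V] exI[of _ "%q. ?z i q * (sg * m q)"]) (auto simp: a_def)
  next
   case False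
   then show ?thesis using oK z0 by (intro exI[of _ "C - K"] exI[of _ "%_. 0"]) (auto simp: a_def)
  qed
 qed
 have supp: "supp_in K (a i)" for i using as K(1) z0 by (simp add: supp_in_def a_def)
 have KU: "K <= U" using K x'(2) by blast
 have key: "dv Z q * \<bar>dens U \<phi> q\<bar> = (\<Sum>i<DIM('e). cvec U \<phi> q (?b i) (a i))" if q: "q : U" for q
 proof (cases "q : K")
  case True
  then have qW: "q : W" using K by blast
  obtain V sg where V: "openin T V" "q : V" "ALL r:V. \<bar>m r\<bar> = sg * m r" using abs_locally_smooth[OF m(1) m0[OF qW]] by blast
  have e1: "E (?b i) q (a i) = sg * E (?b i) q (%r. ?z i r * m r)" for i
  proof -
   have s: "(%r. ?z i r * m r) : SF" by (rule smooth_mult[OF zs m(1)])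
   have "E (?b i) q (a i) = E (?b i) q (%r. sg * (?z i r * m r))"
    by (rule VF_local_arg[OF x'(4) as smooth_mult[OF smooth_const s] V(1,2)]) (use V(3) in \<open>simp add: a_def\<close>)
   then show ?thesis using VF_cmult_arg[OF x'(4) s] by simp
  qed
  have "(\<Sum>i<DIM('e). cvec U \<phi> q (?b i) (a i)) = (\<Sum>i<DIM('e). sg * E (?b i) q (%r. ?z i r * m r))"
   using e1 x'(6)[OF qW] by simp
  also have "... = sg * (dv Z q * m q)"
   unfolding divergence_in_coords[OF c x qW Z(1) md] by (simp add: sum_distrib_left)
  also have "... = dv Z q * \<bar>m q\<bar>" using V by simp
  finally show ?thesis using m(2)[OF qW] by simp
 next
  case False
  have "cvec U \<phi> q (?b i) (a i) = 0" for i
  proof -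
   have "cvec U \<phi> q (?b i) (a i) = cvec U \<phi> q (?b i) (%_. 0)"
    by (rule tangent_local[OF cvec_tangent[OF c q] as smooth_const oK]) (use False z0 in \<open>auto simp: a_def\<close>)
   then show ?thesis using tangent_zero[OF cvec_tangent[OF c q]] by simp
  qed
  then show ?thesis using dv_zero_off[OF Z(1) K(1) Z(2) False] by simp
 qed
 have "ext0 U \<phi> (%q. dv Z q * \<bar>dens U \<phi> q\<bar>) = ext0 U \<phi> (%q. \<Sum>i<DIM('e). cvec U \<phi> q (?b i) (a i))"
 proof
  fix y
  show "ext0 U \<phi> (%q. dv Z q * \<bar>dens U \<phi> q\<bar>) y = ext0 U \<phi> (%q. \<Sum>i<DIM('e). cvec U \<phi> q (?b i) (a i)) y"
   using key[of "inv_into U \<phi> y"] inv_into_into[of y \<phi> U] by (auto simp: ext0_def)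
 qed
 then have "vint (U, \<phi>) (dv Z) = integral\<^sup>L lborel (%y. \<Sum>i<DIM('e). ext0 U \<phi> (%q. cvec U \<phi> q (?b i) (a i)) y)"
  by (simp add: vint_def chart_int_def ext0_sum)
 also have "... = (\<Sum>i<DIM('e). chart_int U \<phi> (%q. cvec U \<phi> q (?b i) (a i)))"
  unfolding chart_int_def
  by (rule Bochner_Integration.integral_sum) (rule chart_int_derivative(2)[OF comp c supp KU])
 also have "... = 0" using chart_int_derivative(1)[OF comp c supp KU] by simp
 finally show ?thesis .
qed

section \<open>Partitions of unity\<close>

text \<open>
 The support is required to lie in the domain of cut-off coordinates, where
 \<open>vint_divergence\<close> applies.
\<close>
definition good_chart :: "('m, 'e) chart => 'm set => bool" where
 "good_chart c K \<longleftrightarrow> c : A & (EX W x E. coords_on (fst c) (snd c) W x E & K <= W)"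

definition is_partition :: "nat => (nat => ('m, 'e) chart) => (nat => 'm => real) => (nat => 'm set) => bool" where
 "is_partition n c th K \<longleftrightarrow>
   (ALL i<n. good_chart (c i) (K i) & supp_in (K i) (th i) & (ALL q. th i q \<ge> 0)) & (ALL q. (\<Sum>i<n. th i q) = 1)"

definition is_bump :: "'m => ('m, 'e) chart => ('m => real) => 'm set => 'm set => bool" where
 "is_bump p c th K V \<longleftrightarrow> good_chart c K & supp_in K th & (ALL q. th q \<ge> 0) & openin T V & p : V & (ALL q:V. th q = 1)"

lemma is_bump_exists: "EX c th K V. is_bump p c th K V"
proof -
 obtain U \<phi> where c: "(U, \<phi>) : A" "p : U" using carrier_chart[of p] by auto
 obtain W x E where W: "p : W" "coords_on U \<phi> W x E" using coords_on_exists[OF c] by blast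
 have "EX th K V. th : SF & closedin T K & K <= W & openin T V & p : V & V <= K &
  (ALL q. q : V --> th q = 1) & (ALL q. q ~: K --> th q = 0) & (ALL q. 0 \<le> th q) & (ALL q. th q \<le> 1)"
  by (rule bump_ex[OF coords_onD(1)[OF W(2)] W(1)])
 then obtain th K V where th: "th : SF" "closedin T K" "K <= W" "openin T V" "p : V"
  "ALL q. q : V --> th q = 1" "ALL q. q ~: K --> th q = 0" "ALL q. 0 \<le> th q" by (elim exE conjE) (rule that)
 have "good_chart (U, \<phi>) K" unfolding good_chart_def using c W th(3) by auto
 then have "is_bump p (U, \<phi>) th K V" unfolding is_bump_def supp_in_def using th by simp
 then show ?thesis by blast
qed

lemma partition_exists: "EX n c th K. is_partition n c th K"
proof -
 have "ALL p. EX d. is_bump p (fst d) (fst (snd d)) (fst (snd (snd d))) (snd (snd (snd d)))"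
  using is_bump_exists by (metis fst_conv snd_conv)
 then obtain d where d: "!!p. is_bump p (fst (d p)) (fst (snd (d p))) (fst (snd (snd (d p)))) (snd (snd (snd (d p))))"
  by metis
 define c where "c p = fst (d p)" for p
 define th where "th p = fst (snd (d p))" for p
 define K where "K p = fst (snd (snd (d p)))" for p
 define V where "V p = snd (snd (snd (d p)))" for p
 have b: "is_bump p (c p) (th p) (K p) (V p)" for p using d by (simp add: c_def th_def K_def V_def)
 have "(\<Union>p. V p) = C" using b total unfolding is_bump_def by blast
 have oV: "openin T W" if "W : range V" for W using b that unfolding is_bump_def by blast
 have "EX \<F>. finite \<F> & \<F> <= range V & C <= \<Union>\<F>"
  using compactinD[OF comp[unfolded compact_space_def] oV] \<open>(\<Union>p. V p) = C\<close> by simp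
 then obtain \<F> where "finite \<F>" "\<F> <= range V" "C <= \<Union>\<F>" by blast
 then have F: "finite \<F>" "\<F> <= range V" "\<Union>\<F> = C" using total by auto
 obtain P where P: "finite P" "\<F> = V ` P" using finite_subset_image[OF F(1,2)] by blast
 obtain h where h: "bij_betw h {0..<card P} P" using ex_bij_betw_nat_finite[OF P(1)] by blast
 let ?n = "card P"
 let ?s = "%q. \<Sum>i<?n. th (h i) q"
 have sb: "supp_in (K p) (th p)" "th p q \<ge> 0" "good_chart (c p) (K p)" for p q using b unfolding is_bump_def by blast+
 have ts: "th p : SF" for p using sb(1) by (simp add: supp_in_def)
 have pos: "?s q > 0" for q
 proof -
  obtain p where p: "p : P" "q : V p" using F(3) P(2) total by (metis UNIV_I UN_E)
  then have "p : h ` {0..<?n}" using h by (simp add: bij_betw_def)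
  then obtain i where i: "i < ?n" "h i = p" by auto
  have "1 = th (h i) q" using b[of p] p i unfolding is_bump_def by simp
  also have "... \<le> ?s q" by (rule member_le_sum) (use i sb(2) in auto)
  finally show ?thesis by simp
 qed
 have ss: "?s : SF" by (rule smooth_sum) (rule ts)
 have inv: "(%q. inverse (?s q)) : SF"
  by (rule smooth_comp[OF ss _ _ Ck_on_inverse]) (use pos in \<open>auto simp: open_Compl, metis less_irrefl\<close>)
 define th' where "th' i q = th (h i) q * inverse (?s q)" for i q
 have "is_partition ?n (%i. c (h i)) th' (%i. K (h i))"
  unfolding is_partition_def
 proof (intro conjI allI impI)
  fix i q
  show "good_chart (c (h i)) (K (h i))" by (rule sb(3))
  show "supp_in (K (h i)) (th' i)"
   using sb(1)[of "h i"] smooth_mult[OF ts[of "h i"] inv] unfolding supp_in_def th'_def[abs_def] by auto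
  show "0 \<le> th' i q" using sb(2)[of "h i" q] pos[of q] by (simp add: th'_def)
 next
  fix q
  have "(\<Sum>i<?n. th' i q) = ?s q * inverse (?s q)" unfolding th'_def sum_distrib_right ..
  then show "(\<Sum>i<?n. th' i q) = 1" using pos[of q] by simp
 qed
 then show ?thesis by blast
qed

lemma supp_in_mult: "supp_in K a ==> u : SF ==> supp_in K (%q. a q * u q)"
 by (auto simp: supp_in_def intro: smooth_mult)

lemma supp_in_mult2: "supp_in K a ==> supp_in L b ==> supp_in (K \<inter> L) (%q. a q * b q)"
 by (auto simp: supp_in_def intro: smooth_mult closedin_Int)

lemma vint_partition:
 assumes c: "c : A" and P: "!!q. (\<Sum>j\<in>I. \<eta> j q) = 1"
  and s: "!!j. j : I ==> supp_in (K j) (%q. \<eta> j q * v q) & K j <= fst c"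
 shows "vint c v = (\<Sum>j\<in>I. vint c (%q. \<eta> j q * v q))"
proof -
 have "v q = (\<Sum>j\<in>I. \<eta> j q * v q)" for q using P[of q] by (simp add: sum_distrib_right[symmetric])
 then have "vint c v = vint c (%q. \<Sum>j\<in>I. \<eta> j q * v q)" by (rule arg_cong[OF ext])
 also have "... = (\<Sum>j\<in>I. vint c (%q. \<eta> j q * v q))" by (rule vint_sum[OF c]) (use s in blast)+
 finally show ?thesis .
qed

lemma partitions_agree:
 assumes I: "!!i. i : I ==> c i : A & supp_in (K i) (th i) & K i <= fst (c i)" "!!q. (\<Sum>i\<in>I. th i q) = 1"
  and I': "!!j. j : I' ==> d j : A & supp_in (L j) (\<eta> j) & L j <= fst (d j)" "!!q. (\<Sum>j\<in>I'. \<eta> j q) = 1"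
  and u: "u : SF"
 shows "(\<Sum>i\<in>I. vint (c i) (%q. th i q * u q)) = (\<Sum>j\<in>I'. vint (d j) (%q. \<eta> j q * u q))"
proof -
 have s: "supp_in (K i \<inter> L j) (%q. \<eta> j q * (th i q * u q))" if "i : I" "j : I'" for i j
  using supp_in_mult[OF supp_in_mult2[of "K i" "th i" "L j" "\<eta> j"] u] I(1) I'(1) that by (simp add: ac_simps)
 have "(\<Sum>i\<in>I. vint (c i) (%q. th i q * u q)) = (\<Sum>i\<in>I. \<Sum>j\<in>I'. vint (c i) (%q. \<eta> j q * (th i q * u q)))"
  by (rule sum.cong[OF refl], rule vint_partition[OF _ I'(2), where K="%j. K _ \<inter> L j"]) (use I(1) s in blast)+
 also have "... = (\<Sum>i\<in>I. \<Sum>j\<in>I'. vint (d j) (%q. \<eta> j q * (th i q * u q)))"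
  by (intro sum.cong refl vint_chart_independent[OF _ _ s]) (use I(1) I'(1) in auto)
 also have "... = (\<Sum>j\<in>I'. \<Sum>i\<in>I. vint (d j) (%q. th i q * (\<eta> j q * u q)))" by (subst sum.swap) (simp add: ac_simps)
 also have "... = (\<Sum>j\<in>I'. vint (d j) (%q. \<eta> j q * u q))"
 proof (rule sum.cong[OF refl], rule vint_partition[OF _ I(2), symmetric])
  show "supp_in (K i \<inter> L j) (%q. th i q * (\<eta> j q * u q)) & K i \<inter> L j <= fst (d j)" if "i : I" "j : I'" for i j
   using s[OF that] I'(1)[OF that(2)] by (auto simp: ac_simps)
 qed (use I'(1) in auto)
 finally show ?thesis .
qed

lemma good_chartD: "good_chart c K ==> c : A" "good_chart c K ==> K <= fst c"
 unfolding good_chart_def by (auto dest: coords_onD(2))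

definition chart_sum :: "nat set => (nat => ('m, 'e) chart) => (nat => 'm => real) => ('m => real) => real" where
 "chart_sum I c th u = (\<Sum>i\<in>I. LINT y : snd (c i) ` fst (c i) | lborel.
      (let p = inv_into (fst (c i)) (snd (c i)) y; bs = coord_vectors A (c i) p
      in sgn (\<mu> p bs) * th i p * fscale u \<mu> p bs))"

lemma partition_integral:
 assumes P: "partition_of_unity A I c th" and Q: "is_partition n d \<eta> L" and u: "u : SF"
 shows "chart_sum I c th u = (\<Sum>j<n. vint (d j) (%q. \<eta> j q * u q))"
proof -
 have P': "finite I" "!!i. i : I ==> c i : A" "!!i. i : I ==> th i : SF"
  "!!i. i : I ==> T closure_of {p : C. th i p ~= 0} <= fst (c i)" "!!p. (\<Sum>i\<in>I. th i p) = 1"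
  using P by (auto simp: partition_of_unity_def)
 let ?K = "%i. T closure_of {p : C. th i p ~= 0}"
 have sI: "supp_in (?K i) (th i)" if "i : I" for i
 proof -
  have "{p : C. th i p ~= 0} <= ?K i" by (rule closure_of_subset) auto
  then show ?thesis unfolding supp_in_def using P'(3)[OF that] by auto
 qed
 have L: "(LINT y : snd (c i) ` fst (c i) | lborel.
      (let p = inv_into (fst (c i)) (snd (c i)) y; bs = coord_vectors A (c i) p
      in sgn (\<mu> p bs) * th i p * fscale u \<mu> p bs)) = vint (c i) (%q. th i q * u q)" for i
 proof -
  obtain U \<phi> where ci: "c i = (U, \<phi>)" by (cases "c i") auto
  have "indicat_real (\<phi> ` U) y *\<^sub>R (let p = inv_into U \<phi> y; bs = coord_vectors A (U, \<phi>) p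
      in sgn (\<mu> p bs) * th i p * fscale u \<mu> p bs) = ext0 U \<phi> (%q. th i q * u q * \<bar>dens U \<phi> q\<bar>) y" for y
   by (simp add: ext0_def coord_vectors_eq Let_def fscale_def dens_def abs_sgn indicator_def)
  then show ?thesis unfolding set_lebesgue_integral_def vint_def chart_int_def ci fst_conv snd_conv by simp
 qed
 have "chart_sum I c th u = (\<Sum>i\<in>I. vint (c i) (%q. th i q * u q))"
  unfolding chart_sum_def by (rule sum.cong[OF refl L])
 also have "... = (\<Sum>j<n. vint (d j) (%q. \<eta> j q * u q))"
 proof (rule partitions_agree[where K="?K" and L=L])
  show "c i : A & supp_in (?K i) (th i) & ?K i <= fst (c i)" if "i : I" for i using P' sI that by blast
  show "d j : A & supp_in (L j) (\<eta> j) & L j <= fst (d j)" if "j : {..<n}" for j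
   using Q that good_chartD unfolding is_partition_def by blast
  show "(\<Sum>j<n. \<eta> j q) = 1" for q using Q unfolding is_partition_def by blast
 qed (use P' u in auto)
 finally show ?thesis .
qed

lemma partition_of_unity_exists:
 assumes Q: "is_partition n d \<eta> L" shows "partition_of_unity A {..<n} d \<eta>"
 unfolding partition_of_unity_def
proof (intro conjI ballI)
 show "finite {..<n}" by simp
 fix i assume i: "i : {..<n}"
 then have q: "good_chart (d i) (L i)" "supp_in (L i) (\<eta> i)" "ALL q. \<eta> i q \<ge> 0" using Q unfolding is_partition_def by auto
 show "d i : A" by (rule good_chartD(1)[OF q(1)])
 show "\<eta> i : SF" using q(2) by (simp add: supp_in_def)
 show "0 \<le> \<eta> i p" for p using q(3) by blast
 have "T closure_of {p : C. \<eta> i p ~= 0} <= L i"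
  by (rule closure_of_minimal) (use q(2) in \<open>auto simp: supp_in_def\<close>)
 then show "T closure_of {p : C. \<eta> i p ~= 0} <= fst (d i)" using good_chartD(2)[OF q(1)] by blast
next
 show "(\<Sum>i<n. \<eta> i p) = 1" for p using Q unfolding is_partition_def by blast
qed

definition volume_integral :: "('m => real) => real" where
 "volume_integral u = form_integral A \<mu> (fscale u \<mu>)"

lemma volume_integral_partition:
 assumes Q: "is_partition n d \<eta> L" and u: "u : SF"
 shows "volume_integral u = (\<Sum>j<n. vint (d j) (%q. \<eta> j q * u q))"
 unfolding volume_integral_def form_integral_def chart_sum_def[symmetric]
proof (rule the_equality)
 show "ALL I c th. partition_of_unity A I c th --> (\<Sum>j<n. vint (d j) (%q. \<eta> j q * u q)) = chart_sum I c th u"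
  using partition_integral[OF _ Q u] by simp
 fix r assume r: "ALL I c th. partition_of_unity A I c th --> r = chart_sum I c th u"
 show "r = (\<Sum>j<n. vint (d j) (%q. \<eta> j q * u q))"
  using r[rule_format, OF partition_of_unity_exists[OF Q]] partition_integral[OF partition_of_unity_exists[OF Q] Q u] by simp
qed

lemma volume_integral_supp:
 assumes u: "supp_in K u" and c: "c : A" "K <= fst c"
 shows "volume_integral u = vint c u"
proof -
 obtain n d \<eta> L where Q: "is_partition n d \<eta> L" using partition_exists by blast
 have q: "good_chart (d j) (L j)" "supp_in (L j) (\<eta> j)" if "j < n" for j using Q that unfolding is_partition_def by auto
 have us: "u : SF" using u by (simp add: supp_in_def)
 have s: "supp_in (L j \<inter> K) (%q. \<eta> j q * u q)" if "j < n" for j by (rule supp_in_mult2[OF q(2)[OF that] u])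
 have "volume_integral u = (\<Sum>j<n. vint c (%q. \<eta> j q * u q))"
  unfolding volume_integral_partition[OF Q us]
  by (intro sum.cong refl vint_chart_independent[OF good_chartD(1)[OF q(1)] c(1) s] le_infI1 good_chartD(2)[OF q(1)] le_infI2 c(2)) simp_all
 also have "... = vint c (%q. \<Sum>j<n. \<eta> j q * u q)"
  by (rule vint_sum[OF c(1), where K="%j. L j \<inter> K", symmetric]) (use s c(2) in auto)
 also have "(%q. \<Sum>j<n. \<eta> j q * u q) = u"
 proof
  fix q
  have "(\<Sum>j<n. \<eta> j q) = 1" using Q unfolding is_partition_def by blast
  then show "(\<Sum>j<n. \<eta> j q * u q) = u q" by (simp add: sum_distrib_right[symmetric])
 qed
 finally show ?thesis .
qed

lemma volume_integral_add: assumes u: "u : SF" and v: "v : SF"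
 shows "volume_integral (%p. u p + v p) = volume_integral u + volume_integral v"
proof -
 obtain n d \<eta> L where Q: "is_partition n d \<eta> L" using partition_exists by blast
 have q: "good_chart (d j) (L j)" "supp_in (L j) (\<eta> j)" if "j < n" for j using Q that unfolding is_partition_def by auto
 have "vint (d j) (%q. \<eta> j q * (u q + v q)) = vint (d j) (%q. \<eta> j q * u q) + vint (d j) (%q. \<eta> j q * v q)" if j: "j < n" for j
  using vint_add[OF good_chartD(1)[OF q(1)[OF j]] supp_in_mult[OF q(2)[OF j] u] good_chartD(2)[OF q(1)[OF j]]
    supp_in_mult[OF q(2)[OF j] v] good_chartD(2)[OF q(1)[OF j]]] by (simp add: distrib_left)
 then show ?thesis
  unfolding volume_integral_partition[OF Q u] volume_integral_partition[OF Q v] volume_integral_partition[OF Q smooth_add[OF u v]]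
  by (simp add: sum.distrib)
qed

lemma volume_integral_cmult: assumes u: "u : SF"
 shows "volume_integral (%p. r * u p) = r * volume_integral u"
proof -
 obtain n d \<eta> L where Q: "is_partition n d \<eta> L" using partition_exists by blast
 have "vint (d j) (%q. \<eta> j q * (r * u q)) = r * vint (d j) (%q. \<eta> j q * u q)" for j
  using vint_cmult[of "d j" r "%q. \<eta> j q * u q"] by (simp add: mult.left_commute)
 then show ?thesis
  unfolding volume_integral_partition[OF Q u] volume_integral_partition[OF Q smooth_mult[OF smooth_const u]]
  by (simp add: sum_distrib_left)
qed

lemma volume_integral_definite:
 assumes u: "u : SF" and nn: "!!p. u p \<ge> 0" and z: "volume_integral u = 0"
 shows "u p = 0"
proof -
 obtain n d \<eta> L where Q: "is_partition n d \<eta> L" using partition_exists by blast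
 have q: "good_chart (d j) (L j)" "supp_in (L j) (\<eta> j)" "!!q. \<eta> j q \<ge> 0" if "j < n" for j
  using Q that unfolding is_partition_def by auto
 let ?F = "%j. ext0 (fst (d j)) (snd (d j)) (%q. \<eta> j q * u q * \<bar>dens (fst (d j)) (snd (d j)) q\<bar>)"
 have F0: "?F j y \<ge> 0" if "j < n" for j y using q(3)[OF that] nn by (simp add: ext0_def)
 have FI: "vint (d j) (%q. \<eta> j q * u q) = integral\<^sup>L lborel (?F j)" for j by (simp add: vint_def chart_int_def)
 have "(\<Sum>j<n. vint (d j) (%q. \<eta> j q * u q)) = 0" using z volume_integral_partition[OF Q u] by simp
 moreover have "vint (d j) (%q. \<eta> j q * u q) \<ge> 0" if "j < n" for j unfolding FI using F0[OF that] by simp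
 ultimately have J0: "vint (d j) (%q. \<eta> j q * u q) = 0" if "j < n" for j
  using sum_nonneg_eq_0_iff[of "{..<n}" "%j. vint (d j) (%q. \<eta> j q * u q)"] that by simp
 have "EX j<n. \<eta> j p ~= 0"
 proof (rule ccontr)
  assume "~ (EX j<n. \<eta> j p ~= 0)"
  then have "(\<Sum>j<n. \<eta> j p) = 0" by simp
  moreover have "(\<Sum>j<n. \<eta> j p) = 1" using Q unfolding is_partition_def by blast
  ultimately show False by simp
 qed
 then obtain j where j: "j < n" "\<eta> j p ~= 0" by blast
 note dj = good_chartD[OF q(1)[OF j(1)]]
 have "p : L j" using j q(2)[OF j(1)] unfolding supp_in_def by blast
 then have pU: "p : fst (d j)" using dj by blast
 have c': "(fst (d j), snd (d j)) : A" using dj by simp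
 have "?F j (snd (d j) p) = 0"
  by (rule continuous_nonneg_integral_zero[OF vint_integrable(2,1)[OF dj(1) supp_in_mult[OF q(2)[OF j(1)] u] dj(2)]])
   (use F0[OF j(1)] J0[OF j(1)] FI in auto)
 then show ?thesis using pU j inv_chart[OF c' pU] dens_nonzero[OF c' pU] by (simp add: ext0_def)
qed

text \<open>Split the field by a partition of unity; each part has its divergence supported in a chart.\<close>
lemma volume_integral_divergence:
 assumes Z: "VF Z" shows "volume_integral (dv Z) = 0"
proof -
 obtain n d \<eta> L where Q: "is_partition n d \<eta> L" using partition_exists by blast
 have q: "good_chart (d j) (L j)" "supp_in (L j) (\<eta> j)" if "j < n" for j using Q that unfolding is_partition_def by auto
 have es: "\<eta> j : SF" if "j < n" for j using q(2)[OF that] by (simp add: supp_in_def)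
 have VZ: "VF (fscale (\<eta> j) Z)" if "j < n" for j by (rule VF_fscale[OF es[OF that] Z])
 have z: "volume_integral (dv (fscale (\<eta> j) Z)) = 0" if j: "j < n" for j
 proof -
  note dj = good_chartD[OF q(1)[OF j]]
  have c': "(fst (d j), snd (d j)) : A" using dj by simp
  have L: "closedin T (L j)" "!!r. r ~: L j ==> fscale (\<eta> j) Z r = 0"
   using q(2)[OF j] unfolding supp_in_def fscale_def by (auto simp: zero_fun_def)
  have supp: "supp_in (L j) (dv (fscale (\<eta> j) Z))"
   unfolding supp_in_def using dv_smooth[OF VZ[OF j]] L(1) dv_zero_off[OF VZ[OF j] L] by blast
  obtain W x E where W: "coords_on (fst (d j)) (snd (d j)) W x E" "L j <= W" using q(1)[OF j] unfolding good_chart_def by blast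
  have "volume_integral (dv (fscale (\<eta> j) Z)) = vint (d j) (dv (fscale (\<eta> j) Z))"
   by (rule volume_integral_supp[OF supp dj])
  also have "... = 0" using vint_divergence[OF c' W(1) L(1) W(2) VZ[OF j] L(2)] by simp
  finally show ?thesis .
 qed
 have Ze: "Z = (\<Sum>j<n. fscale (\<eta> j) Z)"
 proof (intro ext)
  fix p f
  have "(\<Sum>j<n. \<eta> j p) = 1" using Q unfolding is_partition_def by blast
  then show "Z p f = (\<Sum>j<n. fscale (\<eta> j) Z) p f"
   by (simp add: sum_field_apply fscale_def sum_distrib_right[symmetric])
 qed
 have part: "volume_integral (dv (\<Sum>j<k. fscale (\<eta> j) Z)) = 0" if "k \<le> n" for k
  using that
 proof (induction k)
  case 0
  have "dv 0 = (%_. 0)" using dv_zero by blast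
  then show ?case using volume_integral_cmult[OF smooth_const, of 0 0] by (simp add: zero_fun_def)
 next
  case (Suc k)
  let ?S = "\<Sum>j<k. fscale (\<eta> j) Z"
  have S: "VF ?S" by (rule VF_sum) (use Suc VZ in auto)
  have k: "k < n" using Suc by simp
  have "dv (\<Sum>j<Suc k. fscale (\<eta> j) Z) = (%p. dv ?S p + dv (fscale (\<eta> k) Z) p)"
   unfolding sum.lessThan_Suc using dv_add[OF S VZ[OF k]] by blast
  then have "volume_integral (dv (\<Sum>j<Suc k. fscale (\<eta> j) Z)) = volume_integral (dv ?S) + volume_integral (dv (fscale (\<eta> k) Z))"
   using volume_integral_add[OF dv_smooth[OF S] dv_smooth[OF VZ[OF k]]] by simp
  also have "... = 0" using Suc z[OF k] by simp
  finally show ?case .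
 qed
 show ?thesis using part[of n] Ze by simp
qed

sublocale riem_integral A g volume_integral
 by unfold_locales (fact volume_integral_add volume_integral_cmult volume_integral_definite volume_integral_divergence)+

end

section \<open>Curvature of affine connections\<close>

context total_manifold begin

lemma field_eqI: "(!!p f. X p f = (Y p f :: real)) ==> X = Y" by (intro ext)

lemmas field_apply = fscale_def plus_fun_apply minus_apply uminus_apply bracket_apply

context
 fixes K assumes K: "affine_connection A K"
begin

lemmas K_VF = affine_connectionD(1)[OF K] and K_lin1 = affine_connectionD(2)[OF K] and K_lin2 = affine_connectionD(3)[OF K]

lemma K_zero1: assumes "VF Y" shows "K 0 Y = 0"
 using K_lin1[OF VF_zero assms VF_zero smooth_const[of 1]] by simp

lemma curvature_antisym: assumes X: "VF X" "VF Y" "VF Z"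
 shows "curvature K Y X Z = - curvature K X Y Z"
proof -
 have "K (Lie Y X) Z = - K (Lie X Y) Z"
  using K_lin1[OF VF_bracket[OF X(1,2)] X(3) VF_zero smooth_const[of "-1"]] K_zero1[OF X(3)]
  by (simp add: fscale_m1 bracket_antisym[of Y X])
 then show ?thesis by (simp add: curvature_def)
qed

lemma curvature_lin3: assumes X: "VF X" "VF Y" "VF Z" "VF W" "h : SF"
 shows "curvature K X Y (fscale h Z + W) = fscale h (curvature K X Y Z) + curvature K X Y W"
proof -
 have 2: "K X (K Y (fscale h Z + W)) = fscale (%p. X p (%q. Y q h)) Z + fscale (%p. Y p h) (K X Z) +
   (fscale (%p. X p h) (K Y Z) + fscale h (K X (K Y Z)) + K X (K Y W))" if "VF X" "VF Y" for X Y
  unfolding K_lin2[OF that(2) X(3,4,5)] add.assoc[of "fscale _ _"]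
  using K_lin2[OF that(1) X(3) VF_add[OF VF_fscale[OF X(5) K_VF[OF that(2) X(3)]] K_VF[OF that(2) X(4)]] VF_smooth[OF that(2) X(5)]]
   K_lin2[OF that(1) K_VF[OF that(2) X(3)] K_VF[OF that(2) X(4)] X(5)] by (simp add: add.assoc)
 show ?thesis
  unfolding curvature_def 2[OF X(1,2)] 2[OF X(2,1)] K_lin2[OF VF_bracket[OF X(1,2)] X(3-5)]
  by (rule field_eqI) (simp add: field_apply algebra_simps)
qed

lemma curvature_lin1: assumes X: "VF X" "VF Y" "VF Z" "VF W" "h : SF"
 shows "curvature K (fscale h X + W) Y Z = fscale h (curvature K X Y Z) + curvature K W Y Z"
proof -
 have m: "(%p. - Y p h) : SF" by (rule smooth_minus[OF VF_smooth[OF X(2,5)]])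
 have b: "Lie (fscale h X + W) Y = fscale h (Lie X Y) + (fscale (%p. - Y p h) X + Lie W Y)"
  unfolding bracket_add_left[OF X(2) VF_fscale[OF X(5,1)] X(4)] bracket_fscale_left[OF X(2,1,5)]
  by (rule field_eqI) (simp add: field_apply)
 note V = VF_bracket[OF X(1,2)] VF_bracket[OF X(4,2)]
 show ?thesis
  unfolding curvature_def b K_lin1[OF X(1,3,4,5)] K_lin1[OF X(1) K_VF[OF X(2,3)] X(4,5)]
   K_lin1[OF V(1) X(3) VF_add[OF VF_fscale[OF m X(1)] V(2)] X(5)] K_lin1[OF X(1,3) V(2) m]
   K_lin2[OF X(2) K_VF[OF X(1,3)] K_VF[OF X(4,3)] X(5)]
  by (rule field_eqI) (simp add: field_apply algebra_simps)
qed

lemma K_diff2: assumes "VF X" "VF Y" "VF Z" shows "K X (Y - Z) = K X Y - K X Z"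
 using K_lin2[OF assms(1,3,2) smooth_const[of "-1"]] VF_const_arg[OF assms(1)] by (simp add: fscale_m1)

lemma curvature_VF: "VF X ==> VF Y ==> VF Z ==> VF (curvature K X Y Z)"
 unfolding curvature_def by (intro VF_diff K_VF VF_bracket)

end

end

section \<open>Almost-Kaehler manifolds\<close>

lemma (in riem) lin_tensorial:
 assumes F: "!!X. VF X ==> VF (F X)"
  and L: "!!X Z h. VF X ==> VF Z ==> h : SF ==> F (fscale h X + Z) = fscale h (F X) + F Z"
  and w: "w : TS p"
 shows "tensorial p (%X. g p (F X p) w)"
proof (rule tensorialI)
 fix X Z assume X: "VF X" "VF Z"
 show "g p (F (X + Z) p) w = g p (F X p) w + g p (F Z p) w"
  using L[OF X smooth_const[of 1]] g_add1[OF VF_tangent[OF F[OF X(1)]] w VF_tangent[OF F[OF X(2)]]] by simp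
next
 fix X h assume X: "VF X" "h : SF"
 have "F 0 = 0" using L[OF VF_zero VF_zero smooth_const[of 1]] by simp
 then have "F (fscale h X) p = (%f. h p * F X p f)" using L[OF X(1) VF_zero X(2)] by (simp add: fscale_at)
 then show "g p (F (fscale h X) p) w = h p * g p (F X p) w" using g_scale1[OF VF_tangent[OF F[OF X(1)]] w] by simp
qed

locale almost_kahler = riem A g for A :: "('m, 'e::euclidean_space) atlas" and g +
 fixes \<omega> :: "'m form" and J :: "'m endo" and n :: nat
 assumes om: "\<omega> : forms A 2" and closed: "ext_d A \<omega> = 0" and compat: "compatible A \<omega> J"
  and gdef: "ak_metric \<omega> J = g" and dim: "DIM('e) = 2 * n" "n > 0"
begin

abbreviation "JF \<equiv> J_field J"

lemma J_tangent: "u : TS p ==> J p u : TS p" and J_J: "u : TS p ==> J p (J p u) = - u"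
 and J_lin: "u : TS p ==> w : TS p ==> J p (%f. c * u f + w f) = (%f. c * J p u f + J p w f)"
 and JF_VF: "VF X ==> VF (JF X)"
 and om_J: "u : TS p ==> v : TS p ==> \<omega> p [J p u, J p v] = \<omega> p [u, v]"
 using compat unfolding compatible_def almost_complex_def J_field_def[abs_def] by blast+

lemma JF_at: "JF X p = J p (X p)" by (simp add: J_field_def)

lemma om_g: "u : TS p ==> v : TS p ==> \<omega> p [u, v] = g p (J p u) v"
 using om_J[of u p v] gdef by (auto simp: ak_metric_def)

lemma g_JJ: "u : TS p ==> v : TS p ==> g p (J p u) (J p v) = g p u v"
 using om_J[of u p "J p v"] J_tangent gdef by (auto simp: ak_metric_def)

lemma g_J: assumes "u : TS p" "v : TS p" shows "g p (J p u) v = - g p u (J p v)"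
proof -
 have "g p (J p u) v = g p (J p (J p u)) (J p v)" using g_JJ[OF J_tangent[OF assms(1)] assms(2)] by simp
 then show ?thesis using assms by (simp add: J_J g_uminus1 J_tangent)
qed

lemma g_JF: "VF X ==> VF Y ==> g p (JF X p) (Y p) = - g p (X p) (JF Y p)"
 unfolding JF_at by (intro g_J VF_tangent)

lemma g_JF_JF: "VF X ==> VF Y ==> g p (JF X p) (JF Y p) = g p (X p) (Y p)"
 unfolding JF_at by (intro g_JJ VF_tangent)

lemma om_JF: "VF X ==> VF Y ==> \<omega> p [X p, Y p] = g p (JF X p) (Y p)"
 unfolding JF_at by (intro om_g VF_tangent)

lemma JF_JF: "VF X ==> JF (JF X) = - X"
 by (rule ext) (simp add: JF_at J_J VF_tangent)

lemma JF_lin: "VF X ==> VF Y ==> JF (fscale h X + Y) = fscale h (JF X) + JF Y"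
proof
 fix p assume "VF X" "VF Y"
 then show "JF (fscale h X + Y) p = (fscale h (JF X) + JF Y) p"
  using J_lin[of "X p" p "Y p" "h p"] by (simp add: JF_at fscale_def VF_tangent plus_fun_def)
qed

lemma JF_zero: "JF 0 = 0" using JF_lin[OF VF_zero VF_zero, of "%_. 1"] by simp
lemma JF_add: "VF X ==> VF Y ==> JF (X + Y) = JF X + JF Y" using JF_lin[of X Y "%_. 1"] by simp
lemma JF_fscale: "VF X ==> JF (fscale h X) = fscale h (JF X)" using JF_lin[OF _ VF_zero, of X h] JF_zero by simp
lemma JF_uminus: "VF X ==> JF (- X) = - JF X" using JF_fscale[of X "%_. -1"] by (simp add: fscale_m1)
lemma JF_diff: "VF X ==> VF Y ==> JF (X - Y) = JF X - JF Y" using JF_add[of X "- Y"] by (simp add: VF_uminus JF_uminus)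

definition dJ :: "'m vfield => 'm vfield => 'm vfield" where "dJ X Y = D X (JF Y) - JF (D X Y)"

lemma dJ_VF: "VF X ==> VF Y ==> VF (dJ X Y)" unfolding dJ_def by (intro VF_diff D_VF JF_VF)

lemma dJ_lin1: assumes "VF X" "VF Y" "VF Z" "h : SF"
 shows "dJ (fscale h X + Z) Y = fscale h (dJ X Y) + dJ Z Y"
 unfolding dJ_def D_lin1[OF assms] D_lin1[OF assms(1) JF_VF[OF assms(2)] assms(3,4)]
  JF_lin[OF D_VF[OF assms(1,2)] D_VF[OF assms(3,2)]]
 by (rule field_eqI) (simp add: field_apply algebra_simps)

lemma dJ_lin2: assumes "VF X" "VF Y" "VF Z" "h : SF"
 shows "dJ X (fscale h Y + Z) = fscale h (dJ X Y) + dJ X Z"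
proof -
 have "JF (D X (fscale h Y + Z)) = fscale (%p. X p h) (JF Y) + (fscale h (JF (D X Y)) + JF (D X Z))"
  unfolding D_lin2[OF assms] add.assoc
  using JF_lin[OF assms(2) VF_add[OF VF_fscale[OF assms(4) D_VF[OF assms(1,2)]] D_VF[OF assms(1,3)]]]
   JF_lin[OF D_VF[OF assms(1,2)] D_VF[OF assms(1,3)]] by simp
 then show ?thesis
  unfolding dJ_def JF_lin[OF assms(2,3)] D_lin2[OF assms(1) JF_VF[OF assms(2)] JF_VF[OF assms(3)] assms(4)]
  by (intro field_eqI) (simp add: field_apply algebra_simps)
qed

lemma dJ_J: assumes "VF X" "VF Y" shows "dJ X (JF Y) = - JF (dJ X Y)"
 unfolding dJ_def JF_JF[OF assms(2)] D_uminus2[OF assms] JF_diff[OF D_VF[OF assms(1) JF_VF[OF assms(2)]] JF_VF[OF D_VF[OF assms]]]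
  JF_JF[OF D_VF[OF assms]] by simp

lemma dJ_skew: assumes X: "VF X" "VF Y" "VF Z"
 shows "g p (dJ X Y p) (Z p) = - g p (Y p) (dJ X Z p)"
proof -
 note V = JF_VF[OF X(2)] JF_VF[OF X(3)] D_VF[OF X(1,2)] D_VF[OF X(1,3)]
 have "X p (%q. g q (JF Y q) (Z q)) = - X p (%q. g q (Y q) (JF Z q))"
  unfolding g_JF[OF X(2,3)] by (rule VF_minus_arg[OF X(1) g_smooth[OF X(2) V(2)]])
 then have "g p (D X (JF Y) p) (Z p) + g p (JF Y p) (D X Z p) = - g p (D X Y p) (JF Z p) - g p (Y p) (D X (JF Z) p)"
  unfolding D_compat[OF X(1) V(1) X(3)] D_compat[OF X(1,2) V(2)] by simp
 moreover have "g p (JF (D X Y) p) (Z p) = - g p (D X Y p) (JF Z p)" by (rule g_JF[OF V(3) X(3)])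
 moreover have "g p (Y p) (JF (D X Z) p) = - g p (JF Y p) (D X Z p)" using g_JF[OF X(2) V(4)] by simp
 ultimately show ?thesis unfolding dJ_def
  using g_at(5)[OF D_VF[OF X(1) V(1)] JF_VF[OF V(3)] X(3)] g_at(6)[OF D_VF[OF X(1) V(2)] JF_VF[OF V(4)] X(2)] by simp
qed

text \<open>The cyclic sum is \<open>d\<omega>\<close>, the connection being metric and torsion free.\<close>
lemma dJ_cyclic: assumes X: "VF X" "VF Y" "VF Z"
 shows "g p (dJ X Y p) (Z p) + g p (dJ Y Z p) (X p) + g p (dJ Z X p) (Y p) = 0"
proof -
 have d: "X p (%q. \<omega> q [Y q, Z q]) = g p (dJ X Y p) (Z p) + g p (JF (D X Y) p) (Z p) - g p (JF (D X Z) p) (Y p)"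
  if X: "VF X" "VF Y" "VF Z" for X Y Z
 proof -
  have "D X (JF Y) = dJ X Y + JF (D X Y)" by (simp add: dJ_def)
  moreover have "g p (JF Y p) (D X Z p) = - g p (JF (D X Z) p) (Y p)"
   unfolding g_JF[OF X(2) D_VF[OF X(1,3)]] using g_field_sym[OF X(2) JF_VF[OF D_VF[OF X(1,3)]]] by simp
  ultimately show ?thesis
   unfolding om_JF[OF X(2,3)] D_compat[OF X(1) JF_VF[OF X(2)] X(3)]
   using g_at(1)[OF dJ_VF[OF X(1,2)] JF_VF[OF D_VF[OF X(1,2)]] X(3)] by simp
 qed
 have b: "\<omega> p [Lie X Y p, Z p] = g p (JF (D X Y) p) (Z p) - g p (JF (D Y X) p) (Z p)"
  if X: "VF X" "VF Y" "VF Z" for X Y Z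
  unfolding om_JF[OF VF_bracket[OF X(1,2)] X(3)] unfolding D_torsion[OF X(1,2), symmetric] JF_diff[OF D_VF[OF X(1,2)] D_VF[OF X(2,1)]]
  by (rule g_at(5)[OF JF_VF[OF D_VF[OF X(1,2)]] JF_VF[OF D_VF[OF X(2,1)]] X(3)])
 have "g p (dJ Y X p) (Z p) = - g p (dJ Y Z p) (X p)"
  using dJ_skew[OF X(2,1,3)] g_field_sym[OF X(1) dJ_VF[OF X(2,3)]] by simp
 moreover have "d2 \<omega> p X Y Z = 0" using ext_d_2[OF om X, of p] closed by simp
 ultimately show ?thesis
  unfolding d2_def d[OF X] d[OF X(2,1,3)] d[OF X(3,1,2)] b[OF X] b[OF X(1,3,2)] b[OF X(2,3,1)] by simp
qed

lemma JF_frame: assumes e: "frame p U e" shows "frame p U (%i. JF (e i))"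
 unfolding orthonormal_frame_def using frameD[OF e] by (auto simp: JF_VF g_JF_JF)

lemma dJ_tensorial1: assumes Y: "VF Y" and w: "w : TS p" shows "tensorial p (%X. g p (dJ X Y p) w)"
 by (rule lin_tensorial[OF dJ_VF[OF _ Y] dJ_lin1[OF _ Y] w])

lemma dJ_tensorial2: assumes X: "VF X" and w: "w : TS p" shows "tensorial p (%Y. g p (dJ X Y p) w)"
 by (rule lin_tensorial[OF dJ_VF[OF X] dJ_lin2[OF X] w])

text \<open>
 Apply \<open>dJ_cyclic\<close> to \<open>X\<close>, \<open>J X\<close>, \<open>Z\<close>. The term
 with the derivative in the direction \<open>Z\<close> vanishes, since \<open>dJ Z\<close> is skew
 and anticommutes with \<open>J\<close>. The other two terms agree after summation, because
 \<open>J\<close> maps orthonormal frames to orthonormal frames.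
\<close>
lemma J_coclosed': assumes e: "frame p U e" and Z: "VF Z"
 shows "(\<Sum>i<DIM('e). g p (dJ (e i) (e i) p) (JF Z p)) = 0"
proof -
 note JZ = JF_VF[OF Z]
 define B where "B X Y = g p (dJ X Y p) (JF Z p)" for X Y
 have "B X X + B (JF X) (JF X) = 0" if X: "VF X" for X
 proof -
  note JX = JF_VF[OF X] and d = dJ_VF[OF X X] dJ_VF[OF Z X] dJ_VF[OF JF_VF[OF X] X]
  have 1: "g p (dJ X (JF X) p) (Z p) = B X X"
   unfolding dJ_J[OF X X] B_def using g_at(7)[OF JF_VF[OF d(1)] d(1) Z] g_JF[OF d(1) Z] by simp
  have 2: "g p (dJ (JF X) Z p) (X p) = B (JF X) (JF X)"
   unfolding dJ_J[OF JX X] B_def using g_at(7)[OF JF_VF[OF d(3)] d(3) JZ] g_JF_JF[OF d(3) Z]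
    dJ_skew[OF JX Z X] g_field_sym[OF Z d(3)] by simp
  have "g p (dJ Z X p) (JF X p) = - g p (X p) (dJ Z (JF X) p)" by (rule dJ_skew[OF Z X JX])
  also have "... = g p (X p) (JF (dJ Z X) p)" unfolding dJ_J[OF Z X] using g_at(8)[OF JF_VF[OF d(2)] X X] by simp
  also have "... = - g p (dJ Z X p) (JF X p)" using g_JF[OF X d(2)] g_field_sym[OF JX d(2)] by simp
  finally have "g p (dJ Z X p) (JF X p) = 0" by simp
  then show ?thesis using dJ_cyclic[OF X JX Z, of p] 1 2 by simp
 qed
 then have "(\<Sum>i<DIM('e). B (e i) (e i)) + (\<Sum>i<DIM('e). B (JF (e i)) (JF (e i))) = 0"
  using frameD(3)[OF e] by (simp add: sum.distrib[symmetric])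
 moreover have "(\<Sum>i<DIM('e). B (e i) (e i)) = (\<Sum>i<DIM('e). B (JF (e i)) (JF (e i)))"
  by (rule frame_trace[where B=B, OF e JF_frame[OF e]])
   (unfold B_def, erule dJ_tensorial1[OF _ VF_tangent[OF JZ]], erule dJ_tensorial2[OF _ VF_tangent[OF JZ]])
 ultimately show ?thesis unfolding B_def by simp
qed

lemma J_coclosed: assumes e: "frame p U e" and Z: "VF Z"
 shows "(\<Sum>i<DIM('e). g p (dJ (e i) (e i) p) (Z p)) = 0"
proof -
 have "g p (dJ (e i) (e i) p) (JF (JF Z) p) = - g p (dJ (e i) (e i) p) (Z p)" if "i < DIM('e)" for i
  unfolding JF_JF[OF Z] by (rule g_at(8)[OF Z Z dJ_VF[OF frameD(3)[OF e that] frameD(3)[OF e that]]])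
 then show ?thesis using J_coclosed'[OF e JF_VF[OF Z]] by (simp add: sum_negf)
qed

text \<open>
 The divergence of \<open>J Z\<close> has no contribution from the derivative of \<open>J\<close>, by
 \<open>J_coclosed\<close>.
\<close>
lemma dv_JF: assumes Z: "VF Z" and e: "frame p U e"
 shows "dv (JF Z) p = - (\<Sum>i<DIM('e). g p (D (e i) Z p) (JF (e i) p))"
proof -
 have "g p (D (e i) (JF Z) p) (e i p) = - g p (dJ (e i) (e i) p) (Z p) - g p (D (e i) Z p) (JF (e i) p)" if "i < DIM('e)" for i
 proof -
  note x = frameD(3)[OF e that]
  have "D (e i) (JF Z) = dJ (e i) Z + JF (D (e i) Z)" by (simp add: dJ_def)
  then show ?thesis using g_at(1)[OF dJ_VF[OF x Z] JF_VF[OF D_VF[OF x Z]] x] dJ_skew[OF x Z x] g_JF[OF D_VF[OF x Z] x]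
   g_field_sym[OF Z dJ_VF[OF x x]] by simp
 qed
 then show ?thesis unfolding dv_frame[OF JF_VF[OF Z] e]
  using J_coclosed[OF e Z] by (simp add: sum_subtractf sum_negf)
qed

section \<open>The canonical Hermitian connection\<close>

abbreviation "nab \<equiv> hermitian_connection A \<omega> J"

lemma nab: "nab X Y = D X Y - fscale (%_. 1 / 2) (JF (dJ X Y))"
 by (simp add: hermitian_connection_def gdef dJ_def Let_def)

lemma nab_affine: "affine_connection A nab"
 unfolding affine_connection_def
proof (intro allI impI conjI, goal_cases)
 case (1 X Y) then show ?case unfolding nab by (intro VF_diff VF_fscale D_VF JF_VF dJ_VF) auto
next
 case (2 X Y Z h)
 then have X: "VF X" "VF Y" "VF Z" "h : SF" by auto
 show ?case unfolding nab D_lin1[OF X] dJ_lin1[OF X] JF_lin[OF dJ_VF[OF X(1,2)] dJ_VF[OF X(3,2)]]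
  by (rule field_eqI) (simp add: field_apply algebra_simps)
next
 case (3 X Y Z h)
 then have X: "VF X" "VF Y" "VF Z" "h : SF" by auto
 show ?case unfolding nab D_lin2[OF X] dJ_lin2[OF X] JF_lin[OF dJ_VF[OF X(1,2)] dJ_VF[OF X(1,3)]]
  by (rule field_eqI) (simp add: field_apply algebra_simps)
qed

lemmas nab_VF = affine_connectionD(1)[OF nab_affine]

text \<open>
 This is the purpose of the correction term: \<open>J\<close> is parallel for the canonical Hermitian
 connection.
\<close>
lemma nab_J: assumes X: "VF X" "VF Y" shows "nab X (JF Y) = JF (nab X Y)"
proof -
 note V = D_VF[OF X] dJ_VF[OF X] JF_VF[OF dJ_VF[OF X]]
 have "JF (nab X Y) = JF (D X Y) + fscale (%_. 1 / 2) (dJ X Y)"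
  unfolding nab JF_diff[OF V(1) VF_fscale[OF smooth_const V(3)]] JF_fscale[OF V(3)] JF_JF[OF V(2)]
  by (rule field_eqI) (simp add: field_apply)
 moreover have "nab X (JF Y) = JF (D X Y) + dJ X Y - fscale (%_. 1 / 2) (dJ X Y)"
  unfolding nab dJ_J[OF X] JF_uminus[OF V(3)] JF_JF[OF V(2)] by (simp add: dJ_def)
 ultimately show ?thesis by (intro field_eqI) (simp add: field_apply)
qed

lemma nab_at: assumes X: "VF X" "VF Y" "VF Z"
 shows "g p (nab X Y p) (Z p) = g p (D X Y p) (Z p) - 1 / 2 * g p (JF (dJ X Y) p) (Z p)"
 unfolding nab using g_at(5)[OF D_VF[OF X(1,2)] VF_fscale[OF smooth_const JF_VF[OF dJ_VF[OF X(1,2)]]] X(3), of p "1/2"]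
  g_at(3)[OF JF_VF[OF dJ_VF[OF X(1,2)]] X(1,3) smooth_const, of p "1/2"] by simp

lemma nab_compat: assumes X: "VF X" "VF Y" "VF Z"
 shows "X p (%q. g q (Y q) (Z q)) = g p (nab X Y p) (Z p) + g p (Y p) (nab X Z p)"
proof -
 note V = dJ_VF[OF X(1,2)] dJ_VF[OF X(1,3)]
 have "g p (JF (dJ X Y) p) (Z p) = - g p (JF (dJ X Z) p) (Y p)"
  using g_JF[OF V(1) X(3)] dJ_skew[OF X(1,2) JF_VF[OF X(3)], of p] g_field_sym[OF X(2) JF_VF[OF V(2)], of p]
   g_at(8)[OF JF_VF[OF V(2)] V(1) X(2), of p] unfolding dJ_J[OF X(1,3)] by simp
 then show ?thesis
  using D_compat[OF X, of p] nab_at[OF X, of p] nab_at[OF X(1,3,2), of p] g_field_sym[OF X(2) nab_VF[OF X(1,3)], of p]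
   g_field_sym[OF X(2) D_VF[OF X(1,3)], of p] by simp
qed

text \<open>
 Metric connections commute with traces: the connection coefficients of an orthonormal frame form a
 skew matrix, which is paired here with a symmetric one.
\<close>
lemma metric_connection_trace:
 assumes e: "frame p U e" and Y: "VF Y"
  and B1: "!!W. VF W ==> tensorial p (%X. B X W)" and B2: "!!X. VF X ==> tensorial p (%W. B X W)"
 shows "(\<Sum>i<DIM('e). B (nab Y (e i)) (e i) + B (e i) (nab Y (e i))) = 0"
proof -
 note d = frameD[OF e]
 let ?t = "%i j. g p (nab Y (e i) p) (e j p)"
 have sk: "?t i j = - ?t j i" if ij: "i < DIM('e)" "j < DIM('e)" for i j
 proof -
  note x = d(3)[OF ij(1)] d(3)[OF ij(2)]
  have "Y p (%q. g q (e i q) (e j q)) = Y p (%_. if i = j then 1 else 0)"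
   by (rule VF_local_arg[OF Y g_smooth[OF x] smooth_const d(1,2)]) (rule d(4)[OF _ ij])
  then show ?thesis using nab_compat[OF Y x] g_field_sym[OF x(1) nab_VF[OF Y x(2)]] VF_const_arg[OF Y] by simp
 qed
 have L: "B (nab Y (e i)) (e i) = (\<Sum>j<DIM('e). ?t i j * B (e j) (e i))"
  "B (e i) (nab Y (e i)) = (\<Sum>j<DIM('e). ?t i j * B (e i) (e j))" if i: "i < DIM('e)" for i
  by (rule tensorial_frame[OF e B1[OF d(3)[OF i]] nab_VF[OF Y d(3)[OF i]]],
    rule tensorial_frame[OF e B2[OF d(3)[OF i]] nab_VF[OF Y d(3)[OF i]]])
 have "(\<Sum>i<DIM('e). B (nab Y (e i)) (e i) + B (e i) (nab Y (e i))) =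
   (\<Sum>i<DIM('e). \<Sum>j<DIM('e). ?t i j * B (e j) (e i)) + (\<Sum>i<DIM('e). \<Sum>j<DIM('e). ?t i j * B (e i) (e j))"
  by (simp add: L sum.distrib)
 also have "(\<Sum>i<DIM('e). \<Sum>j<DIM('e). ?t i j * B (e j) (e i)) = (\<Sum>j<DIM('e). \<Sum>i<DIM('e). ?t i j * B (e j) (e i))"
  by (rule sum.swap)
 also have "... = (\<Sum>j<DIM('e). \<Sum>i<DIM('e). - (?t j i * B (e j) (e i)))"
 proof (intro sum.cong refl)
  fix j i assume "j : {..<DIM('e)}" "i : {..<DIM('e)}"
  then show "?t i j * B (e j) (e i) = - (?t j i * B (e j) (e i))" using sk[of i j] by simp
 qed
 finally show ?thesis by (simp add: sum_negf)
qed

end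

section \<open>Adapted frames and the symplectic volume form\<close>

context almost_kahler begin

abbreviation "adapted \<equiv> adapted_frame A \<omega> J"

lemma adaptedD: assumes "adapted p U e"
 shows "frame p U e" "q : U ==> i < DIM('e) ==> even i ==> e (Suc i) q = J q (e i q)"
 using assms by (auto simp: adapted_frame_def gdef)

text \<open>
 Two fields at a time: after a Gram-Schmidt step with result \<open>Z\<close>, the field \<open>J
 Z\<close> is automatically a unit field orthogonal to \<open>Z\<close> and to the span of the
 earlier fields, which \<open>J\<close> preserves.
\<close>
lemma adapted_step:
 assumes "m \<le> n"
 shows "EX U e. openin T U & p : U & (ALL i<2*m. VF (e i)) &
  (ALL q:U. ALL i<2*m. ALL j<2*m. g q (e i q) (e j q) = (if i = j then 1 else 0)) &
  (ALL q:U. ALL i<2*m. even i --> e (Suc i) q = J q (e i q))"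
 using assms
proof (induction m)
 case 0 then show ?case using openin_C total by auto
next
 case (Suc m)
 then obtain U e where U: "openin T U" "p : U" and e: "ALL i<2*m. VF (e i)"
  and o: "ALL q:U. ALL i<2*m. ALL j<2*m. g q (e i q) (e j q) = (if i = j then 1 else 0)"
  and ev: "ALL q:U. ALL i<2*m. even i --> e (Suc i) q = J q (e i q)" by auto
 have "EX Z W. VF Z & openin T W & p : W & W <= U & (ALL q:W. g q (Z q) (Z q) = 1) & (ALL q:W. ALL i<2*m. g q (Z q) (e i q) = 0)"
  by (rule frame_step[OF U]) (use e o Suc.prems dim in auto)
 then obtain Z W where Z: "VF Z" and W: "openin T W" "p : W" "W <= U" and zz: "ALL q:W. g q (Z q) (Z q) = 1"
  and ze: "ALL q:W. ALL i<2*m. g q (Z q) (e i q) = 0" by blast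
 let ?e = "%i. if i < 2 * m then e i else if i = 2 * m then Z else JF Z"
 have je: "g q (JF Z q) (e i q) = 0" if q: "q : W" and i: "i < 2 * m" for q i
 proof -
  have "g q (Z q) (JF (e i) q) = 0"
  proof (cases "even i")
   case True
   then have "Suc i < 2 * m" using i by (metis Suc_lessI even_Suc even_mult_iff even_numeral)
   then show ?thesis using ze q ev W(3) i True by (metis JF_at subsetD)
  next
   case False
   then obtain k where k: "i = Suc k" "even k" by (metis even_Suc not0_implies_Suc even_zero)
   then have "e i q = JF (e k) q" using ev W(3) q i by (auto simp: JF_at)
   then have "JF (e i) q = - e k q" using e k i by (simp add: JF_at J_J VF_tangent)
   then show ?thesis using ze q k i e Z by (simp add: g_uminus2 VF_tangent)
  qed
  then show ?thesis using g_JF[OF Z] e i by simp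
 qed
 have zj: "g q (JF Z q) (Z q) = 0" for q using g_JF[OF Z Z, of q] g_field_sym[OF Z JF_VF[OF Z], of q] by simp
 have cases: "i < 2 * m \<or> i = 2 * m \<or> i = Suc (2 * m)" if "i < 2 * Suc m" for i using that by auto
 have V: "VF (?e i)" for i using e Z JF_VF[OF Z] by simp
 have half: "g q (?e i q) (?e j q) = (if i = j then 1 else 0)" if q: "q : W" and "i < 2 * Suc m" "j < 2 * Suc m" "j \<le> i" for q i j
  using cases[OF that(2)] cases[OF that(3)] \<open>j \<le> i\<close> zz ze je[OF q] zj[of q] o W(3) q g_JF_JF[OF Z Z, of q] by auto
 have "g q (?e i q) (?e j q) = (if i = j then 1 else 0)" if q: "q : W" "i < 2 * Suc m" "j < 2 * Suc m" for q i j
  using half[OF q] half[OF q(1,3,2)] g_field_sym[OF V[of i] V[of j], of q] by (cases "j \<le> i") auto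
 moreover have "?e (Suc i) q = J q (?e i q)" if q: "q : W" "i < 2 * Suc m" "even i" for q i
 proof (cases "i < 2 * m")
  case True
  then have "Suc i < 2 * m" using \<open>even i\<close> by (metis Suc_lessI even_Suc even_mult_iff even_numeral)
  then show ?thesis using True ev W(3) q by auto
 next
  case False
  then have "i = 2 * m" using cases[OF q(2)] q(3) by auto
  then show ?thesis by (simp add: JF_at)
 qed
 ultimately show ?case using W V by (intro exI[of _ W] exI[of _ ?e]) simp
qed

lemma adapted_exists: "EX U e. adapted p U e"
 using adapted_step[OF order.refl, of p] unfolding adapted_frame_def orthonormal_frame_def gdef dim by metis

lemma adapted_symp: assumes a: "adapted p U e" and q: "q : U"
 shows "symp_basis \<omega> q n (map (%i. e i q) [0..<DIM('e)])"
 unfolding symp_basis_def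
proof (intro conjI allI impI)
 note d = frameD[OF adaptedD(1)[OF a]]
 have t: "e i q : TS q" if "i < DIM('e)" for i using d(3)[OF that] VF_tangent by blast
 show "length (map (%i. e i q) [0..<DIM('e)]) = 2 * n" "set (map (%i. e i q) [0..<DIM('e)]) <= TS q"
  using t by (auto simp: dim)
 fix i j assume ij: "i < 2 * n" "j < 2 * n"
 then have D: "i < DIM('e)" "j < DIM('e)" by (auto simp: dim)
 have "g q (J q (e i q)) (e j q) = J0 i j"
 proof (cases "even i")
  case True
  then have "Suc i < DIM('e)" using D dim by (metis Suc_lessI even_Suc even_mult_iff even_numeral)
  then show ?thesis using adaptedD(2)[OF a q D(1) True, symmetric] d(4)[OF q _ D(2)] True
   by (auto simp: J0_def)
 next
  case False
  then obtain k where k: "i = Suc k" "even k" by (metis even_Suc not0_implies_Suc even_zero)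
  then have kD: "k < DIM('e)" using D by simp
  have "J q (e i q) = - e k q" using adaptedD(2)[OF a q kD k(2)] k(1) t[OF kD] by (simp add: J_J)
  then show ?thesis using d(4)[OF q kD D(2)] t kD D(2) False k by (auto simp: J0_def g_uminus1)
 qed
 then show "\<omega> q [map (%i. e i q) [0..<DIM('e)] ! i, map (%i. e i q) [0..<DIM('e)] ! j] = J0 i j"
  using D t om_g by simp
qed

lemmas om_alt = forms_alt_form[OF om]

lemma power_smooth: "(!!X. X : set Xs ==> VF X) ==> (%q. form_power \<omega> k q (map (%X. X q) Xs)) : SF"
proof (induction k arbitrary: Xs)
 case 0 then show ?case by (cases "Xs = []") (simp_all add: fun_form_def)
next
 case (Suc k)
 have z: "ALL us. length us ~= 2 --> \<omega> q us = 0" for q using form_zero[OF om] by blast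
 show ?case
 proof (cases "length Xs \<ge> 2")
  case True
  have "(%q. \<omega> q (take 2 (permute_list sg (map (%X. X q) Xs)))) : SF &
    (%q. form_power \<omega> k q (drop 2 (permute_list sg (map (%X. X q) Xs)))) : SF" if s: "sg permutes {..<length Xs}" for sg
  proof -
   have sub: "set (permute_list sg Xs) <= set Xs" using set_permute_list[OF s] by simp
   have e: "permute_list sg (map (%X. X q) Xs) = map (%X. X q) (permute_list sg Xs)" for q
    by (rule permute_list_map[OF s])
   have "(%q. \<omega> q (map (%X. X q) (take 2 (permute_list sg Xs)))) : SF"
    by (rule form_smooth[OF om]) (use True Suc.prems sub in \<open>auto dest!: in_set_takeD\<close>)
   moreover have "(%q. form_power \<omega> k q (map (%X. X q) (drop 2 (permute_list sg Xs)))) : SF"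
    by (rule Suc.IH) (use Suc.prems sub in \<open>auto dest!: in_set_dropD\<close>)
   ultimately show ?thesis unfolding e take_map drop_map by blast
  qed
  then have "(%q. 1 / (2 * fact (length Xs - 2)) * (\<Sum>sg | sg permutes {..<length Xs}. of_int (sign sg) *
    \<omega> q (take 2 (permute_list sg (map (%X. X q) Xs))) * form_power \<omega> k q (drop 2 (permute_list sg (map (%X. X q) Xs))))) : SF"
   by (intro smooth_mult smooth_const smooth_sum) auto
  then show ?thesis unfolding form_power.simps wedge_two[OF z] using True by simp
 qed (simp add: wedge_two[OF z])
qed

end

locale compact_almost_kahler = almost_kahler A g \<omega> J n for A :: "('m, 'e::euclidean_space) atlas" and g \<omega> J n +
 assumes compact: "compact_space (manifold_topology A)"
begin

sublocale vol: volume A g "form_power \<omega> n"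
proof (unfold_locales, goal_cases)
 case 1 show ?case by (rule compact)
next
 case (2 q) show ?case using alt_form_power[where \<omega>=\<omega> and p=q, OF om_alt, of n] by (simp add: dim)
next
 case (3 Xs) then show ?case by (intro power_smooth)
next
 case (4 p)
 obtain U e where a: "adapted p U e" using adapted_exists by blast
 note d = frameD[OF adaptedD(1)[OF a]]
 let ?es = "%q. map (%i. e i q) [0..<DIM('e)]"
 have al: "alt_form p (2 * k) (form_power \<omega> k p)" for k by (rule alt_form_power[where \<omega>=\<omega> and p=p, OF om_alt])
 have "form_power \<omega> n q (?es q) = form_power \<omega> n p (?es p)" if q: "q : U" for q
 proof (rule form_power_gram[where \<omega>=\<omega> and p=q and q=p, OF om_alt om_alt])
  fix i j assume "i < length (?es q)" "j < length (?es q)"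
  then show "\<omega> q [?es q ! i, ?es q ! j] = \<omega> p [?es p ! i, ?es p ! j]"
   using adapted_symp[OF a q] adapted_symp[OF a d(2)] by (simp add: symp_basis_def dim)
 qed simp
 moreover have "form_power \<omega> n p (?es p) > 0"
  by (rule form_power_basis_pos[where \<omega>=\<omega> and p=p, OF om_alt adapted_symp[OF a d(2)]])
 ultimately show ?case using adaptedD(1)[OF a] by (metis less_irrefl)
qed

end

section \<open>The Chern-Ricci form and the Chern scalar curvature\<close>

context total_manifold begin

lemma alt_form_comb: assumes a: "alt_form p k \<phi>" and b: "alt_form p k \<psi>"
 shows "alt_form p k (%vs. r * \<phi> vs + s * \<psi> vs)"
proof (rule alt_formI, goal_cases)
 case 1 then show ?case by (simp add: alt_form_zero[OF a] alt_form_zero[OF b])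
next
 case 2 then show ?case
  by (simp only: alt_form_slot[OF a] alt_form_slot[OF b], simp add: algebra_simps)
next
 case 3 then show ?case using alt_form_alt[OF a] alt_form_alt[OF b] by simp
qed

end

context almost_kahler begin

lemma g_J_tensorial: assumes R: "VF R" shows "tensorial p (%W. g p (R p) (JF W p))"
 by (rule tensorialI) (simp_all only: JF_add JF_fscale g_at(2,4)[OF JF_VF JF_VF R])

text \<open>
 The description in \<open>chern_ricci\<close> quantifies over extensions and adapted frames.
 Curvature is tensorial in all arguments, and a trace does not depend on the frame, so that one
 extension and one frame suffice.
\<close>
lemma chern_ricci_frame:
 assumes X: "VF X" "VF Y" and e: "adapted p U e"
 shows "chern_ricci A \<omega> J p [X p, Y p] =
  1 / 2 * (\<Sum>i<DIM('e). g p (curvature nab X Y (e i) p) (JF (e i) p))"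
proof -
 define F where "F X Y e = 1 / 2 * (\<Sum>i<DIM('e). g p (curvature nab X Y (e i) p) (J p (e i p)))" for X Y and e :: "nat => 'm vfield"
 have t1: "tensorial p (%X. g p (curvature nab X Y Z p) w)" if "VF Y" "VF Z" "w : TS p" for Y Z w
  by (rule lin_tensorial[OF curvature_VF[OF nab_affine _ that(1,2)] curvature_lin1[OF nab_affine _ that(1,2)] that(3)])
 have t3: "tensorial p (%Z. g p (curvature nab X Y Z p) w)" if "VF X" "VF Y" "w : TS p" for X Y w
  by (rule lin_tensorial[OF curvature_VF[OF nab_affine that(1,2)] curvature_lin3[OF nab_affine that(1,2)] that(3)])
 have sw: "g p (curvature nab Y X Z p) w = - g p (curvature nab X Y Z p) w" if "VF X" "VF Y" "VF Z" "w : TS p" for X Y Z w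
  using curvature_antisym[OF nab_affine that(1-3)] g_uminus1[OF VF_tangent[OF curvature_VF[OF nab_affine that(1-3)]] that(4)] by simp
 have ext: "F X' Y' e' = F X Y e" if x: "extends A p [X', Y'] [X p, Y p]" and a: "adapted p U' e'" for X' Y' U' e'
 proof -
  have V: "VF X'" "VF Y'" "X' p = X p" "Y' p = Y p" using x by (auto simp: extends_def)
  have c: "g p (curvature nab X' Y' Z p) w = g p (curvature nab X Y Z p) w" if "VF Z" "w : TS p" for Z w
  proof -
   have "g p (curvature nab X' Y' Z p) w = g p (curvature nab X Y' Z p) w"
    by (rule tensorial_cong[OF t1[OF V(2) that] V(1) X(1) V(3)])
   moreover have "g p (curvature nab Y' X Z p) w = g p (curvature nab Y X Z p) w"
    by (rule tensorial_cong[OF t1[OF X(1) that] V(2) X(2) V(4)])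
   ultimately show ?thesis using sw[OF X(1) V(2) that] sw[OF X that] by simp
  qed
  have "F X' Y' e' = 1 / 2 * (\<Sum>i<DIM('e). g p (curvature nab X Y (e' i) p) (J p (e' i p)))"
   unfolding F_def using c frameD(3)[OF adaptedD(1)[OF a]] by (simp add: J_tangent VF_tangent)
  also have "(\<Sum>i<DIM('e). g p (curvature nab X Y (e' i) p) (J p (e' i p))) =
    (\<Sum>i<DIM('e). g p (curvature nab X Y (e i) p) (J p (e i p)))"
  proof (rule frame_trace[where B="%Z W. g p (curvature nab X Y Z p) (J p (W p))", OF adaptedD(1)[OF a] adaptedD(1)[OF e]])
   show "tensorial p (%Z. g p (curvature nab X Y Z p) (J p (W p)))" if "VF W" for W
    by (rule t3[OF X J_tangent[OF VF_tangent[OF that]]])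
   show "tensorial p (%W. g p (curvature nab X Y Z p) (J p (W p)))" if Z: "VF Z" for Z
    using g_J_tensorial[OF curvature_VF[OF nab_affine X Z], of p] by (simp add: JF_at)
  qed
  finally show ?thesis by (simp add: F_def)
 qed
 have xx: "extends A p [X, Y] [X p, Y p]" using X by (simp add: extends_def)
 have "(THE r. ALL X' Y' U e. extends A p [X', Y'] [X p, Y p] & adapted p U e --> r = F X' Y' e) = F X Y e"
 proof (rule the_equality)
  show "ALL X' Y' U e'. extends A p [X', Y'] [X p, Y p] & adapted p U e' --> F X Y e = F X' Y' e'" by (intro allI impI, elim conjE, rule ext[symmetric])
  show "r = F X Y e" if "ALL X' Y' U e. extends A p [X', Y'] [X p, Y p] & adapted p U e --> r = F X' Y' e" for r
   using that xx e by blast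
 qed
 moreover have "chern_ricci A \<omega> J p [X p, Y p] = (THE r. ALL X' Y' U e. extends A p [X', Y'] [X p, Y p] & adapted p U e --> r = F X' Y' e)"
  using X by (simp add: chern_ricci_def VF_tangent F_def gdef)
 ultimately show ?thesis by (simp add: F_def JF_at)
qed

text \<open>Compare two forms of top degree on an adapted frame, using \<open>wedge_power_trace\<close>.\<close>
lemma chern_scalar_trace:
 assumes b: "chern_ricci A \<omega> J : forms A 2" and a: "adapted p U e"
 shows "chern_scalar A n \<omega> J p = (\<Sum>r<n. chern_ricci A \<omega> J p [e (2 * r) p, e (2 * r + 1) p])"
proof -
 let ?\<beta> = "chern_ricci A \<omega> J"
 obtain k where k: "n = Suc k" using dim(2) by (metis not0_implies_Suc less_not_refl)
 let ?tr = "%e p. \<Sum>r<n. ?\<beta> p [e (2 * r) p, e (2 * r + 1) p]"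
 let ?es = "%e p. map (%i. e i p) [0..<DIM('e)]"
 have pt: "?tr e p * form_power \<omega> n p vs = real n * wedge ?\<beta> (form_power \<omega> (n - 1)) p vs" if a: "adapted p U e" for p U e vs
 proof -
  note f = adaptedD(1)[OF a]
  note s = adapted_symp[OF a frameD(2)[OF f], unfolded k]
  have 1: "alt_form p (DIM('e)) (form_power \<omega> n p)" using alt_form_power[where \<omega>=\<omega> and p=p, OF om_alt, of n] by (simp add: dim)
  have 2: "alt_form p (DIM('e)) (wedge ?\<beta> (form_power \<omega> (n - 1)) p)"
   using alt_form_wedge[where al="?\<beta>" and p=p and \<gamma>="form_power \<omega> k" and m="2 * k", OF forms_alt_form[OF b] alt_form_power[where \<omega>=\<omega> and p=p, OF om_alt, of k]] by (simp add: dim k)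
  have tr: "(\<Sum>r<Suc k. ?\<beta> p [?es e p ! (2 * r), ?es e p ! (2 * r + 1)]) = ?tr e p"
   unfolding k by (rule sum.cong) (auto simp: dim k simp del: upt_Suc)
  have "?tr e p * form_power \<omega> n p (?es e p) = real n * wedge ?\<beta> (form_power \<omega> (n - 1)) p (?es e p)"
   using wedge_power_trace[where \<omega>=\<omega> and \<beta>="?\<beta>" and p=p, OF om_alt s forms_alt_form[OF b]]
   unfolding tr by (simp only: k diff_Suc_1)
  then have z: "?tr e p * form_power \<omega> n p (?es e p) + (- real n) * wedge ?\<beta> (form_power \<omega> (n - 1)) p (?es e p) = 0" by linarith
  have "?tr e p * form_power \<omega> n p vs + (- real n) * wedge ?\<beta> (form_power \<omega> (n - 1)) p vs = 0"
   by (rule alt_form_top_zero[where \<phi>="%vs. ?tr e p * form_power \<omega> n p vs + (- real n) * wedge ?\<beta> (form_power \<omega> (n - 1)) p vs",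
      OF alt_form_comb[OF 1 2] f z])
  then show ?thesis by linarith
 qed
 have pos: "form_power \<omega> n p (?es e p) > 0" if a: "adapted p U e" for p U e
  by (rule form_power_basis_pos[where \<omega>=\<omega> and p=p, OF om_alt adapted_symp[OF a frameD(2)[OF adaptedD(1)[OF a]]]])
 let ?P = "%s. fscale s (form_power \<omega> n) = fscale (%_. real n) (wedge ?\<beta> (form_power \<omega> (n - 1)))"
 have val: "s p = ?tr e p" if s: "?P s" and a: "adapted p U e" for s p U e
 proof -
  have "s p * form_power \<omega> n p (?es e p) = ?tr e p * form_power \<omega> n p (?es e p)"
   using fun_cong[OF fun_cong[OF s, of p], of "?es e p"] pt[OF a] by (simp add: fscale_def)
  then show ?thesis using pos[OF a] by simp
 qed
 obtain E where E: "!!p. EX U. adapted p U (E p)" using adapted_exists by metis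
 have "?P (%p. ?tr (E p) p)"
 proof (intro ext)
  fix p vs
  obtain U where "adapted p U (E p)" using E by blast
  from pt[OF this] show "fscale (%p. ?tr (E p) p) (form_power \<omega> n) p vs = fscale (%_. real n) (wedge ?\<beta> (form_power \<omega> (n - 1))) p vs"
   by (simp add: fscale_def)
 qed
 moreover have "s = (%p. ?tr (E p) p)" if s: "?P s" for s
 proof
  fix p
  obtain U where "adapted p U (E p)" using E by blast
  then show "s p = ?tr (E p) p" by (rule val[OF s])
 qed
 ultimately have "?P (chern_scalar A n \<omega> J)" unfolding chern_scalar_def by (rule theI[where P="?P"])
 then show ?thesis using val a by blast
qed

lemma d1_sharp: assumes a: "a : forms A 1" and X: "VF X" "VF Y"
 shows "d1 a p X Y = g p (D X (sharp a) p) (Y p) - g p (D Y (sharp a) p) (X p)"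
proof -
 note Z = sharp(1)[OF a] and s = sharp(2)[OF a]
 show ?thesis
  unfolding d1_def s[OF X(1), symmetric] s[OF X(2), symmetric] s[OF VF_bracket[OF X], symmetric]
   D_compat[OF X(1) Z X(2)] D_compat[OF X(2) Z X(1)] unfolding D_torsion[OF X, symmetric]
  using g_at(6)[OF D_VF[OF X] D_VF[OF X(2,1)] Z, of p] by simp
qed

text \<open>
 Trace \<open>da (X, J X) = g (D\<^sub>X Z) (J X) - g (D\<^sub>J\<^sub>X Z) X\<close>, where
 \<open>Z\<close> is dual to \<open>a\<close>; the frames \<open>e\<close> and \<open>J e\<close>
 contribute equally, each minus the divergence of \<open>J Z\<close>.
\<close>
theorem chern_scalar_divergence:
 assumes a: "a : forms A 1" and r: "chern_ricci A \<omega> J - \<omega> = ext_d A a"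
 shows "chern_scalar A n \<omega> J p = real n - dv (JF (sharp a)) p"
proof -
 obtain U e where e: "adapted p U e" using adapted_exists by blast
 note f = adaptedD(1)[OF e] and Z = sharp(1)[OF a]
 note d = frameD[OF f]
 have ric: "chern_ricci A \<omega> J p vs = \<omega> p vs + ext_d A a p vs" for p vs
  using fun_cong[OF fun_cong[OF r, of p], of vs] by simp
 have "chern_ricci A \<omega> J = (%p vs. \<omega> p vs + ext_d A a p vs)" using ric by (intro ext)
 also have "... : forms A 2"
 proof (rule form2I, goal_cases)
  case 1 then show ?case by (simp add: form_zero[OF om] form_zero[OF ext_d_form2[OF a]])
 next
  case 2 then show ?case by (simp only: form2_lin1[OF om] form2_lin1[OF ext_d_form2[OF a]], simp add: algebra_simps)
 next
  case 3 then show ?case by (simp only: form2_lin2[OF om] form2_lin2[OF ext_d_form2[OF a]], simp add: algebra_simps)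
 next
  case 4 then show ?case by (simp add: form2_same[OF om] form2_same[OF ext_d_form2[OF a]])
 next
  case 5 then show ?case by (intro smooth_add form2_smooth om ext_d_form2[OF a])
 qed
 finally have b: "chern_ricci A \<omega> J : forms A 2" .
 let ?a = "%i. d1 a p (e i) (JF (e i))"
 have pair: "ext_d A a p [e (2 * r) p, e (2 * r + 1) p] = ?a (2 * r)" "?a (2 * r + 1) = ?a (2 * r)"
  "\<omega> p [e (2 * r) p, e (2 * r + 1) p] = 1" if r: "r < n" for r
 proof -
  have i: "2 * r < DIM('e)" "2 * r + 1 < DIM('e)" using r by (auto simp: dim)
  note V = d(3)[OF i(1)] d(3)[OF i(2)]
  have J1: "e (2 * r + 1) p = JF (e (2 * r)) p" using adaptedD(2)[OF e d(2) i(1)] by (simp add: JF_at)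
  then have J2: "JF (e (2 * r + 1)) p = (- e (2 * r)) p" using V by (simp add: JF_at J_J VF_tangent)
  show 1: "ext_d A a p [e (2 * r) p, e (2 * r + 1) p] = ?a (2 * r)"
   unfolding J1 by (rule ext_d_form1[OF a V(1) JF_VF[OF V(1)]])
  have "?a (2 * r + 1) = d1 a p (e (2 * r + 1)) (- e (2 * r))"
   by (rule d1_cong[OF a V(2) JF_VF[OF V(2)] V(2) VF_uminus[OF V(1)] refl J2])
  also have "... = d1 a p (e (2 * r)) (e (2 * r + 1))"
   using tensorial_uminus[OF d1_tensorial2[OF a V(2)] V(1), of p] d1_skew[OF a V, of p] by simp
  finally show "?a (2 * r + 1) = ?a (2 * r)" using 1 ext_d_form1[OF a V, of p] by simp
  show "\<omega> p [e (2 * r) p, e (2 * r + 1) p] = 1"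
   unfolding om_JF[OF V] J1[symmetric] using d(4)[OF d(2) i(2,2)] by simp
 qed
 have "chern_scalar A n \<omega> J p = (\<Sum>r<n. 1 + ?a (2 * r))"
  unfolding chern_scalar_trace[OF b e] ric by (intro sum.cong refl arg_cong2[where f="(+)"]) (use pair in auto)
 also have "... = real n + 1 / 2 * (\<Sum>i<DIM('e). ?a i)"
  unfolding dim sum_pairs using pair(2) by (simp add: sum.distrib sum_distrib_left)
 also have "(\<Sum>i<DIM('e). ?a i) =
   (\<Sum>i<DIM('e). g p (D (e i) (sharp a) p) (JF (e i) p)) - (\<Sum>i<DIM('e). g p (D (JF (e i)) (sharp a) p) (e i p))"
  unfolding sum_subtractf[symmetric] by (intro sum.cong refl d1_sharp[OF a] d(3) JF_VF) auto
 also have "(\<Sum>i<DIM('e). g p (D (e i) (sharp a) p) (JF (e i) p)) = - dv (JF (sharp a)) p"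
  using dv_JF[OF Z f] by simp
 also have "(\<Sum>i<DIM('e). g p (D (JF (e i)) (sharp a) p) (e i p)) = dv (JF (sharp a)) p"
 proof -
  have "g p (D (JF (e i)) (sharp a) p) (JF (JF (e i)) p) = - g p (D (JF (e i)) (sharp a) p) (e i p)" if "i < DIM('e)" for i
   unfolding JF_JF[OF d(3)[OF that]] by (rule g_at(8)[OF d(3)[OF that] Z D_VF[OF JF_VF[OF d(3)[OF that]] Z]])
  then show ?thesis unfolding dv_JF[OF Z JF_frame[OF f]] by (simp add: sum_negf)
 qed
 finally show ?thesis by simp
qed

section \<open>Holomorphic Killing fields\<close>

text \<open>
 Put \<open>L Z = Lie \<xi> Z - nab \<xi> Z\<close>, which is linear over the smooth functions. Since
 \<open>\<xi>\<close> preserves the connection, the curvature of \<open>\<xi>\<close> and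
 \<open>Y\<close> is the commutator of \<open>L\<close> with \<open>nab Y\<close>, so its trace
 against \<open>J\<close> is minus the derivative of the trace of \<open>L\<close> against
 \<open>J\<close>. The latter trace is the divergence of \<open>J \<xi>\<close>.
\<close>
lemma ricci_killing:
 assumes \<xi>: "VF \<xi>" and Y: "VF Y"
  and inv: "!!X Y. VF X ==> VF Y ==> Lie \<xi> (nab X Y) = nab (Lie \<xi> X) Y + nab X (Lie \<xi> Y)"
 shows "chern_ricci A \<omega> J p [\<xi> p, Y p] = - 1 / 2 * Y p (dv (JF \<xi>))"
proof -
 obtain U e where e: "adapted p U e" using adapted_exists by blast
 note f = adaptedD(1)[OF e]
 note d = frameD[OF f]
 define L where "L Z = Lie \<xi> Z - nab \<xi> Z" for Z
 have LV: "VF (L Z)" if "VF Z" for Z unfolding L_def by (intro VF_diff VF_bracket nab_VF \<xi> that)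
 have L_lin: "L (fscale h X + Z) = fscale h (L X) + L Z" if X: "VF X" "VF Z" "h : SF" for h X Z
  unfolding L_def bracket_add_right[OF \<xi> VF_fscale[OF X(3,1)] X(2)] bracket_fscale_right[OF \<xi> X(1,3)] K_lin2[OF nab_affine \<xi> X]
  by (rule field_eqI) (simp add: field_apply algebra_simps)
 have R: "curvature nab \<xi> Y Z = L (nab Y Z) - nab Y (L Z)" if Z: "VF Z" for Z
  unfolding L_def curvature_def inv[OF Y Z] K_diff2[OF nab_affine Y VF_bracket[OF \<xi> Z] nab_VF[OF \<xi> Z]]
  by (rule field_eqI) (simp add: field_apply algebra_simps)
 let ?s = "%i q. g q (L (e i) q) (JF (e i) q)"
 have sm: "?s i : SF" if "i < DIM('e)" for i by (rule g_smooth[OF LV[OF d(3)[OF that]] JF_VF[OF d(3)[OF that]]])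
 define B where "B X W = g p (L X p) (JF W p)" for X W
 have B0: "(\<Sum>i<DIM('e). B (nab Y (e i)) (e i) + B (e i) (nab Y (e i))) = 0"
 proof (rule metric_connection_trace[OF f Y])
  show "tensorial p (%X. B X W)" if "VF W" for W
   unfolding B_def by (rule lin_tensorial[OF LV L_lin VF_tangent[OF JF_VF[OF that]]])
  show "tensorial p (%W. B X W)" if X: "VF X" for X
   unfolding B_def by (rule g_J_tensorial[OF LV[OF X]])
 qed
 have "g p (curvature nab \<xi> Y (e i) p) (JF (e i) p) = B (nab Y (e i)) (e i) + B (e i) (nab Y (e i)) - Y p (?s i)"
  if i: "i < DIM('e)" for i
 proof -
  note V = d(3)[OF i] and N = nab_VF[OF Y d(3)[OF i]] and LE = LV[OF d(3)[OF i]]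
  have "Y p (?s i) = g p (nab Y (L (e i)) p) (JF (e i) p) + B (e i) (nab Y (e i))"
   unfolding nab_compat[OF Y LE JF_VF[OF V]] nab_J[OF Y V] B_def ..
  then show ?thesis unfolding R[OF V] B_def using g_at(5)[OF LV[OF N] nab_VF[OF Y LE] JF_VF[OF V], of p] by simp
 qed
 then have "(\<Sum>i<DIM('e). g p (curvature nab \<xi> Y (e i) p) (JF (e i) p)) = - (\<Sum>i<DIM('e). Y p (?s i))"
  using B0 by (simp add: sum_subtractf)
 also have "(\<Sum>i<DIM('e). Y p (?s i)) = Y p (%q. \<Sum>i<DIM('e). ?s i q)"
  by (rule VF_sum_arg[OF Y, symmetric]) (use sm in auto)
 also have "... = Y p (dv (JF \<xi>))"
 proof (rule VF_local_arg[OF Y smooth_sum dv_smooth[OF JF_VF[OF \<xi>]] d(1,2)])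
  show "?s i : SF" if "i : {..<DIM('e)}" for i using sm that by blast
  fix q assume q: "q : U"
  have "?s i q = - g q (D (e i) \<xi> q) (JF (e i) q)" if i: "i < DIM('e)" for i
  proof -
   note V = d(3)[OF i]
   note J = JF_VF[OF V] and dV = dJ_VF[OF \<xi> V]
   have "g q (JF (dJ \<xi> (e i)) q) (JF (e i) q) = 0"
    unfolding g_JF_JF[OF dV V] using dJ_skew[OF \<xi> V V, of q] g_field_sym[OF V dV, of q] by simp
   then show ?thesis
    unfolding L_def D_torsion[OF \<xi> V, symmetric]
    using nab_at[OF \<xi> V J, of q] g_at(5)[OF VF_diff[OF D_VF[OF \<xi> V] D_VF[OF V \<xi>]] nab_VF[OF \<xi> V] J, of q]
     g_at(5)[OF D_VF[OF \<xi> V] D_VF[OF V \<xi>] J, of q] by simp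
  qed
  then show "(\<Sum>i<DIM('e). ?s i q) = dv (JF \<xi>) q" unfolding dv_JF[OF \<xi> frame_move[OF f q]] by (simp add: sum_negf)
 qed
 finally show ?thesis unfolding chern_ricci_frame[OF \<xi> Y e] by simp
qed

end

context almost_kahler begin

text \<open>
 \<open>\<xi>\<close> preserves \<open>\<omega>\<close> by closedness and \<open>J\<close> by
 assumption, hence \<open>g\<close>. The change \<open>S\<close> of the Levi-Civita connection is
 then symmetric in its two arguments, by absence of torsion, and skew as an endomorphism; such a
 tensor vanishes, as in the uniqueness proof for the Levi-Civita connection.
\<close>
lemma killing_connection:
 assumes \<xi>: "VF \<xi>" and f: "f : SF" and ham: "!!p v. v : TS p ==> \<omega> p [\<xi> p, v] = - v f"
  and inJ: "!!X. VF X ==> Lie \<xi> (JF X) = JF (Lie \<xi> X)"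
  and X: "VF X" "VF Y"
 shows "Lie \<xi> (nab X Y) = nab (Lie \<xi> X) Y + nab X (Lie \<xi> Y)"
proof -
 note b = VF_bracket[OF \<xi>]
 have br_diff: "Lie \<xi> (X - Y) = Lie \<xi> X - Lie \<xi> Y" if "VF X" "VF Y" for X Y
  using bracket_add_right[OF \<xi> VF_diff[OF that] that(2)] by simp
 have L_om: "\<xi> p (%q. \<omega> q [X q, Y q]) = \<omega> p [Lie \<xi> X p, Y p] + \<omega> p [X p, Lie \<xi> Y p]"
  if X: "VF X" "VF Y" for X Y p
 proof -
  have h: "\<omega> q [\<xi> q, Z q] = - Z q f" if "VF Z" for Z q by (rule ham[OF VF_tangent[OF that]])
  have "d2 \<omega> p \<xi> X Y = 0" using ext_d_2[OF om \<xi> X, of p] closed by simp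
  moreover have "\<omega> p [Lie X Y p, \<xi> p] = Lie X Y p f"
   using form2_swap[OF om \<xi> VF_bracket[OF X], of p] h[OF VF_bracket[OF X]] by simp
  moreover have "\<omega> p [Lie \<xi> Y p, X p] = - \<omega> p [X p, Lie \<xi> Y p]" by (rule form2_swap[OF om X(1) b[OF X(2)]])
  ultimately show ?thesis unfolding d2_def h[OF X(1)] h[OF X(2)] bracket_apply[of X Y p f]
   by (simp add: VF_minus_arg[OF X(1) VF_smooth[OF X(2) f]] VF_minus_arg[OF X(2) VF_smooth[OF X(1) f]])
 qed
 have om_g': "\<omega> p [X p, JF Y p] = g p (X p) (Y p)" if "VF X" "VF Y" for X Y p
  using om_JF[OF that(1) JF_VF[OF that(2)]] g_JF_JF[OF that] by simp
 have L_g: "\<xi> p (%q. g q (X q) (Y q)) = g p (Lie \<xi> X p) (Y p) + g p (X p) (Lie \<xi> Y p)"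
  if X: "VF X" "VF Y" for X Y p
  using L_om[OF X(1) JF_VF[OF X(2)], of p] unfolding inJ[OF X(2)] om_g'[OF X] om_g'[OF b[OF X(1)] X(2)] om_g'[OF X(1) b[OF X(2)]] .
 \<comment> \<open>the Lie derivative of the Levi-Civita connection\<close>
 define S where "S X Y = Lie \<xi> (D X Y) - D (Lie \<xi> X) Y - D X (Lie \<xi> Y)" for X Y
 have SV: "VF (S X Y)" if "VF X" "VF Y" for X Y unfolding S_def by (intro VF_diff b D_VF that)
 have sym: "S X Y = S Y X" if X: "VF X" "VF Y" for X Y
 proof -
  have "S X Y - S Y X = Lie \<xi> (D X Y - D Y X) - (D (Lie \<xi> X) Y - D Y (Lie \<xi> X)) -
    (D X (Lie \<xi> Y) - D (Lie \<xi> Y) X)"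
   unfolding S_def br_diff[OF D_VF[OF X] D_VF[OF X(2,1)]] by (simp add: algebra_simps)
  also have "... = 0" unfolding D_torsion[OF X] D_torsion[OF b[OF X(1)] X(2)] D_torsion[OF X(1) b[OF X(2)]] jacobi[OF \<xi> X] by simp
  finally show ?thesis by (simp add: algebra_simps)
 qed
 have skew: "g p (S X Y p) (Z p) = - g p (S X Z p) (Y p)" if X: "VF X" "VF Y" "VF Z" for X Y Z p
 proof -
  have s: "g p (S X Y p) (Z p) = g p (Lie \<xi> (D X Y) p) (Z p) - g p (D (Lie \<xi> X) Y p) (Z p) - g p (D X (Lie \<xi> Y) p) (Z p)"
   if X: "VF X" "VF Y" "VF Z" for X Y Z
   unfolding S_def using g_at(5)[OF VF_diff[OF b[OF D_VF[OF X(1,2)]] D_VF[OF b[OF X(1)] X(2)]] D_VF[OF X(1) b[OF X(2)]] X(3), of p]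
    g_at(5)[OF b[OF D_VF[OF X(1,2)]] D_VF[OF b[OF X(1)] X(2)] X(3), of p] by simp
  note V = D_VF[OF X(1,2)] D_VF[OF X(1,3)]
  have "(%q. X q (%q. g q (Y q) (Z q))) = (%q. g q (D X Y q) (Z q) + g q (Y q) (D X Z q))" using D_compat[OF X] by blast
  then have "\<xi> p (%q. X q (%q. g q (Y q) (Z q))) = \<xi> p (%q. g q (D X Y q) (Z q)) + \<xi> p (%q. g q (Y q) (D X Z q))"
   using VF_add_arg[OF \<xi> g_smooth[OF V(1) X(3)] g_smooth[OF X(2) V(2)], of p] by simp
  moreover have "(%q. \<xi> q (%q. g q (Y q) (Z q))) = (%q. g q (Lie \<xi> Y q) (Z q) + g q (Y q) (Lie \<xi> Z q))"
   using L_g[OF X(2,3)] by blast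
  then have "X p (%q. \<xi> q (%q. g q (Y q) (Z q))) = X p (%q. g q (Lie \<xi> Y q) (Z q)) + X p (%q. g q (Y q) (Lie \<xi> Z q))"
   using VF_add_arg[OF X(1) g_smooth[OF b[OF X(2)] X(3)] g_smooth[OF X(2) b[OF X(3)]], of p] by simp
  ultimately show ?thesis
   using s[OF X] s[OF X(1,3,2)] bracket_apply[of \<xi> X p "%q. g q (Y q) (Z q)"]
    D_compat[OF b[OF X(1)] X(2,3), of p] L_g[OF V(1) X(3), of p] L_g[OF X(2) V(2), of p]
    D_compat[OF X(1) b[OF X(2)] X(3), of p] D_compat[OF X(1,2) b[OF X(3)], of p]
    g_field_sym[OF X(2) b[OF V(2)], of p] g_field_sym[OF X(2) D_VF[OF b[OF X(1)] X(3)], of p] g_field_sym[OF X(2) D_VF[OF X(1) b[OF X(3)]], of p]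
   by simp
 qed
 have S0: "S X Y = 0" if X: "VF X" "VF Y" for X Y
 proof (rule g_nondegenerate[OF SV[OF X] VF_zero])
  fix Z p assume Z: "VF Z"
  have "g p (S X Y p) (Z p) = - g p (S Z X p) (Y p)" unfolding skew[OF X Z] sym[OF X(1) Z] ..
  also have "... = g p (S Y Z p) (X p)" unfolding skew[OF Z X] sym[OF Z X(2)] by simp
  also have "... = - g p (S X Y p) (Z p)" unfolding skew[OF X(2) Z X(1)] sym[OF X(2,1)] ..
  finally show "g p (S X Y p) (Z p) = g p (0 p) (Z p)" using Z by (simp add: g_zero1 VF_tangent)
 qed
 have L_D: "Lie \<xi> (D X Y) = D (Lie \<xi> X) Y + D X (Lie \<xi> Y)" if "VF X" "VF Y" for X Y
  using S0[OF that] unfolding S_def by (simp add: algebra_simps)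
 have L_dJ: "Lie \<xi> (dJ X Y) = dJ (Lie \<xi> X) Y + dJ X (Lie \<xi> Y)"
  unfolding dJ_def br_diff[OF D_VF[OF X(1) JF_VF[OF X(2)]] JF_VF[OF D_VF[OF X]]] L_D[OF X(1) JF_VF[OF X(2)]]
   inJ[OF X(2)] inJ[OF D_VF[OF X]] L_D[OF X] JF_add[OF D_VF[OF b[OF X(1)] X(2)] D_VF[OF X(1) b[OF X(2)]]] by simp
 note dV = dJ_VF[OF X] and dV' = dJ_VF[OF b[OF X(1)] X(2)] dJ_VF[OF X(1) b[OF X(2)]]
 have "Lie \<xi> (fscale (%_. 1 / 2) (JF (dJ X Y))) =
   fscale (%_. 1 / 2) (JF (dJ (Lie \<xi> X) Y)) + fscale (%_. 1 / 2) (JF (dJ X (Lie \<xi> Y)))"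
  unfolding bracket_fscale_right[OF \<xi> JF_VF[OF dV] smooth_const] inJ[OF dV] L_dJ JF_add[OF dV'] VF_const_arg[OF \<xi>]
  by (rule field_eqI) (simp add: field_apply)
 then show ?thesis unfolding nab br_diff[OF D_VF[OF X] VF_fscale[OF smooth_const JF_VF[OF dV]]] L_D[OF X] by simp
qed

lemma J_form_inv1: assumes a: "al : forms A 1" shows "J_form_inv A J al : forms A 1"
  and "u : TS p ==> J_form_inv A J al p [u] = al p [J p u]"
proof -
 show e: "J_form_inv A J al p [u] = al p [J p u]" if "u : TS p" for p u using that by (simp add: J_form_inv_def)
 show "J_form_inv A J al : forms A 1"
 proof (rule form1I, goal_cases)
  case (1 p vs) then show ?case using form_zero[OF a, of "map (J p) vs" p] by (auto simp: J_form_inv_def)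
 next
  case 2 then show ?case by (simp only: e tangent_comb J_lin form1_lin[OF a] J_tangent)
 next
  case 3 then show ?case using form1_smooth[OF a JF_VF] by (simp add: e VF_tangent JF_at)
 qed
qed

end

section \<open>Smooth group actions\<close>

lemma (in hausdorff_manifold) tangent_directional:
 assumes c: "(U, \<phi>) : A" "p : U" and v: "v : tangent A p"
 shows "EX w. ALL f:SF. v f = FD (f \<circ> inv_into U \<phi>) (at (\<phi> p)) w"
proof -
 obtain x W where x: "openin T W" "p : W" "W <= U" "!!b. x b : SF" "!!b q. q : W ==> x b q = \<phi> q \<bullet> b"
  using cutoff_coordinates[OF c] by metis
 have "v f = FD (f \<circ> inv_into U \<phi>) (at (\<phi> p)) (\<Sum>b\<in>Basis. v (x b) *\<^sub>R b)" if f: "f : SF" for f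
 proof -
  have l: "linear (FD (f \<circ> inv_into U \<phi>) (at (\<phi> p)))"
   by (rule linear_frechet_derivative[OF smooth_chart_differentiable[OF f c(1)]]) (use c in auto)
  have "v f = (\<Sum>b\<in>Basis. v (x b) * cvec U \<phi> p b f)" by (rule tangent_chart[OF c(1) x(2,1,3,4,5) v])
  then show ?thesis using f by (simp add: linear_sum[OF l] linear_scale[OF l] cvec_def)
 qed
 then show ?thesis by blast
qed

lemma frechet_chain:
 assumes "H differentiable at (h x)" "(h has_derivative h') (at x)"
 shows "((%x. H (h x)) has_derivative (%a. FD H (at (h x)) (h' a))) (at x)"
 using diff_chain_at[OF assms(2) assms(1)[unfolded frechet_derivative_works]] by (simp add: o_def)

locale smooth_action = total_manifold A + Grp: hausdorff_manifold B
 for A :: "('m, 'e::euclidean_space) atlas" and B :: "('m => 'm, 'f::euclidean_space) atlas" +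
 assumes act: "smooth_map (prod_atlas B A) A (%(F, x). F x)"
begin

text \<open>
 The function \<open>(F, q) \<mapsto> u (F q)\<close> in charts of the group and of the manifold.
\<close>
definition coord_act :: "('m => real) => ('m => 'm) set \<times> (('m => 'm) => 'f) => 'm set \<times> ('m => 'e) => 'f \<times> 'e => real" where
 "coord_act u c d yz = u (inv_into (fst c) (snd c) (fst yz) (inv_into (fst d) (snd d) (snd yz)))"

lemma coord_act_smooth:
 assumes u: "u : SF" and c: "(W, \<kappa>) : B" and d: "(U, \<phi>) : A"
 shows "Ck_on k (\<kappa> ` W \<times> \<phi> ` U) (coord_act u (W, \<kappa>) (U, \<phi>))"
proof (rule Ck_on_open_cover)
 fix yz assume "yz : \<kappa> ` W \<times> \<phi> ` U"
 then obtain F q where F: "F : W" "q : U" "yz = (\<kappa> F, \<phi> q)" by blast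
 obtain V \<psi> where V: "(V, \<psi>) : A" "F q : V" using carrier_chart[of "F q"] by auto
 let ?S = "map_prod \<kappa> \<phi> ` (W \<times> U \<inter> (%(F, x). F x) -` V)"
 let ?g = "\<psi> \<circ> (%(F, x). F x) \<circ> inv_into (W \<times> U) (map_prod \<kappa> \<phi>)"
 have "(W \<times> U, map_prod \<kappa> \<phi>) : prod_atlas B A" using c d by (auto simp: prod_atlas_def)
 then have S: "open ?S" "Ck_on k ?S ?g" using act V(1) unfolding smooth_map_def smooth_on_def by blast+
 have inj: "inj_on (map_prod \<kappa> \<phi>) (W \<times> U)" using Grp.chart_inj[OF c] chart_inj[OF d] by (auto simp: inj_on_def)
 have g: "?g (\<kappa> F, \<phi> q) = \<psi> (F q)" if "F : W" "q : U" for F q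
  using inv_into_f_f[OF inj, of "(F, q)"] that by simp
 have "Ck_on k ?S (%yz. (u \<circ> inv_into V \<psi>) (?g yz))"
  by (rule Ck_on_compose[OF S(1) chart_open[OF V(1)] _ S(2) smooth_chart[OF u V(1)]]) (use g in auto)
 moreover have "(u \<circ> inv_into V \<psi>) (?g yz) = coord_act u (W, \<kappa>) (U, \<phi>) yz" if "yz : ?S" for yz
  using that g inv_chart[OF V(1)] inv_chart[OF d] Grp.inv_chart[OF c] by (auto simp: coord_act_def)
 ultimately have "Ck_on k ?S (coord_act u (W, \<kappa>) (U, \<phi>))" by (rule Ck_on_cong[OF S(1), rotated])
 moreover have "yz : ?S" using F V by (force intro: image_eqI[of _ _ "(F, q)"])
 ultimately show "EX S. open S & yz : S & Ck_on k S (coord_act u (W, \<kappa>) (U, \<phi>))" using S(1) by blast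
qed

lemma act_smooth: assumes u: "u : SF" and F: "F : carrier B" shows "u \<circ> F : SF"
proof (rule smoothI)
 fix U \<phi> k assume d: "(U, \<phi>) : A"
 obtain W \<kappa> where c: "(W, \<kappa>) : B" "F : W" using Grp.carrier_chart[OF F] by blast
 have L: "Ck_on k (\<phi> ` U) (%z. (\<kappa> F, 0) + (0, z))"
  by (intro Ck_on_add Ck_on_const Ck_on_linear chart_open[OF d] bounded_linear_Pair bounded_linear_zero bounded_linear_ident)
 have "Ck_on k (\<phi> ` U) (%z. coord_act u (W, \<kappa>) (U, \<phi>) ((\<kappa> F, 0) + (0, z)))"
  by (rule Ck_on_compose[OF chart_open[OF d] open_Times[OF Grp.chart_open[OF c(1)] chart_open[OF d]] _ L coord_act_smooth[OF u c(1) d]])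
   (use c in auto)
 then show "Ck_on k (\<phi> ` U) (u \<circ> F \<circ> inv_into U \<phi>)"
  by (rule Ck_on_cong[OF chart_open[OF d], rotated]) (simp add: coord_act_def Grp.inv_chart[OF c])
qed

lemma orbit_smooth: assumes u: "u : SF" shows "(%F. u (F p)) : smooth_functions B"
proof (rule Grp.smoothI)
 fix W \<kappa> k assume c: "(W, \<kappa>) : B"
 obtain U \<phi> where d: "(U, \<phi>) : A" "p : U" using carrier_chart[of p] by auto
 have L: "Ck_on k (\<kappa> ` W) (%y. (0, \<phi> p) + (y, 0))"
  by (intro Ck_on_add Ck_on_const Ck_on_linear Grp.chart_open[OF c] bounded_linear_Pair bounded_linear_zero bounded_linear_ident)
 have "Ck_on k (\<kappa> ` W) (%y. coord_act u (W, \<kappa>) (U, \<phi>) ((0, \<phi> p) + (y, 0)))"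
  by (rule Ck_on_compose[OF Grp.chart_open[OF c] open_Times[OF Grp.chart_open[OF c] chart_open[OF d(1)]] _ L coord_act_smooth[OF u c d(1)]])
   (use d in auto)
 then show "Ck_on k (\<kappa> ` W) ((%F. u (F p)) \<circ> inv_into W \<kappa>)"
  by (rule Ck_on_cong[OF Grp.chart_open[OF c], rotated]) (simp add: coord_act_def inv_chart[OF d])
qed

lemma push_tangent: assumes F: "F : carrier B" and v: "v : TS p" shows "push A F v : TS (F p)"
proof -
 have "push A F v (%x. c * f x + h x) = c * push A F v f + push A F v h" if "f : SF" "h : SF" for c f h
  using tangent_lin[OF v act_smooth[OF that(1) F] act_smooth[OF that(2) F], of c] that
   smooth_add[OF smooth_mult[OF smooth_const that(1)] that(2)] by (simp add: push_def o_def)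
 moreover have "push A F v (%x. f x * h x) = f (F p) * push A F v h + h (F p) * push A F v f" if "f : SF" "h : SF" for f h
  using tangent_mult[OF v act_smooth[OF that(1) F] act_smooth[OF that(2) F]] that smooth_mult[OF that] by (simp add: push_def o_def)
 ultimately show ?thesis unfolding tangent_def by (auto simp: push_def)
qed

text \<open>
 The curve \<open>\<Phi>\<close> is a straight line in a chart of the group through the identity; it
 need not be a one-parameter subgroup, since only first derivatives at time 0 matter. The second
 derivative formula is the symmetry of mixed derivatives of \<open>u (F q)\<close> in the group and
 in the manifold variables.
\<close>
lemma flow:
 assumes v: "v : tangent B id" and i: "id : carrier B" and \<xi>: "VF \<xi>"
  and \<xi>v: "!!p f. f : SF ==> \<xi> p f = v (%F. f (F p))"
 shows "EX \<Phi>. \<Phi> 0 = id & (\<forall>\<^sub>F t in nhds 0. \<Phi> t : carrier B) &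
  (ALL u:SF. ALL p. ((%t. u (\<Phi> t p)) has_real_derivative \<xi> p u) (at 0)) &
  (ALL u:SF. ALL p X. VF X --> ((%t. X p (u \<circ> \<Phi> t)) has_real_derivative X p (%q. \<xi> q u)) (at 0))"
proof -
 obtain W \<kappa> where c: "(W, \<kappa>) : B" "id : W" using Grp.carrier_chart[OF i] by blast
 obtain w where w: "!!k. k : smooth_functions B ==> v k = FD (k \<circ> inv_into W \<kappa>) (at (\<kappa> id)) w"
  using Grp.tangent_directional[OF c v] by blast
 let ?y = "%t. \<kappa> id + t *\<^sub>R w"
 define \<Phi> where "\<Phi> t = inv_into W \<kappa> (?y t)" for t
 have dy: "(?y has_derivative (%t. t *\<^sub>R w)) (at t)" for t by (auto intro!: derivative_eq_intros)
 have "(?y \<longlongrightarrow> ?y 0) (nhds 0)" by (intro tendsto_intros filterlim_ident)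
 then have ev: "\<forall>\<^sub>F t in nhds 0. ?y t : \<kappa> ` W"
  by (rule topological_tendstoD[OF _ Grp.chart_open[OF c(1)]]) (use c in simp)
 have 0: "\<Phi> 0 = id" unfolding \<Phi>_def using Grp.inv_chart[OF c] by simp
 have \<Phi>W: "\<forall>\<^sub>F t in nhds 0. \<Phi> t : carrier B" unfolding \<Phi>_def
  by (rule eventually_mono[OF ev]) (rule subsetD[OF Grp.chart_carrier[OF c(1)] inv_into_into])
 have K1: "((%t. u (\<Phi> t p)) has_real_derivative \<xi> p u) (at 0)" if u: "u : SF" for u p
 proof -
  note k = orbit_smooth[OF u, of p]
  have "((%t. ((%F. u (F p)) \<circ> inv_into W \<kappa>) (?y t)) has_derivative
    (%t. FD ((%F. u (F p)) \<circ> inv_into W \<kappa>) (at (?y 0)) (t *\<^sub>R w))) (at 0)"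
   by (rule frechet_chain[OF _ dy]) (rule Grp.smooth_chart_differentiable[OF k c(1)], use c in simp)
  moreover have "linear (FD ((%F. u (F p)) \<circ> inv_into W \<kappa>) (at (\<kappa> id)))"
   by (rule linear_frechet_derivative[OF Grp.smooth_chart_differentiable[OF k c(1)]]) (use c in simp)
  ultimately show ?thesis
   unfolding has_field_derivative_def \<xi>v[OF u] w[OF k] \<Phi>_def by (simp add: o_def linear_scale mult_commute_abs)
 qed
 have K2: "((%t. X p (u \<circ> \<Phi> t)) has_real_derivative X p (%q. \<xi> q u)) (at 0)" if u: "u : SF" and X: "VF X" for u p X
 proof -
  obtain U \<phi> where d: "(U, \<phi>) : A" "p : U" using carrier_chart[of p] by auto
  obtain a where a: "!!k. k : SF ==> X p k = FD (k \<circ> inv_into U \<phi>) (at (\<phi> p)) a"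
   using tangent_directional[OF d VF_tangent[OF X]] by blast
  let ?H = "coord_act u (W, \<kappa>) (U, \<phi>)" and ?S = "\<kappa> ` W \<times> \<phi> ` U"
  let ?P = "%e x. FD ?H (at x) e"
  have C: "Ck_on 2 ?S ?H" by (rule coord_act_smooth[OF u c(1) d(1)])
  have oS: "open ?S" by (rule open_Times[OF Grp.chart_open[OF c(1)] chart_open[OF d(1)]])
  have H: "?H differentiable at x" and P: "?P e differentiable at x" if "x : ?S" for x e
   using C that unfolding numeral_2_eq_2 Ck_on.simps by blast+
  have x0: "(\<kappa> id, \<phi> p) : ?S" using c d by blast
  have hz: "((%z. (y, z)) has_derivative (%s. (0, s))) (at z)" for y :: 'f and z :: 'e by (auto intro!: derivative_eq_intros)
  have hy: "((%y. (y, z)) has_derivative (%s. (s, 0))) (at y)" for y :: 'f and z :: 'e by (auto intro!: derivative_eq_intros)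
  have t1: "X p (u \<circ> \<Phi> t) = ?P (0, a) (?y t, \<phi> p)" if t: "?y t : \<kappa> ` W" for t
  proof -
   have F: "\<Phi> t : carrier B" unfolding \<Phi>_def using inv_into_into[OF t] Grp.chart_carrier[OF c(1)] by blast
   have "(%z. ?H (?y t, z)) = u \<circ> \<Phi> t \<circ> inv_into U \<phi>" by (rule ext) (simp add: coord_act_def \<Phi>_def)
   moreover have x: "(?y t, \<phi> p) : ?S" using t d by blast
   ultimately show ?thesis unfolding a[OF act_smooth[OF u F]]
    using fun_cong[OF frechet_derivative_at[OF frechet_chain[where h="%z. (?y t, z)", OF H[OF x] hz]], of a] by simp
  qed
  have "((%t. ?P (0, a) (?y t, \<phi> p)) has_derivative
    (%t. FD (?P (0, a)) (at (?y 0, \<phi> p)) (t *\<^sub>R w, 0))) (at 0)"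
   by (rule frechet_chain[where h="%t. (?y t, \<phi> p)", OF P]) (use c d in \<open>auto intro!: derivative_eq_intros\<close>)
  moreover have "FD (?P (0, a)) (at (\<kappa> id, \<phi> p)) (t *\<^sub>R w, 0) = t * FD (?P (0, a)) (at (\<kappa> id, \<phi> p)) (w, 0)" for t
   using linear_scale[OF linear_frechet_derivative[OF P[OF x0]], of "(0, a)" t "(w, 0)"] by simp
  ultimately have K: "((%t. ?P (0, a) (?y t, \<phi> p)) has_real_derivative FD (?P (0, a)) (at (\<kappa> id, \<phi> p)) (w, 0)) (at 0)"
   by (simp add: has_field_derivative_def mult_commute_abs)
  have E: "\<forall>\<^sub>F t in nhds 0. X p (u \<circ> \<Phi> t) = ?P (0, a) (?y t, \<phi> p)" using ev by eventually_elim (rule t1)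
  have L: "((%t. X p (u \<circ> \<Phi> t)) has_real_derivative FD (?P (0, a)) (at (\<kappa> id, \<phi> p)) (w, 0)) (at 0)"
   by (rule DERIV_cong_ev[OF refl E refl, THEN iffD2, OF K])
  have s: "((%q. \<xi> q u) \<circ> inv_into U \<phi>) z = ?P (w, 0) (\<kappa> id, z)" if z: "z : \<phi> ` U" for z
  proof -
   have "(%y. ?H (y, z)) = (%F. u (F (inv_into U \<phi> z))) \<circ> inv_into W \<kappa>" by (rule ext) (simp add: coord_act_def)
   moreover have x: "(\<kappa> id, z) : ?S" using z c by blast
   ultimately show ?thesis unfolding comp_apply[of _ _ z] \<xi>v[OF u] w[OF orbit_smooth[OF u]]
    using fun_cong[OF frechet_derivative_at[OF frechet_chain[where h="%y. (y, z)", OF H[OF x] hy]], of w] by simp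
  qed
  have dd: "((%z. ?P (w, 0) (\<kappa> id, z)) has_derivative (%s. FD (?P (w, 0)) (at (\<kappa> id, \<phi> p)) (0, s))) (at (\<phi> p))"
   by (rule frechet_chain[where h="%z. (\<kappa> id, z)", OF P[OF x0] hz])
  have "X p (%q. \<xi> q u) = FD ((%q. \<xi> q u) \<circ> inv_into U \<phi>) (at (\<phi> p)) a" by (rule a[OF VF_smooth[OF \<xi> u]])
  also have "FD ((%q. \<xi> q u) \<circ> inv_into U \<phi>) (at (\<phi> p)) = FD (%z. ?P (w, 0) (\<kappa> id, z)) (at (\<phi> p))"
   by (rule frechet_derivative_transform_within_open[OF smooth_chart_differentiable[OF VF_smooth[OF \<xi> u] d(1)] chart_open[OF d(1)]])
    (use d s in auto)
  also have "... a = FD (?P (w, 0)) (at (\<kappa> id, \<phi> p)) (0, a)"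
   using fun_cong[OF frechet_derivative_at[OF dd], of a] by simp
  also have "... = FD (?P (0, a)) (at (\<kappa> id, \<phi> p)) (w, 0)"
   by (rule mixed_second_derivatives[OF oS x0 C])
  finally show ?thesis using L by simp
 qed
 show ?thesis using 0 \<Phi>W K1 K2 by blast
qed

lemma form1_local_frame:
 assumes F: "is_local_frame p th V x E" and a: "al : forms A 1" and u: "u : TS q"
 shows "th q * al q [u] = (\<Sum>b\<in>Basis. u (x b) * al q [E b q])"
proof -
 note d = is_local_frameD[OF F]
 obtain Y where Y: "VF Y" "Y q = u" using tangent_extends[OF u] by blast
 note L = form1_tensorial[OF a, of q]
 let ?Z = "\<Sum>b\<in>Basis. fscale (%r. Y r (x b)) (E b)"
 have V: "VF (fscale (%r. Y r (x b)) (E b))" for b by (rule VF_fscale[OF VF_smooth[OF Y(1) d(5)] d(6)])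
 have "th q * al q [u] = al q [fscale th Y q]" using tensorial_fscale[OF L Y(1) d(1)] Y by simp
 also have "... = al q [?Z q]"
  by (rule tensorial_cong[OF L VF_fscale[OF d(1) Y(1)] VF_sum[OF V]])
   (use d(7)[OF u] Y in \<open>simp add: fun_eq_iff sum_field_apply fscale_apply\<close>)
 also have "... = (\<Sum>b\<in>Basis. u (x b) * al q [E b q])"
  using tensorial_sum[OF L V, where I=Basis] tensorial_fscale[OF L d(6) VF_smooth[OF Y(1) d(5)]] Y by simp
 finally show ?thesis .
qed

text \<open>
 The derivative of the transported 1-form is its Lie derivative. The cut-off function
 \<open>th\<close> of a local frame makes the expansion of \<open>al\<close> in the frame valid at
 \<open>\<Phi> t p\<close> for all \<open>t\<close>; it is constant near \<open>p\<close> and does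
 not contribute.
\<close>
lemma lie_derivative_flow:
 assumes v: "v : tangent B id" and i: "id : carrier B" and \<xi>: "VF \<xi>"
  and \<xi>v: "!!p f. f : SF ==> \<xi> p f = v (%F. f (F p))"
 shows "EX \<Phi> th. (\<forall>\<^sub>F t in nhds 0. \<Phi> t : carrier B) & ((%t. th (\<Phi> t p)) has_real_derivative 0) (at 0) &
  (ALL al X. al : forms A 1 --> VF X -->
   ((%t. th (\<Phi> t p) * al (\<Phi> t p) [push A (\<Phi> t) (X p)]) has_real_derivative
    \<xi> p (%q. al q [X q]) - al p [Lie \<xi> X p]) (at 0))"
proof -
 obtain \<Phi> where 0: "\<Phi> 0 = id" and ev: "\<forall>\<^sub>F t in nhds 0. \<Phi> t : carrier B"
  and K1: "ALL u:SF. ALL p. ((%t. u (\<Phi> t p)) has_real_derivative \<xi> p u) (at 0)"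
  and K2: "ALL u:SF. ALL p X. VF X --> ((%t. X p (u \<circ> \<Phi> t)) has_real_derivative X p (%q. \<xi> q u)) (at 0)"
  using flow[OF assms] by blast
 obtain th V x E where F: "is_local_frame p th V x E" using local_frame by blast
 note d = is_local_frameD[OF F] and fr = form1_local_frame[OF F]
 have "\<xi> p th = \<xi> p (%_. 1)" by (rule VF_local_arg[OF \<xi> d(1) smooth_const d(2,3,4)])
 then have th0: "((%t. th (\<Phi> t p)) has_real_derivative 0) (at 0)" using K1 d(1) VF_const_arg[OF \<xi>] by metis
 have "((%t. th (\<Phi> t p) * al (\<Phi> t p) [push A (\<Phi> t) (X p)]) has_real_derivative
    \<xi> p (%q. al q [X q]) - al p [Lie \<xi> X p]) (at 0)" if a: "al : forms A 1" and X: "VF X" for al X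
 proof -
  have as: "(%q. al q [E b q]) : SF" for b by (rule form1_smooth[OF a d(6)])
  have Xs: "(%q. X q (x b)) : SF" for b by (rule VF_smooth[OF X d(5)])
  have "\<xi> p (%q. al q [X q]) = \<xi> p (%q. \<Sum>b\<in>Basis. X q (x b) * al q [E b q])"
  proof (rule VF_local_arg[OF \<xi> form1_smooth[OF a X] smooth_sum[OF smooth_mult[OF Xs as]] d(2,3)])
   show "al q [X q] = (\<Sum>b\<in>Basis. X q (x b) * al q [E b q])" if "q : V" for q
    using fr[OF a VF_tangent[OF X], of q] d(4)[OF that] by simp
  qed
  also have "... = (\<Sum>b\<in>Basis. X p (x b) * \<xi> p (%q. al q [E b q]) + al p [E b p] * \<xi> p (%q. X q (x b)))"
   using VF_sum_arg[OF \<xi>, of Basis "%b q. X q (x b) * al q [E b q]"] smooth_mult[OF Xs as] VF_mult_arg[OF \<xi> Xs as] by simp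
  moreover have "al p [Lie \<xi> X p] = (\<Sum>b\<in>Basis. Lie \<xi> X p (x b) * al p [E b p])"
   using fr[OF a VF_tangent[OF VF_bracket[OF \<xi> X]], of p] d(3,4) by simp
  ultimately have val: "(\<Sum>b\<in>Basis. X p (x b) * \<xi> p (%q. al q [E b q]) + X p (%q. \<xi> q (x b)) * al p [E b p]) =
    \<xi> p (%q. al q [X q]) - al p [Lie \<xi> X p]"
   by (simp add: sum_subtractf[symmetric] bracket_apply algebra_simps)
  have "((%t. X p (x b \<circ> \<Phi> t) * al (\<Phi> t p) [E b (\<Phi> t p)]) has_real_derivative
    X p (x b) * \<xi> p (%q. al q [E b q]) + X p (%q. \<xi> q (x b)) * al p [E b p]) (at 0)" for b
   using DERIV_mult'[OF K2[rule_format, OF d(5) X] K1[rule_format, OF as]] by (simp add: 0)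
  then have K: "((%t. \<Sum>b\<in>Basis. X p (x b \<circ> \<Phi> t) * al (\<Phi> t p) [E b (\<Phi> t p)]) has_real_derivative
    \<xi> p (%q. al q [X q]) - al p [Lie \<xi> X p]) (at 0)"
   unfolding val[symmetric] by (rule DERIV_sum)
  have E: "\<forall>\<^sub>F t in nhds 0. th (\<Phi> t p) * al (\<Phi> t p) [push A (\<Phi> t) (X p)] = (\<Sum>b\<in>Basis. X p (x b \<circ> \<Phi> t) * al (\<Phi> t p) [E b (\<Phi> t p)])"
   using ev by eventually_elim (use fr[OF a push_tangent[OF _ VF_tangent[OF X]]] d(5) in \<open>simp add: push_def\<close>)
  show ?thesis by (rule DERIV_cong_ev[OF refl E refl, THEN iffD2, OF K])
 qed
 then show ?thesis using ev th0 by blast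
qed

end

context almost_kahler begin

text \<open>
 Apply \<open>lie_derivative_flow\<close> to \<open>a\<close>, whose transport is constant, and to
 \<open>du \<circ> J\<close> on \<open>X\<close> and \<open>du\<close> on \<open>J X\<close>, whose
 transports agree. If the group is trivial, its only tangent vector is zero.
\<close>
lemma infinitesimal_invariance:
 assumes G: "compact_connected_Lie_subgroup A \<omega> G B" and \<xi>: "\<xi> : Lie_algebra A B" "VF \<xi>"
  and inJ: "!!F p u. F : G ==> u : TS p ==> push A F (J p u) = J (F p) (push A F u)"
  and a: "a : forms A 1" "G_invariant_form A G a" and X: "VF X"
 shows "Lie \<xi> (JF X) = JF (Lie \<xi> X)" "\<xi> p (%q. a q [X q]) = a p [Lie \<xi> X p]"
proof -
 obtain v where v: "v : tangent B id" "\<xi> = (%p f. if f : SF then v (%F. f (F p)) else 0)"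
  using \<xi>(1) unfolding Lie_algebra_def by blast
 have "Lie \<xi> (JF X) = JF (Lie \<xi> X) & (ALL p. \<xi> p (%q. a q [X q]) = a p [Lie \<xi> X p])"
 proof (cases "G = {id} & B = {}")
  case True
  have "v u = 0" for u
  proof -
   have SB: "k : smooth_functions B" for k using True by (simp add: smooth_functions_def)
   \<comment> \<open>the indicator of the identity is idempotent, so derivations at the identity annihilate it\<close>
   let ?e = "%F. if F = id then 1 else (0 :: real)"
   have m: "v (%x. h x * k x) = h id * v k + k id * v h" for h k using v(1) SB unfolding tangent_def by blast
   have l: "v (%x. c * h x + k x) = c * v h + v k" for c h k using v(1) SB unfolding tangent_def by blast
   have e: "v ?e = 0" using m[of ?e ?e] by (simp add: if_distrib cong: if_cong)
   have "v (%_. 0) = 0" using l[of 1 "%_. 0" "%_. 0"] by simp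
   then have "v (%x. u id * ?e x) = 0" using l[of "u id" ?e "%_. 0"] e by simp
   moreover have "(%x. u id * ?e x) = (%x. u x * ?e x)" by auto
   ultimately show ?thesis using m[of u ?e] e by simp
  qed
  then have "\<xi> = 0" unfolding v(2) by (intro ext) simp
  moreover have "Lie 0 Y = 0" if "VF Y" for Y using VF_zero_arg[OF that] by (intro ext) (simp add: bracket_apply)
  moreover have "a p [0 p] = 0" for p using tensorial_0[OF form1_tensorial[OF a(1)]] .
  ultimately show ?thesis using X JF_VF[OF X] JF_zero by simp
 next
  case False
  then have B: "carrier B = G" "compact_manifold B" "smooth_map (prod_atlas B A) A (%(F, x). F x)" "id : carrier B"
   using G unfolding compact_connected_Lie_subgroup_def by auto
  interpret smooth_action A B by unfold_locales (use B in \<open>auto simp: compact_manifold_def\<close>)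
  have flow: "EX \<Phi> th. (\<forall>\<^sub>F t in nhds 0. \<Phi> t : carrier B) & ((%t. th (\<Phi> t p)) has_real_derivative 0) (at 0) &
   (ALL al X. al : forms A 1 --> VF X -->
    ((%t. th (\<Phi> t p) * al (\<Phi> t p) [push A (\<Phi> t) (X p)]) has_real_derivative
     \<xi> p (%q. al q [X q]) - al p [Lie \<xi> X p]) (at 0))" for p
   by (rule lie_derivative_flow[OF v(1) B(4) \<xi>(2)]) (simp add: v(2))
  have "\<xi> p (%q. a q [X q]) = a p [Lie \<xi> X p]" for p
  proof -
   obtain \<Phi> th where P: "\<forall>\<^sub>F t in nhds 0. \<Phi> t : carrier B" "((%t. th (\<Phi> t p)) has_real_derivative 0) (at 0)"
    "((%t. th (\<Phi> t p) * a (\<Phi> t p) [push A (\<Phi> t) (X p)]) has_real_derivative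
     \<xi> p (%q. a q [X q]) - a p [Lie \<xi> X p]) (at 0)" using flow[of p] a(1) X by blast
   have inv: "a (F p) [push A F (X p)] = a p [X p]" if "F : carrier B" for F
   proof -
    have "pullback A F a p [X p] = a p [X p]" using a(2) that B(1) by (simp add: G_invariant_form_def)
    then show ?thesis using X by (simp add: pullback_def VF_tangent)
   qed
   have E: "\<forall>\<^sub>F t in nhds 0. th (\<Phi> t p) * a (\<Phi> t p) [push A (\<Phi> t) (X p)] = th (\<Phi> t p) * a p [X p]"
    using P(1) by eventually_elim (simp add: inv)
   from DERIV_unique[OF DERIV_cong_ev[OF refl E refl, THEN iffD1, OF P(3)] DERIV_cmult_right[OF P(2), of "a p [X p]"]] show ?thesis by simp
  qed
  moreover have "Lie \<xi> (JF X) = JF (Lie \<xi> X)"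
  proof (rule VF_eqI[OF VF_bracket[OF \<xi>(2) JF_VF[OF X]] JF_VF[OF VF_bracket[OF \<xi>(2) X]]])
   fix p u assume u: "u : SF"
   let ?al = "ext_d A (fun_form u)" and ?\<beta> = "J_form_inv A J (ext_d A (fun_form u))"
   note al = ext_d_fun_form[OF u]
   note b = J_form_inv1[OF al]
   obtain \<Phi> th where P: "\<forall>\<^sub>F t in nhds 0. \<Phi> t : carrier B"
    "((%t. th (\<Phi> t p) * ?al (\<Phi> t p) [push A (\<Phi> t) (JF X p)]) has_real_derivative
     \<xi> p (%q. ?al q [JF X q]) - ?al p [Lie \<xi> (JF X) p]) (at 0)"
    "((%t. th (\<Phi> t p) * ?\<beta> (\<Phi> t p) [push A (\<Phi> t) (X p)]) has_real_derivative
     \<xi> p (%q. ?\<beta> q [X q]) - ?\<beta> p [Lie \<xi> X p]) (at 0)"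
    using flow[of p] al b(1) X JF_VF[OF X] by blast
   have e: "?\<beta> (F p) [push A F (X p)] = ?al (F p) [push A F (JF X p)]" if F: "F : carrier B" for F
    unfolding b(2)[OF push_tangent[OF F VF_tangent[OF X]]] using inJ[of F "X p" p] F B(1) X by (simp add: VF_tangent JF_at)
   have E: "\<forall>\<^sub>F t in nhds 0. th (\<Phi> t p) * ?\<beta> (\<Phi> t p) [push A (\<Phi> t) (X p)] = th (\<Phi> t p) * ?al (\<Phi> t p) [push A (\<Phi> t) (JF X p)]"
    using P(1) by eventually_elim (simp add: e)
   from DERIV_unique[OF DERIV_cong_ev[OF refl E refl, THEN iffD1, OF P(3)] P(2)]
   have "?\<beta> p [Lie \<xi> X p] = ?al p [Lie \<xi> (JF X) p]"
    by (simp add: b(2) VF_tangent X JF_at)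
   then show "Lie \<xi> (JF X) p u = JF (Lie \<xi> X) p u"
    using b(2)[OF VF_tangent[OF VF_bracket[OF \<xi>(2) X]]]
     ext_d_fun[OF u VF_tangent[OF VF_bracket[OF \<xi>(2) JF_VF[OF X]]]] ext_d_fun[OF u J_tangent[OF VF_tangent[OF VF_bracket[OF \<xi>(2) X]]]]
    by (simp add: JF_at)
  qed
  ultimately show ?thesis by blast
 qed
 then show "Lie \<xi> (JF X) = JF (Lie \<xi> X)" "\<xi> p (%q. a q [X q]) = a p [Lie \<xi> X p]" by auto
qed

end

section \<open>Conformal change of the metric\<close>

lemma (in total_manifold) VF_exp_arg: assumes X: "VF X" and s: "s : SF"
 shows "X p (%q. exp (c * s q)) = c * exp (c * s p) * X p s"
proof -
 obtain U \<phi> where d: "(U, \<phi>) : A" "p : U" using carrier_chart[of p] by auto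
 obtain a where a: "!!k. k : SF ==> X p k = FD (k \<circ> inv_into U \<phi>) (at (\<phi> p)) a"
  using tangent_directional[OF d VF_tangent[OF X]] by blast
 let ?S = "s \<circ> inv_into U \<phi>"
 have "?S differentiable at (\<phi> p)" by (rule smooth_chart_differentiable[OF s d(1)]) (use d in simp)
 then have S: "(?S has_derivative FD ?S (at (\<phi> p))) (at (\<phi> p))" by (simp only: frechet_derivative_works)
 have "((%y. exp (c * S y)) has_derivative (%v. c * exp (c * S x) * S' v)) (at x)"
  if "(S has_derivative S') (at x)" for S S' and x :: 'e using that by (auto intro!: derivative_eq_intros)
 from fun_cong[OF frechet_derivative_at[OF this[OF S]], of a] show ?thesis
  using a[OF smooth_exp[OF smooth_mult[OF smooth_const s]], of c] a[OF s] by (simp add: o_def inv_chart[OF d])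
qed

context riem begin

abbreviation conf :: "('m => real) => 'm metric" where "conf s \<equiv> %p u v. exp (- (2 * s p)) * g p u v"

lemma exp_smooth: "s : SF ==> (%q. exp (c * s q)) : SF" by (intro smooth_exp smooth_mult smooth_const)

context
 fixes s assumes s: "s : SF"
begin

lemma conf_riem: "riem A (conf s)"
proof unfold_locales
 have "riemannian_metric A g" by (rule metric)
 then show "riemannian_metric A (conf s)"
  using exp_smooth[OF s, of "-2"] unfolding riemannian_metric_def by (auto simp: algebra_simps intro: smooth_mult)
qed

text \<open>
 The frame \<open>exp s e\<^sub>i\<close> is orthonormal for the conformal metric; use
 \<open>dv_bracket\<close>.
\<close>
lemma conf_dv: assumes Z: "VF Z" shows "riem.dv A (conf s) Z p = dv Z p - real DIM('e) * Z p s"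
proof -
 obtain U e where e: "frame p U e" using frame_exists by blast
 note d = frameD[OF e]
 let ?w = "%q. exp (1 * s q)" and ?w' = "%p. Z p (%q. exp (1 * s q))"
 note w = exp_smooth[OF s, of 1]
 have E: "exp (- (2 * s q)) * (?w q * (?w q * x)) = x" for q x by (simp add: mult_exp_exp[symmetric] mult.assoc[symmetric] exp_minus_inverse flip: exp_add)
 have f': "orthonormal_frame A (conf s) p U (%i. fscale ?w (e i))"
  unfolding orthonormal_frame_def
 proof (intro conjI allI impI ballI d(1,2) VF_fscale w d(3))
  fix q i j assume q: "q : U" and i: "i < DIM('e)" and j: "j < DIM('e)"
  have "g q (fscale ?w (e i) q) (fscale ?w (e j) q) = ?w q * (?w q * (if i = j then 1 else 0))"
   using g_at(3)[OF d(3)[OF i] d(3)[OF i] VF_fscale[OF w d(3)[OF j]] w, of q] g_at(4)[OF d(3)[OF j] d(3)[OF i] d(3)[OF i] w, of q]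
    d(4)[OF q i j] by simp
  then show "conf s q (fscale ?w (e i) q) (fscale ?w (e j) q) = (if i = j then 1 else 0)" using E by simp
 qed
 have "riem.dv A (conf s) Z p = (\<Sum>i<DIM('e). conf s p (Lie (fscale ?w (e i)) Z p) (fscale ?w (e i) p))"
  by (rule riem.dv_bracket[OF conf_riem Z f'])
 also have "... = (\<Sum>i<DIM('e). g p (Lie (e i) Z p) (e i p) - Z p s)"
 proof (intro sum.cong refl)
  fix i assume "i : {..<DIM('e)}"
  then have i: "i < DIM('e)" by simp
  note V = d(3)[OF i] and B = VF_bracket[OF d(3)[OF i] Z] and wZ = VF_smooth[OF Z w]
  have "g p (Lie (fscale ?w (e i)) Z p) (fscale ?w (e i) p) =
    ?w p * (?w p * g p (Lie (e i) Z p) (e i p)) - ?w' p * (?w p * 1)"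
   unfolding bracket_fscale_left[OF Z V w] g_at(5)[OF VF_fscale[OF w B] VF_fscale[OF wZ V] VF_fscale[OF w V]]
    g_at(3)[OF B V VF_fscale[OF w V] w] g_at(3)[OF V V VF_fscale[OF w V] wZ] g_at(4)[OF V V V w] g_at(4)[OF V V B w]
   using d(4)[OF d(2) i i] by simp
  also have "... = ?w p * (?w p * (g p (Lie (e i) Z p) (e i p) - Z p s))"
   unfolding VF_exp_arg[OF Z s] by (simp add: algebra_simps)
  finally have eq: "g p (Lie (fscale ?w (e i)) Z p) (fscale ?w (e i) p) =
   ?w p * (?w p * (g p (Lie (e i) Z p) (e i p) - Z p s))" .
  show "conf s p (Lie (fscale ?w (e i)) Z p) (fscale ?w (e i) p) = g p (Lie (e i) Z p) (e i p) - Z p s"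
   unfolding eq E ..
 qed
 finally show ?thesis unfolding dv_bracket[OF Z e] by (simp add: sum_subtractf)
qed

text \<open>
 Raising the index costs a factor \<open>exp (2 s)\<close>, whose derivative contributes
 \<open>2\<close> to the coefficient of \<open>sharp b p s\<close>.
\<close>
lemma conf_codiff: assumes b: "b : forms A 1"
 shows "riem.dv A (conf s) (riem.sharp A (conf s) b) p =
  exp (2 * s p) * (dv (sharp b) p - (real DIM('e) - 2) * sharp b p s)"
proof -
 note S = sharp(1)[OF b] and w = exp_smooth[OF s, of 2]
 have "riem.sharp A (conf s) b = fscale (%q. exp (2 * s q)) (sharp b)"
 proof (rule riem.sharp_unique[OF conf_riem b VF_fscale[OF w S]])
  show "conf s p (fscale (%q. exp (2 * s q)) (sharp b) p) (X p) = b p [X p]" if "VF X" for p X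
   using g_at(3)[OF S S that w, of p] sharp(2)[OF b that, of p] by (simp add: exp_minus)
 qed
 then show ?thesis
  using conf_dv[OF VF_fscale[OF w S], of p] dv_fscale[OF S w, of p] VF_exp_arg[OF S s, of p 2]
  by (simp add: fscale_apply algebra_simps)
qed

end

end

text \<open>
 The volume form of the conformal metric is \<open>exp (- DIM s)\<close> times that of
 \<open>g\<close>.
\<close>
lemma (in riem_integral) conf_integral: assumes s: "s : SF"
 shows "riem_integral A (conf s) (%u. I (%p. exp (- real DIM('e) * s p) * u p))"
proof -
 interpret c: riem A "conf s" by (rule conf_riem[OF s])
 note w = exp_smooth[OF s, of "- real DIM('e)"]
 show ?thesis
 proof (unfold_locales, goal_cases)
  case (1 u v) then show ?case using I_add[OF smooth_mult[OF w 1(1)] smooth_mult[OF w 1(2)]] by (simp add: distrib_left)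
 next
  case (2 u c) then show ?case using I_cmult[OF smooth_mult[OF w 2], of c] by (simp add: mult.left_commute)
 next
  case (3 u p) then show ?case using I_definite[OF smooth_mult[OF w 3(1)], of p] by simp
 next
  case (4 Z)
  have "(%p. exp (- real DIM('e) * s p) * c.dv Z p) = dv (fscale (%p. exp (- real DIM('e) * s p)) Z)"
   by (rule ext) (simp only: conf_dv[OF s 4] dv_fscale[OF 4 w] VF_exp_arg[OF 4 s], simp add: algebra_simps)
  then show ?case using I_div[OF VF_fscale[OF w 4]] by simp
 qed
qed

section \<open>The twisted Hodge decomposition\<close>

context almost_kahler begin

lemma J_form_inv2: assumes a: "\<psi> : forms A 2" shows "J_form_inv A J \<psi> : forms A 2"
proof (rule form2I, goal_cases)
 case (1 p vs) then show ?case using form_zero[OF a, of "map (J p) vs" p] by (auto simp: J_form_inv_def)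
next
 case 2 then show ?case by (simp add: J_form_inv_def tangent_comb J_lin form2_lin1[OF a] J_tangent)
next
 case 3 then show ?case by (simp add: J_form_inv_def tangent_comb J_lin form2_lin2[OF a] J_tangent)
next
 case 4 then show ?case by (simp add: J_form_inv_def form2_same[OF a] J_tangent)
next
 case 5 then show ?case using form2_smooth[OF a JF_VF[OF 5(1)] JF_VF[OF 5(2)]] by (simp add: J_form_inv_def VF_tangent JF_at)
qed

lemma J_form_inv_J_form: assumes "!!p vs. ~ set vs <= TS p ==> \<beta> p vs = 0"
 shows "J_form_inv A J (J_form A J \<beta>) = \<beta>"
proof (intro ext)
 fix p vs
 show "J_form_inv A J (J_form A J \<beta>) p vs = \<beta> p vs"
 proof (cases "set vs <= TS p")
  case True
  then have "map (%v. - J p v) (map (J p) vs) = vs" by (induction vs) (auto simp: J_J)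
  moreover have "set (map (J p) vs) <= TS p" using True J_tangent by auto
  ultimately show ?thesis using True by (simp add: J_form_inv_def J_form_def)
 qed (simp add: J_form_inv_def assms)
qed

lemma d_c_fun: "d_c A J (fun_form h) = J_form A J (ext_d A (fun_form h))"
proof -
 have "J_form_inv A J (fun_form h) = fun_form h" by (intro ext) (simp add: J_form_inv_def fun_form_def)
 then show ?thesis by (simp add: d_c_def)
qed

lemma J_form_at: "u : TS p ==> J_form A J \<beta> p [J p u] = \<beta> p [u]"
 by (simp add: J_form_def J_tangent J_J)

lemma d_c_eq_iff: assumes h: "h : SF" and f: "f : SF"
 shows "d_c A J (fun_form h) = - d_c A J (fun_form f) \<longleftrightarrow> (ALL X p. VF X --> X p h = - X p f)"
proof
 assume L: "d_c A J (fun_form h) = - d_c A J (fun_form f)"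
 show "ALL X p. VF X --> X p h = - X p f"
 proof (intro allI impI)
  fix X p assume "VF X"
  then have X: "X p : TS p" by (rule VF_tangent)
  show "X p h = - X p f" using fun_cong[OF fun_cong[OF L, of p], of "[J p (X p)]"]
   unfolding d_c_fun uminus_apply J_form_at[OF X] ext_d_fun[OF h X] ext_d_fun[OF f X] .
 qed
next
 assume R: "ALL X p. VF X --> X p h = - X p f"
 have "ext_d A (fun_form h) p vs = - ext_d A (fun_form f) p vs" for p vs
 proof (cases "EX u. vs = [u] & u : TS p")
  case True
  then obtain u where u: "vs = [u]" "u : TS p" by blast
  obtain X where "VF X" "X p = u" using tangent_extends[OF u(2)] by blast
  then show ?thesis using R u ext_d_fun[OF h u(2)] ext_d_fun[OF f u(2)] by auto
 next
  case False
  then have "length vs ~= 1 \<or> ~ set vs <= TS p" by (cases vs) auto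
  then consider "length vs ~= 1" | "~ set vs <= TS p" by blast
  then show ?thesis by cases (simp_all add: ext_d_fun_degree ext_d_nontangent)
 qed
 then show "d_c A J (fun_form h) = - d_c A J (fun_form f)" unfolding d_c_fun by (intro ext) (simp add: J_form_def)
qed

text \<open>The twisted operators are conjugate to the usual ones by \<open>J\<close>.\<close>
lemma laplacian_c_hodge: assumes "u : TS p"
 shows "laplacian_c A J \<gamma> aH p [J p u] = hodge_laplacian A \<gamma> (J_form_inv A J aH) p [u]"
proof -
 have "codiff_c A J \<gamma> (d_c A J aH) = J_form A J (codiff A \<gamma> (ext_d A (J_form_inv A J aH)))"
  unfolding codiff_c_def d_c_def by (subst J_form_inv_J_form) (simp_all add: ext_d_nontangent)
 moreover have "d_c A J (codiff_c A J \<gamma> aH) = J_form A J (ext_d A (codiff A \<gamma> (J_form_inv A J aH)))"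
  unfolding codiff_c_def d_c_def by (subst J_form_inv_J_form) (simp_all add: codiff_def)
 ultimately show ?thesis using J_form_at[OF assms] by (simp add: laplacian_c_def hodge_laplacian_def)
qed

end

context compact_almost_kahler begin

text \<open>
 With \<open>s = f / (n - 1)\<close> the coefficient \<open>(DIM - 2) s\<close> in
 \<open>conf_codiff\<close> is \<open>2 f\<close>. This determines the conformal factor in the
 theorem.
\<close>
lemma twisted_coclosed:
 assumes f: "f : SF" and n: "n > 1" and a: "a : forms A 1"
  and dec: "twisted_hodge_decomposition A J (conformal_metric n f g) a aH h \<psi>"
 shows "h : SF" "dv (sharp (J_form_inv A J a)) p - 2 * sharp (J_form_inv A J a) p f = dv (grad h) p - 2 * grad h p f"
proof -
 define s where "s q = f q / (real n - 1)" for q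
 have s: "s : SF" unfolding s_def[abs_def] using smooth_mult[OF smooth_const f, of "1 / (real n - 1)"] by simp
 have cm: "conformal_metric n f g = conf s" by (intro ext) (simp add: conformal_metric_def s_def)
 let ?b = "J_form_inv A J a" and ?bH = "J_form_inv A J aH" and ?\<psi> = "J_form_inv A J \<psi>"
 have d: "aH : forms A 1" "laplacian_c A J (conf s) aH = 0" "h : SF" "\<psi> : forms A 2"
  "a = aH + d_c A J (fun_form h) + codiff_c A J (conf s) \<psi>"
  using dec unfolding twisted_hodge_decomposition_def cm by auto
 then show h: "h : SF" by blast
 interpret c: riem_integral A "conf s" "%u. vol.volume_integral (%p. exp (- real DIM('e) * s p) * u p)"
  by (rule vol.conf_integral[OF s])
 note b = J_form_inv1[OF a] and bH = J_form_inv1[OF d(1)] and ps = J_form_inv2[OF d(4)] and dh = ext_d_fun_form[OF d(3)]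
 note cps = c.codiff_form2_form[OF ps]
 have co: "riem.dv A (conf s) (c.sharp ?bH) p = 0"
 proof (rule c.harmonic_form_coclosed[OF bH(1)])
  fix p u assume "u : TS p"
  from laplacian_c_hodge[OF this, of "conf s" aH] show "hodge_laplacian A (conf s) ?bH p [u] = 0" using d(2) by simp
 qed
 have "c.sharp ?b = c.sharp ?bH + c.sharp (ext_d A (fun_form h)) + c.sharp (codiff A (conf s) ?\<psi>)" (is "_ = ?Z")
 proof (rule c.sharp_unique[OF b(1)])
  note V = c.sharp(1)[OF bH(1)] c.sharp(1)[OF dh] c.sharp(1)[OF cps]
  show "VF ?Z" by (intro VF_add V)
  fix p X assume X: "VF X"
  have u: "X p : TS p" by (rule VF_tangent[OF X])
  have "?b p [X p] = ?bH p [X p] + ext_d A (fun_form h) p [X p] + codiff A (conf s) ?\<psi> p [X p]"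
   unfolding b(2)[OF u] bH(2)[OF u] using fun_cong[OF fun_cong[OF d(5), of p], of "[J p (X p)]"]
   unfolding plus_fun_apply d_c_fun codiff_c_def J_form_at[OF u] .
  then show "conf s p (?Z p) (X p) = ?b p [X p]"
   using c.g_at(1)[OF VF_add[OF V(1,2)] V(3) X, of p] c.g_at(1)[OF V(1,2) X, of p]
    c.sharp(2)[OF bH(1) X, of p] c.sharp(2)[OF dh X, of p] c.sharp(2)[OF cps X, of p] by simp
 qed
 then have "riem.dv A (conf s) (c.sharp ?b) p = riem.dv A (conf s) (c.sharp (ext_d A (fun_form h))) p"
  using c.dv_add[OF VF_add[OF c.sharp(1)[OF bH(1)] c.sharp(1)[OF dh]] c.sharp(1)[OF cps], of p]
   c.dv_add[OF c.sharp(1)[OF bH(1)] c.sharp(1)[OF dh], of p] co c.codiff_codiff[OF ps, of p] by simp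
 then have "dv (sharp ?b) p - (real DIM('e) - 2) * sharp ?b p s = dv (grad h) p - (real DIM('e) - 2) * grad h p s"
  unfolding conf_codiff[OF s b(1)] conf_codiff[OF s dh] grad_def by simp
 moreover have "(real DIM('e) - 2) * X p s = 2 * X p f" if X: "VF X" for X
 proof -
  have "X p s = 1 / (real n - 1) * X p f" using VF_cmult_arg[OF X f, of p "1 / (real n - 1)"] by (simp add: s_def[abs_def])
  then show ?thesis using n by (simp add: dim field_simps)
 qed
 ultimately show "dv (sharp ?b) p - 2 * sharp ?b p f = dv (grad h) p - 2 * grad h p f"
  using sharp(1)[OF b(1)] grad(1)[OF h] by simp
qed

section \<open>The soliton equation\<close>

theorem soliton_iff:
 assumes conn: "connected_space T" and n: "n > 1"
  and G: "compact_connected_Lie_subgroup A \<omega> G B" and \<xi>: "\<xi> : Lie_algebra A B"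
  and inJ: "!!F p u. F : G ==> u : TS p ==> push A F (J p u) = J (F p) (push A F u)"
  and pot: "is_potential A n \<omega> \<xi> f"
  and a: "a : forms A 1" "G_invariant_form A G a" and ric: "chern_ricci A \<omega> J - \<omega> = ext_d A a"
  and dec: "twisted_hodge_decomposition A J (conformal_metric n f g) a aH h \<psi>"
 shows "GeAKRS A n \<omega> J f \<longleftrightarrow> d_c A J (fun_form h) = - d_c A J (fun_form f)"
proof -
 let ?I = vol.volume_integral
 have V\<xi>: "VF \<xi>" and f: "f : SF" and ham: "!!p v. v : TS p ==> \<omega> p [\<xi> p, v] = - v f"
  and f0: "?I (%p. f p * exp (- 2 * f p)) = 0"
  using pot ext_d_fun unfolding is_potential_def hamiltonian_field_def vol.volume_integral_def by auto
 define b where "b = J_form_inv A J a"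
 have b: "b : forms A 1" "!!u p. u : TS p ==> b p [u] = a p [J p u]" unfolding b_def using J_form_inv1[OF a(1)] by auto
 have h: "h : SF" and co: "!!p. dv (sharp b) p - 2 * sharp b p f = dv (grad h) p - 2 * grad h p f"
  unfolding b_def using twisted_coclosed[OF f n a(1) dec] by auto
 note Sa = sharp(1)[OF a(1)] and Sb = sharp(1)[OF b(1)] and Gf = grad(1)[OF f] and Gh = grad(1)[OF h]
 have "sharp b = - JF (sharp a)"
 proof (rule sharp_unique[OF b(1) VF_uminus[OF JF_VF[OF Sa]]])
  fix p X assume X: "VF X"
  show "g p ((- JF (sharp a)) p) (X p) = b p [X p]"
   using g_at(7)[OF JF_VF[OF Sa] Sa X, of p] g_JF[OF Sa X, of p] sharp(2)[OF a(1) JF_VF[OF X], of p] b(2)[OF VF_tangent[OF X], of p]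
   by (simp add: JF_at)
 qed
 then have "dv (sharp b) p = - dv (JF (sharp a)) p" for p
  using dv_fscale[OF JF_VF[OF Sa] smooth_const[of "-1"], of p] VF_const_arg[OF JF_VF[OF Sa], of p "-1"] by (simp add: fscale_m1)
 then have scal: "chern_scalar A n \<omega> J p = real n + dv (sharp b) p" for p
  using chern_scalar_divergence[OF a(1) ric, of p] by simp
 have J\<xi>: "JF \<xi> = - grad f"
 proof (rule g_nondegenerate[OF JF_VF[OF V\<xi>] VF_uminus[OF Gf]])
  fix X p assume X: "VF X"
  show "g p (JF \<xi> p) (X p) = g p ((- grad f) p) (X p)"
   using om_JF[OF V\<xi> X, of p] ham[OF VF_tangent[OF X], of p] g_at(7)[OF Gf Gf X, of p] grad(2)[OF f X, of p] by simp
 qed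
 have inv: "Lie \<xi> (JF X) = JF (Lie \<xi> X)" "\<xi> p (%q. a q [X q]) = a p [Lie \<xi> X p]" if "VF X" for X p
  by (rule infinitesimal_invariance[OF G \<xi> V\<xi> inJ a that]; assumption)+
 have "dv (JF \<xi>) p = - dv (grad f) p" for p unfolding J\<xi>
  using dv_fscale[OF Gf smooth_const[of "-1"], of p] VF_const_arg[OF Gf, of p "-1"] by (simp add: fscale_m1)
 then have dvJ: "dv (JF \<xi>) = (%p. - dv (grad f) p)" by blast
 let ?k = "%p. a p [\<xi> p] + f p + 1 / 2 * dv (grad f) p"
 note ks = form1_smooth[OF a(1) V\<xi>] and ds = dv_smooth[OF Gf]
 have k_smooth: "?k : SF" by (intro smooth_add smooth_mult smooth_const ks f ds)
 \<comment> \<open>the contraction of \<open>da\<close> with \<open>\<xi>\<close>, computed from the curvature and from the invariance of \<open>a\<close>\<close>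
 have "Y p ?k = 0" if Y: "VF Y" for Y p
 proof -
  have "chern_ricci A \<omega> J p [\<xi> p, Y p] = 1 / 2 * Y p (dv (grad f))"
   using ricci_killing[OF V\<xi> Y killing_connection[OF V\<xi> f ham inv(1)], of p] VF_minus_arg[OF Y ds, of p] unfolding dvJ by simp
  moreover have "chern_ricci A \<omega> J p [\<xi> p, Y p] = \<omega> p [\<xi> p, Y p] + ext_d A a p [\<xi> p, Y p]"
   using fun_cong[OF fun_cong[OF ric, of p], of "[\<xi> p, Y p]"] by simp
  moreover have "ext_d A a p [\<xi> p, Y p] = - Y p (%q. a q [\<xi> q])"
   unfolding ext_d_form1[OF a(1) V\<xi> Y] d1_def inv(2)[OF Y] by simp
  ultimately show ?thesis using ham[OF VF_tangent[OF Y], of p] VF_add_arg[OF Y smooth_add[OF ks f] smooth_mult[OF smooth_const ds], of p "1/2"]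
   VF_add_arg[OF Y ks f, of p] VF_cmult_arg[OF Y ds, of p "1/2"] by simp
 qed
 then have "?k p = ?k q" for p q by (rule zero_derivative_constant[OF conn k_smooth])
 then obtain c where c: "!!p. ?k p = c" by blast
 have axi: "sharp b p f = a p [\<xi> p]" for p
 proof -
  have "J p (grad f p) = \<xi> p" using JF_JF[OF V\<xi>] JF_uminus[OF Gf] unfolding J\<xi> by (metis JF_at neg_equal_iff_equal)
  then have "a p [\<xi> p] = b p [grad f p]" using b(2)[OF VF_tangent[OF Gf]] by simp
  also have "... = sharp b p f" using sharp(2)[OF b(1) Gf, of p] g_field_sym[OF Sb Gf, of p] grad(2)[OF f Sb, of p] by simp
  finally show ?thesis by simp
 qed
 define E where "E p = dv (grad h + grad f) p - 2 * (grad h p f + grad f p f)" for p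
 \<comment> \<open>the soliton expression is \<open>W (h + f) + 2 c\<close>, where \<open>E = W (h + f)\<close>\<close>
 have expr: "chern_scalar A n \<omega> J p - real n - 2 * laplacian A g f p + 2 * f p - 2 * covector_norm_sq A g (ext_d A (fun_form f)) p = E p + 2 * c" for p
  unfolding scal laplacian_grad[OF f] covector_norm_grad[OF f] E_def dv_add[OF Gh Gf] using co[of p] c[of p] axi[of p] by simp
 let ?w = "%p. exp (- 2 * f p)"
 have w: "?w : SF" by (rule exp_smooth[OF f])
 have dw: "dv (fscale ?w X) p = ?w p * (dv X p - 2 * X p f)" if X: "VF X" for X p
  unfolding dv_fscale[OF X w] VF_exp_arg[OF X f] by (simp add: algebra_simps)
 have Iw: "?I ?w ~= 0" using vol.I_definite[OF w] by (metis exp_ge_zero exp_not_eq_zero)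
 note Gu = VF_add[OF Gh Gf]
 have wE: "dv (fscale ?w (grad h + grad f)) p = ?w p * E p" for p unfolding dw[OF Gu] E_def by simp
 have GE: "GeAKRS A n \<omega> J f \<longleftrightarrow> (ALL p. E p + 2 * c = 0)" unfolding GeAKRS_def gdef Let_def expr ..
 show ?thesis unfolding GE d_c_eq_iff[OF h f]
 proof
  assume E0: "ALL p. E p + 2 * c = 0"
  have "E p = - 2 * c" for p using spec[OF E0, of p] by linarith
  then have "dv (fscale ?w (grad h + grad f)) = (%p. - 2 * c * ?w p)" by (intro ext) (simp only: wE, simp)
  then have "- 2 * c * ?I ?w = 0" using vol.I_div[OF VF_fscale[OF w Gu]] vol.I_cmult[OF w, of "- 2 * c"] by simp
  then have c0: "c = 0" using Iw by simp
  let ?u = "%p. h p + f p"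
  have u: "?u : SF" by (rule smooth_add[OF h f])
  have gu: "grad ?u = grad h + grad f" unfolding grad_def
  proof (rule sharp_unique[OF ext_d_fun_form[OF u]], unfold grad_def[symmetric])
   show "VF (grad h + grad f)" by (rule Gu)
   show "g p ((grad h + grad f) p) (X p) = ext_d A (fun_form ?u) p [X p]" if X: "VF X" for X p
    unfolding ext_d_fun[OF u VF_tangent[OF X]] g_at(1)[OF Gh Gf X] grad(2)[OF h X] grad(2)[OF f X] VF_add_arg[OF X h f] ..
  qed
  have "?I (%p. fscale ?w (grad ?u) p ?u) = 0"
   using vol.I_parts[OF VF_fscale[OF w Gu] u] wE E0 c0 vol.I_cmult[OF smooth_const, of 0 0] unfolding gu by simp
  moreover have "fscale ?w (grad ?u) p ?u = ?w p * grad ?u p ?u" for p by (simp add: fscale_apply)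
  moreover have "?w p * grad ?u p ?u \<ge> 0" for p using grad_nonneg[OF u] by simp
  ultimately have "?w p * grad ?u p ?u = 0" for p
   using vol.I_definite[OF smooth_mult[OF w VF_smooth[OF grad(1)[OF u] u]], of p] by simp
  then have "grad ?u p ?u = 0" for p by simp
  then have "X p ?u = 0" if "VF X" for X p using grad_zero[OF u _ that] by blast
  then show "ALL X p. VF X --> X p h = - X p f" using VF_add_arg[OF _ h f] by (simp add: eq_neg_iff_add_eq_0)
 next
  assume R: "ALL X p. VF X --> X p h = - X p f"
  have gu: "grad h = - grad f"
  proof (rule g_nondegenerate[OF Gh VF_uminus[OF Gf]])
   show "g p (grad h p) (X p) = g p ((- grad f) p) (X p)" if X: "VF X" for X p
    unfolding g_at(7)[OF Gf Gf X] grad(2)[OF h X] grad(2)[OF f X] using R X by blast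
  qed
  have E0: "E p = 0" for p unfolding E_def gu using vol.dv_zero[of p] by simp
  let ?B = "sharp b - grad h"
  have B: "VF ?B" by (rule VF_diff[OF Sb Gh])
  have "dv (?B + grad h) p = dv ?B p + dv (grad h) p" for p by (rule dv_add[OF B Gh])
  then have "dv (fscale ?w ?B) p = 0" for p unfolding dw[OF B] using co[of p] by (simp add: algebra_simps)
  then have z: "?I (%p. ?w p * ?B p f) = 0"
   using vol.I_parts[OF VF_fscale[OF w B] f] vol.I_cmult[OF smooth_const, of 0 0] by (simp add: fscale_apply)
  \<comment> \<open>the Laplacian of \<open>f\<close> contributes the square norm of \<open>df\<close>, which cancels the contribution of \<open>b\<close>\<close>
  have z2: "?I (%p. ?w p * dv (grad f) p) = - ?I (%p. (- 2) * (?w p * grad f p f))"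
   using vol.I_parts[OF Gf w] unfolding VF_exp_arg[OF Gf f] by (simp add: mult.assoc)
  have m: "(%p. ?w p * grad f p f) : SF" "(%p. ?w p * ?B p f) : SF" "(%p. ?w p * dv (grad f) p) : SF" "(%p. f p * ?w p) : SF"
   by (intro smooth_mult w f ds VF_smooth[OF Gf f] VF_smooth[OF B f])+
  have "c * ?w p = (?w p * ?B p f + (1 / 2 * (?w p * dv (grad f) p) + (- 1) * (?w p * grad f p f))) + f p * ?w p" for p
   using axi[of p] gu unfolding c[of p, symmetric] by (simp add: algebra_simps)
  then have "c * ?I ?w = ?I (%p. (?w p * ?B p f + (1 / 2 * (?w p * dv (grad f) p) + (- 1) * (?w p * grad f p f))) + f p * ?w p)"
   using vol.I_cmult[OF w, of c] by simp
  also have "... = 0"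
   unfolding vol.I_add[OF smooth_add[OF m(2) smooth_add[OF smooth_mult[OF smooth_const m(3)] smooth_mult[OF smooth_const m(1)]]] m(4)]
    vol.I_add[OF m(2) smooth_add[OF smooth_mult[OF smooth_const m(3)] smooth_mult[OF smooth_const m(1)]]]
    vol.I_add[OF smooth_mult[OF smooth_const m(3)] smooth_mult[OF smooth_const m(1)]]
    vol.I_cmult[OF m(3)] vol.I_cmult[OF m(1)] z z2 f0 by simp
  finally show "ALL p. E p + 2 * c = 0" using Iw E0 by simp
 qed
qed

end

theorem proposition6:
  fixes A :: "('m, 'e::euclidean_space) atlas"
    and B :: "('m \<Rightarrow> 'm, 'f::euclidean_space) atlas"
    and G :: "('m \<Rightarrow> 'm) set"
    and n :: nat
    and \<omega> a aH \<psi> :: "'m form"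
    and J :: "'m endo"
    and \<xi> :: "'m vfield"
    and f h :: "'m \<Rightarrow> real"
  assumes "compact_manifold A" and "carrier A = UNIV" and "connected_space (manifold_topology A)"
    and "DIM('e) = 2 * n" and "2 * n > 2"
    and "symplectic_form A \<omega>" and "symplectic_fano A \<omega>"
    and "compact_connected_Lie_subgroup A \<omega> G B"
    and "\<xi> \<in> Lie_center A B"
    and "is_potential A n \<omega> \<xi> f"
    and "J \<in> AK A \<omega> G"
    and "a \<in> forms A 1" and "G_invariant_form A G a"
    and "chern_ricci A \<omega> J - \<omega> = ext_d A a"
    and "twisted_hodge_decomposition A J (conformal_metric n f (ak_metric \<omega> J)) a aH h \<psi>"
  shows "GeAKRS A n \<omega> J f \<longleftrightarrow> d_c A J (fun_form h) = - d_c A J (fun_form f)"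
proof -
  have J: "compatible A \<omega> J" and inJ: "\<And>F p u. F \<in> G \<Longrightarrow> u \<in> tangent A p \<Longrightarrow> push A F (J p u) = J (F p) (push A F u)"
    using assms(11) by (auto simp: AK_def)
  interpret compact_almost_kahler A "ak_metric \<omega> J" \<omega> J n
    by unfold_locales (use assms(1,2,4,5,6) J in \<open>auto simp: compact_manifold_def compatible_def symplectic_form_def\<close>)
  have \<xi>: "\<xi> \<in> Lie_algebra A B" using assms(9) by (simp add: Lie_center_def)
  show ?thesis
    by (rule soliton_iff[OF assms(3) _ assms(8) \<xi> inJ assms(10) assms(12-15)]) (use assms(5) in auto)
qed

end
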